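(* Let $(\Gamma,d_0)$ be a compact metric space with $d_0\le1$. Let $\Xi$ be a point process on $\Gamma$ with finite mean measure $\lambda$ and $\mathrm{Var}(|\Xi|)<\mathbb E|\Xi|$, satisfying the type-I local dependence (with neighbourhoods $\{A_x\},\{B_x\}$) and the type-II local dependence (with neighbourhoods $\{A_{xy}\},\{B_{xy}\}$). Let $u>0$ be a constant, let $\mathcal G=\{G_1,\dots,G_k\}$ be a Borel partition of $\Gamma$ with designated centers $t_1,\dots,t_k$, and let $$\beta=\frac{|\lambda|-\mathrm{Var}(|\Xi|)}{|\lambda|-\mathrm{Var}(|\Xi|)+\mathbb E|\Xi|^3-(|\lambda|+1)\mathbb E|\Xi|^2},\qquad a=|\lambda|+\beta(\mathbb E|\Xi|^2-|\lambda|),$$ $$\nu(dx)=\frac1a\Big(\lambda(dx)+\beta\int_{y\in\Gamma}\lambda^{[2]}(dx,dy)\Big).$$ If $\beta\ge0$, then $$d_2(\mathcal L\Xi,\boldsymbol\pi_{a,0;\beta;\nu})\le2d_0(\mathcal G)+\int_\Gamma\mathbb E\big(\epsilon_{1,x}(\Xi_x)+\epsilon_{1,x}(\Xi)\big)\lambda(dx)+\beta\iint_{\Gamma^2}\mathbb E\big(\epsilon_{1,x,y}(\Xi_{xy})+\epsilon_{1,x,y}(\Xi)+\epsilon_{2,x,y}(\Xi_{xy})\big)\lambda^{[2]}(dx,dy).$$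
   Context: $\mathcal H$ is the set of finite nonnegative-integer-valued Borel measures (configurations) on $\Gamma$, $|\xi|$ is the total mass of $\xi$, and $\mathcal H$ carries the smallest $\sigma$-algebra $\mathscr B(\mathcal H)$ making $\xi\mapsto\xi(C)$ measurable for all relatively compact Borel $C\subset\Gamma$. A point process is an $\mathcal H$-valued random element; $\lambda(dx)=\mathbb E\,\Xi(dx)$; $\lambda^{[2]}(dx,dy)=\mathbb E\,\Xi(dx)(\Xi-\delta_x)(dy)$ is the second order factorial moment measure. $\xi|_B(C)=\xi(B\cap C)$. $\mathcal L$ denotes distribution. Metrics: for $\xi=\sum_{i=1}^n\delta_{x_i}$, $\eta=\sum_{i=1}^n\delta_{y_i}$ with $n\ge1$, $d_1(\xi,\eta)=\min_\sigma\frac1n\sum_{i=1}^nd_0(x_i,y_{\sigma(i)})$ over permutations $\sigma$ of $(1,\dots,n)$; $d_1=1$ if total masses differ; $d_1=0$ if both are empty. $d_2(\mathbf P,\mathbf Q)=\sup_{f\in\mathcal F}|\mathbf P(f)-\mathbf Q(f)|$, where $\mathcal F$ is the set of $f:\mathcal H\to\mathbb R$ with $|f(\xi)-f(\eta)|\le d_1(\xi,\eta)$ for all $\xi,\eta\in\mathcal H$. Polynomial birth-death point process: for $a>0$, $0\le b<1$, $\beta\ge0$ and a probability measure $\nu$ on $\Gamma$, $\boldsymbol\pi_{a,b;\beta;\nu}=\mathcal L(\sum_{i=1}^Z\delta_{U_i})$, where $Z$ has the invariant distribution of the birth-death process on $\{0,1,2,\dots\}$ with birth rates $\alpha_k=a+bk$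 and death rates $\beta_k=k+\beta k(k-1)$, and $Z$ is independent of the i.i.d. $U_i\sim\nu$. Reduced Palm processes $\Xi_x$: $\mathbb E\int_\Gamma f(x,\Xi-\delta_x)\,\Xi(dx)=\int_\Gamma\mathbb E f(x,\Xi_x)\,\lambda(dx)$ for all measurable $f:\Gamma\times\mathcal H\to[0,\infty)$. Second order reduced Palm processes $\Xi_{xy}$: $\mathbb E\iint_{\Gamma^2}f(x,y;\Xi-\delta_x-\delta_y)\,\Xi(dx)(\Xi-\delta_x)(dy)=\iint_{\Gamma^2}\mathbb E f(x,y;\Xi_{xy})\,\lambda^{[2]}(dx,dy)$ for all measurable $f:\Gamma^2\times\mathcal H\to[0,\infty)$. Type-I neighbourhood: Borel sets $\{A_x:x\in\Gamma\}$ with $x\in A_x$ and $(x,\xi)\mapsto(x,\xi|_{A_x^c})$ product measurable. Type-II neighbourhood: Borel sets $\{A_{xy}:x,y\in\Gamma\}$ with $\{x,y\}\subset A_{xy}$ and $((x,y),\xi)\mapsto((x,y),\xi|_{A_{xy}^c})$ product measurable. Type-I local dependence: there exist type-I neighbourhoods $\{A_x\},\{B_x\}$ with $A_x\subset B_x$ such that for all $x$: $\mathcal L(\Xi_x|_{A_x^c})=\mathcal L(\Xi|_{A_x^c})$; $\Xi|_{B_x^c}$ is independent of $\Xi|_{A_x}$; $\Xi_x|_{B_x^c}$ is independent of $\Xi_x|_{A_x}$. Type-II local dependence: there exist type-II neighbourhoods $\{A_{xy}\},\{B_{xy}\}$ with $A_{xy}\subset B_{xy}$ such that for all $x,y$: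 $\mathcal L(\Xi_{xy}|_{A_{xy}^c})=\mathcal L(\Xi|_{A_{xy}^c})$; $\Xi|_{B_{xy}^c}$ is independent of $\Xi|_{A_{xy}}$; $\Xi_{xy}|_{B_{xy}^c}$ is independent of $\Xi_{xy}|_{A_{xy}}$. Partition: the center $t_i\in\Gamma$ (not necessarily in $G_i$) is chosen so that $\sup_{s\in G_i}d_0(s,t_i)$ is as small as possible; $d_0(\mathcal G)=\max_{1\le i\le k}\sup_{s\in G_i}d_0(s,t_i)$; $\mathscr M_{\mathcal G}\circ\eta=\sum_{i=1}^k\eta(G_i)\delta_{t_i}$ for $\eta\in\mathcal H$. Let $\mathcal F_{TV}$ be the set of indicator functions of sets in $\mathscr B(\mathcal H)$. For a Borel set $B$ and a point process $\Psi$ define the random variable $$R_B(\Psi)=4\,\mathbb P\Big(\Psi(B^c)+1\le\tfrac au\,\Big|\,\Psi|_{B}\Big)+\frac{4u+10}{a}\max_{1\le j\le k}\sup_{f\in\mathcal F_{TV}}\Big|\mathbb E\big[f(\mathscr M_{\mathcal G}\circ(\Psi|_{B^c}))-f(\mathscr M_{\mathcal G}\circ(\Psi|_{B^c})+\delta_{t_j})\,\big|\,\Psi|_{B}\big]\Big|,$$ and let the number $\bar R_B(\Psi)$ be the same with the conditional probability/expectations replaced by unconditional ones. Set $r_x=R_{B_x}$, $\bar r_x=\bar R_{B_x}$, $r_{x,y}=R_{B_{xy}}$, $\bar r_{x,y}=\bar R_{B_{xy}}$. For $\Psi\in\{\Xi,\Xi_x\}$, $$\epsilon_{1,x}(\Psi)=r_x(\Psi)\Psi(A_x)\Psi(B_x\setminus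 A_x)+\tfrac12\bar r_x(\Psi)[\Psi(A_x)+1]\Psi(A_x)+\Psi(A_x)\,\mathbb E[r_x(\Xi)\Xi(B_x)].$$ For $\Psi\in\{\Xi,\Xi_{xy}\}$, $$\epsilon_{1,x,y}(\Psi)=r_{x,y}(\Psi)\Psi(A_{xy})\Psi(B_{xy}\setminus A_{xy})+\tfrac12\bar r_{x,y}(\Psi)[\Psi(A_{xy})+1]\Psi(A_{xy})+\Psi(A_{xy})\,\mathbb E[r_{x,y}(\Xi)\Xi(B_{xy})],$$ $$\epsilon_{2,x,y}(\Psi)=r_{x,y}(\Psi)\Psi(B_{xy})+\bar r_{x,y}(\Psi)+\mathbb E[r_{x,y}(\Xi)\Xi(B_{xy})].$$ *)

theory Defs
  imports "HOL-Probability.Probability"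
begin

section \<open>Configurations and point processes\<close>

text \<open>
  The carrier space is a type of class \<open>metric_space\<close> with its metric \<^const>\<open>dist\<close>; compactness
  and \<open>dist \<le> 1\<close> are assumptions of the theorem. Configurations are honest measures on the
  Borel sets; an integer-valued measure is automatically finite here, since \<open>of_nat n < \<infinity>\<close>.
\<close>

definition configs :: "'a::topological_space measure set" where
  "configs = {\<xi>. sets \<xi> = sets borel \<and> (\<forall>C\<in>sets borel. \<exists>n::nat. emeasure \<xi> C = of_nat n)}"

definition config_algebra :: "'a::topological_space measure measure" where
  "config_algebra = (SUP C \<in> {C \<in> sets borel. compact (closure C)}.
     vimage_algebra configs (\<lambda>\<xi>. emeasure \<xi> C) borel)"

definition point_process :: "'w measure \<Rightarrow> ('w \<Rightarrow> 'a::topological_space measure) \<Rightarrow> bool" where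
  "point_process M \<Psi> \<longleftrightarrow> prob_space M \<and> \<Psi> \<in> measurable M config_algebra"

abbreviation total_mass :: "'a measure \<Rightarrow> real" where
  "total_mass \<xi> \<equiv> measure \<xi> UNIV"

text \<open>\<open>restr B \<xi>\<close> is the measure \<open>C \<mapsto> \<xi> (B \<inter> C)\<close>, see \<open>emeasure_restricted\<close>.\<close>

definition restr :: "'a::topological_space set \<Rightarrow> 'a measure \<Rightarrow> 'a measure" where
  "restr B \<xi> = density \<xi> (indicator B)"

definition dirac_sum :: "'i set \<Rightarrow> ('i \<Rightarrow> ennreal) \<Rightarrow> ('i \<Rightarrow> 'a::topological_space) \<Rightarrow> 'a measure" where
  "dirac_sum I w x = measure_of UNIV (sets borel) (\<lambda>C. \<Sum>i\<in>I. w i * emeasure (return borel (x i)) C)"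

definition points :: "nat \<Rightarrow> (nat \<Rightarrow> 'a::topological_space) \<Rightarrow> 'a measure" where
  "points n x = dirac_sum {1..n} (\<lambda>_. 1) x"

definition add_point :: "'a::topological_space measure \<Rightarrow> 'a \<Rightarrow> 'a measure" where
  "add_point \<xi> x = measure_of UNIV (sets borel) (\<lambda>C. emeasure \<xi> C + emeasure (return borel x) C)"

text \<open>
  \<open>\<xi> - \<delta>\<^sub>x\<close>. It is used only under an integral with respect to \<open>\<xi>(dx)\<close>, and \<open>\<xi>\<close> is carried by its
  atoms. If \<open>x\<close> is not an atom of \<open>\<xi>\<close>, the set function \<open>\<xi> - \<delta>\<^sub>x\<close> is no measure (unless \<open>\<xi> = 0\<close>) and
  \<^const>\<open>diff_measure\<close> returns the null measure.
\<close>

definition remove_point :: "'a::topological_space measure \<Rightarrow> 'a \<Rightarrow> 'a measure" where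
  "remove_point \<xi> x = diff_measure \<xi> (return borel x)"

definition mean_measure :: "'w measure \<Rightarrow> ('w \<Rightarrow> 'a::topological_space measure) \<Rightarrow> 'a measure" where
  "mean_measure M \<Psi> = measure_of UNIV (sets borel) (\<lambda>C. \<integral>\<^sup>+\<omega>. emeasure (\<Psi> \<omega>) C \<partial>M)"

definition factorial_moment2 ::
    "'w measure \<Rightarrow> ('w \<Rightarrow> 'a::topological_space measure) \<Rightarrow> ('a \<times> 'a) measure" where
  "factorial_moment2 M \<Psi> = measure_of UNIV (sets (borel \<Otimes>\<^sub>M borel))
     (\<lambda>C. \<integral>\<^sup>+\<omega>. (\<integral>\<^sup>+x. (\<integral>\<^sup>+y. indicator C (x, y) \<partial>remove_point (\<Psi> \<omega>) x) \<partial>\<Psi> \<omega>) \<partial>M)"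

section \<open>The metrics\<close>

text \<open>
  The description after \<open>THE\<close> has exactly one solution: the number \<open>n\<close> is the common total mass, and
  the enumerations of the points are unique up to permutation, which does not affect the minimum.
\<close>

definition d1 :: "'a::metric_space measure \<Rightarrow> 'a measure \<Rightarrow> real" where
  "d1 \<xi> \<eta> =
     (if total_mass \<xi> \<noteq> total_mass \<eta> then 1
      else if total_mass \<xi> = 0 then 0
      else (THE d. \<exists>n x y. \<xi> = points n x \<and> \<eta> = points n y \<and>
              d = Min {1 / real n * (\<Sum>i=1..n. dist (x i) (y (\<sigma> i))) | \<sigma>. \<sigma> permutes {1..n}}))"

definition d1_Lipschitz :: "('a::metric_space measure \<Rightarrow> real) set" where
  "d1_Lipschitz = {f. \<forall>\<xi>\<in>configs. \<forall>\<eta>\<in>configs. \<bar>f \<xi> - f \<eta>\<bar> \<le> d1 \<xi> \<eta>}"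

definition d2 :: "'a::metric_space measure measure \<Rightarrow> 'a measure measure \<Rightarrow> real" where
  "d2 P Q = (SUP f\<in>d1_Lipschitz. \<bar>(\<integral>\<xi>. f \<xi> \<partial>P) - (\<integral>\<xi>. f \<xi> \<partial>Q)\<bar>)"

section \<open>Polynomial birth-death point processes\<close>

text \<open>
  Invariance of \<open>p\<close> for the birth-death generator \<open>Q\<close>, i.e. \<open>p Q = 0\<close>, where \<open>Q\<close> has the entries
  \<open>Q k (k + 1) = al k\<close>, \<open>Q k (k - 1) = de k\<close> for \<open>k \<ge> 1\<close>, no transition downwards from \<open>0\<close>, and zero row sums.
\<close>

definition bd_generator :: "(nat \<Rightarrow> real) \<Rightarrow> (nat \<Rightarrow> real) \<Rightarrow> nat \<Rightarrow> nat \<Rightarrow> real" where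
  "bd_generator al de i j =
     (if j = i + 1 then al i
      else if i = j + 1 then de i
      else if i = j then - (al i + (if i = 0 then 0 else de i))
      else 0)"

definition bd_invariant :: "(nat \<Rightarrow> real) \<Rightarrow> (nat \<Rightarrow> real) \<Rightarrow> nat pmf \<Rightarrow> bool" where
  "bd_invariant al de p \<longleftrightarrow> (\<forall>j. (\<lambda>i. pmf p i * bd_generator al de i j) sums 0)"

definition pbd_count :: "real \<Rightarrow> real \<Rightarrow> real \<Rightarrow> nat pmf" where
  "pbd_count a b \<beta> =
     (THE p. bd_invariant (\<lambda>k. a + b * real k) (\<lambda>k. real k + \<beta> * real k * (real k - 1)) p)"

definition pbd_process :: "real \<Rightarrow> real \<Rightarrow> real \<Rightarrow> 'a::topological_space measure \<Rightarrow> 'a measure measure" where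
  "pbd_process a b \<beta> \<nu> =
     distr (measure_pmf (pbd_count a b \<beta>) \<Otimes>\<^sub>M Pi\<^sub>M (UNIV :: nat set) (\<lambda>_. \<nu>)) config_algebra
       (\<lambda>(n, U). points n U)"

section \<open>Reduced Palm processes\<close>

text \<open>
  Every Palm process may live on its own probability space. Measurability of the family of laws in
  the index is what makes the right-hand side integrals of the defining identities meaningful.
\<close>

definition palm_process ::
    "'w measure \<Rightarrow> ('w \<Rightarrow> 'a::topological_space measure) \<Rightarrow>
     ('a \<Rightarrow> 'v measure) \<Rightarrow> ('a \<Rightarrow> 'v \<Rightarrow> 'a measure) \<Rightarrow> bool" where
  "palm_process M \<Psi> M1 \<Psi>1 \<longleftrightarrow>
     (\<forall>x. point_process (M1 x) (\<Psi>1 x)) \<and>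
     (\<lambda>x. distr (M1 x) config_algebra (\<Psi>1 x)) \<in> measurable borel (prob_algebra config_algebra) \<and>
     (\<forall>f \<in> borel_measurable (borel \<Otimes>\<^sub>M config_algebra).
        (\<integral>\<^sup>+\<omega>. (\<integral>\<^sup>+x. f (x, remove_point (\<Psi> \<omega>) x) \<partial>\<Psi> \<omega>) \<partial>M) =
        (\<integral>\<^sup>+x. (\<integral>\<^sup>+\<omega>. f (x, \<Psi>1 x \<omega>) \<partial>M1 x) \<partial>mean_measure M \<Psi>))"

definition palm_process2 ::
    "'w measure \<Rightarrow> ('w \<Rightarrow> 'a::topological_space measure) \<Rightarrow>
     ('a \<Rightarrow> 'a \<Rightarrow> 'v measure) \<Rightarrow> ('a \<Rightarrow> 'a \<Rightarrow> 'v \<Rightarrow> 'a measure) \<Rightarrow> bool" where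
  "palm_process2 M \<Psi> M2 \<Psi>2 \<longleftrightarrow>
     (\<forall>x y. point_process (M2 x y) (\<Psi>2 x y)) \<and>
     (\<lambda>(x, y). distr (M2 x y) config_algebra (\<Psi>2 x y))
        \<in> measurable (borel \<Otimes>\<^sub>M borel) (prob_algebra config_algebra) \<and>
     (\<forall>f \<in> borel_measurable ((borel \<Otimes>\<^sub>M borel) \<Otimes>\<^sub>M config_algebra).
        (\<integral>\<^sup>+\<omega>. (\<integral>\<^sup>+x. (\<integral>\<^sup>+y. f ((x, y), remove_point (remove_point (\<Psi> \<omega>) x) y)
             \<partial>remove_point (\<Psi> \<omega>) x) \<partial>\<Psi> \<omega>) \<partial>M) =
        (\<integral>\<^sup>+(x, y). (\<integral>\<^sup>+\<omega>. f ((x, y), \<Psi>2 x y \<omega>) \<partial>M2 x y) \<partial>factorial_moment2 M \<Psi>))"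

section \<open>Local dependence\<close>

definition neighbourhood1 :: "('a::topological_space \<Rightarrow> 'a set) \<Rightarrow> bool" where
  "neighbourhood1 A \<longleftrightarrow>
     (\<forall>x. A x \<in> sets borel \<and> x \<in> A x) \<and>
     (\<lambda>(x, \<xi>). (x, restr (- A x) \<xi>))
        \<in> measurable (borel \<Otimes>\<^sub>M config_algebra) (borel \<Otimes>\<^sub>M config_algebra)"

definition neighbourhood2 :: "('a::topological_space \<Rightarrow> 'a \<Rightarrow> 'a set) \<Rightarrow> bool" where
  "neighbourhood2 A \<longleftrightarrow>
     (\<forall>x y. A x y \<in> sets borel \<and> {x, y} \<subseteq> A x y) \<and>
     (\<lambda>((x, y), \<xi>). ((x, y), restr (- A x y) \<xi>))
        \<in> measurable ((borel \<Otimes>\<^sub>M borel) \<Otimes>\<^sub>M config_algebra)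
                     ((borel \<Otimes>\<^sub>M borel) \<Otimes>\<^sub>M config_algebra)"

definition indep_restr ::
    "'w measure \<Rightarrow> ('w \<Rightarrow> 'a::topological_space measure) \<Rightarrow> 'a set \<Rightarrow> 'a set \<Rightarrow> bool" where
  "indep_restr M \<Psi> B C \<longleftrightarrow>
     prob_space.indep_var M config_algebra (\<lambda>\<omega>. restr B (\<Psi> \<omega>)) config_algebra (\<lambda>\<omega>. restr C (\<Psi> \<omega>))"

definition local_dependence1 ::
    "'w measure \<Rightarrow> ('w \<Rightarrow> 'a::topological_space measure) \<Rightarrow>
     ('a \<Rightarrow> 'v measure) \<Rightarrow> ('a \<Rightarrow> 'v \<Rightarrow> 'a measure) \<Rightarrow>
     ('a \<Rightarrow> 'a set) \<Rightarrow> ('a \<Rightarrow> 'a set) \<Rightarrow> bool" where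
  "local_dependence1 M \<Psi> M1 \<Psi>1 A B \<longleftrightarrow>
     neighbourhood1 A \<and> neighbourhood1 B \<and>
     (\<forall>x. A x \<subseteq> B x \<and>
        distr (M1 x) config_algebra (\<lambda>\<omega>. restr (- A x) (\<Psi>1 x \<omega>)) =
          distr M config_algebra (\<lambda>\<omega>. restr (- A x) (\<Psi> \<omega>)) \<and>
        indep_restr M \<Psi> (- B x) (A x) \<and>
        indep_restr (M1 x) (\<Psi>1 x) (- B x) (A x))"

definition local_dependence2 ::
    "'w measure \<Rightarrow> ('w \<Rightarrow> 'a::topological_space measure) \<Rightarrow>
     ('a \<Rightarrow> 'a \<Rightarrow> 'v measure) \<Rightarrow> ('a \<Rightarrow> 'a \<Rightarrow> 'v \<Rightarrow> 'a measure) \<Rightarrow>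
     ('a \<Rightarrow> 'a \<Rightarrow> 'a set) \<Rightarrow> ('a \<Rightarrow> 'a \<Rightarrow> 'a set) \<Rightarrow> bool" where
  "local_dependence2 M \<Psi> M2 \<Psi>2 A B \<longleftrightarrow>
     neighbourhood2 A \<and> neighbourhood2 B \<and>
     (\<forall>x y. A x y \<subseteq> B x y \<and>
        distr (M2 x y) config_algebra (\<lambda>\<omega>. restr (- A x y) (\<Psi>2 x y \<omega>)) =
          distr M config_algebra (\<lambda>\<omega>. restr (- A x y) (\<Psi> \<omega>)) \<and>
        indep_restr M \<Psi> (- B x y) (A x y) \<and>
        indep_restr (M2 x y) (\<Psi>2 x y) (- B x y) (A x y))"

section \<open>Partitions with centers\<close>

definition borel_partition :: "nat \<Rightarrow> (nat \<Rightarrow> 'a::topological_space set) \<Rightarrow> bool" where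
  "borel_partition k G \<longleftrightarrow>
     partition_on UNIV (G ` {1..k}) \<and> inj_on G {1..k} \<and> (\<forall>i\<in>{1..k}. G i \<in> sets borel)"

definition is_center :: "'a::metric_space set \<Rightarrow> 'a \<Rightarrow> bool" where
  "is_center S t \<longleftrightarrow> (\<forall>c. (SUP s\<in>S. dist s t) \<le> (SUP s\<in>S. dist s c))"

definition mesh :: "nat \<Rightarrow> (nat \<Rightarrow> 'a::metric_space set) \<Rightarrow> (nat \<Rightarrow> 'a) \<Rightarrow> real" where
  "mesh k G t = (MAX i\<in>{1..k}. SUP s\<in>G i. dist s (t i))"

definition discretize ::
    "nat \<Rightarrow> (nat \<Rightarrow> 'a::topological_space set) \<Rightarrow> (nat \<Rightarrow> 'a) \<Rightarrow> 'a measure \<Rightarrow> 'a measure" where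
  "discretize k G t \<eta> = dirac_sum {1..k} (\<lambda>i. emeasure \<eta> (G i)) t"

section \<open>The error terms\<close>

definition F_TV :: "('a::topological_space measure \<Rightarrow> real) set" where
  "F_TV = {indicator D | D. D \<in> sets config_algebra}"

text \<open>
  \<open>max\<^sub>j sup\<^sub>f |E[f(N) - f(N + \<delta>(t j))]|\<close> for a random configuration \<open>N\<close> with distribution \<open>Q\<close>.
\<close>

definition max_shift :: "nat \<Rightarrow> (nat \<Rightarrow> 'a::topological_space) \<Rightarrow> 'a measure measure \<Rightarrow> ennreal" where
  "max_shift k t Q =
     (MAX j\<in>{1..k}. SUP f\<in>F_TV. ennreal \<bar>\<integral>\<eta>. f \<eta> - f (add_point \<eta> (t j)) \<partial>Q\<bar>)"

text \<open>
  A supremum of uncountably many conditional expectations is meaningful only if their versions are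
  chosen consistently. We therefore take all of them with respect to one regular conditional
  distribution \<open>\<kappa>\<close> of \<open>N = discretize k G t (restr (- B) \<Psi>)\<close> given \<open>restr B \<Psi>\<close>. As \<open>N\<close> has countable
  range, \<open>\<kappa>\<close> exists and is almost surely unique, so the choice does not affect any expectation below.
\<close>

definition regular_cond_distr ::
    "'w measure \<Rightarrow> 'w measure \<Rightarrow> 'b measure \<Rightarrow> ('w \<Rightarrow> 'b) \<Rightarrow> ('w \<Rightarrow> 'b measure) \<Rightarrow> bool" where
  "regular_cond_distr M F E N \<kappa> \<longleftrightarrow>
     \<kappa> \<in> measurable F (prob_algebra E) \<and>
     (\<forall>D\<in>sets E. AE \<omega> in M. emeasure (\<kappa> \<omega>) D = nn_cond_exp M F (\<lambda>\<omega>. indicator D (N \<omega>)) \<omega>)"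

definition cond_distr ::
    "'w measure \<Rightarrow> 'w measure \<Rightarrow> 'b measure \<Rightarrow> ('w \<Rightarrow> 'b) \<Rightarrow> 'w \<Rightarrow> 'b measure" where
  "cond_distr M F E N = (SOME \<kappa>. regular_cond_distr M F E N \<kappa>)"

definition sigma_restr ::
    "'w measure \<Rightarrow> ('w \<Rightarrow> 'a::topological_space measure) \<Rightarrow> 'a set \<Rightarrow> 'w measure" where
  "sigma_restr M \<Psi> B = vimage_algebra (space M) (\<lambda>\<omega>. restr B (\<Psi> \<omega>)) config_algebra"

context
  fixes a u :: real and k :: nat and G :: "nat \<Rightarrow> 'a::topological_space set" and t :: "nat \<Rightarrow> 'a"
begin

definition R_cond :: "'a set \<Rightarrow> 'w measure \<Rightarrow> ('w \<Rightarrow> 'a measure) \<Rightarrow> 'w \<Rightarrow> ennreal" where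
  "R_cond B M \<Psi> \<omega> =
     4 * nn_cond_exp M (sigma_restr M \<Psi> B)
           (indicator {\<omega>. emeasure (\<Psi> \<omega>) (- B) + 1 \<le> ennreal (a / u)}) \<omega>
     + ennreal ((4 * u + 10) / a) *
         max_shift k t (cond_distr M (sigma_restr M \<Psi> B) config_algebra
           (\<lambda>\<omega>. discretize k G t (restr (- B) (\<Psi> \<omega>))) \<omega>)"

definition R_bar :: "'a set \<Rightarrow> 'w measure \<Rightarrow> ('w \<Rightarrow> 'a measure) \<Rightarrow> ennreal" where
  "R_bar B M \<Psi> =
     4 * emeasure M {\<omega> \<in> space M. emeasure (\<Psi> \<omega>) (- B) + 1 \<le> ennreal (a / u)}
     + ennreal ((4 * u + 10) / a) *
         max_shift k t (distr M config_algebra (\<lambda>\<omega>. discretize k G t (restr (- B) (\<Psi> \<omega>))))"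

text \<open>
  Here \<open>A\<close>, \<open>B\<close> stand for \<open>A\<^sub>x\<close>, \<open>B\<^sub>x\<close> or \<open>A\<^sub>x\<^sub>y\<close>, \<open>B\<^sub>x\<^sub>y\<close>; \<open>\<Xi>\<close> on \<open>M\<close> is the original process, and \<open>\<Psi>\<close> on \<open>N\<close>
  is either \<open>\<Xi>\<close> itself or its Palm process. \<open>eps1\<close> covers both \<open>\<epsilon>\<^sub>1\<^sub>,\<^sub>x\<close> and \<open>\<epsilon>\<^sub>1\<^sub>,\<^sub>x\<^sub>,\<^sub>y\<close>.
\<close>

definition eps1 ::
    "'w measure \<Rightarrow> ('w \<Rightarrow> 'a measure) \<Rightarrow> 'a set \<Rightarrow> 'a set \<Rightarrow>
     'v measure \<Rightarrow> ('v \<Rightarrow> 'a measure) \<Rightarrow> 'v \<Rightarrow> ennreal" where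
  "eps1 M \<Xi> A B N \<Psi> \<omega> =
     R_cond B N \<Psi> \<omega> * emeasure (\<Psi> \<omega>) A * emeasure (\<Psi> \<omega>) (B - A)
     + 1 / 2 * R_bar B N \<Psi> * (emeasure (\<Psi> \<omega>) A + 1) * emeasure (\<Psi> \<omega>) A
     + emeasure (\<Psi> \<omega>) A * (\<integral>\<^sup>+\<omega>'. R_cond B M \<Xi> \<omega>' * emeasure (\<Xi> \<omega>') B \<partial>M)"

definition eps2 ::
    "'w measure \<Rightarrow> ('w \<Rightarrow> 'a measure) \<Rightarrow> 'a set \<Rightarrow>
     'v measure \<Rightarrow> ('v \<Rightarrow> 'a measure) \<Rightarrow> 'v \<Rightarrow> ennreal" where
  "eps2 M \<Xi> B N \<Psi> \<omega> =
     R_cond B N \<Psi> \<omega> * emeasure (\<Psi> \<omega>) B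
     + R_bar B N \<Psi>
     + (\<integral>\<^sup>+\<omega>'. R_cond B M \<Xi> \<omega>' * emeasure (\<Xi> \<omega>') B \<partial>M)"

end

end

theory Submission
  imports Defs
begin

text \<open>
  Collapse every cell of the partition to its center. This moves \<open>d\<^sub>1\<close> by at most the mesh, so it costs
  \<open>2 d\<^sub>0(\<G>)\<close> and leaves finite multisets of centers. There the target law is stationary for a birth-death
  dynamics with immigration rate \<open>a\<close>, immigrants distributed like \<open>\<nu>\<close> and death rate \<open>1 + \<beta> (n - 1)\<close> per point, so a
  test function \<open>f\<close> is compared through the generator applied to a solution of Stein's equation.
  We use the resolvent equation \<open>(\<epsilon> - L) g = f\<close>, whose solution is an increasing limit of bounded iterates
  and, by a maximum principle, has differences bounded independently of \<open>\<epsilon>\<close>; at the end \<open>\<epsilon>\<close> tends to \<open>0\<close>.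
  The Palm identities turn the expected generator into integrals over \<open>\<lambda>\<close> and \<open>\<lambda>\<^sup>[\<^sup>2\<^sup>]\<close> of expected differences of \<open>g\<close> between
  \<open>\<Xi>\<close> and its Palm processes. By local dependence only the points near \<open>x\<close> matter, and each of these differences
  is, to first order, a multiple of one constant second difference. The choice of \<open>\<beta>\<close> makes the multiples of
  this constant cancel; the remainders are third differences, which the total variation terms in \<open>R\<close> control.
\<close>

section \<open>Stein's equation on finite multisets\<close>

text \<open>The resolvent replaces the Poisson equation because it asks for no ergodicity: for
  positive \<open>\<epsilon>\<close> the chain is killed, the iterates increase and
  \<open>sol\<close> is at most 1/\<open>\<epsilon>\<close>. This bound explodes in the limit, but
  \<open>sol\<close> enters only through differences, except in one term, \<open>\<epsilon>\<close>
  times the difference of its means under the two laws. Since \<open>sol\<close> moves away from its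
  value at \<open>{#}\<close> by at most the number of points, that term vanishes with
  \<open>\<epsilon>\<close>. The constants of R come from two bounds on second differences, 2
  everywhere and 5/a + 2/(n+1) at size n. While n+1 <= a/u the first is used; above that threshold
  the second is at most (5+2u)/a. Comparing two such values doubles both, which gives 4 and
  (4u+10)/a. With finitely many centers the discretized configurations form a countable set. There
  every test function is measurable and conditional laws are countable sums. Only the suprema in R
  might fail to be measurable, and they are reached through measurable functions lying below
  them.\<close>

lemma sum_mset_remove1_add:
  fixes \<phi> :: "'a multiset \<Rightarrow> real"
  shows "(\<Sum>s\<in>#add_mset x m. \<phi> (add_mset x m - {#s#})) =
    \<phi> m + (\<Sum>s\<in>#m. \<phi> (add_mset x (m - {#s#})))"
proof -
  have "image_mset (\<lambda>s. \<phi> (add_mset x m - {#s#})) m = image_mset (\<lambda>s. \<phi> (add_mset x (m - {#s#}))) m"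
    by (intro image_mset_cong) simp
  then show ?thesis by simp
qed

lemma sum_mset_abs_le:
  fixes \<phi> :: "'a \<Rightarrow> real"
  assumes "\<And>s. s \<in># m \<Longrightarrow> \<bar>\<phi> s\<bar> \<le> c"
  shows "\<bar>\<Sum>s\<in>#m. \<phi> s\<bar> \<le> real (size m) * c"
  using assms
proof (induction m)
  case (add x m)
  have "\<bar>\<phi> x\<bar> \<le> c" "\<bar>\<Sum>s\<in>#m. \<phi> s\<bar> \<le> real (size m) * c"
    using add by auto
  then show ?case by (auto simp: algebra_simps)
qed simp

lemma sum_mset_le_const:
  fixes \<phi> :: "'a \<Rightarrow> real"
  assumes "\<And>s. s \<in># m \<Longrightarrow> \<phi> s \<le> c"
  shows "(\<Sum>s\<in>#m. \<phi> s) \<le> real (size m) * c"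
  using assms
proof (induction m)
  case (add x m)
  have "\<phi> x \<le> c" "(\<Sum>s\<in>#m. \<phi> s) \<le> real (size m) * c"
    using add by auto
  then show ?case by (simp add: algebra_simps)
qed simp

lemma sum_mset_diff_const:
  fixes \<phi> :: "'a \<Rightarrow> real"
  shows "(\<Sum>s\<in>#m. \<phi> s - c) = (\<Sum>s\<in>#m. \<phi> s) - real (size m) * c"
  by (induction m) (auto simp: algebra_simps)

lemma sum_mset_diff:
  fixes \<phi> \<psi> :: "'a \<Rightarrow> real"
  shows "(\<Sum>s\<in>#m. \<phi> s - \<psi> s) = (\<Sum>s\<in>#m. \<phi> s) - (\<Sum>s\<in>#m. \<psi> s)"
  by (induction m) auto

lemma size_remove1: "s \<in># m \<Longrightarrow> real (size (m - {#s#})) = real (size m) - 1"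
  by (simp add: size_Diff_singleton of_nat_diff Suc_leI nonempty_has_size flip: nonempty_has_size)
     (metis One_nat_def Suc_leI empty_not_add_mset insert_DiffM nonempty_has_size of_nat_1 of_nat_diff)

text \<open>\<open>f\<close> models a test function after discretization. A metric bounded by 1
  allows a shift into [0,1], and moving one of n+1 points changes an average of n+1 distances by at
  most 1/(n+1). \<open>T\<close> and \<open>w\<close> are the centers and their masses under the
  immigration law; \<open>b\<close> is the \<beta> of the theorem.\<close>

locale birth_death_stein =
  fixes a b \<epsilon> :: real and T :: "'a set" and w :: "'a \<Rightarrow> real" and f :: "'a multiset \<Rightarrow> real"
  assumes a_pos: "a > 0" and b_nonneg: "b \<ge> 0" and eps_pos: "\<epsilon> > 0"
    and T_fin: "finite T" and w_nonneg: "\<And>s. s \<in> T \<Longrightarrow> w s \<ge> 0" and w_sum: "(\<Sum>s\<in>T. w s) = 1"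
    and f_range: "\<And>m. 0 \<le> f m \<and> f m \<le> 1"
    and f_move: "\<And>m x y. \<bar>f (add_mset x m) - f (add_mset y m)\<bar> \<le> 1 / (real (size m) + 1)"
begin

definition Nu :: "('a \<Rightarrow> real) \<Rightarrow> real" where
  "Nu \<phi> = (\<Sum>s\<in>T. w s * \<phi> s)"

text \<open>Death rate per point in a configuration of \<open>n\<close> points.\<close>

definition dr :: "nat \<Rightarrow> real" where
  "dr n = 1 + b * (real n - 1)"

lemma Nu_const [simp]: "Nu (\<lambda>_. c) = c"
  unfolding Nu_def using w_sum by (simp flip: sum_distrib_right)

lemma Nu_diff: "Nu (\<lambda>s. \<phi> s - \<psi> s) = Nu \<phi> - Nu \<psi>"
  unfolding Nu_def by (simp add: algebra_simps sum_subtractf)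

lemma Nu_mono: "(\<And>s. \<phi> s \<le> \<psi> s) \<Longrightarrow> Nu \<phi> \<le> Nu \<psi>"
  unfolding Nu_def by (intro sum_mono mult_left_mono) (auto simp: w_nonneg)

lemma Nu_le: "(\<And>s. \<phi> s \<le> c) \<Longrightarrow> Nu \<phi> \<le> c"
  using Nu_mono[of \<phi> "\<lambda>_. c"] by simp

lemma Nu_ge: "(\<And>s. c \<le> \<phi> s) \<Longrightarrow> c \<le> Nu \<phi>"
  using Nu_mono[of "\<lambda>_. c" \<phi>] by simp

lemma Nu_abs_le: "(\<And>s. \<bar>\<phi> s\<bar> \<le> c) \<Longrightarrow> \<bar>Nu \<phi>\<bar> \<le> c"
  using Nu_le[of \<phi> c] Nu_ge[of "- c" \<phi>] by (auto simp: abs_le_iff minus_le_iff)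

lemma dr_ge_1: "n \<ge> 1 \<Longrightarrow> dr n \<ge> 1"
  using b_nonneg unfolding dr_def by simp

lemma dr_Suc: "dr (Suc n) = dr n + b"
  unfolding dr_def by (simp add: algebra_simps)

lemma dr_mono: "dr n \<le> dr (Suc n)"
  using dr_Suc b_nonneg by simp

lemma size_dr_nonneg: "real n * dr n \<ge> 0"
  by (cases n) (use dr_ge_1[of n] in auto)

text \<open>
  A maximum principle: the generator on the right has unbounded death rates, so \<open>u\<close> is compared with
  small multiples of the Lyapunov function \<open>n + a / \<epsilon>\<close>, which is superharmonic for the killed chain.
\<close>

lemma maximum_principle:
  fixes u kill :: "'a multiset \<Rightarrow> real" and r :: "nat \<Rightarrow> real"
  assumes bdd: "\<And>m. u m \<le> C"
    and kill: "\<And>m. kill m \<ge> \<epsilon>"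
    and r: "\<And>n. n \<ge> 1 \<Longrightarrow> r n \<ge> 0"
    and ineq: "\<And>m. kill m * u m \<le> a * Nu (\<lambda>s. u (add_mset s m) - u m)
                   + r (size m) * (\<Sum>s\<in>#m. u (m - {#s#}) - u m)"
  shows "u m \<le> 0"
proof (rule ccontr)
  assume "\<not> u m \<le> 0"
  then have pos: "u m > 0" by simp
  define K where "K = a / \<epsilon>"
  have K: "K > 0" using a_pos eps_pos by (simp add: K_def)
  \<comment> \<open>The penalty takes exactly half of \<open>u m\<close>, so \<open>z m\<close>
    stays positive, while \<open>z\<close> is negative at large sizes.\<close>
  define \<eta> where "\<eta> = u m / (2 * (real (size m) + K))"
  have eta: "\<eta> > 0" using pos K by (simp add: \<eta>_def add_nonneg_pos)
  define z where "z = (\<lambda>m::'a multiset. u m - \<eta> * (real (size m) + K))"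
  have half: "c / (2 * S) * S = c / 2" if "S > 0" for c S :: real using that by simp
  have "real (size m) + K > 0" using K by simp
  then have "\<eta> * (real (size m) + K) = u m / 2"
    unfolding \<eta>_def by (rule half)
  then have zm: "z m > 0" using pos by (simp add: z_def)
  have zC: "z m \<le> C" for m
    using bdd[of m] eta K by (simp add: z_def) (smt (verit) mult_nonneg_nonneg of_nat_0_le_iff)
  \<comment> \<open>The penalty lowers the birth term by \<open>a * \<eta>\<close>. Killing at rate
    at least \<open>\<epsilon>\<close> makes up for it, because \<open>\<epsilon> * K = a\<close>,
    and deaths only help; so \<open>z\<close> inherits the inequality.\<close>
  have zineq: "kill m * z m \<le> a * Nu (\<lambda>s. z (add_mset s m) - z m)
                   + r (size m) * (\<Sum>s\<in>#m. z (m - {#s#}) - z m)" for m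
  proof -
    have 1: "Nu (\<lambda>s. z (add_mset s m) - z m) = Nu (\<lambda>s. u (add_mset s m) - u m) - \<eta>"
    proof -
      have "(\<lambda>s. z (add_mset s m) - z m) = (\<lambda>s. (u (add_mset s m) - u m) - \<eta>)"
        by (auto simp: z_def algebra_simps)
      then show ?thesis by (simp add: Nu_diff)
    qed
    have 2: "(\<Sum>s\<in>#m. z (m - {#s#}) - z m) = (\<Sum>s\<in>#m. u (m - {#s#}) - u m) + real (size m) * \<eta>"
    proof -
      have "image_mset (\<lambda>s. z (m - {#s#}) - z m) m = image_mset (\<lambda>s. (u (m - {#s#}) - u m) - (- \<eta>)) m"
        by (intro image_mset_cong) (simp add: z_def size_remove1 algebra_simps)
      then have "(\<Sum>s\<in>#m. z (m - {#s#}) - z m) = (\<Sum>s\<in>#m. (u (m - {#s#}) - u m) - (- \<eta>))" by (rule arg_cong)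
      also have "\<dots> = (\<Sum>s\<in>#m. u (m - {#s#}) - u m) - real (size m) * (- \<eta>)" by (rule sum_mset_diff_const)
      finally show ?thesis by simp
    qed
    have 3: "r (size m) * (real (size m) * \<eta>) \<ge> 0"
      using r[of "size m"] eta by (cases "size m") auto
    have 4: "kill m * (\<eta> * (real (size m) + K)) \<ge> a * \<eta>"
    proof -
      have "a * \<eta> = \<epsilon> * (\<eta> * K)" using eps_pos by (simp add: K_def)
      also have "\<dots> \<le> kill m * (\<eta> * (real (size m) + K))"
        using kill[of m] eps_pos eta K by (intro mult_mono) auto
      finally show ?thesis .
    qed
    have "kill m * z m = kill m * u m - kill m * (\<eta> * (real (size m) + K))"
      by (simp add: z_def algebra_simps)
    also have "\<dots> \<le> a * Nu (\<lambda>s. u (add_mset s m) - u m)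
                   + r (size m) * (\<Sum>s\<in>#m. u (m - {#s#}) - u m) - a * \<eta> + r (size m) * (real (size m) * \<eta>)"
      using ineq[of m] 3 4 by linarith
    also have "\<dots> = a * (Nu (\<lambda>s. u (add_mset s m) - u m) - \<eta>)
                   + r (size m) * ((\<Sum>s\<in>#m. u (m - {#s#}) - u m) + real (size m) * \<eta>)"
      by (simp add: algebra_simps)
    finally show ?thesis unfolding 1 2 .
  qed
  define Z where "Z = (SUP m. z m)"
  have bddZ: "bdd_above (range z)" using zC by (auto intro!: bdd_aboveI)
  have zZ: "z m \<le> Z" for m unfolding Z_def by (rule cSUP_upper[OF _ bddZ]) simp
  have Zpos: "Z > 0" using zm zZ[of m] by simp
  \<comment> \<open>Positivity of \<open>z\<close> caps the size: the penalty must stay below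
    \<open>C\<close>. This is what makes the unbounded death rates harmless.\<close>
  define N where "N = nat \<lceil>C / \<eta>\<rceil>"
  have sizeN: "size m \<le> N" if "z m > 0" for m
  proof -
    have "\<eta> * real (size m) \<le> \<eta> * (real (size m) + K)" using eta K by simp
    also have "\<dots> < C" using that bdd[of m] by (simp add: z_def)
    finally have "real (size m) \<le> C / \<eta>" using eta by (simp add: field_simps)
    then show ?thesis unfolding N_def by linarith
  qed
  define Q where "Q = a + (\<Sum>i\<le>N. \<bar>r i\<bar> * real i)"
  have Q: "Q > 0" using a_pos unfolding Q_def by (simp add: add_pos_nonneg sum_nonneg)
  \<comment> \<open>The supremum need not be attained, since infinitely many configurations can
    share a size. A point within \<open>\<theta>\<close> of it suffices: its total jump rate is at
    most \<open>Q\<close>, and \<open>(Q + \<epsilon>) * \<theta> = \<epsilon> * Z / 2\<close>,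
    which contradicts positivity of \<open>Z\<close>.\<close>
  define \<theta> where "\<theta> = \<epsilon> * Z / (2 * (Q + \<epsilon>))"
  have theta: "\<theta> > 0" using eps_pos Zpos Q by (simp add: \<theta>_def)
  have thetaZ: "\<theta> < Z" using eps_pos Zpos Q by (simp add: \<theta>_def field_simps add_pos_pos)
  obtain m' where m': "z m' > Z - \<theta>"
    using less_cSUP_iff[OF _ bddZ, of "Z - \<theta>"] theta unfolding Z_def by force
  have zpos: "z m' > 0" using m' thetaZ by simp
  have A: "Nu (\<lambda>s. z (add_mset s m') - z m') \<le> Z - z m'"
    by (rule Nu_le) (use zZ in simp)
  have B: "(\<Sum>s\<in>#m'. z (m' - {#s#}) - z m') \<le> real (size m') * (Z - z m')"
    by (rule sum_mset_le_const) (use zZ in simp)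
  have C: "r (size m') * real (size m') \<le> (\<Sum>i\<le>N. \<bar>r i\<bar> * real i)"
  proof -
    have "r (size m') * real (size m') \<le> \<bar>r (size m')\<bar> * real (size m')" by (intro mult_right_mono) auto
    also have "\<dots> \<le> (\<Sum>i\<le>N. \<bar>r i\<bar> * real i)"
      using sizeN[OF zpos] by (intro member_le_sum) auto
    finally show ?thesis .
  qed
  have rB: "r (size m') * (\<Sum>s\<in>#m'. z (m' - {#s#}) - z m') \<le> r (size m') * (real (size m') * (Z - z m'))"
  proof (cases "m' = {#}")
    case False
    then have "r (size m') \<ge> 0" by (intro r) (simp add: Suc_leI nonempty_has_size)
    then show ?thesis by (intro mult_left_mono B)
  qed simp
  have "\<epsilon> * z m' \<le> kill m' * z m'" using kill zpos by simp
  also have "\<dots> \<le> a * (Z - z m') + r (size m') * (real (size m') * (Z - z m'))"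
    using zineq[of m'] A rB a_pos by (smt (verit) mult_left_mono)
  also have "\<dots> = (a + r (size m') * real (size m')) * (Z - z m')" by (simp add: algebra_simps)
  also have "\<dots> \<le> Q * (Z - z m')"
    using C zZ[of m'] by (intro mult_right_mono) (auto simp: Q_def)
  also have "\<dots> \<le> Q * \<theta>" using m' Q by (intro mult_left_mono) auto
  finally have "\<epsilon> * (Z - \<theta>) < Q * \<theta>" using m' eps_pos by (smt (verit) mult_less_cancel_left_pos)
  then have "\<epsilon> * Z < (Q + \<epsilon>) * \<theta>" by (simp add: algebra_simps)
  also have "\<dots> = \<epsilon> * Z / 2" using Q eps_pos by (simp add: \<theta>_def field_simps)
  finally show False using eps_pos Zpos by (simp add: field_simps)
qed

section \<open>The resolvent as a monotone limit\<close>

primrec iter :: "nat \<Rightarrow> 'a multiset \<Rightarrow> real" where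
  "iter 0 = (\<lambda>m. 0)"
| "iter (Suc n) = (\<lambda>m. (a * Nu (\<lambda>s. iter n (add_mset s m)) + dr (size m) * (\<Sum>s\<in>#m. iter n (m - {#s#})) + f m)
      / (\<epsilon> + a + real (size m) * dr (size m)))"

declare iter.simps [simp del]

text \<open>Probabilistically, \<open>sol m\<close> is the expected integral of
  exp(-\<open>\<epsilon>\<close> t) f(X t) over all times t for the chain X started in
  \<open>m\<close>, and \<open>iter n\<close> counts only the reward collected in the first
  \<open>n\<close> states visited. The divisor in the recursion is the total rate of leaving or
  being killed.\<close>

definition sol :: "'a multiset \<Rightarrow> real" where
  "sol m = (SUP n. iter n m)"

lemma rate_pos: "\<epsilon> + a + real n * dr n > 0"
  using eps_pos a_pos size_dr_nonneg[of n] by linarith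

lemma dr_sum_mono:
  assumes "\<And>s. s \<in># m \<Longrightarrow> (\<phi> s :: real) \<le> \<psi> s"
  shows "dr (size m) * (\<Sum>s\<in>#m. \<phi> s) \<le> dr (size m) * (\<Sum>s\<in>#m. \<psi> s)"
proof (cases "m = {#}")
  case False
  then have "dr (size m) \<ge> 0" using dr_ge_1[of "size m"] by (simp add: Suc_leI nonempty_has_size)
  moreover have "(\<Sum>s\<in>#m. \<phi> s) \<le> (\<Sum>s\<in>#m. \<psi> s)" using assms by (induction m) (auto intro: add_mono)
  ultimately show ?thesis by (rule mult_left_mono[rotated])
qed simp

lemma iter_mono: "iter n m \<le> iter (Suc n) m"
proof (induction n arbitrary: m)
  case 0
  have "0 \<le> (a * Nu (\<lambda>s. 0) + dr (size m) * (\<Sum>s\<in>#m. 0) + f m)"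
    using f_range[of m] by simp
  then show ?case using rate_pos[of "size m"] by (simp add: iter.simps)
next
  case (Suc n)
  have "a * Nu (\<lambda>s. iter n (add_mset s m)) + dr (size m) * (\<Sum>s\<in>#m. iter n (m - {#s#})) + f m
    \<le> a * Nu (\<lambda>s. iter (Suc n) (add_mset s m)) + dr (size m) * (\<Sum>s\<in>#m. iter (Suc n) (m - {#s#})) + f m"
    by (intro add_mono mult_left_mono Nu_mono dr_sum_mono order_refl Suc.IH less_imp_le a_pos)
  then show ?case
    using rate_pos[of "size m"] by (subst (1 2) iter.simps(2)) (intro divide_right_mono, auto)
qed

lemma iter_range: "0 \<le> iter n m \<and> iter n m \<le> 1 / \<epsilon>"
proof (intro conjI)
  show "0 \<le> iter n m"
    using lift_Suc_mono_le[of "\<lambda>n. iter n m" 0 n] iter_mono by (simp add: iter.simps(1))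
  show "iter n m \<le> 1 / \<epsilon>"
  proof (induction n arbitrary: m)
    case (Suc n)
    have "a * Nu (\<lambda>s. iter n (add_mset s m)) + dr (size m) * (\<Sum>s\<in>#m. iter n (m - {#s#})) + f m
      \<le> a * Nu (\<lambda>s. 1 / \<epsilon>) + dr (size m) * (\<Sum>s\<in>#m. 1 / \<epsilon>) + 1"
      using a_pos Suc f_range by (intro add_mono mult_left_mono Nu_mono dr_sum_mono) auto
    also have "\<dots> = (\<epsilon> + a + real (size m) * dr (size m)) * (1 / \<epsilon>)"
      using eps_pos by (simp add: field_simps)
    finally have "\<dots> \<ge> a * Nu (\<lambda>s. iter n (add_mset s m)) + dr (size m) * (\<Sum>s\<in>#m. iter n (m - {#s#})) + f m" .
    then show ?case using rate_pos[of "size m"] by (simp add: field_simps iter.simps)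
  qed (use eps_pos in \<open>simp add: iter.simps\<close>)
qed

lemma iter_tendsto: "(\<lambda>n. iter n m) \<longlonglongrightarrow> sol m"
  unfolding sol_def
  by (rule LIMSEQ_incseq_SUP)
     (use iter_range iter_mono in \<open>auto intro!: bdd_aboveI incseq_SucI simp del: iter.simps\<close>)

lemma sol_range: "0 \<le> sol m" "\<epsilon> * sol m \<le> 1"
proof -
  have "0 \<le> sol m" "sol m \<le> 1 / \<epsilon>"
    using iter_range by (auto intro!: LIMSEQ_le_const[OF iter_tendsto] LIMSEQ_le_const2[OF iter_tendsto])
  then show "0 \<le> sol m" "\<epsilon> * sol m \<le> 1" using eps_pos by (auto simp: field_simps)
qed

lemma sol_abs_le: "\<bar>sol m\<bar> \<le> 1 / \<epsilon>"
  using sol_range[of m] eps_pos by (simp add: field_simps)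

text \<open>The averages in the recursion are finite sums, so it passes to the limit pointwise;
  multiplying by the total rate then gives Stein's equation.\<close>

lemma sol_eq:
  "\<epsilon> * sol m = a * Nu (\<lambda>s. sol (add_mset s m) - sol m) + dr (size m) * (\<Sum>s\<in>#m. sol (m - {#s#}) - sol m) + f m"
proof -
  have "(\<lambda>n. iter (Suc n) m) \<longlonglongrightarrow>
     (a * Nu (\<lambda>s. sol (add_mset s m)) + dr (size m) * (\<Sum>s\<in>#m. sol (m - {#s#})) + f m)
      / (\<epsilon> + a + real (size m) * dr (size m))"
  proof -
    have 1: "(\<lambda>n. (\<Sum>s\<in>#m'. iter n (m - {#s#}))) \<longlonglongrightarrow> (\<Sum>s\<in>#m'. sol (m - {#s#}))" for m'
      by (induction m') (auto intro!: tendsto_add iter_tendsto)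
    have 2: "(\<lambda>n. Nu (\<lambda>s. iter n (add_mset s m))) \<longlonglongrightarrow> Nu (\<lambda>s. sol (add_mset s m))"
      unfolding Nu_def by (intro tendsto_intros iter_tendsto)
    show ?thesis
      unfolding iter.simps
      by (intro tendsto_intros 1 2) (use rate_pos[of "size m"] in auto)
  qed
  moreover have "(\<lambda>n. iter (Suc n) m) \<longlonglongrightarrow> sol m"
    using iter_tendsto by (rule LIMSEQ_Suc)
  ultimately have "sol m = (a * Nu (\<lambda>s. sol (add_mset s m)) + dr (size m) * (\<Sum>s\<in>#m. sol (m - {#s#})) + f m)
      / (\<epsilon> + a + real (size m) * dr (size m))"
    by (rule LIMSEQ_unique[rotated])
  then have "(\<epsilon> + a + real (size m) * dr (size m)) * sol m =
      a * Nu (\<lambda>s. sol (add_mset s m)) + dr (size m) * (\<Sum>s\<in>#m. sol (m - {#s#})) + f m"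
    using rate_pos[of "size m"] by (simp add: field_simps)
  then show ?thesis by (simp add: Nu_diff sum_mset_diff_const algebra_simps)
qed

text \<open>\<open>D x\<close> is the effect of adding the point \<open>x\<close>, \<open>E x y\<close> that of moving a point from \<open>y\<close> to \<open>x\<close>.\<close>

definition D :: "'a \<Rightarrow> 'a multiset \<Rightarrow> real" where
  "D x m = sol (add_mset x m) - sol m"

definition E :: "'a \<Rightarrow> 'a \<Rightarrow> 'a multiset \<Rightarrow> real" where
  "E x y m = sol (add_mset x m) - sol (add_mset y m)"

definition V :: "'a \<Rightarrow> 'a \<Rightarrow> 'a multiset \<Rightarrow> real" where
  "V x y m = D x (add_mset y m) - D x m"

text \<open>Couple two chains that share \<open>m\<close> and differ in one point. When the
  differing point dies, both reach \<open>m\<close> and the difference is gone; that jump therefore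
  acts as killing at the rate of one point, and the change of \<open>f\<close> is the only
  source.\<close>

lemma E_eq:
  "(\<epsilon> + dr (Suc (size m))) * E x y m = a * Nu (\<lambda>s. E x y (add_mset s m) - E x y m)
    + dr (Suc (size m)) * (\<Sum>s\<in>#m. E x y (m - {#s#}) - E x y m) + (f (add_mset x m) - f (add_mset y m))"
proof -
  have A: "Nu (\<lambda>s. E x y (add_mset s m) - E x y m) = Nu (\<lambda>s. sol (add_mset s (add_mset x m)) - sol (add_mset x m))
      - Nu (\<lambda>s. sol (add_mset s (add_mset y m)) - sol (add_mset y m))"
    unfolding Nu_diff[symmetric] E_def by (intro arg_cong[where f=Nu]) (auto simp: add_mset_commute)
  have S: "(\<Sum>s\<in>#add_mset z m. sol (add_mset z m - {#s#}) - sol (add_mset z m))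
      = sol m + (\<Sum>s\<in>#m. sol (add_mset z (m - {#s#}))) - real (Suc (size m)) * sol (add_mset z m)" for z
    by (simp only: sum_mset_diff_const sum_mset_remove1_add size_add_mset)
  have B: "(\<Sum>s\<in>#m. E x y (m - {#s#}) - E x y m) =
     (\<Sum>s\<in>#m. sol (add_mset x (m - {#s#}))) - (\<Sum>s\<in>#m. sol (add_mset y (m - {#s#}))) - real (size m) * E x y m"
    by (simp add: sum_mset_diff_const E_def sum_mset_diff)
  show ?thesis
    using sol_eq[of "add_mset x m"] sol_eq[of "add_mset y m"]
    unfolding A S B size_add_mset by (simp add: E_def algebra_simps)
qed

text \<open>Comparison with a function of the size alone: the maximum principle applies to the
  difference, because the source of the equation for \<open>E\<close> is at most 1/(n+1) whatever
  the positions of the points.\<close>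

lemma E_le_supersolution:
  assumes e: "\<And>n. e n \<le> (C::real)" "\<And>n. e n \<ge> - C"
    and super: "\<And>n. 1 / (real n + 1) + a * (e (Suc n) - e n) + dr (Suc n) * (real n * (e (n - 1) - e n))
      \<le> (\<epsilon> + dr (Suc n)) * e n"
  shows "E x y m \<le> e (size m)"
proof -
  define u where "u = (\<lambda>m. E x y m - e (size m))"
  have "u m \<le> 0"
  proof (rule maximum_principle[where u=u and kill="\<lambda>m. \<epsilon> + dr (Suc (size m))" and r="\<lambda>n. dr (Suc n)" and C="2 / \<epsilon> + C"])
    show "u m \<le> 2 / \<epsilon> + C" for m
      using sol_abs_le[of "add_mset x m"] sol_abs_le[of "add_mset y m"] e(2)[of "size m"]
      by (simp add: u_def E_def)
    show "\<epsilon> \<le> \<epsilon> + dr (Suc (size m))" for m :: "'a multiset" using dr_ge_1[of "Suc (size m)"] by simp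
    show "0 \<le> dr (Suc n)" for n using dr_ge_1[of "Suc n"] by simp
    show "(\<epsilon> + dr (Suc (size m))) * u m \<le> a * Nu (\<lambda>s. u (add_mset s m) - u m)
        + dr (Suc (size m)) * (\<Sum>s\<in>#m. u (m - {#s#}) - u m)" for m
    proof -
      have 1: "Nu (\<lambda>s. u (add_mset s m) - u m) = Nu (\<lambda>s. E x y (add_mset s m) - E x y m) - (e (Suc (size m)) - e (size m))"
      proof -
        have "(\<lambda>s. u (add_mset s m) - u m) = (\<lambda>s. (E x y (add_mset s m) - E x y m) - (e (Suc (size m)) - e (size m)))"
          by (auto simp: u_def)
        then show ?thesis by (simp add: Nu_diff)
      qed
      have 2: "(\<Sum>s\<in>#m. u (m - {#s#}) - u m) = (\<Sum>s\<in>#m. E x y (m - {#s#}) - E x y m)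
         - real (size m) * (e (size m - 1) - e (size m))"
      proof -
        have "image_mset (\<lambda>s. u (m - {#s#}) - u m) m
           = image_mset (\<lambda>s. (E x y (m - {#s#}) - E x y m) - (e (size m - 1) - e (size m))) m"
          by (intro image_mset_cong) (simp add: u_def size_Diff_singleton)
        then have "(\<Sum>s\<in>#m. u (m - {#s#}) - u m)
            = (\<Sum>s\<in>#m. (E x y (m - {#s#}) - E x y m) - (e (size m - 1) - e (size m)))" by (rule arg_cong)
        also have "\<dots> = (\<Sum>s\<in>#m. E x y (m - {#s#}) - E x y m) - real (size m) * (e (size m - 1) - e (size m))"
          by (rule sum_mset_diff_const)
        finally show ?thesis .
      qed
      have um: "u m = E x y m - e (size m)" by (simp add: u_def)
      have "f (add_mset x m) - f (add_mset y m) \<le> 1 / (real (size m) + 1)" using f_move[of x m y] by linarith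
      then show ?thesis
        using super[of "size m"] E_eq[of m x y] unfolding 1 2 unfolding um by (simp add: algebra_simps)
    qed
  qed
  then show ?thesis by (simp add: u_def)
qed

lemma E_swap: "E x y m = - E y x m"
  by (simp add: E_def)

text \<open>The constant 1 is a supersolution: one point dies at rate at least 1, and the source is
  at most 1.\<close>

lemma E_abs_le_1: "\<bar>E x y m\<bar> \<le> 1"
proof -
  have "E x y m \<le> 1" for x y
  proof (rule E_le_supersolution[where C=1])
    fix n
    have "1 / (real n + 1) \<le> 1" by simp
    then have "1 / (real n + 1) \<le> \<epsilon> + dr (Suc n)"
      using dr_ge_1[of "Suc n"] eps_pos by linarith
    then show "1 / (real n + 1) + a * (1 - 1) + dr (Suc n) * (real n * (1 - 1)) \<le> (\<epsilon> + dr (Suc n)) * 1"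
      by simp
  qed auto
  from this[of x y] this[of y x] show ?thesis using E_swap[of x y m] by linarith
qed

text \<open>A supersolution decaying in the size. For n >= 1 the deaths act on the summand
  1/(2(n+1)) so that it balances its own killing exactly. The source 1/(n+1) is then left to the
  births, which contribute a/(2(n+1)(n+2)), and to the constant 3/(4a).\<close>

definition eb :: "nat \<Rightarrow> real" where
  "eb n = 3 / (4 * a) + 1 / (2 * (real n + 1))"

lemma eb_pos: "eb n > 0"
  using a_pos by (simp add: eb_def add_pos_pos)

lemma eb_antimono: "m \<le> n \<Longrightarrow> eb n \<le> eb m"
  unfolding eb_def by (simp add: frac_le)

lemma eb_supersolution:
  "1 / (real n + 1) + a * (eb (Suc n) - eb n) + dr (Suc n) * (real n * (eb (n - 1) - eb n))
      \<le> (\<epsilon> + dr (Suc n)) * eb n"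
proof -
  have d: "dr (Suc n) \<ge> 1" using dr_ge_1[of "Suc n"] by simp
  have ed: "dr (Suc n) * eb n \<le> (\<epsilon> + dr (Suc n)) * eb n"
    using eps_pos eb_pos[of n] by (intro mult_right_mono) auto
  have s: "a * (eb (Suc n) - eb n) = - (a / (2 * (real n + 1) * (real n + 2)))"
  proof -
    have "eb (Suc n) - eb n = (1 / (real n + 2) - 1 / (real n + 1)) / 2"
      unfolding eb_def by (simp add: diff_divide_distrib algebra_simps)
    also have "1 / (real n + 2) - 1 / (real n + 1) = - (1 / ((real n + 1) * (real n + 2)))"
      by (simp add: divide_simps)
    finally show ?thesis by simp
  qed
  have D1: "3 / (4 * a) \<le> dr (Suc n) * (3 / (4 * a))"
    using mult_right_mono[OF d, of "3 / (4 * a)"] a_pos by simp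
  show ?thesis
  proof (cases n)
    case 0
    \<comment> \<open>At size 0 there are no deaths, so the summand 1/2 of \<open>eb 0\<close> is
      not spent and joins the right-hand side.\<close>
    have "1 \<le> a / 4 + 3 / (4 * a) + 1 / 2"
    proof -
      have "0 \<le> (a - 1)\<^sup>2 + 2" by simp
      then have "2 * a \<le> a\<^sup>2 + 3" by (simp add: power2_eq_square algebra_simps)
      then show ?thesis using a_pos by (simp add: field_simps power2_eq_square)
    qed
    moreover have "3 / (4 * a) + 1 / 2 \<le> dr (Suc n) * eb n"
      using mult_right_mono[OF d, of "eb n"] eb_pos[of n] 0 by (simp add: eb_def)
    ultimately show ?thesis using s ed 0 by simp
  next
    case (Suc k)
    have t: "real n * (eb (n - 1) - eb n) = 1 / (2 * (real n + 1))"
    proof -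
      have h: "N * (1 / (2 * N) - 1 / (2 * (N + 1))) = 1 / (2 * (N + 1))" if "N > 0" for N :: real
        using that by (simp add: divide_simps)
      have "eb (n - 1) - eb n = 1 / (2 * real n) - 1 / (2 * (real n + 1))"
        using Suc by (simp add: eb_def)
      then show ?thesis using h[of "real n"] Suc by simp
    qed
    have "1 / (real n + 1) \<le> a / (2 * (real n + 1) * (real n + 2)) + 3 / (4 * a)"
    proof -
      define N where "N = real n + 1"
      have N: "N \<ge> 2" using Suc by (simp add: N_def)
      \<comment> \<open>By the inequality of means, a constant c/a in place of 3/(4a) would do if c
        >= (N+1)/(2N). For N >= 2 this is largest at N = 2, where it equals 3/4.\<close>
      have "0 \<le> (2 * a - 2 * (N + 1))\<^sup>2 + 2 * (N + 1) * (N - 2)" using N by (intro add_nonneg_nonneg) auto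
      then have "4 * a * (N + 1) * 2 \<le> 4 * a\<^sup>2 + 6 * N * (N+1)" 
        by (simp add: power2_eq_square algebra_simps)
      then have "4 * a * (N + 1) \<le> 2 * a\<^sup>2 + 3 * N * (N+1)" by simp
      then have "1 / N \<le> a / (2 * N * (N + 1)) + 3 / (4 * a)"
      proof -
        define P where "P = 4 * a * N * (N + 1)"
        have P: "P > 0" using a_pos N by (simp add: P_def)
        have "1 / N = 4 * a * (N + 1) / P" "a / (2 * N * (N + 1)) = 2 * a\<^sup>2 / P" "3 / (4 * a) = 3 * N * (N + 1) / P"
          using a_pos N by (auto simp: P_def divide_simps power2_eq_square)
        then show ?thesis
          using divide_right_mono[OF \<open>4 * a * (N + 1) \<le> 2 * a\<^sup>2 + 3 * N * (N + 1)\<close>, of P] P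
          by (simp add: add_divide_distrib)
      qed
      then show ?thesis by (simp add: N_def add.commute)
    qed
    moreover have "dr (Suc n) * eb n = dr (Suc n) * (3 / (4 * a)) + dr (Suc n) * (1 / (2 * (real n + 1)))"
      by (simp add: eb_def algebra_simps)
    ultimately show ?thesis using s ed t D1 by simp
  qed
qed

lemma E_abs_le_eb: "\<bar>E x y m\<bar> \<le> eb (size m)"
proof -
  have "E x y m \<le> eb (size m)" for x y
  proof (rule E_le_supersolution[where C="eb 0"])
    show "eb n \<le> eb 0" for n by (simp add: eb_antimono)
    show "eb n \<ge> - eb 0" for n using eb_pos[of n] eb_pos[of 0] by simp
  qed (rule eb_supersolution)
  from this[of x y] this[of y x] show ?thesis using E_swap[of x y m] by linarith
qed

text \<open>Couple the chains from \<open>add_mset x m\<close> and \<open>m\<close>. The death of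
  \<open>x\<close> merges them. Each point of \<open>m\<close> dies faster by \<open>b\<close> in
  the larger configuration; such an extra death leaves two configurations of equal size that differ
  by one moved point. This explains both the killing \<open>b * size m\<close> and the extra
  source.\<close>

lemma D_eq:
  "(\<epsilon> + dr (Suc (size m)) + b * real (size m)) * D x m = a * Nu (\<lambda>s. D x (add_mset s m) - D x m)
    + dr (size m) * (\<Sum>s\<in>#m. D x (m - {#s#}) - D x m)
    + (f (add_mset x m) - f m + b * (\<Sum>s\<in>#m. sol (add_mset x (m - {#s#})) - sol m))"
proof -
  have A: "Nu (\<lambda>s. D x (add_mset s m) - D x m) = Nu (\<lambda>s. sol (add_mset s (add_mset x m)) - sol (add_mset x m))
      - Nu (\<lambda>s. sol (add_mset s m) - sol m)"
    unfolding Nu_diff[symmetric] D_def by (intro arg_cong[where f=Nu]) (auto simp: add_mset_commute)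
  have S: "(\<Sum>s\<in>#add_mset z m. sol (add_mset z m - {#s#}) - sol (add_mset z m))
      = sol m + (\<Sum>s\<in>#m. sol (add_mset z (m - {#s#}))) - real (Suc (size m)) * sol (add_mset z m)" for z
    by (simp only: sum_mset_diff_const sum_mset_remove1_add size_add_mset)
  have B: "(\<Sum>s\<in>#m. D x (m - {#s#}) - D x m) =
     (\<Sum>s\<in>#m. sol (add_mset x (m - {#s#}))) - (\<Sum>s\<in>#m. sol (m - {#s#})) - real (size m) * D x m"
    by (simp add: sum_mset_diff_const D_def sum_mset_diff)
  show ?thesis
    using sol_eq[of "add_mset x m"] sol_eq[of m]
    unfolding A S B size_add_mset dr_Suc by (simp add: D_def sum_mset_diff_const algebra_simps)
qed

text \<open>Replacing \<open>s\<close> by \<open>x\<close> is the move \<open>E x s\<close> over the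
  remaining points.\<close>

lemma moved_abs_le:
  assumes "s \<in># m" shows "\<bar>sol (add_mset x (m - {#s#})) - sol m\<bar> \<le> 1"
  using E_abs_le_1[of x s "m - {#s#}"] assms by (simp add: E_def)

lemma moved_abs_le_eb:
  assumes "s \<in># m" shows "\<bar>sol (add_mset x (m - {#s#})) - sol m\<bar> \<le> eb (size m - 1)"
  using E_abs_le_eb[of x s "m - {#s#}"] assms by (simp add: E_def size_Diff_singleton)

text \<open>The source is at most 1 + b n, by \<open>moved_abs_le\<close>, and the killing rate is
  at least as large, so 1 is again a supersolution. The factor \<open>\<sigma>\<close> treats both
  signs at once.\<close>

lemma D_abs_le_1: "\<bar>D x m\<bar> \<le> 1"
proof -
  have "\<sigma> * D x m \<le> 1" if \<sigma>: "\<sigma> = 1 \<or> \<sigma> = -1" for \<sigma> :: real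
  proof -
    define u where "u = (\<lambda>m. \<sigma> * D x m - 1)"
    have "u m \<le> 0"
    proof (rule maximum_principle[where u=u and kill="\<lambda>m. \<epsilon> + dr (Suc (size m)) + b * real (size m)" and r=dr and C="2 / \<epsilon>"])
      show "u m \<le> 2 / \<epsilon>" for m
        using sol_abs_le[of "add_mset x m"] sol_abs_le[of m] \<sigma>
        by (auto simp: u_def D_def)
      show "\<epsilon> \<le> \<epsilon> + dr (Suc (size m)) + b * real (size m)" for m :: "'a multiset"
        using dr_ge_1[of "Suc (size m)"] b_nonneg by simp
      show "0 \<le> dr n" if "1 \<le> n" for n using dr_ge_1[OF that] by simp
      fix m
      define src where "src = f (add_mset x m) - f m + b * (\<Sum>s\<in>#m. sol (add_mset x (m - {#s#})) - sol m)"
      have src: "\<sigma> * src \<le> 1 + b * real (size m)"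
      proof -
        have "\<bar>\<Sum>s\<in>#m. sol (add_mset x (m - {#s#})) - sol m\<bar> \<le> real (size m) * 1"
          by (rule sum_mset_abs_le) (rule moved_abs_le)
        then have "\<bar>b * (\<Sum>s\<in>#m. sol (add_mset x (m - {#s#})) - sol m)\<bar> \<le> b * real (size m)"
          using b_nonneg by (simp add: abs_mult mult_left_mono)
        moreover have "\<bar>f (add_mset x m) - f m\<bar> \<le> 1"
          using f_range[of "add_mset x m"] f_range[of m] by (auto simp: abs_le_iff)
        ultimately have "\<bar>src\<bar> \<le> 1 + b * real (size m)" unfolding src_def by linarith
        then show ?thesis using \<sigma> by auto
      qed
      have 1: "Nu (\<lambda>s. u (add_mset s m) - u m) = \<sigma> * Nu (\<lambda>s. D x (add_mset s m) - D x m)"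
        unfolding Nu_def u_def by (simp add: sum_distrib_left algebra_simps)
      have 2: "(\<Sum>s\<in>#m. u (m - {#s#}) - u m) = \<sigma> * (\<Sum>s\<in>#m. D x (m - {#s#}) - D x m)"
        unfolding u_def by (simp add: sum_mset_distrib_left algebra_simps)
      have eq: "\<sigma> * ((\<epsilon> + dr (Suc (size m)) + b * real (size m)) * D x m) = \<sigma> * (a * Nu (\<lambda>s. D x (add_mset s m) - D x m)
        + dr (size m) * (\<Sum>s\<in>#m. D x (m - {#s#}) - D x m) + src)"
        unfolding D_eq src_def ..
      have um: "u m = \<sigma> * D x m - 1" by (simp add: u_def)
      have "1 + b * real (size m) \<le> \<epsilon> + dr (Suc (size m)) + b * real (size m)"
        using eps_pos dr_ge_1[of "Suc (size m)"] by simp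
      then show "(\<epsilon> + dr (Suc (size m)) + b * real (size m)) * u m \<le> a * Nu (\<lambda>s. u (add_mset s m) - u m)
          + dr (size m) * (\<Sum>s\<in>#m. u (m - {#s#}) - u m)"
        using eq src unfolding 1 2 unfolding um by (simp add: algebra_simps)
    qed
    then show ?thesis by (simp add: u_def)
  qed
  from this[of 1] this[of "-1"] show ?thesis by (simp add: abs_le_iff)
qed

section \<open>Second differences of the solution\<close>

lemma V_abs_le_2: "\<bar>V x y m\<bar> \<le> 2"
  using D_abs_le_1[of x "add_mset y m"] D_abs_le_1[of x m] by (simp add: V_def)

lemma V_sym: "V x y m = V y x m"
  by (simp add: V_def D_def add_mset_commute)

lemma residual_abs_le: "\<bar>\<epsilon> * sol m - f m\<bar> \<le> 1"
  using sol_range[of m] f_range[of m] eps_pos by (auto simp: abs_le_iff) (smt (verit) mult_nonneg_nonneg)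

text \<open>Stein's equation at \<open>add_mset y m\<close> with every deletion expressed through
  \<open>D y m\<close> and a moved point. It links first differences at \<open>m\<close> with
  averaged first differences one size higher, and can be read in either direction.\<close>

lemma stein_at_add:
  "a * Nu (\<lambda>s. D s (add_mset y m)) = dr (Suc (size m)) * (real (size m) + 1) * D y m
     - dr (Suc (size m)) * (\<Sum>s\<in>#m. sol (add_mset y (m - {#s#})) - sol m)
     + (\<epsilon> * sol (add_mset y m) - f (add_mset y m))"
proof -
  have S: "(\<Sum>s\<in>#add_mset y m. sol (add_mset y m - {#s#}) - sol (add_mset y m))
      = sol m + (\<Sum>s\<in>#m. sol (add_mset y (m - {#s#}))) - real (Suc (size m)) * sol (add_mset y m)"
    by (simp only: sum_mset_diff_const sum_mset_remove1_add size_add_mset)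
  show ?thesis
    using sol_eq[of "add_mset y m"] unfolding S size_add_mset
    by (simp add: D_def sum_mset_diff_const algebra_simps)
qed

lemma D_minus_Nu: "\<bar>D x m - Nu (\<lambda>s. D s m)\<bar> \<le> eb (size m)"
proof -
  have "D x m - Nu (\<lambda>s. D s m) = Nu (\<lambda>s. E x s m)"
    using Nu_diff[of "\<lambda>_. D x m" "\<lambda>s. D s m"] by (simp add: D_def E_def)
  then show ?thesis using Nu_abs_le[of "\<lambda>s. E x s m"] E_abs_le_eb by simp
qed

text \<open>While deaths are slower than immigration, Stein's equation expresses the averaged
  difference at size n through differences at size n-1 with a total weight below 1, so an induction
  upwards works. The 7/4 consists of 1 for the residual \<open>\<epsilon> * sol m - f m\<close> and
  3/4 for the constant part of \<open>a * eb n\<close>.\<close>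

lemma D_low:
  assumes "real (Suc n) * dr (Suc n) < a" "size m = n"
  shows "(a - real (Suc n) * dr (Suc n)) * \<bar>D y m\<bar> \<le> 7 / 4 + a / (2 * (real n + 1))"
  using assms
proof (induction n arbitrary: m y)
  case 0
  have "a * Nu (\<lambda>s. D s m) = \<epsilon> * sol m - f m"
    using sol_eq[of m] 0 by (simp add: D_def)
  then have "\<bar>a * Nu (\<lambda>s. D s m)\<bar> \<le> 1" using residual_abs_le by simp
  moreover have "\<bar>a * (D y m - Nu (\<lambda>s. D s m))\<bar> \<le> a * eb 0"
    using D_minus_Nu[of y m] 0 a_pos by (simp add: abs_mult)
  ultimately have "\<bar>a * D y m\<bar> \<le> 1 + a * eb 0" by (simp add: algebra_simps)
  then have "a * \<bar>D y m\<bar> \<le> 1 + a * eb 0" using a_pos by (simp add: abs_mult)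
  moreover have "(a - real (Suc 0) * dr (Suc 0)) * \<bar>D y m\<bar> \<le> a * \<bar>D y m\<bar>"
    using dr_ge_1[of 1] by (intro mult_right_mono) auto
  moreover have "1 + a * eb 0 = 7 / 4 + a / (2 * (real 0 + 1))"
    using a_pos by (simp add: eb_def field_simps)
  ultimately show ?case by linarith
next
  case (Suc n)
  let ?N = "Suc n"
  define \<delta> where "\<delta> = real (Suc n) * dr (Suc n)"
  define \<delta>' where "\<delta>' = real (Suc (Suc n)) * dr (Suc (Suc n))"
  have dd: "dr ?N \<ge> 1" "dr (Suc ?N) \<ge> dr ?N" using dr_ge_1[of ?N] dr_mono[of ?N] by auto
  have del: "\<delta> \<le> \<delta>'" unfolding \<delta>_def \<delta>'_def using dd by (intro mult_mono) auto
  have lt: "\<delta>' < a" using Suc.prems by (simp add: \<delta>'_def)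
  have d0: "\<delta> \<ge> 0" using dd by (simp add: \<delta>_def)
  define c where "c = (7 / 4 + a / (2 * (real n + 1))) / (a - \<delta>)"
  have IH: "\<bar>D s (m - {#s#})\<bar> \<le> c" if "s \<in># m" for s
  proof -
    have "(a - \<delta>) * \<bar>D s (m - {#s#})\<bar> \<le> 7 / 4 + a / (2 * (real n + 1))"
      unfolding \<delta>_def by (rule Suc.IH) (use that Suc.prems del lt in \<open>auto simp: \<delta>_def \<delta>'_def size_Diff_singleton\<close>)
    then show ?thesis using del lt unfolding c_def by (subst pos_le_divide_eq) (simp_all add: mult.commute)
  qed
  have "a * Nu (\<lambda>s. D s m) = dr ?N * (\<Sum>s\<in>#m. D s (m - {#s#})) + (\<epsilon> * sol m - f m)"
  proof -
    have "image_mset (\<lambda>s. sol (m - {#s#}) - sol m) m = image_mset (\<lambda>s. - D s (m - {#s#})) m"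
      by (intro image_mset_cong) (simp add: D_def)
    then have "(\<Sum>s\<in>#m. sol (m - {#s#}) - sol m) = (\<Sum>s\<in>#m. - D s (m - {#s#}))" by simp
    also have "\<dots> = - (\<Sum>s\<in>#m. D s (m - {#s#}))"
      using sum_mset_distrib_left[of "-1::real" "\<lambda>s. D s (m - {#s#})" m] by simp
    finally show ?thesis using sol_eq[of m] Suc.prems by (simp add: D_def)
  qed
  moreover have "\<bar>dr ?N * (\<Sum>s\<in>#m. D s (m - {#s#}))\<bar> \<le> \<delta> * c"
  proof -
    have "\<bar>\<Sum>s\<in>#m. D s (m - {#s#})\<bar> \<le> real (size m) * c" by (rule sum_mset_abs_le) (rule IH)
    then show ?thesis using dd Suc.prems by (simp add: abs_mult \<delta>_def mult.assoc mult.left_commute)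
  qed
  ultimately have "\<bar>a * Nu (\<lambda>s. D s m)\<bar> \<le> 1 + \<delta> * c" using residual_abs_le[of m] by linarith
  moreover have "\<bar>a * (D y m - Nu (\<lambda>s. D s m))\<bar> \<le> a * eb ?N"
    using D_minus_Nu[of y m] Suc.prems a_pos by (simp add: abs_mult)
  ultimately have "\<bar>a * D y m\<bar> \<le> 1 + \<delta> * c + a * eb ?N" by (simp add: algebra_simps)
  then have "a * \<bar>D y m\<bar> \<le> 1 + \<delta> * c + a * eb ?N" using a_pos by (simp add: abs_mult)
  \<comment> \<open>The claim reproduces itself because 1 + \<delta>'/(a - \<delta>') = a/(a -
    \<delta>'). In the size-dependent part, \<delta>/(n+1) and \<delta>'/(n+2) are the death rates
    per point, which are ordered.\<close>
  also have "\<dots> \<le> a * ((7 / 4 + a / (2 * (real n + 2))) / (a - \<delta>'))"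
  proof -
    have e: "1 + a * eb ?N = 7 / 4 + a / (2 * (real n + 2))"
      using a_pos unfolding eb_def distrib_left by (simp add: add.commute)
    have 1: "7 / 4 * (\<delta> / (a - \<delta>)) \<le> 7 / 4 * (\<delta>' / (a - \<delta>'))"
      using del lt d0 by (intro mult_left_mono frac_le) auto
    have 2: "\<delta> * (a / (2 * (real n + 1))) / (a - \<delta>) \<le> a / (2 * (real n + 2)) * \<delta>' / (a - \<delta>')"
    proof (rule frac_le)
      have "\<delta> * (a / (2 * (real n + 1))) = dr ?N * a / 2" by (simp add: \<delta>_def field_simps)
      also have "\<dots> \<le> dr (Suc ?N) * a / 2" using dd a_pos by simp
      also have "\<dots> = a / (2 * (real n + 2)) * \<delta>'" by (simp add: \<delta>'_def field_simps)
      finally show "\<delta> * (a / (2 * (real n + 1))) \<le> a / (2 * (real n + 2)) * \<delta>'" .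
    qed (use del lt d0 a_pos in auto)
    have "\<delta> * c = 7 / 4 * (\<delta> / (a - \<delta>)) + \<delta> * (a / (2 * (real n + 1))) / (a - \<delta>)"
      unfolding c_def by (simp add: distrib_left add_divide_distrib)
    also have "\<dots> \<le> 7 / 4 * (\<delta>' / (a - \<delta>')) + a / (2 * (real n + 2)) * \<delta>' / (a - \<delta>')"
      using 1 2 by simp
    also have "\<dots> = (7 / 4 + a / (2 * (real n + 2))) * (\<delta>' / (a - \<delta>'))" by (simp add: algebra_simps)
    finally have dc: "\<delta> * c \<le> (7 / 4 + a / (2 * (real n + 2))) * (\<delta>' / (a - \<delta>'))" .
    have gen: "p \<le> A * r \<Longrightarrow> 1 + q = A \<Longrightarrow> 1 + p + q \<le> A * (1 + r)" for p q A r :: real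
      by (simp add: distrib_left)
    have "1 + \<delta> * c + a * eb ?N \<le> (7 / 4 + a / (2 * (real n + 2))) * (1 + \<delta>' / (a - \<delta>'))"
      using dc e by (rule gen)
    also have "1 + \<delta>' / (a - \<delta>') = a / (a - \<delta>')" using lt by (simp add: field_simps)
    finally show ?thesis by (simp add: mult.commute)
  qed
  finally have "\<bar>D y m\<bar> \<le> (7 / 4 + a / (2 * (real n + 2))) / (a - \<delta>')"
    using a_pos by (rule mult_left_le_imp_le)
  then have "(a - \<delta>') * \<bar>D y m\<bar> \<le> 7 / 4 + a / (2 * (real n + 2))"
    using lt by (subst (asm) pos_le_divide_eq) (simp_all add: mult.commute)
  then show ?case by (simp add: \<delta>'_def add.commute)
qed

text \<open>Once deaths outweigh immigration the recursion is read downwards: \<open>D y m\<close>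
  is bounded through differences at a larger size, with factor \<open>a / \<delta>\<close> below 1.
  There is no size at which to start, so the supremum over all large configurations is used.\<close>

lemma D_high:
  assumes N: "real (Suc N) * dr (Suc N) > a" and m: "size m \<ge> N" and N1: "N \<ge> 1"
  shows "(1 - a / (real (Suc N) * dr (Suc N))) * \<bar>D y m\<bar> \<le> 1 / (real (Suc N) * dr (Suc N)) + eb N"
proof -
  define \<delta> where "\<delta> = real (Suc N) * dr (Suc N)"
  define q where "q = a / \<delta>"
  define c where "c = 1 / \<delta> + eb N"
  have dpos: "\<delta> > 0" using N a_pos by (simp add: \<delta>_def)
  have q: "0 < q" "q < 1" using N a_pos dpos by (auto simp: q_def \<delta>_def)
  \<comment> \<open>Finite because \<open>D\<close> is bounded by 1; otherwise the inequality
    \<open>\<Gamma> \<le> q * \<Gamma> + c\<close> could not be solved for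
    \<open>\<Gamma>\<close>.\<close>
  define \<Gamma> where "\<Gamma> = (SUP (y, m) \<in> UNIV \<times> {m. size m \<ge> N}. \<bar>D y m\<bar>)"
  have bdd: "bdd_above ((\<lambda>(y, m). \<bar>D y m\<bar>) ` (UNIV \<times> {m. size m \<ge> N}))"
    using D_abs_le_1 by (auto intro!: bdd_aboveI[of _ 1])
  have up: "\<bar>D y m\<bar> \<le> \<Gamma>" if "size m \<ge> N" for y m
    unfolding \<Gamma>_def using cSUP_upper[OF _ bdd, of "(y, m)"] that by simp
  have Gnn: "\<Gamma> \<ge> 0" using up[OF m, of y] by linarith
  have step: "\<bar>D y m\<bar> \<le> q * \<Gamma> + c" if sm: "size m \<ge> N" for y m
  proof -
    define n where "n = size m"
    define \<delta>n where "\<delta>n = dr (Suc n) * (real n + 1)"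
    have mono: "dr (Suc N) \<le> dr (Suc n)" using sm b_nonneg unfolding n_def dr_def by (simp add: mult_left_mono)
    have d1: "dr (Suc N) \<ge> 1" "dr (Suc n) \<ge> 1" using dr_ge_1[of "Suc N"] dr_ge_1[of "Suc n"] by auto
    have dn: "\<delta> \<le> \<delta>n" unfolding \<delta>_def \<delta>n_def using mono sm d1
      by (subst mult.commute) (intro mult_mono, auto simp: n_def)
    define S where "S = (\<Sum>s\<in>#m. sol (add_mset y (m - {#s#})) - sol m)"
    have S: "\<bar>S\<bar> \<le> real n * eb (n - 1)"
      unfolding S_def n_def by (rule sum_mset_abs_le) (rule moved_abs_le_eb)
    have "real n * eb (n - 1) \<le> (real n + 1) * eb N"
    proof -
      have "n \<ge> 1" using sm N1 by (simp add: n_def)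
      then have "real n * eb (n - 1) \<le> (real n + 1) * (3 / (4 * a)) + 1 / 2"
        using a_pos by (simp add: eb_def field_simps of_nat_diff)
      also have "1 / 2 \<le> (real n + 1) * (1 / (2 * (real N + 1)))"
        using sm by (simp add: n_def field_simps)
      finally show ?thesis by (simp add: eb_def algebra_simps)
    qed
    then have S': "\<bar>S\<bar> \<le> (real n + 1) * eb N" using S by linarith
    have eq: "\<delta>n * D y m = a * Nu (\<lambda>s. D s (add_mset y m)) + dr (Suc n) * S - (\<epsilon> * sol (add_mset y m) - f (add_mset y m))"
      using stein_at_add[of y m] by (simp add: n_def S_def \<delta>n_def)
    have nu: "\<bar>Nu (\<lambda>s. D s (add_mset y m))\<bar> \<le> \<Gamma>"
      by (rule Nu_abs_le) (rule up, use sm in simp)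
    have "\<bar>\<delta>n * D y m\<bar> \<le> \<bar>a * Nu (\<lambda>s. D s (add_mset y m))\<bar> + \<bar>dr (Suc n) * S\<bar> + 1"
      unfolding eq using residual_abs_le[of "add_mset y m"] by linarith
    also have "\<dots> \<le> a * \<Gamma> + dr (Suc n) * ((real n + 1) * eb N) + 1"
      using nu S' a_pos d1 by (intro add_mono) (auto simp: abs_mult intro!: mult_left_mono)
    finally have "\<bar>\<delta>n * D y m\<bar> \<le> a * \<Gamma> + \<delta>n * eb N + 1" by (simp add: \<delta>n_def mult.assoc)
    moreover have dnp: "\<delta>n > 0" using dn dpos by linarith
    ultimately have "\<bar>D y m\<bar> \<le> (a * \<Gamma> + 1) / \<delta>n + eb N"
      by (simp add: abs_mult field_simps)
    also have "(a * \<Gamma> + 1) / \<delta>n \<le> (a * \<Gamma> + 1) / \<delta>"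
      using dn dpos a_pos Gnn by (intro divide_left_mono) auto
    finally show ?thesis by (simp add: q_def c_def field_simps add_divide_distrib)
  qed
  have "\<Gamma> \<le> q * \<Gamma> + c"
    unfolding \<Gamma>_def[symmetric]
    by (subst (1) \<Gamma>_def, rule cSUP_least) (use m step in auto)
  then have "(1 - q) * \<Gamma> \<le> c" by (simp add: algebra_simps)
  moreover have "(1 - q) * \<bar>D y m\<bar> \<le> (1 - q) * \<Gamma>"
    using up[OF m, of y] q by (intro mult_left_mono) auto
  ultimately show ?thesis by (simp add: q_def c_def \<delta>_def)
qed

text \<open>In \<open>D x (add_mset y m)\<close> the average over the immigrant is split off and
  replaced by Stein's equation, and \<open>D x m\<close> is exchanged for \<open>D y m\<close>. The
  first differences then carry the factor \<open>\<delta> - a\<close>, which is exactly what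
  \<open>D_low\<close> and \<open>D_high\<close> control; everything else is a moved point or the
  residual.\<close>

lemma V_identity:
  assumes "\<delta> = dr (Suc (size m)) * (real (size m) + 1)"
  shows "a * V x y m = (\<delta> - a) * D y m - dr (Suc (size m)) * (\<Sum>s\<in>#m. sol (add_mset y (m - {#s#})) - sol m)
     + (\<epsilon> * sol (add_mset y m) - f (add_mset y m)) + a * (D x (add_mset y m) - Nu (\<lambda>s. D s (add_mset y m)))
     + a * E y x m"
  using stein_at_add[of y m] assms
  by (simp add: V_def E_def D_def algebra_simps)

theorem V_abs_le: "\<bar>V x y m\<bar> \<le> 5 / a + 2 / (real (size m) + 1)"
proof -
  define n where "n = size m"
  define S where "S = (\<Sum>s\<in>#m. sol (add_mset y (m - {#s#})) - sol m)"
  define \<delta> where "\<delta> = dr (Suc n) * (real n + 1)"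
  define R where "R = D x (add_mset y m) - Nu (\<lambda>s. D s (add_mset y m))"
  define F where "F = \<epsilon> * sol (add_mset y m) - f (add_mset y m)"
  have d1: "dr (Suc n) \<ge> 1" using dr_ge_1[of "Suc n"] by simp
  have S: "\<bar>S\<bar> \<le> real n * (3 / (4 * a)) + 1 / 2"
  proof -
    have "\<bar>S\<bar> \<le> real n * eb (n - 1)"
      unfolding S_def n_def by (rule sum_mset_abs_le) (rule moved_abs_le_eb)
    also have "\<dots> \<le> real n * (3 / (4 * a)) + 1 / 2"
      by (cases n) (auto simp: eb_def field_simps)
    finally show ?thesis .
  qed
  have R: "\<bar>R\<bar> \<le> eb (Suc n)" using D_minus_Nu[of x "add_mset y m"] by (simp add: R_def n_def)
  have F: "\<bar>F\<bar> \<le> 1" using residual_abs_le by (simp add: F_def)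
  have Eyx: "\<bar>E y x m\<bar> \<le> eb n" using E_abs_le_eb by (simp add: n_def)
  have en: "eb (Suc n) \<le> eb n" by (simp add: eb_antimono)
  have id: "a * V x y m = (\<delta> - a) * D y m - dr (Suc n) * S + F + a * R + a * E y x m"
    unfolding F_def R_def S_def n_def by (rule V_identity) (simp add: \<delta>_def n_def)
  have target: "a * (5 / a + 2 / (real n + 1)) = 5 + 2 * a / (real n + 1)"
    using a_pos by (simp add: distrib_left)
  have ae: "a * eb n = 3 / 4 + a / (2 * (real n + 1))" using a_pos unfolding eb_def distrib_left by simp
  have aR: "\<bar>a * R\<bar> \<le> a * eb n" using R en a_pos by (simp add: abs_mult)
  have aE: "\<bar>a * E y x m\<bar> \<le> a * eb n" using Eyx a_pos by (simp add: abs_mult)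
  have "\<bar>V x y m\<bar> \<le> 5 / a + 2 / (real n + 1)"
  proof (cases "\<delta> < a")
    case True
    have 1: "\<bar>(\<delta> - a) * D y m\<bar> \<le> 7 / 4 + a / (2 * (real n + 1))"
    proof -
      have "(a - real (Suc n) * dr (Suc n)) * \<bar>D y m\<bar> \<le> 7 / 4 + a / (2 * (real n + 1))"
        by (rule D_low) (use True in \<open>auto simp: \<delta>_def n_def algebra_simps\<close>)
      moreover have "\<bar>(\<delta> - a) * D y m\<bar> = (a - real (Suc n) * dr (Suc n)) * \<bar>D y m\<bar>"
      proof -
        have "\<bar>\<delta> - a\<bar> = a - real (Suc n) * dr (Suc n)" using True by (simp add: \<delta>_def mult.commute)
        then show ?thesis by (simp add: abs_mult)
      qed
      ultimately show ?thesis by simp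
    qed
    have 2: "\<bar>dr (Suc n) * S\<bar> \<le> 3 / 4 + a / (2 * (real n + 1))"
    proof -
      have "\<bar>dr (Suc n) * S\<bar> \<le> dr (Suc n) * (real n * (3 / (4 * a)) + 1 / 2)"
        using S d1 by (simp add: abs_mult)
      also have "\<dots> \<le> (\<delta> / a) * (3 / 4) + \<delta> / (2 * (real n + 1))"
      proof -
        have g: "(d * X / a) * (3 / 4) = d * (X * (3 / (4 * a)))" "X > 0 \<Longrightarrow> d * X / (2 * X) = d * (1 / 2)" for d X :: real
          by simp_all
        have "(\<delta> / a) * (3 / 4) = dr (Suc n) * ((real n + 1) * (3 / (4 * a)))"
          "\<delta> / (2 * (real n + 1)) = dr (Suc n) * (1 / 2)"
          unfolding \<delta>_def by (rule g(1), rule g(2)) simp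
        moreover have "dr (Suc n) * (real n * (3 / (4 * a))) \<le> dr (Suc n) * ((real n + 1) * (3 / (4 * a)))"
          using d1 a_pos by (intro mult_left_mono mult_right_mono) auto
        ultimately show ?thesis by (simp only: distrib_left)
      qed
      also have "\<dots> \<le> 1 * (3 / 4) + a / (2 * (real n + 1))"
        using True a_pos by (intro add_mono mult_right_mono divide_right_mono) auto
      finally show ?thesis by simp
    qed
    have "\<bar>a * V x y m\<bar> \<le> \<bar>(\<delta> - a) * D y m\<bar> + \<bar>dr (Suc n) * S\<bar> + \<bar>F\<bar> + \<bar>a * R\<bar> + \<bar>a * E y x m\<bar>"
      unfolding id by linarith
    \<comment> \<open>7/4 for the first difference, 3/4 for the moved points, 1 for the residual and
      3/4 for each of the last two terms make 5; all of them except the residual also carry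
      a/(2(n+1)).\<close>
    also have "\<dots> \<le> 5 + 4 * (a / (2 * (real n + 1)))"
      using 1 2 F aR aE ae by linarith
    also have "\<dots> = a * (5 / a + 2 / (real n + 1))"
    proof -
      have g: "5 + 4 * (a / (2 * X)) = 5 + 2 * a / X" for X by simp
      show ?thesis unfolding target by (rule g)
    qed
    finally show ?thesis using a_pos by (simp add: abs_mult)
  next
    case False
    have dpos: "\<delta> > 0" using False a_pos by linarith
    \<comment> \<open>Here \<open>D y m\<close> is eliminated in favour of the difference at size
      n+1: \<open>D_high\<close> needs a strict excess of deaths and a nonempty configuration, and
      one size higher both hold even if \<delta> = a or n = 0.\<close>
    have id2: "V x y m = (1 - a / \<delta>) * D x (add_mset y m) + (a / \<delta>) * R - S / (real n + 1) + F / \<delta> + E y x m"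
    proof -
      have *: "D y m = D x (add_mset y m) + E y x m - V x y m"
        by (simp add: V_def D_def E_def)
      have "\<delta> * V x y m = (\<delta> - a) * D x (add_mset y m) + a * R - dr (Suc n) * S + F + \<delta> * E y x m"
        using id unfolding * by (simp add: algebra_simps)
      moreover have "dr (Suc n) * S = \<delta> * (S / (real n + 1))"
        by (simp add: \<delta>_def)
      ultimately have "\<delta> * V x y m = \<delta> * ((1 - a / \<delta>) * D x (add_mset y m) + (a / \<delta>) * R - S / (real n + 1) + F / \<delta> + E y x m)"
        using dpos by (simp add: algebra_simps)
      then show ?thesis using dpos by simp
    qed
    have 1: "\<bar>(1 - a / \<delta>) * D x (add_mset y m)\<bar> \<le> 1 / a + eb n"
    proof -
      define \<delta>' where "\<delta>' = real (Suc (Suc n)) * dr (Suc (Suc n))"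
      have "(real n + 1) * dr (Suc n) \<le> (real n + 1) * dr (Suc (Suc n))"
        using dr_mono[of "Suc n"] by (intro mult_left_mono) auto
      also have "\<dots> < \<delta>'" using dr_ge_1[of "Suc (Suc n)"] by (simp add: \<delta>'_def algebra_simps)
      finally have lt: "\<delta> < \<delta>'" by (simp add: \<delta>_def mult.commute)
      have q: "a / \<delta>' \<le> a / \<delta>" "a / \<delta> \<le> 1" using lt dpos a_pos False by (auto intro!: divide_left_mono)
      have "(1 - a / \<delta>') * \<bar>D x (add_mset y m)\<bar> \<le> 1 / \<delta>' + eb (Suc n)"
        unfolding \<delta>'_def by (rule D_high) (use lt False in \<open>auto simp: \<delta>'_def n_def\<close>)
      moreover have "1 / \<delta>' \<le> 1 / a" using lt False a_pos by (intro divide_left_mono) auto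
      moreover have "(1 - a / \<delta>) * \<bar>D x (add_mset y m)\<bar> \<le> (1 - a / \<delta>') * \<bar>D x (add_mset y m)\<bar>"
        using q by (intro mult_right_mono) auto
      moreover have "\<bar>(1 - a / \<delta>) * D x (add_mset y m)\<bar> = (1 - a / \<delta>) * \<bar>D x (add_mset y m)\<bar>"
        using q by (simp add: abs_mult)
      ultimately show ?thesis using en by linarith
    qed
    have 2: "\<bar>(a / \<delta>) * R\<bar> \<le> eb n"
    proof -
      have "\<bar>(a / \<delta>) * R\<bar> \<le> 1 * \<bar>R\<bar>"
        unfolding abs_mult using False a_pos dpos by (intro mult_right_mono) auto
      then show ?thesis using R en by linarith
    qed
    have 3: "\<bar>S / (real n + 1)\<bar> \<le> eb n"
    proof -
      have "\<bar>S\<bar> \<le> (real n + 1) * eb n"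
      proof -
        have "X > 0 \<Longrightarrow> X * (1 / (2 * X)) = 1 / 2" for X :: real by simp
        from this[of "real n + 1"] have "(real n + 1) * eb n = (real n + 1) * (3 / (4 * a)) + 1 / 2"
          unfolding eb_def distrib_left by simp
        moreover have "real n * (3 / (4 * a)) \<le> (real n + 1) * (3 / (4 * a))"
          using a_pos by (intro mult_right_mono) auto
        ultimately show ?thesis using S by linarith
      qed
      then show ?thesis by (simp add: field_simps)
    qed
    have 4: "\<bar>F / \<delta>\<bar> \<le> 1 / a"
    proof -
      have "\<bar>F\<bar> / \<delta> \<le> 1 / a" using F False a_pos by (intro frac_le) auto
      then show ?thesis using dpos by simp
    qed
    have "\<bar>V x y m\<bar> \<le> 2 / a + 4 * eb n"
    proof -
      have two: "2 / a = 1 / a + 1 / a" by (simp add: add_divide_distrib[symmetric])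
      have g: "\<bar>p\<bar> \<le> c + e \<Longrightarrow> \<bar>q\<bar> \<le> e \<Longrightarrow> \<bar>r\<bar> \<le> e \<Longrightarrow> \<bar>s\<bar> \<le> c \<Longrightarrow> \<bar>t\<bar> \<le> e
        \<Longrightarrow> \<bar>p + q - r + s + t\<bar> \<le> (c + c) + 4 * e" for p q r s t c e :: real by linarith
      show ?thesis unfolding id2 two using 1 2 3 4 Eyx by (rule g)
    qed
    also have "4 * eb n = 3 / a + 2 / (real n + 1)"
    proof -
      have g: "4 * (1 / (2 * X)) = 2 / X" for X :: real by simp
      show ?thesis unfolding eb_def distrib_left[of 4] g by simp
    qed
    also have "2 / a + (3 / a + 2 / (real n + 1)) = 5 / a + 2 / (real n + 1)"
      by (simp add: add_divide_distrib[symmetric])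
    finally show ?thesis .
  qed
  then show ?thesis by (simp add: n_def)
qed

text \<open>\<open>sol\<close> itself is of order 1/\<open>\<epsilon>\<close>, but its distance from
  \<open>sol {#}\<close> is not. This makes \<open>\<epsilon>\<close> times a difference of two
  means of \<open>sol\<close> disappear in the limit.\<close>

lemma sol_growth: "\<bar>sol m - sol {#}\<bar> \<le> real (size m)"
proof (induction m)
  case (add x m)
  then show ?case using D_abs_le_1[of x m] by (simp add: D_def)
qed simp

end

section \<open>Configurations as finite multisets\<close>

definition emb :: "'a::topological_space multiset \<Rightarrow> 'a measure" where
  "emb m = dirac_sum (set_mset m) (\<lambda>x. of_nat (count m x)) (\<lambda>x. x)"

text \<open>Singletons are Borel in a T1 space, so multiplicities can be read off the measure and
  \<open>emb\<close> is injective there.\<close>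

definition pts :: "'a::topological_space measure \<Rightarrow> 'a multiset" where
  "pts \<xi> = (THE m. \<xi> = emb m)"

lemma configE:
  assumes "\<xi> \<in> configs" "C \<in> sets borel"
  obtains n :: nat where "emeasure \<xi> C = of_nat n"
  using assms unfolding configs_def by blast

lemma sum_count_mult:
  fixes \<phi> :: "'a \<Rightarrow> 'b::semiring_1"
  shows "(\<Sum>x\<in>set_mset m. of_nat (count m x) * \<phi> x) = (\<Sum>x\<in>#m. \<phi> x)"
proof -
  have "(\<Sum>x\<in>A. of_nat (count m x) * \<phi> x) = (\<Sum>x\<in>#m. \<phi> x)" if "finite A" "set_mset m \<subseteq> A" for A
    using that(2)
  proof (induction m)
    case (add x m)
    have "(\<Sum>y\<in>A. of_nat (count (add_mset x m) y) * \<phi> y)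
        = (\<Sum>y\<in>A. (if y = x then \<phi> y else 0) + of_nat (count m y) * \<phi> y)"
      by (intro sum.cong) (auto simp: distrib_right)
    also have "\<dots> = \<phi> x + (\<Sum>y\<in>A. of_nat (count m y) * \<phi> y)"
      using add.prems that(1) by (simp add: sum.distrib sum.delta)
    finally show ?case using add by simp
  qed simp
  then show ?thesis by simp
qed

lemma size_filter_mset_eq: "of_nat (size (filter_mset P m)) = (\<Sum>x\<in>#m. of_bool (P x) :: 'b::semiring_1)"
  by (induction m) (auto simp: add.commute)

text \<open>Several measures here are given by their set functions through
  \<open>measure_of\<close>, whose values are known only once countable additivity is shown. This
  covers sums of point masses, the addition of a point and the mixed intensity \<nu>.\<close>

lemma countably_additive_sum:
  fixes N :: "'i \<Rightarrow> 'a measure"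
  assumes "\<And>i. i \<in> I \<Longrightarrow> sets (N i) = sets K"
  shows "countably_additive (sets K) (\<lambda>C. \<Sum>i\<in>I. w i * emeasure (N i) C)"
proof (rule countably_additiveI)
  fix A :: "nat \<Rightarrow> 'a set"
  assume A: "range A \<subseteq> sets K" "disjoint_family A" "\<Union> (range A) \<in> sets K"
  have "(\<Sum>j. \<Sum>i\<in>I. w i * emeasure (N i) (A j)) = (\<Sum>i\<in>I. \<Sum>j. w i * emeasure (N i) (A j))"
    by (rule suminf_sum) simp
  also have "\<dots> = (\<Sum>i\<in>I. w i * emeasure (N i) (\<Union> (range A)))"
    using A assms by (intro sum.cong refl) (simp add: suminf_emeasure)
  finally show "(\<Sum>j. \<Sum>i\<in>I. w i * emeasure (N i) (A j)) = (\<Sum>i\<in>I. w i * emeasure (N i) (\<Union> (range A)))" .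
qed

lemma sigma_algebra_borel: "sigma_algebra UNIV (sets borel)"
  using sets.sigma_algebra_axioms[of borel] by simp

lemma sets_measure_of_borel [simp]: "sets (measure_of UNIV (sets borel) \<mu>) = sets borel"
  using sets.sets_measure_of_eq[of borel] by simp

lemma sets_dirac_sum [simp]: "sets (dirac_sum I w x) = sets borel"
  by (simp add: dirac_sum_def)

lemma emeasure_dirac_sum:
  assumes "C \<in> sets borel"
  shows "emeasure (dirac_sum I w x) C = (\<Sum>i\<in>I. w i * indicator C (x i))"
proof -
  have "emeasure (dirac_sum I w x) C = (\<Sum>i\<in>I. w i * emeasure (return borel (x i)) C)"
    unfolding dirac_sum_def
    by (rule emeasure_measure_of_sigma[OF sigma_algebra_borel])
       (use assms in \<open>auto simp: positive_def intro!: countably_additive_sum\<close>)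
  then show ?thesis using assms by simp
qed

lemma sets_emb [simp]: "sets (emb m) = sets borel"
  by (simp add: emb_def)

lemma space_emb [simp]: "space (emb m) = UNIV"
  using sets_eq_imp_space_eq[OF sets_emb] by simp

lemma emeasure_emb:
  assumes "C \<in> sets borel"
  shows "emeasure (emb m) C = of_nat (size (filter_mset (\<lambda>x. x \<in> C) m))"
proof -
  have "emeasure (emb m) C = (\<Sum>x\<in>set_mset m. of_nat (count m x) * indicator C x)"
    unfolding emb_def by (rule emeasure_dirac_sum[OF assms])
  also have "\<dots> = (\<Sum>x\<in>#m. indicator C x)" by (rule sum_count_mult)
  finally show ?thesis by (simp add: size_filter_mset_eq indicator_def)
qed

lemma measure_emb:
  "C \<in> sets borel \<Longrightarrow> measure (emb m) C = real (size (filter_mset (\<lambda>x. x \<in> C) m))"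
  by (simp add: measure_def emeasure_emb)

lemma emeasure_emb_UNIV [simp]: "emeasure (emb m) UNIV = of_nat (size m)"
  by (simp add: emeasure_emb)

lemma total_mass_emb [simp]: "total_mass (emb m) = real (size m)"
  by (simp add: measure_emb)

lemma emb_configs [simp]: "emb m \<in> configs"
  by (auto simp: configs_def emeasure_emb)

lemma emb_inject [simp]: "emb m = emb m' \<longleftrightarrow> m = m'" for m m' :: "'a::t1_space multiset"
proof
  assume eq: "emb m = emb m'"
  have "count m x = count m' x" for x
  proof -
    have "emeasure (emb k) {x} = of_nat (count k x)" for k
      using arg_cong[OF filter_eq_replicate_mset[of x k], of size] by (simp add: emeasure_emb)
    from this[of m] this[of m'] eq show ?thesis by simp
  qed
  then show "m = m'" by (rule multiset_eqI)
qed simp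

lemma pts_emb [simp]: "pts (emb m) = m" for m :: "'a::t1_space multiset"
  by (simp add: pts_def)

section \<open>Adding, removing and restricting points\<close>

lemma sets_add_point [simp]: "sets (add_point \<xi> x) = sets borel"
  by (simp add: add_point_def)

lemma emeasure_add_point:
  assumes \<xi>: "sets \<xi> = sets borel" and C: "C \<in> sets borel"
  shows "emeasure (add_point \<xi> x) C = emeasure \<xi> C + indicator C x"
proof -
  have "countably_additive (sets borel) (\<lambda>C. \<Sum>i\<in>{True, False}. 1 * emeasure (if i then \<xi> else return borel x) C)"
    by (rule countably_additive_sum) (use \<xi> in auto)
  then have "countably_additive (sets borel) (\<lambda>C. emeasure \<xi> C + emeasure (return borel x) C)" by simp
  then have "emeasure (add_point \<xi> x) C = emeasure \<xi> C + emeasure (return borel x) C"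
    unfolding add_point_def
    by (intro emeasure_measure_of_sigma[OF sigma_algebra_borel]) (use C in \<open>auto simp: positive_def\<close>)
  then show ?thesis using C by simp
qed

lemma add_point_emb: "add_point (emb m) x = emb (add_mset x m)"
  by (rule measure_eqI) (auto simp: emeasure_add_point emeasure_emb indicator_def add.commute)

text \<open>An atom of an integer-valued measure has mass at least 1, so the point mass lies below
  the configuration and \<open>diff_measure\<close> is the true difference.\<close>

lemma emeasure_remove_point:
  fixes x :: "'a::t1_space"
  assumes \<xi>: "\<xi> \<in> configs" and x: "emeasure \<xi> {x} \<noteq> 0" and C: "C \<in> sets borel"
  shows "emeasure (remove_point \<xi> x) C = emeasure \<xi> C - indicator C x"
proof -
  have s: "sets \<xi> = sets borel" using \<xi> by (simp add: configs_def)
  have fin: "finite_measure \<xi>"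
  proof
    have "space \<xi> \<in> sets borel" using sets.top[of \<xi>] s by simp
    then show "emeasure \<xi> (space \<xi>) \<noteq> \<infinity>" using \<xi> by (auto simp: configs_def)
  qed
  have le: "emeasure (return borel x) A \<le> emeasure \<xi> A" if A: "A \<in> sets borel" for A
  proof (cases "x \<in> A")
    case True
    obtain n :: nat where n: "emeasure \<xi> {x} = of_nat n" by (rule configE[OF \<xi>, of "{x}"]) simp
    have "1 \<le> emeasure \<xi> {x}" using x n by (simp add: Suc_leI)
    also have "\<dots> \<le> emeasure \<xi> A" using True A s by (intro emeasure_mono) auto
    finally show ?thesis using True A by simp
  qed (use A in simp)
  have "emeasure (diff_measure \<xi> (return borel x)) C = emeasure \<xi> C - emeasure (return borel x) C"
    by (rule emeasure_diff_measure)
       (use s C le fin in \<open>auto intro!: prob_space.finite_measure prob_space_return\<close>)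
  then show ?thesis using C by (simp add: remove_point_def)
qed

lemma sets_remove_point [simp]: "sets (remove_point \<xi> x) = sets \<xi>"
  by (simp add: remove_point_def)

lemma remove_point_emb:
  fixes x :: "'a::t1_space"
  assumes "x \<in># m"
  shows "remove_point (emb m) x = emb (m - {#x#})"
proof (rule measure_eqI)
  fix C assume "C \<in> sets (remove_point (emb m) x)"
  then have C: "C \<in> sets borel" by simp
  obtain k where m: "m = add_mset x k" using assms by (metis insert_DiffM)
  show "emeasure (remove_point (emb m) x) C = emeasure (emb (m - {#x#})) C"
    using C m by (subst emeasure_remove_point) (auto simp: emeasure_emb indicator_def ennreal_minus_eq_top)
qed simp

lemma restr_emb:
  assumes "B \<in> sets borel"
  shows "restr B (emb m) = emb (filter_mset (\<lambda>x. x \<in> B) m)"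
proof (rule measure_eqI)
  fix C assume "C \<in> sets (restr B (emb m))"
  then have C: "C \<in> sets borel" by (simp add: restr_def)
  have "emeasure (restr B (emb m)) C = emeasure (emb m) (B \<inter> C)"
    unfolding restr_def using assms C by (subst emeasure_restricted) auto
  also have "\<dots> = emeasure (emb (filter_mset (\<lambda>x. x \<in> B) m)) C"
    using assms C by (simp add: emeasure_emb filter_filter_mset)
  finally show "emeasure (restr B (emb m)) C = emeasure (emb (filter_mset (\<lambda>x. x \<in> B) m)) C" .
qed (simp add: restr_def)

lemma points_eq_emb: "points n x = emb (image_mset x (mset_set {1..n}))"
proof (rule measure_eqI)
  fix C assume "C \<in> sets (points n x)"
  then have C: "C \<in> sets borel" by (simp add: points_def)
  have "emeasure (points n x) C = (\<Sum>i\<in>{1..n}. indicator C (x i))"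
    unfolding points_def by (simp add: emeasure_dirac_sum[OF C])
  also have "\<dots> = (\<Sum>y\<in>#image_mset x (mset_set {1..n}). of_bool (y \<in> C))"
    by (simp add: sum_unfold_sum_mset image_mset.compositionality comp_def indicator_def of_bool_def)
  also have "\<dots> = emeasure (emb (image_mset x (mset_set {1..n}))) C"
    by (simp add: emeasure_emb[OF C] size_filter_mset_eq)
  finally show "emeasure (points n x) C = emeasure (emb (image_mset x (mset_set {1..n}))) C" .
qed (simp add: points_def)

text \<open>No measurability of \<open>\<phi>\<close> is assumed: almost everywhere it agrees with a
  simple function supported on the finitely many atoms.\<close>

lemma nn_integral_emb:
  fixes m :: "'a::t1_space multiset"
  shows "(\<integral>\<^sup>+x. \<phi> x \<partial>emb m) = (\<Sum>x\<in>#m. \<phi> x)"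
proof -
  have [measurable]: "{s} \<in> sets (emb m)" for s by simp
  have "emeasure (emb m) (- set_mset m) = 0"
    by (simp add: emeasure_emb finite_imp_closed borel_closed)
  then have "AE x in emb m. x \<in> set_mset m"
    by (intro AE_I[where N="- set_mset m"]) (auto simp: finite_imp_closed borel_closed)
  then have "AE x in emb m. \<phi> x = (\<Sum>s\<in>set_mset m. \<phi> s * indicator {s} x)"
  proof eventually_elim
    case (elim x)
    have "(\<Sum>s\<in>set_mset m. \<phi> s * indicator {s} x) = (\<Sum>s\<in>set_mset m. if s = x then \<phi> s else 0)"
      by (intro sum.cong) (auto simp: indicator_def)
    also have "\<dots> = \<phi> x" using elim by (simp add: sum.delta)
    finally show ?case by simp
  qed
  then have "(\<integral>\<^sup>+x. \<phi> x \<partial>emb m) = (\<integral>\<^sup>+x. (\<Sum>s\<in>set_mset m. \<phi> s * indicator {s} x) \<partial>emb m)"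
    by (rule nn_integral_cong_AE)
  also have "\<dots> = (\<Sum>s\<in>set_mset m. \<phi> s * emeasure (emb m) {s})"
    by (subst nn_integral_sum) (auto simp: nn_integral_cmult_indicator)
  also have "\<dots> = (\<Sum>s\<in>set_mset m. of_nat (count m s) * \<phi> s)"
  proof (intro sum.cong refl)
    fix s
    have "{#x \<in># m. x = s#} = replicate_mset (count m s) s"
      using filter_eq_replicate_mset[of s m] by (simp add: eq_commute)
    then show "\<phi> s * emeasure (emb m) {s} = of_nat (count m s) * \<phi> s"
      by (simp add: emeasure_emb mult.commute)
  qed
  also have "\<dots> = (\<Sum>x\<in>#m. \<phi> x)" by (rule sum_count_mult)
  finally show ?thesis .
qed

section \<open>Configurations on a compact space are finite sums of point masses\<close>

context
  assumes compact_space: "compact (UNIV :: 'a::metric_space set)"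
begin

text \<open>Induction on the total mass; the point is that a nonzero configuration has an atom.
  Without atoms the masses of shrinking balls tend to 0 and, being integers, vanish from some radius
  on. Finitely many such null balls cover the compact space, so the total mass would be 0.\<close>

lemma config_emb_ex:
  fixes \<xi> :: "'a measure"
  assumes "\<xi> \<in> configs"
  shows "\<exists>m. \<xi> = emb m"
proof -
  obtain n :: nat where "emeasure \<xi> UNIV = of_nat n" by (rule configE[OF assms, of UNIV]) simp
  then show ?thesis using assms
  proof (induction n arbitrary: \<xi>)
    case 0
    have s: "sets \<xi> = sets borel" using 0 by (simp add: configs_def)
    have "emeasure \<xi> C = 0" if "C \<in> sets borel" for C
      using emeasure_mono[of C UNIV \<xi>] 0 s by simp
    then have "\<xi> = emb {#}" using s by (intro measure_eqI) (auto simp: emeasure_emb)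
    then show ?case ..
  next
    case (Suc n)
    have s: "sets \<xi> = sets borel" using Suc.prems by (simp add: configs_def)
    have "\<exists>x. emeasure \<xi> {x} \<noteq> 0"
    proof (rule ccontr)
      assume "\<not> (\<exists>x. emeasure \<xi> {x} \<noteq> 0)"
      then have null: "emeasure \<xi> {x} = 0" for x by simp
      have "\<exists>r>0. emeasure \<xi> (ball x r) = 0" for x
      proof -
        define A where "A = (\<lambda>i. ball x (1 / real (Suc i)))"
        have "(\<Inter>i. A i) = {x}"
        proof (intro equalityI subsetI)
          fix y assume y: "y \<in> (\<Inter>i. A i)"
          have "dist x y = 0"
          proof (rule ccontr)
            assume "dist x y \<noteq> 0"
            then obtain i where "inverse (real (Suc i)) < dist x y"
              using reals_Archimedean[of "dist x y"] zero_le_dist[of x y] by (metis less_eq_real_def)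
            moreover have "y \<in> A i" using y by (rule INT_D) simp
            then have "dist x y < inverse (real (Suc i))" by (simp add: A_def inverse_eq_divide)
            ultimately show False by simp
          qed
          then show "y \<in> {x}" by simp
        qed (auto simp: A_def)
        moreover have "(\<lambda>i. emeasure \<xi> (A i)) \<longlonglongrightarrow> emeasure \<xi> (\<Inter>i. A i)"
        proof (rule Lim_emeasure_decseq)
          have "A i \<in> sets \<xi>" for i unfolding s A_def by (intro borel_open open_ball)
          then show "range A \<subseteq> sets \<xi>" by blast
          show "decseq A" unfolding A_def decseq_def by (auto intro!: subset_ball frac_le)
          show "emeasure \<xi> (A i) \<noteq> \<infinity>" for i
            by (rule configE[OF Suc.prems(2), of "A i"]) (auto simp: A_def)
        qed
        ultimately have "(\<lambda>i. emeasure \<xi> (A i)) \<longlonglongrightarrow> 0" using null by simp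
        then have "eventually (\<lambda>i. emeasure \<xi> (A i) < 1) sequentially"
          by (rule order_tendstoD) simp
        then obtain i where i: "emeasure \<xi> (A i) < 1" by (auto simp: eventually_sequentially)
        obtain k :: nat where k: "emeasure \<xi> (A i) = of_nat k"
          by (rule configE[OF Suc.prems(2), of "A i"]) (simp add: A_def)
        have "emeasure \<xi> (A i) = 0" using i unfolding k by (cases k) auto
        then show ?thesis by (intro exI[of _ "1 / real (Suc i)"]) (simp add: A_def)
      qed
      then obtain r where r: "\<And>x. r x > 0" "\<And>x. emeasure \<xi> (ball x (r x)) = 0" by metis
      obtain X where X: "finite X" "UNIV \<subseteq> (\<Union>x\<in>X. ball x (r x))"
      proof (rule compactE_image[OF compact_space])
        have "x \<in> ball x (r x)" for x using r(1) by simp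
        then show "UNIV \<subseteq> (\<Union>x\<in>UNIV. ball x (r x))" by blast
      qed auto
      have "emeasure \<xi> UNIV \<le> emeasure \<xi> (\<Union>x\<in>X. ball x (r x))"
        by (intro emeasure_mono) (use X s in auto)
      also have "\<dots> \<le> (\<Sum>x\<in>X. emeasure \<xi> (ball x (r x)))"
        by (rule emeasure_subadditive_finite) (use X s in auto)
      also have "\<dots> = 0" using r(2) by simp
      finally show False using Suc.prems by simp
    qed
    then obtain x where x: "emeasure \<xi> {x} \<noteq> 0" ..
    define \<eta> where "\<eta> = remove_point \<xi> x"
    have \<eta>: "emeasure \<eta> C = emeasure \<xi> C - indicator C x" if "C \<in> sets borel" for C
      unfolding \<eta>_def by (rule emeasure_remove_point[OF Suc.prems(2) x that])
    have conf: "\<eta> \<in> configs"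
      unfolding configs_def
    proof (safe)
      fix C :: "'a set" assume C: "C \<in> sets borel"
      obtain k :: nat where "emeasure \<xi> C = of_nat k" by (rule configE[OF Suc.prems(2) C])
      then have "emeasure \<eta> C = of_nat (k - (if x \<in> C then 1 else 0))"
        using \<eta>[OF C] by (cases k) (auto simp: indicator_def)
      then show "\<exists>n::nat. emeasure \<eta> C = of_nat n" ..
    qed (use s in \<open>simp_all add: \<eta>_def\<close>)
    have "emeasure \<eta> UNIV = of_nat n" using \<eta>[of UNIV] Suc.prems(1) by simp
    then obtain m where m: "\<eta> = emb m" using Suc.IH conf by blast
    have "\<xi> = emb (add_mset x m)"
    proof (rule measure_eqI)
      fix C assume "C \<in> sets \<xi>"
      then have C: "C \<in> sets borel" using s by simp
      have "1 \<le> emeasure \<xi> C" if "x \<in> C"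
      proof -
        obtain k :: nat where k: "emeasure \<xi> {x} = of_nat k" by (rule configE[OF Suc.prems(2), of "{x}"]) simp
        have "1 \<le> emeasure \<xi> {x}" using x k by (simp add: Suc_leI)
        also have "\<dots> \<le> emeasure \<xi> C" using that C s by (intro emeasure_mono) auto
        finally show ?thesis .
      qed
      then have "emeasure \<xi> C = emeasure \<eta> C + indicator C x"
        using \<eta>[OF C] by (auto simp: indicator_def diff_add_cancel_ennreal)
      also have "\<dots> = emeasure (emb (add_mset x m)) C"
        using C by (simp add: m emeasure_emb indicator_def add.commute)
      finally show "emeasure \<xi> C = emeasure (emb (add_mset x m)) C" .
    qed (use s in simp)
    then show ?case ..
  qed
qed

lemma emb_pts:
  fixes \<xi> :: "'a measure"
  assumes "\<xi> \<in> configs"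
  shows "emb (pts \<xi>) = \<xi>"
  using config_emb_ex[OF assms] by auto

lemma config_index_nonempty: "{C \<in> sets borel. compact (closure C)} \<noteq> ({} :: 'a set set)"
  by (auto intro!: exI[of _ "{}"])

lemma space_config_algebra: "space (config_algebra :: 'a measure measure) = configs"
  unfolding config_algebra_def using config_index_nonempty by (subst space_Sup_eq_UN) auto

lemma compact_closure: "compact (closure C)" for C :: "'a set"
  using compact_Int_closed[OF compact_space closed_closure[of C]] by simp

text \<open>In a compact space every set is relatively compact, so all Borel sets are admissible in
  the definition of the sigma-algebra.\<close>

lemma measurable_emeasure_config [measurable]:
  assumes "C \<in> sets borel"
  shows "(\<lambda>\<xi> :: 'a measure. emeasure \<xi> C) \<in> borel_measurable config_algebra"
  unfolding config_algebra_def
  by (rule measurable_Sup1[where m="vimage_algebra configs (\<lambda>\<xi>. emeasure \<xi> C) borel"])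
     (use assms compact_closure in \<open>auto intro!: measurable_vimage_algebra1\<close>)

lemma measurable_config_algebraI:
  fixes \<Psi> :: "'w \<Rightarrow> 'a measure"
  assumes "\<And>\<omega>. \<omega> \<in> space N \<Longrightarrow> \<Psi> \<omega> \<in> configs"
    and "\<And>C. C \<in> sets borel \<Longrightarrow> (\<lambda>\<omega>. emeasure (\<Psi> \<omega>) C) \<in> borel_measurable N"
  shows "\<Psi> \<in> measurable N config_algebra"
  unfolding config_algebra_def
  by (rule measurable_Sup2)
     (use assms config_index_nonempty in \<open>auto intro!: measurable_vimage_algebra2\<close>)

end

section \<open>The matching distance between finite multisets\<close>

lemma image_mset_ex: "\<exists>z. m = image_mset z (mset_set {1..size m})"
proof (induction m)
  case (add x m)
  then obtain z where z: "m = image_mset z (mset_set {1..size m})" ..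
  have "{1..size (add_mset x m)} = insert (Suc (size m)) {1..size m}" by auto
  then have "image_mset (z(Suc (size m) := x)) (mset_set {1..size (add_mset x m)})
      = add_mset x (image_mset (z(Suc (size m) := x)) (mset_set {1..size m}))" by simp
  also have "image_mset (z(Suc (size m) := x)) (mset_set {1..size m}) = image_mset z (mset_set {1..size m})"
    by (intro image_mset_cong) auto
  finally show ?case using z by (intro exI[of _ "z(Suc (size m) := x)"]) simp
qed simp

definition matching_costs :: "nat \<Rightarrow> (nat \<Rightarrow> 'a::metric_space) \<Rightarrow> (nat \<Rightarrow> 'a) \<Rightarrow> real set" where
  "matching_costs n x y = {1 / real n * (\<Sum>i=1..n. dist (x i) (y (\<sigma> i))) | \<sigma>. \<sigma> permutes {1..n}}"

text \<open>Two enumerations of a multiset differ by a permutation, and conjugating the matching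
  with these permutations keeps its cost. Hence the cost set depends on the multisets only, which
  makes the description in \<open>d1\<close> unique.\<close>

lemma matching_costs_subset:
  assumes x: "image_mset x (mset_set {1..n}) = image_mset x' (mset_set {1..n})"
    and y: "image_mset y (mset_set {1..n}) = image_mset y' (mset_set {1..n})"
  shows "matching_costs n x y \<subseteq> matching_costs n x' y'"
proof
  fix d assume "d \<in> matching_costs n x y"
  then obtain \<sigma> where \<sigma>: "\<sigma> permutes {1..n}" and d: "d = 1 / real n * (\<Sum>i=1..n. dist (x i) (y (\<sigma> i)))"
    by (auto simp: matching_costs_def)
  obtain \<pi> where \<pi>: "\<pi> permutes {1..n}" "\<forall>i\<in>{1..n}. x i = x' (\<pi> i)"
    using image_mset_eq_implies_permutes[OF _ x] by auto
  obtain \<rho> where \<rho>: "\<rho> permutes {1..n}" "\<forall>i\<in>{1..n}. y i = y' (\<rho> i)"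
    using image_mset_eq_implies_permutes[OF _ y] by auto
  define \<sigma>' where "\<sigma>' = \<rho> \<circ> \<sigma> \<circ> inv \<pi>"
  have \<sigma>': "\<sigma>' permutes {1..n}"
    unfolding \<sigma>'_def by (intro permutes_compose permutes_inv \<pi> \<sigma> \<rho>)
  have "(\<Sum>i=1..n. dist (x' i) (y' (\<sigma>' i))) = (\<Sum>i=1..n. dist (x' (\<pi> i)) (y' (\<sigma>' (\<pi> i))))"
    by (rule sum.permute[OF \<pi>(1), unfolded comp_def])
  also have "\<dots> = (\<Sum>i=1..n. dist (x i) (y (\<sigma> i)))"
  proof (intro sum.cong refl)
    fix i assume i: "i \<in> {1..n}"
    then have "\<sigma> i \<in> {1..n}" using permutes_in_image[OF \<sigma>] by blast
    then show "dist (x' (\<pi> i)) (y' (\<sigma>' (\<pi> i))) = dist (x i) (y (\<sigma> i))"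
      using i \<pi> \<rho> by (simp add: \<sigma>'_def permutes_inverses)
  qed
  finally show "d \<in> matching_costs n x' y'"
    using \<sigma>' d unfolding matching_costs_def by (metis (mono_tags, lifting) mem_Collect_eq)
qed

lemma finite_matching_costs: "finite (matching_costs n x y)"
proof -
  have "matching_costs n x y = (\<lambda>\<sigma>. 1 / real n * (\<Sum>i=1..n. dist (x i) (y (\<sigma> i)))) ` {\<sigma>. \<sigma> permutes {1..n}}"
    by (auto simp: matching_costs_def)
  then show ?thesis by (simp add: finite_permutations)
qed

lemma d1_points:
  assumes "n \<ge> 1"
  shows "d1 (points n x) (points n y) = Min (matching_costs n x y)"
proof -
  have mass: "total_mass (points n x) = real n" for x :: "nat \<Rightarrow> 'a"
    by (simp add: points_eq_emb)
  have "(THE d. \<exists>n' x' y'. points n x = points n' x' \<and> points n y = points n' y' \<and> d = Min (matching_costs n' x' y'))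
      = Min (matching_costs n x y)"
  proof (rule the_equality)
    fix d assume "\<exists>n' x' y'. points n x = points n' x' \<and> points n y = points n' y' \<and> d = Min (matching_costs n' x' y')"
    then obtain n' x' y' where *: "points n x = points n' x'" "points n y = points n' y'" "d = Min (matching_costs n' x' y')"
      by blast
    have "real n = total_mass (points n x)" "real n' = total_mass (points n' x')"
      by (simp_all add: points_eq_emb)
    then have "real n = real n'" using *(1) by simp
    then have n: "n' = n" by simp
    have "matching_costs n x y = matching_costs n' x' y'"
      using *(1,2) unfolding n points_eq_emb by (intro equalityI matching_costs_subset) auto
    then show "d = Min (matching_costs n x y)" using *(3) by simp
  qed blast
  then show ?thesis using assms unfolding d1_def mass matching_costs_def[symmetric] by simp
qed

lemma d1_points_le:
  assumes "n \<ge> 1"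
  shows "d1 (points n x) (points n y) \<le> 1 / real n * (\<Sum>i=1..n. dist (x i) (y i))"
proof -
  have "1 / real n * (\<Sum>i=1..n. dist (x i) (y i)) \<in> matching_costs n x y"
    unfolding matching_costs_def by (auto intro!: exI[of _ id] permutes_id)
  then show ?thesis unfolding d1_points[OF assms] by (intro Min_le finite_matching_costs)
qed

lemma d1_points_nonneg:
  assumes "n \<ge> 1"
  shows "d1 (points n x) (points n y) \<ge> 0"
proof -
  have "matching_costs n x y \<noteq> {}" unfolding matching_costs_def using permutes_id[of "{1..n}"] by blast
  then have "Min (matching_costs n x y) \<in> matching_costs n x y" by (intro Min_in finite_matching_costs)
  moreover have "0 \<le> d" if "d \<in> matching_costs n x y" for d
    using that by (auto simp: matching_costs_def intro!: divide_nonneg_nonneg sum_nonneg)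
  ultimately show ?thesis unfolding d1_points[OF assms] by blast
qed

lemma d1_emb_range:
  fixes m m' :: "'a::metric_space multiset"
  assumes "\<forall>x y :: 'a. dist x y \<le> 1"
  shows "0 \<le> d1 (emb m) (emb m') \<and> d1 (emb m) (emb m') \<le> 1"
proof (cases "size m = size m' \<and> size m \<noteq> 0")
  case True
  define n where "n = size m"
  have n: "n \<ge> 1" "size m' = n" using True by (auto simp: n_def Suc_le_eq nonempty_has_size)
  obtain x y where xy: "m = image_mset x (mset_set {1..n})" "m' = image_mset y (mset_set {1..n})"
    using image_mset_ex[of m] image_mset_ex[of m'] n by (auto simp: n_def)
  have eq: "emb m = points n x" "emb m' = points n y" by (simp_all add: points_eq_emb xy)
  have "(\<Sum>i=1..n. dist (x i) (y i)) \<le> (\<Sum>i=1..n. 1)" by (intro sum_mono) (use assms in auto)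
  then have "1 / real n * (\<Sum>i=1..n. dist (x i) (y i)) \<le> 1" using n by (simp add: field_simps)
  then show ?thesis using d1_points_le[OF n(1), of x y] d1_points_nonneg[OF n(1), of x y] unfolding eq by linarith
qed (auto simp: d1_def)

text \<open>Match every common point with itself and \<open>x\<close> with \<open>y\<close>; only
  one of the n+1 distances can be nonzero. This supplies the move condition on test
  functions.\<close>

lemma d1_emb_add_le:
  fixes x y :: "'a::metric_space"
  assumes "\<forall>x y :: 'a. dist x y \<le> 1"
  shows "d1 (emb (add_mset x m)) (emb (add_mset y m)) \<le> 1 / (real (size m) + 1)"
proof -
  define n where "n = size m"
  obtain z where z: "m = image_mset z (mset_set {1..n})" using image_mset_ex[of m] by (auto simp: n_def)
  have ins: "{1..Suc n} = insert (Suc n) {1..n}" by auto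
  have pt: "emb (add_mset x m) = points (Suc n) (z(Suc n := x))" for x
  proof -
    have "image_mset (z(Suc n := x)) (mset_set {1..n}) = image_mset z (mset_set {1..n})"
      by (intro image_mset_cong) auto
    then show ?thesis unfolding points_eq_emb ins using z by simp
  qed
  have "d1 (emb (add_mset x m)) (emb (add_mset y m))
      \<le> 1 / real (Suc n) * (\<Sum>i=1..Suc n. dist ((z(Suc n := x)) i) ((z(Suc n := y)) i))"
    unfolding pt by (rule d1_points_le) simp
  also have "(\<Sum>i=1..Suc n. dist ((z(Suc n := x)) i) ((z(Suc n := y)) i)) = dist x y"
    by (simp add: ins)
  also have "1 / real (Suc n) * dist x y \<le> 1 / (real n + 1)"
    using assms by (simp add: divide_right_mono add.commute)
  finally show ?thesis by (simp add: n_def)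
qed

lemma d1_emb_image_le:
  fixes \<tau> :: "'a::metric_space \<Rightarrow> 'a"
  assumes "\<And>x. dist x (\<tau> x) \<le> \<rho>" "\<rho> \<ge> 0"
  shows "d1 (emb m) (emb (image_mset \<tau> m)) \<le> \<rho>"
proof (cases "size m = 0")
  case False
  define n where "n = size m"
  have n: "n \<ge> 1" using False by (simp add: n_def Suc_le_eq nonempty_has_size)
  obtain z where z: "m = image_mset z (mset_set {1..n})" using image_mset_ex[of m] by (auto simp: n_def)
  have "emb m = points n z" "emb (image_mset \<tau> m) = points n (\<lambda>i. \<tau> (z i))"
    by (simp_all add: points_eq_emb z image_mset.compositionality comp_def)
  then have "d1 (emb m) (emb (image_mset \<tau> m)) \<le> 1 / real n * (\<Sum>i=1..n. dist (z i) (\<tau> (z i)))"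
    using d1_points_le[OF n] by simp
  also have "\<dots> \<le> 1 / real n * (\<Sum>i=1..n. \<rho>)" using assms by (intro mult_left_mono sum_mono) auto
  also have "\<dots> = \<rho>" using n by simp
  finally show ?thesis .
qed (use assms in \<open>auto simp: d1_def\<close>)

section \<open>Discrete random elements and kernels\<close>

lemma discrete_measurableI:
  assumes "countable C" "\<And>\<omega>. \<omega> \<in> space N \<Longrightarrow> Y \<omega> \<in> C"
    and "\<And>c. c \<in> C \<Longrightarrow> {\<omega> \<in> space N. Y \<omega> = c} \<in> sets N"
  shows "Y \<in> measurable N (count_space UNIV)"
proof (rule measurableI)
  fix A
  have "Y -` A \<inter> space N = (\<Union>c\<in>A \<inter> C. {\<omega> \<in> space N. Y \<omega> = c})" using assms(2) by auto
  also have "\<dots> \<in> sets N" using assms(1,3) by (intro sets.countable_UN') auto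
  finally show "Y -` A \<inter> space N \<in> sets N" .
qed simp

text \<open>The type of values may be uncountable, so a countable range is what guarantees that the
  law is carried by its atoms and is a \<open>pmf\<close>.\<close>

lemma discrete_law:
  assumes N: "prob_space N" and Y: "Y \<in> measurable N (count_space UNIV)"
    and C: "countable C" "\<And>\<omega>. \<omega> \<in> space N \<Longrightarrow> Y \<omega> \<in> C"
  obtains p where "measure_pmf p = distr N (count_space UNIV) Y"
proof -
  define D where "D = distr N (count_space UNIV) Y"
  interpret D: prob_space D unfolding D_def by (rule prob_space.prob_space_distr[OF N Y])
  have "AE x in D. x \<in> C"
    unfolding D_def by (subst AE_distr_iff[OF Y]) (use C in auto)
  then have "AE x in D. measure D {x} \<noteq> 0"
    by (subst D.AE_support_countable) (use C in \<open>auto simp: D_def\<close>)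
  then have "measure_pmf (Abs_pmf D) = D"
    by (intro Abs_pmf_inverse CollectI conjI D.prob_space_axioms) (simp_all add: D_def)
  then show ?thesis using that unfolding D_def by blast
qed

lemma integral_pmf_count_space:
  fixes \<psi> :: "'a \<Rightarrow> real"
  assumes "\<And>x. \<bar>\<psi> x\<bar> \<le> c"
  shows "integrable (count_space UNIV) (\<lambda>x. pmf p x * \<psi> x)"
    and "(\<integral>x. \<psi> x \<partial>measure_pmf p) = (\<integral>x. pmf p x * \<psi> x \<partial>count_space UNIV)"
proof -
  show "integrable (count_space UNIV) (\<lambda>x. pmf p x * \<psi> x)"
  proof (rule Bochner_Integration.integrable_bound)
    show "integrable (count_space UNIV) (\<lambda>x. pmf p x * c)" by (intro integrable_mult_left integrable_pmf)
    show "AE x in count_space UNIV. norm (pmf p x * \<psi> x) \<le> norm (pmf p x * c)"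
      using assms by (intro AE_I2) (auto simp: abs_mult intro!: mult_left_mono order.trans[OF assms abs_ge_self])
  qed simp
  show "(\<integral>x. \<psi> x \<partial>measure_pmf p) = (\<integral>x. pmf p x * \<psi> x \<partial>count_space UNIV)"
    unfolding measure_pmf_eq_density by (subst integral_density) auto
qed

text \<open>Among functions bounded by \<open>c\<close> the difference of integrals is largest for
  the one equal to \<open>c\<close> where the first mass function dominates and to
  \<open>- c\<close> elsewhere. For that function it is a combination of two set differences, whence
  the factor 2.\<close>

lemma pmf_total_variation:
  fixes \<psi> :: "'a \<Rightarrow> real" and p q :: "'a pmf"
  assumes tv: "\<And>X. \<bar>measure p X - measure q X\<bar> \<le> \<delta>" and \<psi>: "\<And>x. \<bar>\<psi> x\<bar> \<le> c"
  shows "\<bar>(\<integral>x. \<psi> x \<partial>measure_pmf p) - (\<integral>x. \<psi> x \<partial>measure_pmf q)\<bar> \<le> 2 * c * \<delta>"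
proof -
  have c: "c \<ge> 0" using \<psi>[of undefined] by linarith
  have le: "(\<integral>x. \<psi> x \<partial>measure_pmf p) - (\<integral>x. \<psi> x \<partial>measure_pmf q) \<le> 2 * c * \<delta>" if \<psi>: "\<And>x. \<bar>\<psi> x\<bar> \<le> c" for \<psi>
  proof -
    define P where "P = {x. pmf p x \<ge> pmf q x}"
    define \<psi>' where "\<psi>' = (\<lambda>x. c * (indicator P x - indicator (- P) x))"
    have \<psi>': "\<bar>\<psi>' x\<bar> \<le> c" for x using c by (auto simp: \<psi>'_def indicator_def)
    have "(\<integral>x. \<psi> x \<partial>measure_pmf p) - (\<integral>x. \<psi> x \<partial>measure_pmf q) = (\<integral>x. pmf p x * \<psi> x - pmf q x * \<psi> x \<partial>count_space UNIV)"
      by (simp add: integral_pmf_count_space[OF \<psi>])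
    also have "\<dots> \<le> (\<integral>x. pmf p x * \<psi>' x - pmf q x * \<psi>' x \<partial>count_space UNIV)"
    proof (rule integral_mono)
      fix x
      have "(pmf p x - pmf q x) * \<psi> x \<le> (pmf p x - pmf q x) * \<psi>' x"
      proof (cases "x \<in> P")
        case True
        then show ?thesis using \<psi>[of x] by (intro mult_left_mono) (auto simp: P_def \<psi>'_def)
      next
        case False
        then show ?thesis using \<psi>[of x] by (intro mult_left_mono_neg) (auto simp: P_def \<psi>'_def)
      qed
      then show "pmf p x * \<psi> x - pmf q x * \<psi> x \<le> pmf p x * \<psi>' x - pmf q x * \<psi>' x"
        by (simp add: algebra_simps)
    qed (intro Bochner_Integration.integrable_diff integral_pmf_count_space[OF \<psi>] integral_pmf_count_space[OF \<psi>'])+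
    also have "\<dots> = (\<integral>x. \<psi>' x \<partial>measure_pmf p) - (\<integral>x. \<psi>' x \<partial>measure_pmf q)"
      by (simp add: integral_pmf_count_space[OF \<psi>'])
    also have "\<dots> = c * ((measure p P - measure q P) - (measure p (- P) - measure q (- P)))"
    proof -
      have "(\<integral>x. \<psi>' x \<partial>measure_pmf r) = c * (measure r P - measure r (- P))" for r :: "'a pmf"
      proof -
        have "(\<integral>x. \<psi>' x \<partial>measure_pmf r) = c * ((\<integral>x. indicator P x \<partial>measure_pmf r) - (\<integral>x. indicator (- P) x \<partial>measure_pmf r))"
          unfolding \<psi>'_def by (subst integral_mult_right_zero, subst Bochner_Integration.integral_diff)
               (auto intro!: measure_pmf.integrable_const_bound[where B=1] AE_I2)
        then show ?thesis by simp
      qed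
      then show ?thesis by (simp add: algebra_simps)
    qed
    also have "\<dots> \<le> c * (\<delta> + \<delta>)"
      using tv[of P] tv[of "- P"] c by (intro mult_left_mono) linarith+
    finally show ?thesis by (simp add: algebra_simps)
  qed
  have "- ((\<integral>x. \<psi> x \<partial>measure_pmf p) - (\<integral>x. \<psi> x \<partial>measure_pmf q)) \<le> 2 * c * \<delta>"
    using le[of "\<lambda>x. - \<psi> x"] \<psi> by simp
  then show ?thesis using le[OF \<psi>] by (simp add: abs_le_iff)
qed

lemma discrete_total_variation:
  fixes \<psi> :: "'c \<Rightarrow> real"
  assumes N: "prob_space N" and C: "countable C"
    and Y: "Y \<in> measurable N (count_space UNIV)" "\<And>\<omega>. \<omega> \<in> space N \<Longrightarrow> Y \<omega> \<in> C"
    and Y': "Y' \<in> measurable N (count_space UNIV)" "\<And>\<omega>. \<omega> \<in> space N \<Longrightarrow> Y' \<omega> \<in> C"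
    and tv: "\<And>X. \<bar>measure N {\<omega> \<in> space N. Y \<omega> \<in> X} - measure N {\<omega> \<in> space N. Y' \<omega> \<in> X}\<bar> \<le> \<delta>"
    and \<psi>: "\<And>x. \<bar>\<psi> x\<bar> \<le> c"
  shows "\<bar>(\<integral>\<omega>. \<psi> (Y \<omega>) \<partial>N) - (\<integral>\<omega>. \<psi> (Y' \<omega>) \<partial>N)\<bar> \<le> 2 * c * \<delta>"
proof -
  obtain p where p: "measure_pmf p = distr N (count_space UNIV) Y" by (rule discrete_law[OF N Y(1) C Y(2)])
  obtain q where q: "measure_pmf q = distr N (count_space UNIV) Y'" by (rule discrete_law[OF N Y'(1) C Y'(2)])
  have "measure p X = measure N {\<omega> \<in> space N. Y \<omega> \<in> X}" "measure q X = measure N {\<omega> \<in> space N. Y' \<omega> \<in> X}" for X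
    unfolding p q using Y(1) Y'(1) by (auto simp: measure_distr vimage_def Int_def conj_commute)
  moreover have "(\<integral>x. \<psi> x \<partial>measure_pmf p) = (\<integral>\<omega>. \<psi> (Y \<omega>) \<partial>N)" "(\<integral>x. \<psi> x \<partial>measure_pmf q) = (\<integral>\<omega>. \<psi> (Y' \<omega>) \<partial>N)"
    unfolding p q using Y(1) Y'(1) by (auto simp: integral_distr)
  ultimately show ?thesis using pmf_total_variation[of p q \<delta> \<psi> c] tv \<psi> by simp
qed

text \<open>Only each section \<open>g c\<close> is measurable. Splitting the integral over the
  values of the discrete variable and exchanging sum and integral avoids any joint measurability on
  the uncountable type of values.\<close>

lemma nn_integral_discrete_split:
  assumes N: "sigma_finite_measure N" and C: "countable C"
    and W: "W \<in> measurable N (count_space UNIV)" "\<And>\<omega>. \<omega> \<in> space N \<Longrightarrow> W \<omega> \<in> C"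
    and g: "\<And>c. c \<in> C \<Longrightarrow> g c \<in> borel_measurable N"
  shows "(\<integral>\<^sup>+\<omega>. g (W \<omega>) \<omega> \<partial>N) = (\<integral>\<^sup>+c. (\<integral>\<^sup>+\<omega>. indicator {c} (W \<omega>) * g c \<omega> \<partial>N) \<partial>count_space C)"
proof -
  interpret P: pair_sigma_finite "count_space C" N
    using N C by (intro pair_sigma_finite.intro sigma_finite_measure_count_space_countable)
  have [measurable]: "(\<lambda>\<omega>. indicator {c} (W \<omega>) :: ennreal) \<in> borel_measurable N" for c
    using measurable_compose[OF W(1), of "indicator {c}" borel] by simp
  have meas: "(\<lambda>(c, \<omega>). indicator {c} (W \<omega>) * g c \<omega>) \<in> borel_measurable (count_space C \<Otimes>\<^sub>M N)"
    by (rule measurable_pair_measure_countable1[OF C]) (use g in auto)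
  have "(\<integral>\<^sup>+\<omega>. g (W \<omega>) \<omega> \<partial>N) = (\<integral>\<^sup>+\<omega>. (\<integral>\<^sup>+c. indicator {c} (W \<omega>) * g c \<omega> \<partial>count_space C) \<partial>N)"
  proof (rule nn_integral_cong)
    fix \<omega> assume \<omega>: "\<omega> \<in> space N"
    have "(\<integral>\<^sup>+c. indicator {c} (W \<omega>) * g c \<omega> \<partial>count_space C) = (\<integral>\<^sup>+c. g (W \<omega>) \<omega> * indicator {W \<omega>} c \<partial>count_space C)"
      by (intro nn_integral_cong) (auto simp: indicator_def)
    also have "\<dots> = g (W \<omega>) \<omega>" using W(2)[OF \<omega>] by (subst nn_integral_cmult_indicator) auto
    finally show "g (W \<omega>) \<omega> = (\<integral>\<^sup>+c. indicator {c} (W \<omega>) * g c \<omega> \<partial>count_space C)" ..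
  qed
  also have "\<dots> = (\<integral>\<^sup>+c. (\<integral>\<^sup>+\<omega>. indicator {c} (W \<omega>) * g c \<omega> \<partial>N) \<partial>count_space C)"
    using P.Fubini[OF meas] by simp
  finally show ?thesis .
qed

text \<open>On the event \<open>W = w\<close>, taken as a density, the hypothesis says that the law
  of \<open>X\<close> and the mixture of the kernel agree on every set. Equality of measures extends
  this to all functions of \<open>X\<close>, and summation over \<open>w\<close> lets the function
  depend on \<open>W\<close>. It serves both genuine conditional laws and, under independence, a
  constant kernel.\<close>

lemma nn_integral_kernel:
  assumes N: "prob_space N" and C: "countable C"
    and W: "W \<in> measurable N (count_space UNIV)" "\<And>\<omega>. \<omega> \<in> space N \<Longrightarrow> W \<omega> \<in> C"
    and X: "X \<in> measurable N K" and \<kappa>: "\<kappa> \<in> measurable N (prob_algebra K)"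
    and disint: "\<And>w D. w \<in> C \<Longrightarrow> D \<in> sets K \<Longrightarrow>
      (\<integral>\<^sup>+\<omega>. indicator {w} (W \<omega>) * emeasure (\<kappa> \<omega>) D \<partial>N) = (\<integral>\<^sup>+\<omega>. indicator {w} (W \<omega>) * indicator D (X \<omega>) \<partial>N)"
    and \<Phi>: "\<And>w. w \<in> C \<Longrightarrow> \<Phi> w \<in> borel_measurable K"
  shows "(\<integral>\<^sup>+\<omega>. \<Phi> (W \<omega>) (X \<omega>) \<partial>N) = (\<integral>\<^sup>+\<omega>. (\<integral>\<^sup>+\<eta>. \<Phi> (W \<omega>) \<eta> \<partial>\<kappa> \<omega>) \<partial>N)"
proof -
  interpret N: prob_space N by (rule N)
  note [measurable] = X
  have [measurable]: "(\<lambda>\<omega>. indicator {c} (W \<omega>) :: ennreal) \<in> borel_measurable N" for c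
    using measurable_compose[OF W(1), of "indicator {c}" borel] by simp
  have \<kappa>s: "\<kappa> \<in> measurable N (subprob_algebra K)" using \<kappa> by (rule measurable_prob_algebraD)
  have eq: "(\<integral>\<^sup>+\<omega>. indicator {w} (W \<omega>) * \<phi> (X \<omega>) \<partial>N) = (\<integral>\<^sup>+\<omega>. indicator {w} (W \<omega>) * (\<integral>\<^sup>+\<eta>. \<phi> \<eta> \<partial>\<kappa> \<omega>) \<partial>N)"
    if w: "w \<in> C" and \<phi>[measurable]: "\<phi> \<in> borel_measurable K" for w \<phi>
  proof -
    define N' where "N' = density N (\<lambda>\<omega>. indicator {w} (W \<omega>))"
    have N'[simp, measurable_cong]: "sets N' = sets N" "space N' = space N" by (simp_all add: N'_def)
    have \<kappa>': "\<kappa> \<in> measurable N' (subprob_algebra K)" using \<kappa>s by simp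
    have "distr N' K X = N' \<bind> \<kappa>"
    proof (rule measure_eqI)
      show "sets (distr N' K X) = sets (N' \<bind> \<kappa>)"
        using sets_bind[of N' \<kappa> K] sets_kernel[OF \<kappa>'] N.not_empty by simp
      fix D assume "D \<in> sets (distr N' K X)"
      then have D: "D \<in> sets K" by simp
      have "emeasure (distr N' K X) D = (\<integral>\<^sup>+\<eta>. indicator D \<eta> \<partial>distr N' K X)" using D by simp
      also have "\<dots> = (\<integral>\<^sup>+\<omega>. indicator D (X \<omega>) \<partial>N')" using D by (subst nn_integral_distr) auto
      also have "\<dots> = (\<integral>\<^sup>+\<omega>. indicator {w} (W \<omega>) * indicator D (X \<omega>) \<partial>N)"
        unfolding N'_def using D by (subst nn_integral_density) auto
      also have "\<dots> = (\<integral>\<^sup>+\<omega>. indicator {w} (W \<omega>) * emeasure (\<kappa> \<omega>) D \<partial>N)" using disint[OF w D] by simp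
      also have "\<dots> = (\<integral>\<^sup>+\<omega>. emeasure (\<kappa> \<omega>) D \<partial>N')"
        unfolding N'_def using measurable_emeasure_kernel[OF \<kappa>s D] by (subst nn_integral_density) auto
      also have "\<dots> = emeasure (N' \<bind> \<kappa>) D"
        using emeasure_bind[OF _ \<kappa>' D] N.not_empty by simp
      finally show "emeasure (distr N' K X) D = emeasure (N' \<bind> \<kappa>) D" .
    qed
    then have "(\<integral>\<^sup>+\<eta>. \<phi> \<eta> \<partial>distr N' K X) = (\<integral>\<^sup>+\<eta>. \<phi> \<eta> \<partial>(N' \<bind> \<kappa>))" by simp
    then have "(\<integral>\<^sup>+\<omega>. \<phi> (X \<omega>) \<partial>N') = (\<integral>\<^sup>+\<omega>. (\<integral>\<^sup>+\<eta>. \<phi> \<eta> \<partial>\<kappa> \<omega>) \<partial>N')"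
      by (subst (asm) nn_integral_distr) (simp_all add: nn_integral_bind[OF _ \<kappa>'])
    moreover have "(\<lambda>\<omega>. \<integral>\<^sup>+\<eta>. \<phi> \<eta> \<partial>\<kappa> \<omega>) \<in> borel_measurable N"
      using measurable_compose[OF \<kappa>s nn_integral_measurable_subprob_algebra[OF \<phi>]] .
    ultimately show ?thesis
      unfolding N'_def by (subst (asm) (1 2) nn_integral_density) auto
  qed
  have "(\<integral>\<^sup>+\<omega>. \<Phi> (W \<omega>) (X \<omega>) \<partial>N) = (\<integral>\<^sup>+w. (\<integral>\<^sup>+\<omega>. indicator {w} (W \<omega>) * \<Phi> w (X \<omega>) \<partial>N) \<partial>count_space C)"
    by (rule nn_integral_discrete_split[OF _ C W]) (use \<Phi> N.sigma_finite_measure_axioms in auto)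
  also have "\<dots> = (\<integral>\<^sup>+w. (\<integral>\<^sup>+\<omega>. indicator {w} (W \<omega>) * (\<integral>\<^sup>+\<eta>. \<Phi> w \<eta> \<partial>\<kappa> \<omega>) \<partial>N) \<partial>count_space C)"
    by (rule nn_integral_cong) (use eq \<Phi> in auto)
  also have "\<dots> = (\<integral>\<^sup>+\<omega>. (\<integral>\<^sup>+\<eta>. \<Phi> (W \<omega>) \<eta> \<partial>\<kappa> \<omega>) \<partial>N)"
    by (rule nn_integral_discrete_split[OF _ C W, symmetric])
       (use \<Phi> N.sigma_finite_measure_axioms measurable_compose[OF \<kappa>s nn_integral_measurable_subprob_algebra] in auto)
  finally show ?thesis .
qed

lemma integral_kernel_bound:
  fixes \<Phi> :: "'c \<Rightarrow> 'b \<Rightarrow> real"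
  assumes N: "prob_space N" and C: "countable C"
    and W: "W \<in> measurable N (count_space UNIV)" "\<And>\<omega>. \<omega> \<in> space N \<Longrightarrow> W \<omega> \<in> C"
    and X: "X \<in> measurable N K" and \<kappa>: "\<kappa> \<in> measurable N (prob_algebra K)"
    and disint: "\<And>w D. w \<in> C \<Longrightarrow> D \<in> sets K \<Longrightarrow>
      (\<integral>\<^sup>+\<omega>. indicator {w} (W \<omega>) * emeasure (\<kappa> \<omega>) D \<partial>N) = (\<integral>\<^sup>+\<omega>. indicator {w} (W \<omega>) * indicator D (X \<omega>) \<partial>N)"
    and \<Phi>: "\<And>w. w \<in> C \<Longrightarrow> \<Phi> w \<in> borel_measurable K"
    and bd: "\<And>w \<eta>. \<bar>\<Phi> w \<eta>\<bar> \<le> c w" and c: "integrable N (\<lambda>\<omega>. c (W \<omega>))"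
  shows "(\<lambda>\<omega>. \<integral>\<eta>. \<Phi> (W \<omega>) \<eta> \<partial>\<kappa> \<omega>) \<in> borel_measurable N"
    and "integrable N (\<lambda>\<omega>. \<Phi> (W \<omega>) (X \<omega>))"
    and "ennreal \<bar>\<integral>\<omega>. \<Phi> (W \<omega>) (X \<omega>) \<partial>N\<bar> \<le> (\<integral>\<^sup>+\<omega>. ennreal \<bar>\<integral>\<eta>. \<Phi> (W \<omega>) \<eta> \<partial>\<kappa> \<omega>\<bar> \<partial>N)"
proof -
  interpret N: prob_space N by (rule N)
  have \<kappa>s: "\<kappa> \<in> measurable N (subprob_algebra K)" using \<kappa> by (rule measurable_prob_algebraD)
  have W': "W \<in> measurable N (count_space C)"
    using W C by (subst measurable_count_space_eq_countable) (auto intro!: measurable_sets)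
  show m1: "(\<lambda>\<omega>. \<integral>\<eta>. \<Phi> (W \<omega>) \<eta> \<partial>\<kappa> \<omega>) \<in> borel_measurable N"
    by (rule measurable_compose_countable'[OF _ W' C, where f="\<lambda>w \<omega>. \<integral>\<eta>. \<Phi> w \<eta> \<partial>\<kappa> \<omega>"])
       (use measurable_compose[OF \<kappa>s integral_measurable_subprob_algebra] \<Phi> in auto)
  have m2: "(\<lambda>\<omega>. \<Phi> (W \<omega>) (X \<omega>)) \<in> borel_measurable N"
    by (rule measurable_compose_countable'[OF _ W' C, where f="\<lambda>w \<omega>. \<Phi> w (X \<omega>)"])
       (use measurable_compose[OF X \<Phi>] in auto)
  have c0: "0 \<le> c w" for w using bd[of w undefined] by linarith
  show int: "integrable N (\<lambda>\<omega>. \<Phi> (W \<omega>) (X \<omega>))"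
    by (rule Bochner_Integration.integrable_bound[OF c m2]) (use bd c0 in \<open>auto intro!: AE_I2\<close>)
  have fin: "integrable (\<kappa> \<omega>) (\<Phi> (W \<omega>))" "prob_space (\<kappa> \<omega>)" if \<omega>: "\<omega> \<in> space N" for \<omega>
  proof -
    have \<kappa>\<omega>: "prob_space (\<kappa> \<omega>)" "sets (\<kappa> \<omega>) = sets K"
      using measurable_space[OF \<kappa> \<omega>] by (auto simp: space_prob_algebra)
    interpret k: prob_space "\<kappa> \<omega>" by fact
    have "\<Phi> (W \<omega>) \<in> borel_measurable (\<kappa> \<omega>)"
      using \<Phi>[OF W(2)[OF \<omega>]] measurable_cong_sets[OF \<kappa>\<omega>(2) refl] by blast
    then show "integrable (\<kappa> \<omega>) (\<Phi> (W \<omega>))" "prob_space (\<kappa> \<omega>)"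
      using bd by (auto intro!: k.integrable_const_bound[where B="c (W \<omega>)"] k.prob_space_axioms)
  qed
  define J where "J = (\<lambda>\<omega>. \<integral>\<eta>. \<Phi> (W \<omega>) \<eta> \<partial>\<kappa> \<omega>)"
  have Jb: "\<bar>J \<omega>\<bar> \<le> c (W \<omega>)" if \<omega>: "\<omega> \<in> space N" for \<omega>
  proof -
    interpret k: prob_space "\<kappa> \<omega>" by (rule fin(2)[OF \<omega>])
    have "\<bar>J \<omega>\<bar> \<le> (\<integral>\<eta>. \<bar>\<Phi> (W \<omega>) \<eta>\<bar> \<partial>\<kappa> \<omega>)" unfolding J_def by (rule integral_abs_bound)
    also have "\<dots> \<le> (\<integral>\<eta>. c (W \<omega>) \<partial>\<kappa> \<omega>)"
      using fin(1)[OF \<omega>] bd by (intro integral_mono) auto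
    finally show ?thesis by (simp add: k.prob_space)
  qed
  have Jm: "J \<in> borel_measurable N" using m1 by (simp add: J_def)
  have Jint: "integrable N J"
    by (rule Bochner_Integration.integrable_bound[OF c Jm]) (use Jb c0 in \<open>auto intro!: AE_I2\<close>)
  \<comment> \<open>The kernel identity is available for nonnegative functions only, so
    \<open>\<Phi>\<close> is raised by its own bound, which depends on \<open>W\<close> and has a
    finite mean.\<close>
  have "(\<integral>\<^sup>+\<omega>. ennreal (\<Phi> (W \<omega>) (X \<omega>) + c (W \<omega>)) \<partial>N) = (\<integral>\<^sup>+\<omega>. (\<integral>\<^sup>+\<eta>. ennreal (\<Phi> (W \<omega>) \<eta> + c (W \<omega>)) \<partial>\<kappa> \<omega>) \<partial>N)"
    by (rule nn_integral_kernel[OF N C W X \<kappa> disint, where \<Phi>="\<lambda>w \<eta>. ennreal (\<Phi> w \<eta> + c w)"]) (use \<Phi> in auto)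
  also have "\<dots> = (\<integral>\<^sup>+\<omega>. ennreal (J \<omega> + c (W \<omega>)) \<partial>N)"
  proof (rule nn_integral_cong)
    fix \<omega> assume \<omega>: "\<omega> \<in> space N"
    interpret k: prob_space "\<kappa> \<omega>" by (rule fin(2)[OF \<omega>])
    have nn: "0 \<le> \<Phi> (W \<omega>) \<eta> + c (W \<omega>)" for \<eta> using bd[of "W \<omega>" \<eta>] by (simp add: abs_le_iff)
    have "(\<integral>\<^sup>+\<eta>. ennreal (\<Phi> (W \<omega>) \<eta> + c (W \<omega>)) \<partial>\<kappa> \<omega>) = ennreal (\<integral>\<eta>. \<Phi> (W \<omega>) \<eta> + c (W \<omega>) \<partial>\<kappa> \<omega>)"
      using fin(1)[OF \<omega>] nn by (intro nn_integral_eq_integral) auto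
    also have "(\<integral>\<eta>. \<Phi> (W \<omega>) \<eta> + c (W \<omega>) \<partial>\<kappa> \<omega>) = J \<omega> + c (W \<omega>)"
      using fin(1)[OF \<omega>] by (simp add: J_def k.prob_space)
    finally show "(\<integral>\<^sup>+\<eta>. ennreal (\<Phi> (W \<omega>) \<eta> + c (W \<omega>)) \<partial>\<kappa> \<omega>) = ennreal (J \<omega> + c (W \<omega>))" .
  qed
  finally have "(\<integral>\<^sup>+\<omega>. ennreal (\<Phi> (W \<omega>) (X \<omega>) + c (W \<omega>)) \<partial>N) = (\<integral>\<^sup>+\<omega>. ennreal (J \<omega> + c (W \<omega>)) \<partial>N)" .
  moreover have nn1: "0 \<le> \<Phi> (W \<omega>) (X \<omega>) + c (W \<omega>)" for \<omega> using bd[of "W \<omega>" "X \<omega>"] by (simp add: abs_le_iff)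
  moreover have nn2: "AE \<omega> in N. 0 \<le> J \<omega> + c (W \<omega>)" using Jb by (intro AE_I2) (force simp: abs_le_iff)
  ultimately have "ennreal (\<integral>\<omega>. \<Phi> (W \<omega>) (X \<omega>) + c (W \<omega>) \<partial>N) = ennreal (\<integral>\<omega>. J \<omega> + c (W \<omega>) \<partial>N)"
    using int Jint c by (subst (asm) (1 2) nn_integral_eq_integral) auto
  then have "(\<integral>\<omega>. \<Phi> (W \<omega>) (X \<omega>) + c (W \<omega>) \<partial>N) = (\<integral>\<omega>. J \<omega> + c (W \<omega>) \<partial>N)"
    using nn1 nn2 by (subst (asm) ennreal_inj) (auto intro!: integral_nonneg_AE)
  then have eq: "(\<integral>\<omega>. \<Phi> (W \<omega>) (X \<omega>) \<partial>N) = (\<integral>\<omega>. J \<omega> \<partial>N)"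
    using int Jint c by simp
  have "ennreal \<bar>\<integral>\<omega>. J \<omega> \<partial>N\<bar> \<le> ennreal (\<integral>\<omega>. \<bar>J \<omega>\<bar> \<partial>N)" by (intro ennreal_leI integral_abs_bound)
  also have "\<dots> = (\<integral>\<^sup>+\<omega>. ennreal \<bar>J \<omega>\<bar> \<partial>N)" using Jint by (subst nn_integral_eq_integral) auto
  finally show "ennreal \<bar>\<integral>\<omega>. \<Phi> (W \<omega>) (X \<omega>) \<partial>N\<bar> \<le> (\<integral>\<^sup>+\<omega>. ennreal \<bar>\<integral>\<eta>. \<Phi> (W \<omega>) \<eta> \<partial>\<kappa> \<omega>\<bar> \<partial>N)"
    unfolding eq J_def .
qed

text \<open>For a discrete variable one version of the conditional probability is fixed for each of
  the countably many values, and the law is assembled from them. These versions sum to 1 only almost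
  surely.\<close>

lemma regular_cond_distr_ex:
  fixes Y :: "'w \<Rightarrow> 'c" and h :: "'c \<Rightarrow> 'b"
  assumes N: "prob_space N" and F: "subalgebra N F" and C: "countable C"
    and Y: "Y \<in> measurable N (count_space UNIV)" "\<And>\<omega>. \<omega> \<in> space N \<Longrightarrow> Y \<omega> \<in> C"
    and h: "\<And>c. h c \<in> space K"
  shows "\<exists>\<kappa>. regular_cond_distr N F K (\<lambda>\<omega>. h (Y \<omega>)) \<kappa>"
proof -
  interpret N: prob_space N by (rule N)
  interpret finite_measure_subalgebra N F by standard (rule F)
  interpret P: pair_sigma_finite "count_space C" N
    using N.sigma_finite_measure_axioms C by (intro pair_sigma_finite.intro sigma_finite_measure_count_space_countable)
  have spF: "space F = space N" using F by (simp add: subalgebra_def)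
  have [measurable]: "(\<lambda>\<omega>. indicator {c} (Y \<omega>) :: ennreal) \<in> borel_measurable N" for c
    using measurable_compose[OF Y(1), of "indicator {c}" borel] by simp
  define g where "g = (\<lambda>c. nn_cond_exp N F (\<lambda>\<omega>. indicator {c} (Y \<omega>)))"
  have gF[measurable]: "g c \<in> borel_measurable F" for c by (simp add: g_def)
  have gN[measurable]: "g c \<in> borel_measurable N" for c by (simp add: g_def)
  define L where "L = (\<lambda>D \<omega>. \<integral>\<^sup>+c. g c \<omega> * indicator D (h c) \<partial>count_space C)"
  have Lmeas: "L D \<in> borel_measurable A" if "\<And>c. g c \<in> borel_measurable A" for D A
  proof -
    have "(\<lambda>(\<omega>, c). g c \<omega> * indicator D (h c)) \<in> borel_measurable (A \<Otimes>\<^sub>M count_space C)"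
      by (rule measurable_pair_swap_iff[THEN iffD2])
         (use that in \<open>auto intro!: measurable_pair_measure_countable1[OF C] simp: case_prod_beta\<close>)
    then show ?thesis unfolding L_def by (rule P.M1.borel_measurable_nn_integral)
  qed
  have Lce: "AE \<omega> in N. L D \<omega> = nn_cond_exp N F (\<lambda>\<omega>. indicator D (h (Y \<omega>))) \<omega>" for D
  proof (rule nn_cond_exp_charact)
    show "L D \<in> borel_measurable F" by (rule Lmeas) simp
    show hm: "(\<lambda>\<omega>. indicator D (h (Y \<omega>)) :: ennreal) \<in> borel_measurable N"
      using measurable_compose[OF Y(1), of "\<lambda>c. indicator D (h c)" borel] by simp
    fix A assume A: "A \<in> sets F"
    then have AN[measurable]: "A \<in> sets N" using F by (auto simp: subalgebra_def)
    have meas: "(\<lambda>(c, \<omega>). g c \<omega> * indicator D (h c) * indicator A \<omega>) \<in> borel_measurable (count_space C \<Otimes>\<^sub>M N)"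
      by (rule measurable_pair_measure_countable1[OF C]) auto
    have "(\<integral>\<^sup>+\<omega>\<in>A. L D \<omega> \<partial>N) = (\<integral>\<^sup>+\<omega>. (\<integral>\<^sup>+c. g c \<omega> * indicator D (h c) * indicator A \<omega> \<partial>count_space C) \<partial>N)"
      unfolding L_def by (intro nn_integral_cong) (simp add: nn_integral_multc)
    also have "\<dots> = (\<integral>\<^sup>+c. (\<integral>\<^sup>+\<omega>. g c \<omega> * indicator D (h c) * indicator A \<omega> \<partial>N) \<partial>count_space C)"
      using P.Fubini[OF meas] by simp
    also have "\<dots> = (\<integral>\<^sup>+c. (\<integral>\<^sup>+\<omega>. indicator {c} (Y \<omega>) * (indicator D (h c) * indicator A \<omega>) \<partial>N) \<partial>count_space C)"
    proof (rule nn_integral_cong)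
      fix c
      have "(\<integral>\<^sup>+\<omega>. g c \<omega> * indicator D (h c) * indicator A \<omega> \<partial>N) = indicator D (h c) * (\<integral>\<^sup>+\<omega>. indicator A \<omega> * g c \<omega> \<partial>N)"
        by (subst nn_integral_cmult[symmetric]) (auto simp: mult_ac)
      also have "(\<integral>\<^sup>+\<omega>. indicator A \<omega> * g c \<omega> \<partial>N) = (\<integral>\<^sup>+\<omega>. indicator A \<omega> * indicator {c} (Y \<omega>) \<partial>N)"
        unfolding g_def by (rule nn_cond_exp_intg) (use A in auto)
      also have "indicator D (h c) * \<dots> = (\<integral>\<^sup>+\<omega>. indicator {c} (Y \<omega>) * (indicator D (h c) * indicator A \<omega>) \<partial>N)"
        by (subst nn_integral_cmult[symmetric]) (auto simp: mult_ac)
      finally show "(\<integral>\<^sup>+\<omega>. g c \<omega> * indicator D (h c) * indicator A \<omega> \<partial>N) = \<dots>" .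
    qed
    also have "\<dots> = (\<integral>\<^sup>+\<omega>. indicator D (h (Y \<omega>)) * indicator A \<omega> \<partial>N)"
      by (rule nn_integral_discrete_split[OF N.sigma_finite_measure_axioms C Y, symmetric]) auto
    finally show "(\<integral>\<^sup>+\<omega>\<in>A. indicator D (h (Y \<omega>)) \<partial>N) = (\<integral>\<^sup>+\<omega>\<in>A. L D \<omega> \<partial>N)" ..
  qed
  define S where "S = L UNIV"
  have S1: "AE \<omega> in N. S \<omega> = 1"
  proof -
    have "AE \<omega> in N. 1 = nn_cond_exp N F (\<lambda>\<omega>. 1) \<omega>" by (rule nn_cond_exp_F_meas) simp
    moreover have "AE \<omega> in N. S \<omega> = nn_cond_exp N F (\<lambda>\<omega>. 1) \<omega>" unfolding S_def using Lce[of UNIV] by simp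
    ultimately show ?thesis by eventually_elim simp
  qed
  obtain c0 :: 'c where True by simp
  \<comment> \<open>On the null set where the total mass is wrong, a fixed point mass is used, so
    that \<open>\<kappa>\<close> is a probability measure at every outcome and remains
    measurable.\<close>
  define \<kappa> where "\<kappa> = (\<lambda>\<omega>. if S \<omega> = 1 then distr (density (count_space C) (\<lambda>c. g c \<omega>)) K h else return K (h c0))"
  have hm: "h \<in> measurable (count_space C) K" using h by simp
  have em: "emeasure (\<kappa> \<omega>) D = (if S \<omega> = 1 then L D \<omega> else indicator D (h c0))" if D: "D \<in> sets K" for D \<omega>
  proof -
    have "emeasure (distr (density (count_space C) (\<lambda>c. g c \<omega>)) K h) D
        = (\<integral>\<^sup>+c. g c \<omega> * indicator (h -` D \<inter> C) c \<partial>count_space C)"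
      using D hm by (subst emeasure_distr) (auto simp: emeasure_density)
    also have "\<dots> = L D \<omega>" unfolding L_def by (intro nn_integral_cong) (auto simp: indicator_def)
    finally show ?thesis using D by (simp add: \<kappa>_def)
  qed
  have pr: "prob_space (\<kappa> \<omega>)" for \<omega>
  proof
    have sp: "space (\<kappa> \<omega>) = space K" by (simp add: \<kappa>_def)
    have "L (space K) \<omega> = S \<omega>" unfolding S_def L_def using h by (intro nn_integral_cong) (auto simp: indicator_def)
    then show "emeasure (\<kappa> \<omega>) (space (\<kappa> \<omega>)) = 1" unfolding sp using em[of "space K" \<omega>] h by auto
  qed
  have "\<kappa> \<in> measurable F (prob_algebra K)"
  proof (rule measurable_prob_algebraI)
    show "\<kappa> \<in> measurable F (subprob_algebra K)"
    proof (rule measurable_subprob_algebra)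
      show "subprob_space (\<kappa> \<omega>)" for \<omega> using pr[of \<omega>] by (rule prob_space_imp_subprob_space)
      show "sets (\<kappa> \<omega>) = sets K" for \<omega> by (simp add: \<kappa>_def)
      fix D assume D: "D \<in> sets K"
      have [measurable]: "S \<in> borel_measurable F" "L D \<in> borel_measurable F" unfolding S_def by (intro Lmeas gF)+
      show "(\<lambda>\<omega>. emeasure (\<kappa> \<omega>) D) \<in> borel_measurable F" unfolding em[OF D] by measurable
    qed
  qed (rule pr)
  moreover have "AE \<omega> in N. emeasure (\<kappa> \<omega>) D = nn_cond_exp N F (\<lambda>\<omega>. indicator D (h (Y \<omega>))) \<omega>" if D: "D \<in> sets K" for D
    using S1 Lce[of D] by eventually_elim (simp add: em[OF D])
  ultimately show ?thesis unfolding regular_cond_distr_def by blast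
qed

section \<open>Discretized configurations\<close>

definition tally :: "('a::t1_space \<Rightarrow> 'a) \<Rightarrow> 'a measure \<Rightarrow> 'a multiset" where
  "tally \<phi> \<xi> = image_mset \<phi> (pts \<xi>)"

lemma tally_emb [simp]: "tally \<phi> (emb m) = image_mset \<phi> m"
  by (simp add: tally_def)

lemma countable_multisets_over: "countable T \<Longrightarrow> countable {m. set_mset m \<subseteq> T}"
proof -
  assume T: "countable T"
  have "{m. set_mset m \<subseteq> T} \<subseteq> mset ` lists T"
  proof
    fix m assume "m \<in> {m. set_mset m \<subseteq> T}"
    moreover obtain xs where "mset xs = m" using ex_mset by blast
    ultimately show "m \<in> mset ` lists T" by (auto intro!: imageI)
  qed
  moreover have "countable (mset ` lists T)" using T by (intro countable_image countable_lists)
  ultimately show ?thesis by (rule countable_subset)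
qed

locale discretization =
  fixes k :: nat and G :: "nat \<Rightarrow> 'a::metric_space set" and t :: "nat \<Rightarrow> 'a" and a u :: real
  assumes compact_space: "compact (UNIV :: 'a set)"
    and part: "borel_partition k G" and a_gt_0: "a > 0" and u_gt_0: "u > 0"
begin

definition centers :: "'a set" where
  "centers = t ` {1..k}"

lemma finite_centers [simp]: "finite centers"
  by (simp add: centers_def)

definition cell_index :: "'a \<Rightarrow> nat" where
  "cell_index x = (THE i. i \<in> {1..k} \<and> x \<in> G i)"

definition \<tau> :: "'a \<Rightarrow> 'a" where
  "\<tau> x = t (cell_index x)"

text \<open>A retraction onto the set of centers. (\<open>\<tau>\<close> is none: a center need not lie in its own cell.)\<close>

definition \<rho> :: "'a \<Rightarrow> 'a" where
  "\<rho> x = (if x \<in> centers then x else t 1)"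

abbreviation over :: "'a multiset set" where
  "over \<equiv> {m. set_mset m \<subseteq> centers}"

lemma cell_index_ex1: "\<exists>!i. i \<in> {1..k} \<and> x \<in> G i"
proof -
  have P: "partition_on UNIV (G ` {1..k})" and inj: "inj_on G {1..k}"
    using part unfolding borel_partition_def by blast+
  have "x \<in> \<Union> (G ` {1..k})" using P unfolding partition_on_def by blast
  then obtain i where i: "i \<in> {1..k}" "x \<in> G i" by blast
  have "j = i" if "j \<in> {1..k}" "x \<in> G j" for j
  proof -
    have "G j = G i"
    proof -
      have "G j \<in> G ` {1..k}" "G i \<in> G ` {1..k}" using that(1) i(1) by blast+
      then have "G j = G i \<or> G j \<inter> G i = {}"
        using P unfolding partition_on_def disjoint_def by blast
      then show ?thesis using that(2) i(2) by blast
    qed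
    then show ?thesis using inj that i by (meson inj_onD)
  qed
  then show ?thesis using i by blast
qed

lemma cell_index: "cell_index x \<in> {1..k}" "x \<in> G (cell_index x)"
  using theI'[OF cell_index_ex1[of x]] unfolding cell_index_def by blast+

lemma cell_index_eq: "i \<in> {1..k} \<Longrightarrow> x \<in> G i \<Longrightarrow> cell_index x = i"
  using cell_index_ex1[of x] cell_index[of x] by blast

lemma k_ge_1: "1 \<le> k"
  using cell_index(1)[of undefined] by simp

lemma \<tau>_center [simp]: "\<tau> x \<in> centers"
  unfolding \<tau>_def centers_def using cell_index(1) by blast

lemma \<rho>_center [simp]: "\<rho> x \<in> centers"
  unfolding \<rho>_def centers_def using k_ge_1 by auto

lemma \<rho>_id: "x \<in> centers \<Longrightarrow> \<rho> x = x"
  by (simp add: \<rho>_def)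

lemma image_\<rho>: "m \<in> over \<Longrightarrow> image_mset \<rho> m = m"
proof -
  assume "m \<in> over"
  then have "image_mset \<rho> m = image_mset (\<lambda>x. x) m" by (intro image_mset_cong) (auto simp: \<rho>_id)
  then show ?thesis by simp
qed

lemma \<tau>_borel [measurable]: "\<tau> -` S \<in> sets borel"
proof -
  have "\<tau> -` S = (\<Union>i\<in>{i\<in>{1..k}. t i \<in> S}. G i)"
    using cell_index cell_index_eq by (force simp: \<tau>_def)
  also have "\<dots> \<in> sets borel" using part by (intro sets.finite_UN) (auto simp: borel_partition_def)
  finally show ?thesis .
qed

lemma \<rho>_borel: "\<rho> -` S \<in> sets borel"
proof -
  have "finite centers" by simp
  then have 1: "centers \<inter> S \<in> sets borel" "centers \<in> sets borel"
    by (intro borel_closed finite_imp_closed; simp)+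
  have "\<rho> -` S = (centers \<inter> S) \<union> (if t 1 \<in> S then - centers else {})"
    by (auto simp: \<rho>_def split: if_splits)
  then show ?thesis using 1 by auto
qed

lemma countable_over: "countable over"
  by (intro countable_multisets_over countable_finite) simp

lemma tally_over: "tally \<tau> \<xi> \<in> over" "tally \<rho> \<xi> \<in> over"
  by (auto simp: tally_def)

lemmas space_config = space_config_algebra[OF compact_space]
  and emb_pts = emb_pts[OF compact_space]
  and measurable_emeasure_config = measurable_emeasure_config[OF compact_space]
  and measurable_config_algebraI = measurable_config_algebraI[OF compact_space]

text \<open>The image multiset is determined by the masses of the fibres over the finitely many
  centers, and each such mass is a measurable function of the configuration.\<close>

lemma measurable_image_pts:
  assumes \<phi>: "\<And>x. \<phi> x \<in> centers" "\<And>S. \<phi> -` S \<in> sets borel"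
  shows "tally \<phi> \<in> measurable config_algebra (count_space UNIV)"
proof (rule discrete_measurableI[OF countable_over])
  fix m assume m: "m \<in> over"
  have eq: "tally \<phi> \<xi> = m \<longleftrightarrow> (\<forall>s\<in>centers. emeasure \<xi> (\<phi> -` {s}) = of_nat (count m s))"
    if "\<xi> \<in> configs" for \<xi>
  proof -
    define n where "n = pts \<xi>"
    have n: "\<xi> = emb n" unfolding n_def using emb_pts[OF that] by (rule sym)
    have c: "emeasure \<xi> (\<phi> -` {s}) = of_nat (count (image_mset \<phi> n) s)" for s
    proof -
      have "count (image_mset \<phi> n) s = size (filter_mset (\<lambda>x. x \<in> \<phi> -` {s}) n)"
        by (induction n) auto
      then show ?thesis unfolding n emeasure_emb[OF \<phi>(2)] by (rule arg_cong[symmetric])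
    qed
    have tal: "tally \<phi> \<xi> = image_mset \<phi> n" unfolding n by (rule tally_emb)
    show ?thesis
    proof
      assume "\<forall>s\<in>centers. emeasure \<xi> (\<phi> -` {s}) = of_nat (count m s)"
      then have "count (image_mset \<phi> n) s = count m s" if "s \<in> centers" for s
        using that unfolding c of_nat_eq_iff by blast
      moreover have "count (image_mset \<phi> n) s = count m s" if "s \<notin> centers" for s
      proof -
        have "s \<notin># image_mset \<phi> n" "s \<notin># m" using \<phi>(1) m that by auto
        then show ?thesis unfolding not_in_iff by simp
      qed
      ultimately have "image_mset \<phi> n = m" by (intro multiset_eqI) blast
      then show "tally \<phi> \<xi> = m" unfolding tal .
    next
      assume "tally \<phi> \<xi> = m"
      then show "\<forall>s\<in>centers. emeasure \<xi> (\<phi> -` {s}) = of_nat (count m s)" unfolding c tal by simp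
    qed
  qed
  have "{\<xi> \<in> space config_algebra. tally \<phi> \<xi> = m}
      = {\<xi> \<in> space config_algebra. \<forall>s\<in>centers. emeasure \<xi> (\<phi> -` {s}) = of_nat (count m s)}"
    using eq by (intro Collect_cong) (unfold space_config, blast)
  also have "\<dots> \<in> sets config_algebra"
  proof (rule sets.sets_Collect_finite_All)
    fix s
    have [measurable]: "(\<lambda>\<xi>. emeasure \<xi> (\<phi> -` {s})) \<in> borel_measurable config_algebra"
      by (rule measurable_emeasure_config[OF \<phi>(2)])
    show "{\<xi> \<in> space config_algebra. emeasure \<xi> (\<phi> -` {s}) = of_nat (count m s)} \<in> sets config_algebra"
      by measurable
  qed simp
  finally show "{\<xi> \<in> space config_algebra. tally \<phi> \<xi> = m} \<in> sets config_algebra" .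
qed (use \<phi> in \<open>auto simp: tally_def\<close>)

lemma measurable_tally [measurable]:
  "tally \<tau> \<in> measurable config_algebra (count_space UNIV)"
  "tally \<rho> \<in> measurable config_algebra (count_space UNIV)"
  by (intro measurable_image_pts \<tau>_borel \<rho>_borel; simp)+

lemma restr_config: "(\<xi> :: 'a measure) \<in> configs \<Longrightarrow> B \<in> sets borel \<Longrightarrow> restr B \<xi> \<in> configs"
  using restr_emb[of B "pts \<xi>"] emb_pts[of \<xi>] emb_configs[of "filter_mset (\<lambda>x. x \<in> B) (pts \<xi>)"] by simp

lemma measurable_restr:
  fixes B :: "'a set"
  assumes B: "B \<in> sets borel"
  shows "restr B \<in> measurable config_algebra config_algebra"
proof (rule measurable_config_algebraI)
  fix \<xi> :: "'a measure" assume "\<xi> \<in> space config_algebra"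
  then show "restr B \<xi> \<in> configs" using restr_config[OF _ B] by (simp add: space_config)
next
  fix C :: "'a set" assume C: "C \<in> sets borel"
  have "emeasure (restr B \<xi>) C = emeasure \<xi> (B \<inter> C)" if "\<xi> \<in> space config_algebra" for \<xi>
    using that B C unfolding restr_def by (subst emeasure_restricted) (auto simp: space_config configs_def)
  then show "(\<lambda>\<xi>. emeasure (restr B \<xi>) C) \<in> borel_measurable config_algebra"
    using measurable_emeasure_config[of "B \<inter> C"] B C by (subst measurable_cong) auto
qed

lemma add_point_config: "(\<xi> :: 'a measure) \<in> configs \<Longrightarrow> add_point \<xi> x \<in> configs"
  using add_point_emb[of "pts \<xi>" x] emb_pts[of \<xi>] emb_configs[of "add_mset x (pts \<xi>)"] by simp

lemma measurable_add_point: "(\<lambda>\<xi> :: 'a measure. add_point \<xi> x) \<in> measurable config_algebra config_algebra"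
proof (rule measurable_config_algebraI)
  fix \<xi> :: "'a measure" assume "\<xi> \<in> space config_algebra"
  then show "add_point \<xi> x \<in> configs" using add_point_config by (simp add: space_config)
next
  fix C :: "'a set" assume C: "C \<in> sets borel"
  have "emeasure (add_point \<xi> x) C = emeasure \<xi> C + indicator C x" if "\<xi> \<in> space config_algebra" for \<xi>
    using that C by (intro emeasure_add_point) (auto simp: space_config configs_def)
  moreover have "(\<lambda>\<xi>. emeasure \<xi> C + indicator C x) \<in> borel_measurable config_algebra"
    using measurable_emeasure_config[OF C] by (intro borel_measurable_add) auto
  ultimately show "(\<lambda>\<xi>. emeasure (add_point \<xi> x) C) \<in> borel_measurable config_algebra"
    by (subst measurable_cong)
qed

lemma measurable_emb_over [measurable]: "(emb :: 'a multiset \<Rightarrow> _) \<in> measurable (count_space UNIV) config_algebra"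
  by (simp add: space_config)

lemma discretize_eq: "\<xi> \<in> configs \<Longrightarrow> discretize k G t \<xi> = emb (tally \<tau> \<xi>)"
proof -
  assume "\<xi> \<in> configs"
  then obtain m where m: "\<xi> = emb m" using emb_pts[of \<xi>, symmetric] by blast
  have Gb: "G i \<in> sets borel" if "i \<in> {1..k}" for i using part that by (auto simp: borel_partition_def)
  show ?thesis
  proof (rule measure_eqI)
    fix C assume "C \<in> sets (discretize k G t \<xi>)"
    then have C: "C \<in> sets borel" by (simp add: discretize_def)
    have "emeasure (discretize k G t \<xi>) C = (\<Sum>i\<in>{1..k}. emeasure \<xi> (G i) * indicator C (t i))"
      unfolding discretize_def by (rule emeasure_dirac_sum[OF C])
    also have "\<dots> = (\<Sum>i\<in>{1..k}. of_nat (size (filter_mset (\<lambda>x. x \<in> G i) m)) * indicator C (t i))"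
      unfolding m using Gb by (intro sum.cong refl) (simp add: emeasure_emb)
    also have "\<dots> = of_nat (size (filter_mset (\<lambda>x. x \<in> C) (image_mset \<tau> m)))"
    proof (induction m)
      case (add x m)
      have "(\<Sum>i\<in>{1..k}. of_nat (size (filter_mset (\<lambda>x. x \<in> G i) (add_mset x m))) * indicator C (t i) :: ennreal)
        = (\<Sum>i\<in>{1..k}. (if i = cell_index x then indicator C (t i) else 0)
              + of_nat (size (filter_mset (\<lambda>x. x \<in> G i) m)) * indicator C (t i))"
      proof (intro sum.cong refl)
        fix i assume i: "i \<in> {1..k}"
        have "x \<in> G i \<longleftrightarrow> i = cell_index x" using cell_index(2)[of x] cell_index_eq[OF i] by blast
        then show "of_nat (size (filter_mset (\<lambda>x. x \<in> G i) (add_mset x m))) * indicator C (t i)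
          = (if i = cell_index x then indicator C (t i) else 0)
              + of_nat (size (filter_mset (\<lambda>x. x \<in> G i) m)) * (indicator C (t i) :: ennreal)"
          by (simp add: distrib_right)
      qed
      also have "\<dots> = indicator C (\<tau> x) + of_nat (size (filter_mset (\<lambda>x. x \<in> C) (image_mset \<tau> m)))"
      proof -
        have "(\<Sum>i\<in>{1..k}. if i = cell_index x then indicator C (t i) else 0) = (indicator C (\<tau> x) :: ennreal)"
          using cell_index(1)[of x] by (simp add: sum.delta \<tau>_def)
        then show ?thesis by (simp only: sum.distrib add)
      qed
      finally show ?case by (simp add: indicator_def)
    qed simp
    also have "\<dots> = emeasure (emb (tally \<tau> \<xi>)) C" by (simp add: m emeasure_emb[OF C])
    finally show "emeasure (discretize k G t \<xi>) C = emeasure (emb (tally \<tau> \<xi>)) C" .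
  qed (simp add: discretize_def)
qed

section \<open>The functional R of a fixed law and shifts by one center\<close>

definition small :: "'a measure set" where
  "small = {\<eta> \<in> space config_algebra. emeasure \<eta> UNIV + 1 \<le> ennreal (a / u)}"

text \<open>\<open>Q\<close> lives on all configurations, while the Stein solution lives on
  multisets. Reading off points through \<open>\<rho>\<close> is total and returns the tally
  unchanged on configurations that are already discretized.\<close>

definition law :: "'a measure measure \<Rightarrow> 'a multiset measure" where
  "law Q = distr Q (count_space UNIV) (tally \<rho>)"

text \<open>Both forms of R are values of this functional, at a conditional law or at an
  unconditional one. All analytic estimates are therefore proved once, for a deterministic law
  \<open>Q\<close>.\<close>

definition Rf :: "'a measure measure \<Rightarrow> ennreal" where
  "Rf Q = 4 * emeasure Q small + ennreal ((4 * u + 10) / a) * max_shift k t Q"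

lemma small_sets: "small \<in> sets config_algebra"
proof -
  have [measurable]: "(\<lambda>\<eta> :: 'a measure. emeasure \<eta> UNIV) \<in> borel_measurable config_algebra"
    by (rule measurable_emeasure_config) simp
  show ?thesis unfolding small_def by measurable
qed

lemma mass_le_iff: "emeasure (emb m) UNIV + 1 \<le> ennreal (a / u) \<longleftrightarrow> real (size m) + 1 \<le> a / u"
proof -
  have "emeasure (emb m) UNIV + 1 = ennreal (real (size m) + 1)"
    unfolding emeasure_emb_UNIV ennreal_of_nat_eq_real_of_nat
    by (metis ennreal_1 ennreal_plus of_nat_0_le_iff zero_le_one)
  then show ?thesis using a_gt_0 u_gt_0 by (simp only: ennreal_le_iff divide_nonneg_nonneg less_imp_le)
qed

lemma small_iff: "\<eta> \<in> space config_algebra \<Longrightarrow> \<eta> \<in> small \<longleftrightarrow> real (size (tally \<rho> \<eta>)) + 1 \<le> a / u"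
  using mass_le_iff[of "pts \<eta>"] emb_pts[of \<eta>] by (simp add: small_def tally_def space_config)

context
  fixes Q :: "'a measure measure"
  assumes Q: "prob_space Q" "sets Q = sets config_algebra"
begin

interpretation Q: prob_space Q by (rule Q)

lemma space_Q: "space Q = configs"
  using sets_eq_imp_space_eq[OF Q(2)] by (simp add: space_config)

lemma tally_measurable_Q: "tally \<rho> \<in> measurable Q (count_space UNIV)"
  using measurable_tally(2) measurable_cong_sets[OF Q(2) refl] by blast

lemma integrable_tally:
  fixes \<phi> :: "'a multiset \<Rightarrow> real"
  assumes "\<And>m. \<bar>\<phi> m\<bar> \<le> c"
  shows "integrable Q (\<lambda>\<eta>. \<phi> (tally \<rho> \<eta>))"
  using assms measurable_compose[OF tally_measurable_Q, of \<phi> borel]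
  by (intro Q.integrable_const_bound[where B=c]) auto

lemma law_integral:
  fixes \<phi> :: "'a multiset \<Rightarrow> real"
  shows "(\<integral>m. \<phi> m \<partial>law Q) = (\<integral>\<eta>. \<phi> (tally \<rho> \<eta>) \<partial>Q)"
  unfolding law_def by (rule integral_distr[OF tally_measurable_Q]) simp

lemma law_integrable:
  fixes \<phi> :: "'a multiset \<Rightarrow> real"
  assumes "\<And>m. \<bar>\<phi> m\<bar> \<le> c"
  shows "integrable (law Q) \<phi>"
  unfolding law_def
  by (subst integrable_distr_eq[OF tally_measurable_Q]) (use integrable_tally[OF assms] in auto)

lemma add_preimage_sets:
  assumes "D \<in> sets config_algebra"
  shows "{\<eta> \<in> space Q. add_point \<eta> x \<in> D} \<in> sets Q"
proof -
  have "(\<lambda>\<eta>. add_point \<eta> x) -` D \<inter> space config_algebra \<in> sets config_algebra"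
    using measurable_sets[OF measurable_add_point assms] .
  then show ?thesis using Q(2) sets_eq_imp_space_eq[OF Q(2)] by (auto simp: vimage_def Int_def conj_commute)
qed

lemma shift_integral:
  assumes D: "D \<in> sets config_algebra"
  shows "(\<integral>\<eta>. indicator D \<eta> - indicator D (add_point \<eta> x) \<partial>Q)
    = measure Q D - measure Q {\<eta> \<in> space Q. add_point \<eta> x \<in> D}"
proof -
  have "(\<integral>\<eta>. indicator D \<eta> - indicator D (add_point \<eta> x) \<partial>Q)
    = (\<integral>\<eta>. indicator D \<eta> - indicator {\<eta> \<in> space Q. add_point \<eta> x \<in> D} \<eta> \<partial>Q)"
    by (intro Bochner_Integration.integral_cong refl) (auto simp: indicator_def)
  also have "\<dots> = measure Q D - measure Q {\<eta> \<in> space Q. add_point \<eta> x \<in> D}"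
    using add_preimage_sets[OF D] D Q(2)
    by (subst Bochner_Integration.integral_diff)
       (auto simp: Q.emeasure_eq_measure intro!: integrable_real_indicator)
  finally show ?thesis .
qed

lemma max_shift_ge:
  assumes j: "j \<in> {1..k}" and D: "D \<in> sets config_algebra"
  shows "ennreal \<bar>measure Q D - measure Q {\<eta> \<in> space Q. add_point \<eta> (t j) \<in> D}\<bar> \<le> max_shift k t Q"
proof -
  have "ennreal \<bar>\<integral>\<eta>. indicator D \<eta> - indicator D (add_point \<eta> (t j)) \<partial>Q\<bar>
      \<le> (SUP f\<in>F_TV. ennreal \<bar>\<integral>\<eta>. f \<eta> - f (add_point \<eta> (t j)) \<partial>Q\<bar>)"
    using D by (intro SUP_upper2[of "indicator D"]) (auto simp: F_TV_def)
  also have "\<dots> \<le> max_shift k t Q"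
    unfolding max_shift_def using j by (intro Max_ge) auto
  finally show ?thesis by (simp add: shift_integral[OF D])
qed

text \<open>Each term compares two probabilities. Finiteness is what allows \<open>enn2real\<close>
  to be used below without loss.\<close>

lemma max_shift_le_1: "max_shift k t Q \<le> 1"
  unfolding max_shift_def
proof (rule Max.boundedI)
  show "(\<lambda>j. SUP f\<in>F_TV. ennreal \<bar>\<integral>\<eta>. f \<eta> - f (add_point \<eta> (t j)) \<partial>Q\<bar>) ` {1..k} \<noteq> {}"
    using k_ge_1 by auto
  fix x assume "x \<in> (\<lambda>j. SUP f\<in>F_TV. ennreal \<bar>\<integral>\<eta>. f \<eta> - f (add_point \<eta> (t j)) \<partial>Q\<bar>) ` {1..k}"
  then obtain j where x: "x = (SUP f\<in>F_TV. ennreal \<bar>\<integral>\<eta>. f \<eta> - f (add_point \<eta> (t j)) \<partial>Q\<bar>)" by blast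
  show "x \<le> 1"
    unfolding x
  proof (rule SUP_least)
    fix f :: "'a measure \<Rightarrow> real" assume "f \<in> F_TV"
    then obtain D where f: "f = indicator D" and D: "D \<in> sets config_algebra" by (auto simp: F_TV_def)
    have "\<bar>measure Q D - measure Q {\<eta> \<in> space Q. add_point \<eta> (t j) \<in> D}\<bar> \<le> 1"
      using Q.prob_le_1[of D] Q.prob_le_1[of "{\<eta> \<in> space Q. add_point \<eta> (t j) \<in> D}"]
      by (smt (verit) measure_nonneg)
    then show "ennreal \<bar>\<integral>\<eta>. f \<eta> - f (add_point \<eta> (t j)) \<partial>Q\<bar> \<le> 1"
      unfolding f shift_integral[OF D] by simp
  qed
qed simp

definition rQ :: real where
  "rQ = 4 * measure Q small + (4 * u + 10) / a * enn2real (max_shift k t Q)"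

lemma max_shift_eq: "max_shift k t Q = ennreal (enn2real (max_shift k t Q))"
  using max_shift_le_1 by (intro ennreal_enn2real[symmetric]) (auto intro: le_less_trans)

lemma Rf_eq: "Rf Q = ennreal rQ"
proof -
  have "4 * emeasure Q small = ennreal (4 * measure Q small)"
    by (simp add: Q.emeasure_eq_measure ennreal_mult)
  moreover have "ennreal ((4 * u + 10) / a) * max_shift k t Q = ennreal ((4 * u + 10) / a * enn2real (max_shift k t Q))"
    by (subst max_shift_eq, rule ennreal_mult[symmetric]) (use u_gt_0 a_gt_0 in auto)
  ultimately have "Rf Q = ennreal (4 * measure Q small) + ennreal ((4 * u + 10) / a * enn2real (max_shift k t Q))"
    unfolding Rf_def by simp
  also have "\<dots> = ennreal rQ"
    unfolding rQ_def using u_gt_0 a_gt_0 by (intro ennreal_plus[symmetric]) auto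
  finally show ?thesis .
qed

lemma rQ_nonneg: "0 \<le> rQ"
  unfolding rQ_def using u_gt_0 a_gt_0 by (intro add_nonneg_nonneg mult_nonneg_nonneg divide_nonneg_nonneg) auto

text \<open>Split the function at the size threshold. The part on large configurations has the
  better bound \<open>c\<close> and is compared by total variation; the part on small ones keeps the
  crude bound \<open>c'\<close> but contributes only on the event \<open>small\<close>.\<close>

lemma shift_bound:
  fixes \<phi> :: "'a multiset \<Rightarrow> real"
  assumes s: "s \<in> centers" and all: "\<And>m. \<bar>\<phi> m\<bar> \<le> c'"
    and large: "\<And>m. real (size m) + 1 > a / u \<Longrightarrow> \<bar>\<phi> m\<bar> \<le> c"
    and c: "c \<ge> 0"
  shows "\<bar>\<integral>m. \<phi> m - \<phi> (add_mset s m) \<partial>law Q\<bar>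
    \<le> 2 * c' * measure Q small + 2 * c * enn2real (max_shift k t Q)"
proof -
  have c': "c' \<ge> 0" using all[of "{#}"] by linarith
  obtain j where j: "j \<in> {1..k}" and sj: "s = t j" using s unfolding centers_def by blast
  define L where "L = {m :: 'a multiset. real (size m) + 1 > a / u}"
  define \<phi>L where "\<phi>L = (\<lambda>m. indicator L m * \<phi> m)"
  define \<phi>S where "\<phi>S = (\<lambda>m. indicator (- L) m * \<phi> m)"
  have split: "\<phi> m = \<phi>L m + \<phi>S m" for m by (simp add: \<phi>L_def \<phi>S_def indicator_def)
  have bL: "\<bar>\<phi>L m\<bar> \<le> c" for m using large[of m] c by (auto simp: \<phi>L_def L_def indicator_def)
  have bS: "\<bar>\<phi>S m\<bar> \<le> c' * indicator (- L) m" for m using all[of m] by (auto simp: \<phi>S_def indicator_def)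
  have bS': "\<bar>\<phi>S m\<bar> \<le> c'" for m using all[of m] c' by (auto simp: \<phi>S_def indicator_def)
  \<comment> \<open>Adding a point never turns a large configuration into a small one, so both the
    shifted and the unshifted small part vanish off \<open>small\<close>.\<close>
  have step: "indicator (- L) (add_mset s m) \<le> (indicator (- L) m :: real)" for m
    by (auto simp: L_def indicator_def)
  let ?P = "tally \<rho>"
  have iL: "integrable Q (\<lambda>\<eta>. \<phi>L (?P \<eta>))" "integrable Q (\<lambda>\<eta>. \<phi>L (add_mset s (?P \<eta>)))"
    using bL by (auto intro!: integrable_tally[where \<phi>="\<phi>L"] integrable_tally[where \<phi>="\<lambda>m. \<phi>L (add_mset s m)"])
  have iS: "integrable Q (\<lambda>\<eta>. \<phi>S (?P \<eta>))" "integrable Q (\<lambda>\<eta>. \<phi>S (add_mset s (?P \<eta>)))"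
    using bS' by (auto intro!: integrable_tally[where \<phi>="\<phi>S"] integrable_tally[where \<phi>="\<lambda>m. \<phi>S (add_mset s m)"])
  have tvL: "\<bar>(\<integral>\<eta>. \<phi>L (?P \<eta>) \<partial>Q) - (\<integral>\<eta>. \<phi>L (add_mset s (?P \<eta>)) \<partial>Q)\<bar> \<le> 2 * c * enn2real (max_shift k t Q)"
  proof (rule discrete_total_variation[OF Q(1) countable_over tally_measurable_Q])
    show "(\<lambda>\<eta>. add_mset s (?P \<eta>)) \<in> measurable Q (count_space UNIV)"
      using measurable_compose[OF tally_measurable_Q, of "add_mset s"] by simp
    show "?P \<eta> \<in> over" "add_mset s (?P \<eta>) \<in> over" for \<eta> using tally_over(2)[of \<eta>] s by auto
    fix X :: "'a multiset set"
    define D where "D = {\<eta> \<in> space config_algebra. ?P \<eta> \<in> X}"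
    have D: "D \<in> sets config_algebra"
      using measurable_sets[OF measurable_tally(2), of X] by (simp add: D_def vimage_def Int_def conj_commute)
    \<comment> \<open>Here it matters that \<open>\<rho>\<close> fixes centers; the cell map
      \<open>\<tau>\<close> could send the added center elsewhere.\<close>
    have "?P (add_point \<eta> (t j)) = add_mset s (?P \<eta>)" if "\<eta> \<in> configs" for \<eta>
    proof -
      have "?P (add_point (emb (pts \<eta>)) (t j)) = add_mset s (?P (emb (pts \<eta>)))"
        unfolding add_point_emb tally_emb using s by (simp add: \<rho>_id sj)
      then show ?thesis using emb_pts[OF that] by simp
    qed
    then have "{\<eta> \<in> space Q. add_mset s (?P \<eta>) \<in> X} = {\<eta> \<in> space Q. add_point \<eta> (t j) \<in> D}"
      by (auto simp: D_def space_Q space_config add_point_config)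
    moreover have "{\<eta> \<in> space Q. ?P \<eta> \<in> X} = D" by (auto simp: D_def space_Q space_config)
    ultimately have "ennreal \<bar>measure Q {\<eta> \<in> space Q. ?P \<eta> \<in> X} - measure Q {\<eta> \<in> space Q. add_mset s (?P \<eta>) \<in> X}\<bar>
        \<le> max_shift k t Q"
      using max_shift_ge[OF j D] by simp
    then show "\<bar>measure Q {\<eta> \<in> space Q. ?P \<eta> \<in> X} - measure Q {\<eta> \<in> space Q. add_mset s (?P \<eta>) \<in> X}\<bar>
        \<le> enn2real (max_shift k t Q)"
      by (subst (asm) max_shift_eq) simp
  qed (rule bL)
  have tvS: "\<bar>\<integral>\<eta>. \<phi>S (?P \<eta>) - \<phi>S (add_mset s (?P \<eta>)) \<partial>Q\<bar> \<le> 2 * c' * measure Q small"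
  proof -
    have ind: "indicator (- L) (?P \<eta>) = (indicator small \<eta> :: real)" if "\<eta> \<in> space Q" for \<eta>
      using small_iff[of \<eta>] that by (auto simp: indicator_def L_def space_Q space_config)
    have "\<bar>\<integral>\<eta>. \<phi>S (?P \<eta>) - \<phi>S (add_mset s (?P \<eta>)) \<partial>Q\<bar> \<le> (\<integral>\<eta>. \<bar>\<phi>S (?P \<eta>) - \<phi>S (add_mset s (?P \<eta>))\<bar> \<partial>Q)"
      by (rule integral_abs_bound)
    also have "\<dots> \<le> (\<integral>\<eta>. 2 * c' * indicator small \<eta> \<partial>Q)"
    proof (rule integral_mono)
      show "integrable Q (\<lambda>\<eta>. 2 * c' * indicator small \<eta>)"
        using small_sets Q(2) by (intro integrable_mult_right integrable_real_indicator) (auto simp: Q.emeasure_eq_measure)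
      fix \<eta> assume \<eta>: "\<eta> \<in> space Q"
      have "\<bar>\<phi>S (add_mset s (?P \<eta>))\<bar> \<le> c' * indicator (- L) (?P \<eta>)"
        using bS[of "add_mset s (?P \<eta>)"] mult_left_mono[OF step[of "?P \<eta>"] c'] by linarith
      then show "\<bar>\<phi>S (?P \<eta>) - \<phi>S (add_mset s (?P \<eta>))\<bar> \<le> 2 * c' * indicator small \<eta>"
        using bS[of "?P \<eta>"] ind[OF \<eta>] by simp
    qed (use iS in auto)
    also have "\<dots> = 2 * c' * measure Q small" using small_sets Q(2) by simp
    finally show ?thesis .
  qed
  have "(\<integral>\<eta>. \<phi> (?P \<eta>) - \<phi> (add_mset s (?P \<eta>)) \<partial>Q)
     = ((\<integral>\<eta>. \<phi>L (?P \<eta>) \<partial>Q) - (\<integral>\<eta>. \<phi>L (add_mset s (?P \<eta>)) \<partial>Q)) + (\<integral>\<eta>. \<phi>S (?P \<eta>) - \<phi>S (add_mset s (?P \<eta>)) \<partial>Q)"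
    unfolding split using iL iS by simp
  then show ?thesis unfolding law_integral using tvL tvS by linarith
qed

end

end

section \<open>Averaged differences of the solution under a fixed law\<close>

locale stein_discretization = discretization k G t a u + birth_death_stein a b \<epsilon> T w f
  for k :: nat and G :: "nat \<Rightarrow> 'a::metric_space set" and t :: "nat \<Rightarrow> 'a" and a u b \<epsilon> and T :: "'a set" and w
    and f :: "'a multiset \<Rightarrow> real"
begin

context
  fixes Q :: "'a measure measure"
  assumes Q: "prob_space Q" "sets Q = sets config_algebra"
begin

interpretation Q: prob_space Q by (rule Q)

abbreviation avg :: "('a multiset \<Rightarrow> real) \<Rightarrow> real" where "avg \<phi> \<equiv> (\<integral>m. \<phi> m \<partial>law Q)"

lemma integrable_V: "integrable (law Q) (\<lambda>m. V x y (g m))"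
  by (rule law_integrable[OF Q]) (rule V_abs_le_2)

lemma integrable_D: "integrable (law Q) (\<lambda>m. D x (g m))"
  by (rule law_integrable[OF Q]) (rule D_abs_le_1)

lemmas avg_add = Bochner_Integration.integral_add[where M="law Q"]

lemmas avg_integrable = Bochner_Integration.integrable_add Bochner_Integration.integrable_diff
  Bochner_Integration.integrable_minus integrable_V integrable_D

lemma inverse_size_le: "real (size m) + 1 > a / u \<Longrightarrow> 1 / (real (size m) + 1) \<le> u / a"
  using a_gt_0 u_gt_0 by (simp add: field_simps)

text \<open>The origin of the constants in R: the bounds 2 and (5+2u)/a on second differences,
  inserted into \<open>shift_bound\<close>, give 4 and (4u+10)/a.\<close>

lemma third_difference:
  assumes s: "s \<in> centers"
  shows "\<bar>avg (\<lambda>m. V x y (m + \<zeta>) - V x y (add_mset s m + \<zeta>))\<bar> \<le> rQ Q"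
proof -
  have "\<bar>avg (\<lambda>m. V x y (m + \<zeta>) - V x y (add_mset s m + \<zeta>))\<bar>
     \<le> 2 * 2 * measure Q small + 2 * ((5 + 2 * u) / a) * enn2real (max_shift k t Q)"
  proof (rule shift_bound[OF Q s, where \<phi>="\<lambda>m. V x y (m + \<zeta>)"])
    show "\<bar>V x y (m + \<zeta>)\<bar> \<le> 2" for m by (rule V_abs_le_2)
    show "0 \<le> (5 + 2 * u) / a" using a_gt_0 u_gt_0 by simp
    fix m :: "'a multiset" assume "real (size m) + 1 > a / u"
    then have "1 / (real (size m) + 1) \<le> u / a" by (rule inverse_size_le)
    moreover have "2 / (real (size (m + \<zeta>)) + 1) \<le> 2 / (real (size m) + 1)"
      by (intro divide_left_mono) auto
    moreover have "2 / (real (size m) + 1) = 2 * (1 / (real (size m) + 1))" by simp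
    ultimately have "5 / a + 2 / (real (size (m + \<zeta>)) + 1) \<le> 5 / a + 2 * (u / a)" by linarith
    also have "\<dots> = (5 + 2 * u) / a" by (simp add: add_divide_distrib)
    finally show "\<bar>V x y (m + \<zeta>)\<bar> \<le> (5 + 2 * u) / a" using V_abs_le[of x y "m + \<zeta>"] by linarith
  qed
  also have "\<dots> = rQ Q" unfolding rQ_def[OF Q] by (simp add: algebra_simps)
  finally show ?thesis .
qed

text \<open>Changing one argument of \<open>V\<close> is a first difference of a moved point, whose
  bounds 1 and (5+2u)/(2a) are half of those for \<open>V\<close>. So each argument costs
  \<open>rQ Q / 2\<close>; the second one is reached by symmetry.\<close>

lemma location_move:
  assumes "x \<in> centers" "y \<in> centers" "x' \<in> centers" "y' \<in> centers"
  shows "\<bar>avg (\<lambda>m. V x y m - V x' y' m)\<bar> \<le> rQ Q"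
proof -
  have one: "\<bar>avg (\<lambda>m. V x y m - V x' y m)\<bar> \<le> rQ Q / 2" if y: "y \<in> centers" for x x' y
  proof -
    have "\<bar>avg (\<lambda>m. E x' x m - E x' x (add_mset y m))\<bar>
       \<le> 2 * 1 * measure Q small + 2 * ((5 + 2 * u) / (2 * a)) * enn2real (max_shift k t Q)"
    proof (rule shift_bound[OF Q y, where \<phi>="\<lambda>m. E x' x m"])
      show "\<bar>E x' x m\<bar> \<le> 1" for m by (rule E_abs_le_1)
      show "0 \<le> (5 + 2 * u) / (2 * a)" using a_gt_0 u_gt_0 by simp
      fix m :: "'a multiset" assume "real (size m) + 1 > a / u"
      then have 1: "1 / (real (size m) + 1) \<le> u / a" by (rule inverse_size_le)
      have "1 / (2 * (real (size m) + 1)) = 1 / (real (size m) + 1) / 2" by simp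
      also have "\<dots> \<le> u / a"
      proof -
        have half: "X / 2 \<le> c" if "0 \<le> X" "X \<le> c" for X c :: real using that by simp
        show ?thesis by (rule half[OF _ 1]) simp
      qed
      finally have "eb (size m) \<le> 3 / (4 * a) + u / a" unfolding eb_def by simp
      also have "\<dots> \<le> (5 + 2 * u) / (2 * a)" using a_gt_0 by (simp add: field_simps)
      finally show "\<bar>E x' x m\<bar> \<le> (5 + 2 * u) / (2 * a)" using E_abs_le_eb[of x' x m] by linarith
    qed
    also have "\<dots> = rQ Q / 2" unfolding rQ_def[OF Q] using a_gt_0 by (simp add: field_simps)
    also have "avg (\<lambda>m. E x' x m - E x' x (add_mset y m)) = avg (\<lambda>m. V x y m - V x' y m)"
      by (intro Bochner_Integration.integral_cong refl) (simp add: V_def D_def E_def add_mset_commute)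
    finally show ?thesis .
  qed
  have "avg (\<lambda>m. V x y m - V x' y' m) = avg (\<lambda>m. (V x y m - V x' y m) + (V y x' m - V y' x' m))"
    by (intro Bochner_Integration.integral_cong refl) (simp add: V_sym)
  also have "\<dots> = avg (\<lambda>m. V x y m - V x' y m) + avg (\<lambda>m. V y x' m - V y' x' m)"
    by (intro avg_add avg_integrable)
  finally show ?thesis using one[OF assms(2), of x x'] one[OF assms(3), of y y'] by linarith
qed

text \<open>Telescoping: the points of \<open>v\<close> are added singly, each costing one third
  difference. The spectator \<open>\<zeta>\<close> carries the points already present.\<close>

lemma V_shift_bound:
  assumes "set_mset v \<subseteq> centers"
  shows "\<bar>avg (\<lambda>m. V x y (m + v + \<zeta>) - V x y (m + \<zeta>))\<bar> \<le> real (size v) * rQ Q"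
  using assms
proof (induction v)
  case (add s v)
  have "avg (\<lambda>m. V x y (m + add_mset s v + \<zeta>) - V x y (m + \<zeta>))
     = avg (\<lambda>m. (V x y (m + v + \<zeta>) - V x y (m + \<zeta>)) + (- (V x y (m + (v + \<zeta>)) - V x y (add_mset s m + (v + \<zeta>)))))"
    by (intro Bochner_Integration.integral_cong refl) (simp add: ac_simps)
  also have "\<dots> = avg (\<lambda>m. V x y (m + v + \<zeta>) - V x y (m + \<zeta>)) + avg (\<lambda>m. - (V x y (m + (v + \<zeta>)) - V x y (add_mset s m + (v + \<zeta>))))"
    by (intro avg_add avg_integrable)
  also have "avg (\<lambda>m. - (V x y (m + (v + \<zeta>)) - V x y (add_mset s m + (v + \<zeta>))))
      = - avg (\<lambda>m. V x y (m + (v + \<zeta>)) - V x y (add_mset s m + (v + \<zeta>)))" by (rule integral_minus)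
  finally have "\<bar>avg (\<lambda>m. V x y (m + add_mset s v + \<zeta>) - V x y (m + \<zeta>))\<bar>
    \<le> \<bar>avg (\<lambda>m. V x y (m + v + \<zeta>) - V x y (m + \<zeta>))\<bar> + \<bar>avg (\<lambda>m. V x y (m + (v + \<zeta>)) - V x y (add_mset s m + (v + \<zeta>)))\<bar>"
    by linarith
  also have "\<dots> \<le> real (size v) * rQ Q + rQ Q"
    using add by (intro add_mono third_difference) auto
  finally show ?case by (simp add: algebra_simps)
qed simp

text \<open>Peeling off one point of \<open>v\<close> leaves a second difference shifted by
  \<open>w'\<close>, which costs \<open>size w'\<close> third differences; hence the product of the
  two sizes.\<close>

lemma mixed_shift_bound:
  assumes "set_mset v \<subseteq> centers" "set_mset w' \<subseteq> centers"
  shows "\<bar>avg (\<lambda>m. (D x (m + w' + v) - D x (m + w')) - (D x (m + v) - D x m))\<bar> \<le> real (size v) * real (size w') * rQ Q"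
  using assms(1)
proof (induction v)
  case (add y v)
  let ?f = "\<lambda>v m. (D x (m + w' + v) - D x (m + w')) - (D x (m + v) - D x m)"
  have "avg (?f (add_mset y v)) = avg (\<lambda>m. ?f v m + (V x y (m + w' + v) - V x y (m + v)))"
    by (intro Bochner_Integration.integral_cong refl) (simp add: V_def)
  also have "\<dots> = avg (?f v) + avg (\<lambda>m. V x y (m + w' + v) - V x y (m + v))"
    by (intro avg_add avg_integrable)
  finally have "\<bar>avg (?f (add_mset y v))\<bar> \<le> \<bar>avg (?f v)\<bar> + \<bar>avg (\<lambda>m. V x y (m + w' + v) - V x y (m + v))\<bar>"
    by linarith
  also have "\<dots> \<le> real (size v) * real (size w') * rQ Q + real (size w') * rQ Q"
    using add assms(2) by (intro add_mono V_shift_bound) auto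
  finally show ?case by (simp add: algebra_simps)
qed simp

text \<open>To first order each added point contributes the same second difference
  \<open>V s s\<close>. The j-th point is off by j-1 shifts and one change of location, and 1 + ...
  + n = n(n+1)/2. This is the origin of the half in the first error term.\<close>

lemma increment_bound:
  assumes "set_mset v \<subseteq> centers" "x \<in> centers" "s \<in> centers"
  shows "\<bar>avg (\<lambda>m. D x (m + v) - D x m) - real (size v) * avg (V s s)\<bar>
    \<le> 1 / 2 * rQ Q * (real (size v) + 1) * real (size v)"
  using assms(1)
proof (induction v)
  case (add y v)
  have "avg (\<lambda>m. D x (m + add_mset y v) - D x m)
     = avg (\<lambda>m. (D x (m + v) - D x m) + ((V x y (m + v + {#}) - V x y (m + {#})) + ((V x y m - V s s m) + V s s m)))"
    by (intro Bochner_Integration.integral_cong refl) (simp add: V_def)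
  also have "\<dots> = avg (\<lambda>m. D x (m + v) - D x m) + avg (\<lambda>m. ((V x y (m + v + {#}) - V x y (m + {#})) + ((V x y m - V s s m) + V s s m)))"
    by (intro avg_add avg_integrable)
  also have "avg (\<lambda>m. ((V x y (m + v + {#}) - V x y (m + {#})) + ((V x y m - V s s m) + V s s m)))
     = avg (\<lambda>m. V x y (m + v + {#}) - V x y (m + {#})) + avg (\<lambda>m. (V x y m - V s s m) + V s s m)"
    by (intro avg_add avg_integrable)
  also have "avg (\<lambda>m. (V x y m - V s s m) + V s s m) = avg (\<lambda>m. V x y m - V s s m) + avg (V s s)"
    by (intro avg_add avg_integrable)
  finally have eq: "avg (\<lambda>m. D x (m + add_mset y v) - D x m) - real (size (add_mset y v)) * avg (V s s)
     = (avg (\<lambda>m. D x (m + v) - D x m) - real (size v) * avg (V s s))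
       + avg (\<lambda>m. V x y (m + v + {#}) - V x y (m + {#})) + avg (\<lambda>m. V x y m - V s s m)"
    by (simp add: algebra_simps)
  have "\<bar>avg (\<lambda>m. V x y (m + v + {#}) - V x y (m + {#}))\<bar> \<le> real (size v) * rQ Q"
    by (rule V_shift_bound) (use add in auto)
  moreover have "\<bar>avg (\<lambda>m. V x y m - V s s m)\<bar> \<le> rQ Q"
    using add assms by (intro location_move) auto
  moreover have "\<bar>avg (\<lambda>m. D x (m + v) - D x m) - real (size v) * avg (V s s)\<bar> \<le> 1 / 2 * rQ Q * (real (size v) + 1) * real (size v)"
    using add by simp
  ultimately have "\<bar>avg (\<lambda>m. D x (m + add_mset y v) - D x m) - real (size (add_mset y v)) * avg (V s s)\<bar>
     \<le> 1 / 2 * rQ Q * (real (size v) + 1) * real (size v) + real (size v) * rQ Q + rQ Q"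
    unfolding eq by linarith
  also have "\<dots> = 1 / 2 * rQ Q * (real (size (add_mset y v)) + 1) * real (size (add_mset y v))"
    by (simp add: algebra_simps)
  finally show ?case .
qed simp

end

end

section \<open>Local dependence and the error terms\<close>

lemma restr_restr_emb:
  "A \<in> sets borel \<Longrightarrow> B \<in> sets borel \<Longrightarrow> restr A (restr B (emb m)) = restr (A \<inter> B) (emb m)"
  by (simp add: restr_emb filter_filter_mset conj_commute)

context discretization
begin

lemma tally_restr_add:
  fixes \<xi> :: "'a measure"
  assumes \<xi>: "\<xi> \<in> configs" and AB: "A \<in> sets borel" "B \<in> sets borel" "A \<inter> B = {}"
  shows "tally \<tau> (restr (A \<union> B) \<xi>) = tally \<tau> (restr A \<xi>) + tally \<tau> (restr B \<xi>)"
proof -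
  obtain m where m: "\<xi> = emb m" using emb_pts[OF \<xi>, symmetric] by blast
  have "filter_mset (\<lambda>x. x \<in> A \<union> B) n = filter_mset (\<lambda>x. x \<in> A) n + filter_mset (\<lambda>x. x \<in> B) n" for n :: "'a multiset"
    using AB(3) by (induction n) auto
  then show ?thesis unfolding m using AB by (simp add: restr_emb)
qed

lemma restr_UNIV:
  fixes \<xi> :: "'a measure"
  assumes "\<xi> \<in> configs" shows "restr UNIV \<xi> = \<xi>"
  using restr_emb[of UNIV "pts \<xi>"] emb_pts[OF assms] by simp

lemma restr_restr:
  fixes \<xi> :: "'a measure"
  assumes "\<xi> \<in> configs" "A \<in> sets borel" "B \<in> sets borel"
  shows "restr A (restr B \<xi>) = restr (A \<inter> B) \<xi>"
  using restr_restr_emb[OF assms(2,3), of "pts \<xi>"] emb_pts[OF assms(1)] by simp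

lemma emeasure_eq_size:
  fixes \<xi> :: "'a measure"
  assumes \<xi>: "\<xi> \<in> configs" and B: "B \<in> sets borel"
  shows "emeasure \<xi> B = of_nat (size (tally \<tau> (restr B \<xi>)))"
proof -
  obtain m where m: "\<xi> = emb m" using emb_pts[OF \<xi>, symmetric] by blast
  show ?thesis unfolding m using B by (simp add: restr_emb emeasure_emb)
qed

section \<open>Conditioning on the configuration inside a neighbourhood\<close>

context
  fixes N :: "'n measure" and \<Psi> :: "'n \<Rightarrow> 'a measure" and B :: "'a set"
  assumes N: "prob_space N" and \<Psi>[measurable]: "\<Psi> \<in> measurable N config_algebra"
    and B: "B \<in> sets borel"
begin

interpretation N: prob_space N by (rule N)

lemma \<Psi>_config: "\<omega> \<in> space N \<Longrightarrow> \<Psi> \<omega> \<in> configs"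
  using measurable_space[OF \<Psi>] by (simp add: space_config)

lemma measurable_restr_process [measurable]:
  "C \<in> sets borel \<Longrightarrow> (\<lambda>\<omega>. restr C (\<Psi> \<omega>)) \<in> measurable N config_algebra"
  by (rule measurable_compose[OF \<Psi> measurable_restr])

definition outer :: "'n \<Rightarrow> 'a measure" where
  "outer \<omega> = discretize k G t (restr (- B) (\<Psi> \<omega>))"

lemma outer_eq: "\<omega> \<in> space N \<Longrightarrow> outer \<omega> = emb (tally \<tau> (restr (- B) (\<Psi> \<omega>)))"
  unfolding outer_def using \<Psi>_config B by (intro discretize_eq restr_config) auto

lemma tally_outer: "\<omega> \<in> space N \<Longrightarrow> tally \<rho> (outer \<omega>) = tally \<tau> (restr (- B) (\<Psi> \<omega>))"
  by (simp only: outer_eq tally_emb image_\<rho>[OF tally_over(1)])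

lemma measurable_tally_restr [measurable]:
  "C \<in> sets borel \<Longrightarrow> (\<lambda>\<omega>. tally \<tau> (restr C (\<Psi> \<omega>))) \<in> measurable N (count_space UNIV)"
  by (rule measurable_compose[OF measurable_restr_process measurable_tally(1)])

lemma measurable_emb_outer: "(\<lambda>\<omega>. emb (tally \<tau> (restr (- B) (\<Psi> \<omega>)))) \<in> measurable N config_algebra"
  using B by (intro measurable_compose[OF measurable_tally_restr measurable_emb_over]) auto

lemma measurable_outer [measurable]: "outer \<in> measurable N config_algebra"
  using measurable_emb_outer outer_eq by (subst measurable_cong)

lemma outer_small:
  "\<omega> \<in> space N \<Longrightarrow> outer \<omega> \<in> small \<longleftrightarrow> emeasure (\<Psi> \<omega>) (- B) + 1 \<le> ennreal (a / u)"
proof -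
  assume \<omega>: "\<omega> \<in> space N"
  have "emeasure (outer \<omega>) UNIV = emeasure (\<Psi> \<omega>) (- B)"
    using emeasure_eq_size[OF \<Psi>_config[OF \<omega>], of "- B"] B by (simp add: outer_eq[OF \<omega>])
  then show ?thesis using measurable_space[OF measurable_outer \<omega>] by (simp add: small_def)
qed

lemma R_bar_eq: "R_bar a u k G t B N \<Psi> = Rf (distr N config_algebra outer)"
proof -
  have "emeasure (distr N config_algebra outer) small
      = emeasure N {\<omega> \<in> space N. emeasure (\<Psi> \<omega>) (- B) + 1 \<le> ennreal (a / u)}"
    using small_sets outer_small
    by (subst emeasure_distr) (auto intro!: arg_cong[where f="emeasure N"])
  then show ?thesis unfolding R_bar_def Rf_def outer_def by simp
qed

abbreviation inner :: "'n measure" where "inner \<equiv> sigma_restr N \<Psi> B"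

lemma subalgebra_inner: "subalgebra N inner"
  unfolding subalgebra_def sigma_restr_def
  using sets_image_in_sets[OF refl measurable_restr_process[OF B]] by simp

lemma inner_measurable:
  assumes "h \<in> measurable config_algebra K"
  shows "(\<lambda>\<omega>. h (restr B (\<Psi> \<omega>))) \<in> measurable inner K"
proof -
  have "(\<lambda>\<omega>. restr B (\<Psi> \<omega>)) \<in> measurable inner config_algebra"
    unfolding sigma_restr_def
    using measurable_space[OF measurable_restr_process[OF B]] by (intro measurable_vimage_algebra1) auto
  then show ?thesis using assms by (rule measurable_compose)
qed

text \<open>Counts inside a subset of \<open>B\<close> are functions of the conditioned
  configuration, hence may be pulled out of conditional expectations.\<close>

lemma inner_tally:
  assumes C: "C \<in> sets borel" "C \<subseteq> B"
  shows "(\<lambda>\<omega>. tally \<tau> (restr C (\<Psi> \<omega>))) \<in> measurable inner (count_space UNIV)"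
proof -
  have "(\<lambda>\<omega>. tally \<tau> (restr C (restr B (\<Psi> \<omega>)))) \<in> measurable inner (count_space UNIV)"
    by (rule inner_measurable[OF measurable_compose[OF measurable_restr[OF C(1)] measurable_tally(1)]])
  moreover have "restr C (restr B (\<Psi> \<omega>)) = restr C (\<Psi> \<omega>)" if "\<omega> \<in> space inner" for \<omega>
  proof -
    have "\<omega> \<in> space N" using that subalgebra_inner by (simp add: subalgebra_def)
    moreover have "C \<inter> B = C" using C(2) by blast
    ultimately show ?thesis using restr_restr[OF \<Psi>_config C(1) B] by simp
  qed
  ultimately show ?thesis by (subst (asm) measurable_cong) auto
qed

abbreviation kernel :: "'n \<Rightarrow> 'a measure measure" where
  "kernel \<equiv> cond_distr N inner config_algebra outer"

text \<open>Existence is inherited from the discrete tally outside \<open>B\<close>. The two random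
  elements agree only on the sample space, so the conditional expectations are matched almost surely
  before the choice operator is applied.\<close>

lemma kernel: "regular_cond_distr N inner config_algebra outer kernel"
proof -
  have "\<exists>\<kappa>. regular_cond_distr N inner config_algebra (\<lambda>\<omega>. emb (tally \<tau> (restr (- B) (\<Psi> \<omega>)))) \<kappa>"
    by (rule regular_cond_distr_ex[OF N subalgebra_inner countable_over])
       (use B tally_over in \<open>auto simp: space_config intro!: measurable_tally_restr\<close>)
  then obtain \<kappa> where \<kappa>: "regular_cond_distr N inner config_algebra (\<lambda>\<omega>. emb (tally \<tau> (restr (- B) (\<Psi> \<omega>)))) \<kappa>" ..
  interpret finite_measure_subalgebra N inner by standard (rule subalgebra_inner)
  have "regular_cond_distr N inner config_algebra outer \<kappa>"
    unfolding regular_cond_distr_def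
  proof (intro conjI ballI)
    show "\<kappa> \<in> measurable inner (prob_algebra config_algebra)" using \<kappa> by (simp add: regular_cond_distr_def)
    fix D :: "'a measure set" assume D: "D \<in> sets config_algebra"
    have "AE \<omega> in N. emeasure (\<kappa> \<omega>) D = nn_cond_exp N inner (\<lambda>\<omega>. indicator D (emb (tally \<tau> (restr (- B) (\<Psi> \<omega>))))) \<omega>"
      using \<kappa> D by (simp add: regular_cond_distr_def)
    moreover have "AE \<omega> in N. nn_cond_exp N inner (\<lambda>\<omega>. indicator D (emb (tally \<tau> (restr (- B) (\<Psi> \<omega>))))) \<omega>
        = nn_cond_exp N inner (\<lambda>\<omega>. indicator D (outer \<omega>)) \<omega>"
    proof (rule nn_cond_exp_cong)
      show "AE \<omega> in N. (indicator D (emb (tally \<tau> (restr (- B) (\<Psi> \<omega>)))) :: ennreal) = indicator D (outer \<omega>)"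
        using outer_eq by (intro AE_I2) auto
      show "(\<lambda>\<omega>. indicator D (emb (tally \<tau> (restr (- B) (\<Psi> \<omega>)))) :: ennreal) \<in> borel_measurable N"
        by (rule measurable_compose[OF measurable_emb_outer]) (use D in simp)
      show "(\<lambda>\<omega>. indicator D (outer \<omega>) :: ennreal) \<in> borel_measurable N"
        by (rule measurable_compose[OF measurable_outer]) (use D in simp)
    qed
    ultimately show "AE \<omega> in N. emeasure (\<kappa> \<omega>) D = nn_cond_exp N inner (\<lambda>\<omega>. indicator D (outer \<omega>)) \<omega>"
      by eventually_elim simp
  qed
  then show ?thesis unfolding cond_distr_def
    by (rule someI[where P="regular_cond_distr N inner config_algebra outer"])
qed

lemma kernel_measurable: "kernel \<in> measurable N (prob_algebra config_algebra)"
  using kernel measurable_from_subalg[OF subalgebra_inner, of kernel] unfolding regular_cond_distr_def by blast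

lemma kernel_prob:
  "\<omega> \<in> space N \<Longrightarrow> prob_space (kernel \<omega>)" "\<omega> \<in> space N \<Longrightarrow> sets (kernel \<omega>) = sets config_algebra"
  using measurable_space[OF kernel_measurable] by (auto simp: space_prob_algebra)

text \<open>\<open>R_cond\<close> mixes an ordinary conditional probability with a supremum over the
  kernel. Almost surely the former is also a value of the kernel, so the whole is \<open>Rf\<close>
  of one random law.\<close>

lemma R_cond_eq: "AE \<omega> in N. R_cond a u k G t B N \<Psi> \<omega> = Rf (kernel \<omega>)"
proof -
  interpret finite_measure_subalgebra N inner by standard (rule subalgebra_inner)
  have "AE \<omega> in N. emeasure (kernel \<omega>) small = nn_cond_exp N inner (\<lambda>\<omega>. indicator small (outer \<omega>)) \<omega>"
    using kernel small_sets by (simp add: regular_cond_distr_def)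
  moreover have "AE \<omega> in N. nn_cond_exp N inner (\<lambda>\<omega>. indicator small (outer \<omega>)) \<omega>
      = nn_cond_exp N inner (indicator {\<omega>. emeasure (\<Psi> \<omega>) (- B) + 1 \<le> ennreal (a / u)}) \<omega>"
  proof (rule nn_cond_exp_cong)
    have eq: "(indicator small (outer \<omega>) :: ennreal) = indicator {\<omega>. emeasure (\<Psi> \<omega>) (- B) + 1 \<le> ennreal (a / u)} \<omega>"
      if "\<omega> \<in> space N" for \<omega> using outer_small[OF that] by (simp add: indicator_def)
    then show "AE \<omega> in N. (indicator small (outer \<omega>) :: ennreal) = indicator {\<omega>. emeasure (\<Psi> \<omega>) (- B) + 1 \<le> ennreal (a / u)} \<omega>"
      by (intro AE_I2)
    show m: "(\<lambda>\<omega>. indicator small (outer \<omega>) :: ennreal) \<in> borel_measurable N"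
      by (rule measurable_compose[OF measurable_outer]) (use small_sets in simp)
    show "(indicator {\<omega>. emeasure (\<Psi> \<omega>) (- B) + 1 \<le> ennreal (a / u)} :: _ \<Rightarrow> ennreal) \<in> borel_measurable N"
      using m eq by (subst (asm) measurable_cong) auto
  qed
  ultimately show ?thesis
  proof eventually_elim
    case (elim \<omega>)
    then show ?case unfolding R_cond_def Rf_def outer_def[abs_def] by simp
  qed
qed

text \<open>A bound valid for every law \<open>Q\<close> is applied to the kernel, with
  \<open>W\<close> frozen by conditioning. The supremum inside \<open>R_cond\<close> is uncountable
  and is not shown to be measurable; its integral is a lower integral, which need not be additive.
  The measurable function \<open>\<phi>\<close> below it is therefore handed out, so that several
  bounds can be added first.\<close>

lemma conditional_bound:
  fixes W :: "'n \<Rightarrow> 'c" and \<psi> :: "'c \<Rightarrow> 'a multiset \<Rightarrow> real"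
  assumes C: "countable C" and W: "W \<in> measurable inner (count_space UNIV)" "\<And>\<omega>. \<omega> \<in> space N \<Longrightarrow> W \<omega> \<in> C"
    and bd: "\<And>w m. \<bar>\<psi> w m\<bar> \<le> c w" and c: "integrable N (\<lambda>\<omega>. c (W \<omega>))"
    and Q: "\<And>Q w. prob_space Q \<Longrightarrow> sets Q = sets config_algebra \<Longrightarrow> w \<in> C \<Longrightarrow> \<bar>\<integral>m. \<psi> w m \<partial>law Q\<bar> \<le> rQ Q * n w"
  obtains \<phi> where "\<phi> \<in> borel_measurable N" "AE \<omega> in N. \<phi> \<omega> \<le> R_cond a u k G t B N \<Psi> \<omega> * ennreal (n (W \<omega>))"
    "ennreal \<bar>\<integral>\<omega>. \<psi> (W \<omega>) (tally \<tau> (restr (- B) (\<Psi> \<omega>))) \<partial>N\<bar> \<le> (\<integral>\<^sup>+\<omega>. \<phi> \<omega> \<partial>N)"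
    "integrable N (\<lambda>\<omega>. \<psi> (W \<omega>) (tally \<tau> (restr (- B) (\<Psi> \<omega>))))"
proof -
  interpret finite_measure_subalgebra N inner by standard (rule subalgebra_inner)
  have WN: "W \<in> measurable N (count_space UNIV)" using W(1) measurable_from_subalg[OF subalgebra_inner] by blast
  have disint: "(\<integral>\<^sup>+\<omega>. indicator {w} (W \<omega>) * emeasure (kernel \<omega>) D \<partial>N) = (\<integral>\<^sup>+\<omega>. indicator {w} (W \<omega>) * indicator D (outer \<omega>) \<partial>N)"
    if D: "D \<in> sets config_algebra" for w D
  proof -
    have "(\<integral>\<^sup>+\<omega>. indicator {w} (W \<omega>) * emeasure (kernel \<omega>) D \<partial>N)
        = (\<integral>\<^sup>+\<omega>. indicator {w} (W \<omega>) * nn_cond_exp N inner (\<lambda>\<omega>. indicator D (outer \<omega>)) \<omega> \<partial>N)"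
    proof (rule nn_integral_cong_AE)
      have "AE \<omega> in N. emeasure (kernel \<omega>) D = nn_cond_exp N inner (\<lambda>\<omega>. indicator D (outer \<omega>)) \<omega>"
        using kernel D by (simp add: regular_cond_distr_def)
      then show "AE \<omega> in N. indicator {w} (W \<omega>) * emeasure (kernel \<omega>) D
          = indicator {w} (W \<omega>) * nn_cond_exp N inner (\<lambda>\<omega>. indicator D (outer \<omega>)) \<omega>"
        by eventually_elim simp
    qed
    also have "\<dots> = (\<integral>\<^sup>+\<omega>. indicator {w} (W \<omega>) * indicator D (outer \<omega>) \<partial>N)"
    proof (rule nn_cond_exp_intg)
      show "(\<lambda>\<omega>. indicator {w} (W \<omega>) :: ennreal) \<in> borel_measurable inner"
        by (rule measurable_compose[OF W(1)]) simp
      show "(\<lambda>\<omega>. indicator D (outer \<omega>) :: ennreal) \<in> borel_measurable N"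
        by (rule measurable_compose[OF measurable_outer]) (use D in simp)
    qed
    finally show ?thesis .
  qed
  let ?\<Phi> = "\<lambda>w \<eta>. \<psi> w (tally \<rho> \<eta>)"
  have \<Phi>: "?\<Phi> w \<in> borel_measurable config_algebra" for w
    by (rule measurable_compose[OF measurable_tally(2)]) simp
  note K = integral_kernel_bound[where \<Phi>="?\<Phi>" and c=c and W=W and X=outer and \<kappa>=kernel,
      OF N C WN W(2) measurable_outer kernel_measurable disint \<Phi> bd c]
  have K1: "(\<lambda>\<omega>. \<integral>\<eta>. \<psi> (W \<omega>) (tally \<rho> \<eta>) \<partial>kernel \<omega>) \<in> borel_measurable N" by (rule K(1))
  have K2: "integrable N (\<lambda>\<omega>. \<psi> (W \<omega>) (tally \<rho> (outer \<omega>)))" by (rule K(2))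
  have K3: "ennreal \<bar>\<integral>\<omega>. \<psi> (W \<omega>) (tally \<rho> (outer \<omega>)) \<partial>N\<bar>
      \<le> (\<integral>\<^sup>+\<omega>. ennreal \<bar>\<integral>\<eta>. \<psi> (W \<omega>) (tally \<rho> \<eta>) \<partial>kernel \<omega>\<bar> \<partial>N)" by (rule K(3))
  have eq: "(\<integral>\<omega>. \<psi> (W \<omega>) (tally \<rho> (outer \<omega>)) \<partial>N) = (\<integral>\<omega>. \<psi> (W \<omega>) (tally \<tau> (restr (- B) (\<Psi> \<omega>))) \<partial>N)"
    by (intro Bochner_Integration.integral_cong refl) (simp add: tally_outer)
  show ?thesis
  proof (rule that)
    let ?\<phi> = "\<lambda>\<omega>. ennreal \<bar>\<integral>\<eta>. \<psi> (W \<omega>) (tally \<rho> \<eta>) \<partial>kernel \<omega>\<bar>"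
    show "?\<phi> \<in> borel_measurable N" using K1 by measurable
    show "ennreal \<bar>\<integral>\<omega>. \<psi> (W \<omega>) (tally \<tau> (restr (- B) (\<Psi> \<omega>))) \<partial>N\<bar> \<le> (\<integral>\<^sup>+\<omega>. ?\<phi> \<omega> \<partial>N)"
      using K3 unfolding eq .
    show "integrable N (\<lambda>\<omega>. \<psi> (W \<omega>) (tally \<tau> (restr (- B) (\<Psi> \<omega>))))"
      using K2 by (subst (asm) Bochner_Integration.integrable_cong[OF refl]) (simp_all add: tally_outer)
    show "AE \<omega> in N. ?\<phi> \<omega> \<le> R_cond a u k G t B N \<Psi> \<omega> * ennreal (n (W \<omega>))"
      using R_cond_eq AE_space
    proof eventually_elim
      case (elim \<omega>)
      note p = kernel_prob[OF elim(2)]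
      have "\<bar>\<integral>\<eta>. \<psi> (W \<omega>) (tally \<rho> \<eta>) \<partial>kernel \<omega>\<bar> \<le> rQ (kernel \<omega>) * n (W \<omega>)"
        using Q[OF p W(2)[OF elim(2)]] unfolding law_integral[OF p] .
      then have "?\<phi> \<omega> \<le> ennreal (rQ (kernel \<omega>) * n (W \<omega>))" by (rule ennreal_leI)
      also have "\<dots> = Rf (kernel \<omega>) * ennreal (n (W \<omega>))"
        unfolding Rf_eq[OF p] by (rule ennreal_mult') (rule rQ_nonneg[OF p])
      finally show ?case using elim(1) by simp
    qed
  qed
qed

text \<open>If the inside of \<open>A\<close> is independent of the outside of \<open>B\<close>,
  conditioning does not change the law outside, and a constant kernel takes the place of the
  conditional one. Hence the unconditional R appears.\<close>

lemma independent_bound: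
  fixes \<psi> :: "'a multiset \<Rightarrow> 'a multiset \<Rightarrow> real"
  assumes A: "A \<in> sets borel" and ind: "indep_restr N \<Psi> (- B) A"
    and bd: "\<And>w m. \<bar>\<psi> w m\<bar> \<le> c w" and c: "integrable N (\<lambda>\<omega>. c (tally \<tau> (restr A (\<Psi> \<omega>))))"
    and Q: "\<And>w. w \<in> over \<Longrightarrow> \<bar>\<integral>m. \<psi> w m \<partial>law (distr N config_algebra outer)\<bar> \<le> rQ (distr N config_algebra outer) * n w"
  obtains \<phi> where "\<phi> \<in> borel_measurable N" "AE \<omega> in N. \<phi> \<omega> \<le> R_bar a u k G t B N \<Psi> * ennreal (n (tally \<tau> (restr A (\<Psi> \<omega>))))"
    "ennreal \<bar>\<integral>\<omega>. \<psi> (tally \<tau> (restr A (\<Psi> \<omega>))) (tally \<tau> (restr (- B) (\<Psi> \<omega>))) \<partial>N\<bar> \<le> (\<integral>\<^sup>+\<omega>. \<phi> \<omega> \<partial>N)"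
    "integrable N (\<lambda>\<omega>. \<psi> (tally \<tau> (restr A (\<Psi> \<omega>))) (tally \<tau> (restr (- B) (\<Psi> \<omega>))))"
proof -
  define L where "L = distr N config_algebra outer"
  have p: "prob_space L" "sets L = sets config_algebra"
    unfolding L_def by (simp_all add: N.prob_space_distr)
  let ?W = "\<lambda>\<omega>. tally \<tau> (restr A (\<Psi> \<omega>))"
  have WN: "?W \<in> measurable N (count_space UNIV)" by (rule measurable_tally_restr[OF A])
  have Wo: "?W \<omega> \<in> over" for \<omega> by (rule tally_over)
  have kern: "(\<lambda>_. L) \<in> measurable N (prob_algebra config_algebra)"
    using p by (intro measurable_const) (simp add: space_prob_algebra)
  \<comment> \<open>For a constant kernel the disintegration hypothesis is the product formula for
    one event outside \<open>B\<close> and one inside \<open>A\<close>.\<close>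
  have disint: "(\<integral>\<^sup>+\<omega>. indicator {w} (?W \<omega>) * emeasure L D \<partial>N) = (\<integral>\<^sup>+\<omega>. indicator {w} (?W \<omega>) * indicator D (outer \<omega>) \<partial>N)"
    if D: "D \<in> sets config_algebra" for w D
  proof -
    define DD where "DD = {\<xi> \<in> space config_algebra. emb (tally \<tau> \<xi>) \<in> D}"
    define DW where "DW = {\<xi> :: 'a measure \<in> space config_algebra. tally \<tau> \<xi> = w}"
    have DD: "DD \<in> sets config_algebra"
      using measurable_sets[OF measurable_compose[OF measurable_tally(1) measurable_emb_over] D]
      by (simp add: DD_def vimage_def Int_def conj_commute)
    have DW: "DW \<in> sets config_algebra"
      using measurable_sets[OF measurable_tally(1), of "{w}"] by (simp add: DW_def vimage_def Int_def conj_commute)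
    define SD where "SD = {\<omega> \<in> space N. outer \<omega> \<in> D}"
    define SW where "SW = {\<omega> \<in> space N. ?W \<omega> = w}"
    have SDs: "SD \<in> sets N" using measurable_sets[OF measurable_outer D] by (simp add: SD_def vimage_def Int_def conj_commute)
    have SWs: "SW \<in> sets N" using measurable_sets[OF WN, of "{w}"] by (simp add: SW_def vimage_def Int_def conj_commute)
    have "N.prob (SD \<inter> SW) = N.prob SD * N.prob SW"
    proof -
      have "N.prob ((\<lambda>\<omega>. (restr (- B) (\<Psi> \<omega>), restr A (\<Psi> \<omega>))) -` (DD \<times> DW) \<inter> space N)
        = N.prob ((\<lambda>\<omega>. restr (- B) (\<Psi> \<omega>)) -` DD \<inter> space N) * N.prob ((\<lambda>\<omega>. restr A (\<Psi> \<omega>)) -` DW \<inter> space N)"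
        by (rule N.indep_varD[OF ind[unfolded indep_restr_def] DD DW])
      moreover have "(\<lambda>\<omega>. restr (- B) (\<Psi> \<omega>)) -` DD \<inter> space N = SD"
        using outer_eq restr_config[OF \<Psi>_config, of _ "- B"] B by (auto simp: SD_def DD_def space_config)
      moreover have "(\<lambda>\<omega>. restr A (\<Psi> \<omega>)) -` DW \<inter> space N = SW"
        using restr_config[OF \<Psi>_config A] by (auto simp: SW_def DW_def space_config)
      moreover have "(\<lambda>\<omega>. (restr (- B) (\<Psi> \<omega>), restr A (\<Psi> \<omega>))) -` (DD \<times> DW) \<inter> space N
         = ((\<lambda>\<omega>. restr (- B) (\<Psi> \<omega>)) -` DD \<inter> space N) \<inter> ((\<lambda>\<omega>. restr A (\<Psi> \<omega>)) -` DW \<inter> space N)"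
        by auto
      ultimately show ?thesis by simp
    qed
    then have e: "emeasure N (SD \<inter> SW) = emeasure N SD * emeasure N SW"
      by (simp add: N.emeasure_eq_measure ennreal_mult)
    have LD: "emeasure L D = emeasure N SD"
      unfolding L_def using D by (subst emeasure_distr) (auto simp: SD_def vimage_def Int_def conj_commute)
    have "(\<integral>\<^sup>+\<omega>. indicator {w} (?W \<omega>) * emeasure L D \<partial>N) = (\<integral>\<^sup>+\<omega>. emeasure L D * indicator SW \<omega> \<partial>N)"
      by (intro nn_integral_cong) (auto simp: SW_def indicator_def)
    also have "\<dots> = emeasure L D * emeasure N SW" using SWs by (rule nn_integral_cmult_indicator)
    also have "\<dots> = emeasure N (SD \<inter> SW)" unfolding e LD ..
    also have "\<dots> = (\<integral>\<^sup>+\<omega>. indicator (SD \<inter> SW) \<omega> \<partial>N)" using SDs SWs by simp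
    also have "\<dots> = (\<integral>\<^sup>+\<omega>. indicator {w} (?W \<omega>) * indicator D (outer \<omega>) \<partial>N)"
      by (intro nn_integral_cong) (auto simp: SW_def SD_def indicator_def)
    finally show ?thesis .
  qed
  let ?\<Phi> = "\<lambda>w \<eta>. \<psi> w (tally \<rho> \<eta>)"
  have \<Phi>: "?\<Phi> w \<in> borel_measurable config_algebra" for w
    by (rule measurable_compose[OF measurable_tally(2)]) simp
  note K = integral_kernel_bound[where \<Phi>="?\<Phi>" and c=c and W="?W" and X=outer and \<kappa>="\<lambda>_. L",
      OF N countable_over WN Wo measurable_outer kern disint \<Phi> bd c]
  have K1: "(\<lambda>\<omega>. \<integral>\<eta>. \<psi> (?W \<omega>) (tally \<rho> \<eta>) \<partial>L) \<in> borel_measurable N" by (rule K(1))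
  have K2: "integrable N (\<lambda>\<omega>. \<psi> (?W \<omega>) (tally \<rho> (outer \<omega>)))" by (rule K(2))
  have K3: "ennreal \<bar>\<integral>\<omega>. \<psi> (?W \<omega>) (tally \<rho> (outer \<omega>)) \<partial>N\<bar>
      \<le> (\<integral>\<^sup>+\<omega>. ennreal \<bar>\<integral>\<eta>. \<psi> (?W \<omega>) (tally \<rho> \<eta>) \<partial>L\<bar> \<partial>N)" by (rule K(3))
  have eq: "(\<integral>\<omega>. \<psi> (?W \<omega>) (tally \<rho> (outer \<omega>)) \<partial>N) = (\<integral>\<omega>. \<psi> (?W \<omega>) (tally \<tau> (restr (- B) (\<Psi> \<omega>))) \<partial>N)"
    by (intro Bochner_Integration.integral_cong refl) (simp add: tally_outer)
  show ?thesis
  proof (rule that)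
    let ?\<phi> = "\<lambda>\<omega>. ennreal \<bar>\<integral>\<eta>. \<psi> (?W \<omega>) (tally \<rho> \<eta>) \<partial>L\<bar>"
    show "?\<phi> \<in> borel_measurable N" using K1 by measurable
    show "ennreal \<bar>\<integral>\<omega>. \<psi> (?W \<omega>) (tally \<tau> (restr (- B) (\<Psi> \<omega>))) \<partial>N\<bar> \<le> (\<integral>\<^sup>+\<omega>. ?\<phi> \<omega> \<partial>N)"
      using K3 unfolding eq .
    show "integrable N (\<lambda>\<omega>. \<psi> (?W \<omega>) (tally \<tau> (restr (- B) (\<Psi> \<omega>))))"
      using K2 by (subst (asm) Bochner_Integration.integrable_cong[OF refl]) (simp_all add: tally_outer)
    show "AE \<omega> in N. ?\<phi> \<omega> \<le> R_bar a u k G t B N \<Psi> * ennreal (n (?W \<omega>))"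
    proof (rule AE_I2)
      fix \<omega>
      have "\<bar>\<integral>\<eta>. \<psi> (?W \<omega>) (tally \<rho> \<eta>) \<partial>L\<bar> \<le> rQ L * n (?W \<omega>)"
        using Q[OF Wo] unfolding L_def[symmetric] law_integral[OF p] .
      then have "?\<phi> \<omega> \<le> ennreal (rQ L * n (?W \<omega>))" by (rule ennreal_leI)
      also have "\<dots> = Rf L * ennreal (n (?W \<omega>))"
        unfolding Rf_eq[OF p] by (rule ennreal_mult') (rule rQ_nonneg[OF p])
      finally show "?\<phi> \<omega> \<le> R_bar a u k G t B N \<Psi> * ennreal (n (?W \<omega>))"
        unfolding R_bar_eq L_def .
    qed
  qed
qed

end

end

section \<open>Error terms of a single neighbourhood\<close>

context stein_discretization
begin

text \<open>The reference location: by \<open>location_move\<close>, second differences at any two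
  centers may be replaced by the one here.\<close>

definition s0 :: 'a where
  "s0 = t 1"

lemma s0_center [simp]: "s0 \<in> centers"
  using k_ge_1 by (auto simp: s0_def centers_def)

text \<open>The cost of replacing \<open>\<Xi>\<close> by its restriction to the complement of \<open>B\<close> in an expected second difference.\<close>

definition removal_cost :: "'m measure \<Rightarrow> ('m \<Rightarrow> 'a measure) \<Rightarrow> 'a set \<Rightarrow> ennreal" where
  "removal_cost M \<Xi> B = (\<integral>\<^sup>+\<omega>. R_cond a u k G t B M \<Xi> \<omega> * emeasure (\<Xi> \<omega>) B \<partial>M)"

text \<open>Conditionally on the inside of \<open>B\<close>, putting its points back one by one
  changes the second difference by at most R per point.\<close>

lemma removal_cost_bound:
  fixes M :: "'m measure" and \<Xi> :: "'m \<Rightarrow> 'a measure"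
  assumes M: "prob_space M" and \<Xi>: "\<Xi> \<in> measurable M config_algebra" and B: "B \<in> sets borel"
  shows "ennreal \<bar>(\<integral>\<omega>. V x y (tally \<tau> (\<Xi> \<omega>)) \<partial>M) - (\<integral>\<omega>. V x y (tally \<tau> (restr (- B) (\<Xi> \<omega>))) \<partial>M)\<bar>
    \<le> removal_cost M \<Xi> B"
proof -
  interpret M: prob_space M by (rule M)
  let ?W = "\<lambda>\<omega>. tally \<tau> (restr B (\<Xi> \<omega>))" and ?P = "\<lambda>\<omega>. tally \<tau> (restr (- B) (\<Xi> \<omega>))"
  have Bc: "- B \<in> sets borel" using B by auto
  note mt = measurable_tally_restr[OF M \<Xi> B]
  obtain \<phi> where \<phi>: "\<phi> \<in> borel_measurable M"
    "AE \<omega> in M. \<phi> \<omega> \<le> R_cond a u k G t B M \<Xi> \<omega> * ennreal (real (size (?W \<omega>)))"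
    "ennreal \<bar>\<integral>\<omega>. V x y (?P \<omega> + ?W \<omega> + {#}) - V x y (?P \<omega> + {#}) \<partial>M\<bar> \<le> (\<integral>\<^sup>+\<omega>. \<phi> \<omega> \<partial>M)"
  proof (rule conditional_bound[OF M \<Xi> B countable_over inner_tally[OF M \<Xi> B B order_refl] tally_over(1),
        where \<psi>="\<lambda>w m. V x y (m + w + {#}) - V x y (m + {#})" and c="\<lambda>_. 4" and n="\<lambda>w. real (size w)"])
    show "\<bar>V x y (m + w + {#}) - V x y (m + {#})\<bar> \<le> 4" for w m
      using V_abs_le_2[of x y "m + w + {#}"] V_abs_le_2[of x y "m + {#}"] by linarith
    show "\<bar>\<integral>m. V x y (m + w + {#}) - V x y (m + {#}) \<partial>law Q\<bar> \<le> rQ Q * real (size w)"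
      if "prob_space Q" "sets Q = sets config_algebra" "w \<in> over" for Q w
      using V_shift_bound[OF that(1,2), of w x y "{#}"] that(3) by (simp add: mult.commute)
  qed auto
  have iV: "integrable M (\<lambda>\<omega>. V x y (tally \<tau> (restr C (\<Xi> \<omega>))))" if "C \<in> sets borel" for C
    using measurable_compose[OF measurable_tally_restr[OF M \<Xi> B that], of "V x y" borel] V_abs_le_2
    by (intro M.integrable_const_bound[where B=2]) auto
  have dec: "tally \<tau> (\<Xi> \<omega>) = ?P \<omega> + ?W \<omega>" if "\<omega> \<in> space M" for \<omega>
    using tally_restr_add[OF \<Psi>_config[OF M \<Xi> B that], of "- B" B] B restr_UNIV[OF \<Psi>_config[OF M \<Xi> B that]]
    by (simp add: Compl_partition2)
  have iV0: "integrable M (\<lambda>\<omega>. V x y (tally \<tau> (\<Xi> \<omega>)))"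
  proof -
    have "integrable M (\<lambda>\<omega>. V x y (tally \<tau> (restr UNIV (\<Xi> \<omega>)))) = integrable M (\<lambda>\<omega>. V x y (tally \<tau> (\<Xi> \<omega>)))"
      by (intro Bochner_Integration.integrable_cong refl) (simp add: restr_UNIV[OF \<Psi>_config[OF M \<Xi> B]])
    then show ?thesis using iV[of UNIV] by simp
  qed
  have "(\<integral>\<omega>. V x y (tally \<tau> (\<Xi> \<omega>)) \<partial>M) - (\<integral>\<omega>. V x y (?P \<omega>) \<partial>M) = (\<integral>\<omega>. V x y (tally \<tau> (\<Xi> \<omega>)) - V x y (?P \<omega>) \<partial>M)"
    using iV0 iV[OF Bc] by simp
  also have "\<dots> = (\<integral>\<omega>. V x y (?P \<omega> + ?W \<omega> + {#}) - V x y (?P \<omega> + {#}) \<partial>M)"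
    by (intro Bochner_Integration.integral_cong refl) (simp add: dec)
  finally have "ennreal \<bar>(\<integral>\<omega>. V x y (tally \<tau> (\<Xi> \<omega>)) \<partial>M) - (\<integral>\<omega>. V x y (?P \<omega>) \<partial>M)\<bar> \<le> (\<integral>\<^sup>+\<omega>. \<phi> \<omega> \<partial>M)"
    using \<phi>(3) by simp
  also have "\<dots> \<le> removal_cost M \<Xi> B"
    unfolding removal_cost_def
  proof (rule nn_integral_mono_AE)
    show "AE \<omega> in M. \<phi> \<omega> \<le> R_cond a u k G t B M \<Xi> \<omega> * emeasure (\<Xi> \<omega>) B"
      using \<phi>(2) AE_space
    proof eventually_elim
      case (elim \<omega>)
      then show ?case
        using emeasure_eq_size[OF \<Psi>_config[OF M \<Xi> B elim(2)] B] by (simp add: ennreal_of_nat_eq_real_of_nat)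
    qed
  qed
  finally show ?thesis .
qed

context
  fixes M :: "'m measure" and \<Xi> :: "'m \<Rightarrow> 'a measure" and N :: "'n measure" and \<Psi> :: "'n \<Rightarrow> 'a measure"
    and B :: "'a set"
  assumes M: "prob_space M" and \<Xi>: "\<Xi> \<in> measurable M config_algebra"
    and N: "prob_space N" and \<Psi>: "\<Psi> \<in> measurable N config_algebra"
    and B: "B \<in> sets borel"
    and same: "distr N config_algebra (\<lambda>\<omega>. restr (- B) (\<Psi> \<omega>)) = distr M config_algebra (\<lambda>\<omega>. restr (- B) (\<Xi> \<omega>))"
begin

interpretation M: prob_space M by (rule M)
interpretation N: prob_space N by (rule N)

text \<open>\<open>c0\<close> is the constant whose multiples cancel at the end; it depends on
  \<open>\<Xi>\<close> only and not on the location or on \<open>B\<close>. \<open>cN\<close> is its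
  version with \<open>B\<close> emptied, and is the same for \<open>\<Psi>\<close> and
  \<open>\<Xi>\<close> because their laws agree outside \<open>B\<close>.\<close>

abbreviation "c0 \<equiv> (\<integral>\<omega>. V s0 s0 (tally \<tau> (\<Xi> \<omega>)) \<partial>M)"
abbreviation "cN \<equiv> (\<integral>\<omega>. V s0 s0 (tally \<tau> (restr (- B) (\<Psi> \<omega>))) \<partial>N)"

lemma cN_bound: "ennreal \<bar>cN - c0\<bar> \<le> removal_cost M \<Xi> B"
proof -
  have Bc: "- B \<in> sets borel" using B by auto
  have m: "(\<lambda>\<xi>. V s0 s0 (tally \<tau> \<xi>)) \<in> borel_measurable config_algebra"
    by (rule measurable_compose[OF measurable_tally(1)]) simp
  have "cN = (\<integral>\<xi>. V s0 s0 (tally \<tau> \<xi>) \<partial>distr N config_algebra (\<lambda>\<omega>. restr (- B) (\<Psi> \<omega>)))"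
    by (rule integral_distr[OF measurable_restr_process[OF N \<Psi> B Bc] m, symmetric])
  also have "\<dots> = (\<integral>\<omega>. V s0 s0 (tally \<tau> (restr (- B) (\<Xi> \<omega>))) \<partial>M)"
    unfolding same by (rule integral_distr[OF measurable_restr_process[OF M \<Xi> B Bc] m])
  finally show ?thesis
    using removal_cost_bound[OF M \<Xi> B, of s0 s0] by (simp add: abs_minus_commute)
qed

lemma cN_law: "(\<integral>m. V s0 s0 m \<partial>law (distr N config_algebra (outer \<Psi> B))) = cN"
proof -
  have p: "prob_space (distr N config_algebra (outer \<Psi> B))"
    by (rule N.prob_space_distr[OF measurable_outer[OF N \<Psi> B]])
  have m: "(\<lambda>\<xi>. V s0 s0 (tally \<rho> \<xi>)) \<in> borel_measurable config_algebra"
    by (rule measurable_compose[OF measurable_tally(2)]) simp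
  have "(\<integral>m. V s0 s0 m \<partial>law (distr N config_algebra (outer \<Psi> B)))
     = (\<integral>\<omega>. V s0 s0 (tally \<rho> (outer \<Psi> B \<omega>)) \<partial>N)"
    unfolding law_integral[OF p sets_distr] by (rule integral_distr[OF measurable_outer[OF N \<Psi> B] m])
  also have "\<dots> = cN"
    by (intro Bochner_Integration.integral_cong refl) (simp add: tally_outer[OF N \<Psi> B])
  finally show ?thesis .
qed

lemma integrable_bounded_tally:
  fixes \<phi> :: "'a multiset \<Rightarrow> real"
  assumes "\<And>m. \<bar>\<phi> m\<bar> \<le> c" "C \<in> sets borel"
  shows "integrable N (\<lambda>\<omega>. \<phi> (tally \<tau> (restr C (\<Psi> \<omega>))))"
  using assms measurable_compose[OF measurable_tally_restr[OF N \<Psi> B assms(2)], of \<phi> borel]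
  by (intro N.integrable_const_bound[where B=c]) auto

lemma integrable_bounded_tally0:
  fixes \<phi> :: "'a multiset \<Rightarrow> real"
  assumes "\<And>m. \<bar>\<phi> m\<bar> \<le> c"
  shows "integrable N (\<lambda>\<omega>. \<phi> (tally \<tau> (\<Psi> \<omega>)))"
proof -
  have "integrable N (\<lambda>\<omega>. \<phi> (tally \<tau> (restr UNIV (\<Psi> \<omega>)))) = integrable N (\<lambda>\<omega>. \<phi> (tally \<tau> (\<Psi> \<omega>)))"
    by (intro Bochner_Integration.integrable_cong refl) (simp add: restr_UNIV[OF \<Psi>_config[OF N \<Psi> B]])
  then show ?thesis using integrable_bounded_tally[of \<phi> c UNIV] assms by simp
qed

text \<open>The effect of the points in \<open>A\<close> is compared with \<open>c0\<close> times
  their mean number in three moves: drop the points of \<open>B - A\<close> at the cost of mixed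
  differences, replace the increment by a multiple of \<open>cN\<close> using independence, and pass
  from \<open>cN\<close> to \<open>c0\<close>. These are the three summands of \<open>eps1\<close>,
  in this order.\<close>

theorem eps1_bound:
  assumes A: "A \<in> sets borel" "A \<subseteq> B" and ind: "indep_restr N \<Psi> (- B) A"
    and fin: "integrable N (\<lambda>\<omega>. real (size (tally \<tau> (restr A (\<Psi> \<omega>)))))"
    and x: "x \<in> centers"
  shows "ennreal \<bar>(\<integral>\<omega>. D x (tally \<tau> (\<Psi> \<omega>)) \<partial>N) - (\<integral>\<omega>. D x (tally \<tau> (restr (- A) (\<Psi> \<omega>))) \<partial>N)
        - c0 * (\<integral>\<omega>. real (size (tally \<tau> (restr A (\<Psi> \<omega>)))) \<partial>N)\<bar>
    \<le> (\<integral>\<^sup>+\<omega>. eps1 a u k G t M \<Xi> A B N \<Psi> \<omega> \<partial>N)"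
proof -
  let ?P = "\<lambda>\<omega>. tally \<tau> (restr (- B) (\<Psi> \<omega>))" and ?W = "\<lambda>\<omega>. tally \<tau> (restr (B - A) (\<Psi> \<omega>))"
    and ?V = "\<lambda>\<omega>. tally \<tau> (restr A (\<Psi> \<omega>))"
  have sb: "- B \<in> sets borel" "B - A \<in> sets borel" "- A \<in> sets borel" using A B by auto
  note conf = \<Psi>_config[OF N \<Psi> B]
  have dec1: "tally \<tau> (restr (- A) (\<Psi> \<omega>)) = ?P \<omega> + ?W \<omega>" if "\<omega> \<in> space N" for \<omega>
  proof -
    have "- B \<union> (B - A) = - A" using A(2) by blast
    then show ?thesis using tally_restr_add[OF conf[OF that] sb(1,2)] by auto
  qed
  have dec2: "tally \<tau> (\<Psi> \<omega>) = ?P \<omega> + ?W \<omega> + ?V \<omega>" if "\<omega> \<in> space N" for \<omega>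
    using tally_restr_add[OF conf[OF that] sb(3) A(1)] dec1[OF that] restr_UNIV[OF conf[OF that]]
    by (simp add: Compl_partition2)
  have Win: "(\<lambda>\<omega>. (?V \<omega>, ?W \<omega>)) \<in> measurable (sigma_restr N \<Psi> B) (count_space UNIV)"
  proof (rule discrete_measurableI[of "over \<times> over"])
    show "countable (over \<times> over)" using countable_over by (intro countable_SIGMA) auto
    show "(?V \<omega>, ?W \<omega>) \<in> over \<times> over" for \<omega> using tally_over(1) by simp
    fix c assume "c \<in> over \<times> over"
    have 1: "?V \<in> measurable (sigma_restr N \<Psi> B) (count_space UNIV)"
      "?W \<in> measurable (sigma_restr N \<Psi> B) (count_space UNIV)"
      using A by (auto intro!: inner_tally[OF N \<Psi> B] sb)
    have "{\<omega> \<in> space (sigma_restr N \<Psi> B). (?V \<omega>, ?W \<omega>) = c}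
      = (?V -` {fst c} \<inter> space (sigma_restr N \<Psi> B)) \<inter> (?W -` {snd c} \<inter> space (sigma_restr N \<Psi> B))"
      by auto
    also have "\<dots> \<in> sets (sigma_restr N \<Psi> B)"
      by (intro sets.Int measurable_sets[OF 1(1)] measurable_sets[OF 1(2)]) auto
    finally show "{\<omega> \<in> space (sigma_restr N \<Psi> B). (?V \<omega>, ?W \<omega>) = c} \<in> sets (sigma_restr N \<Psi> B)" .
  qed
  \<comment> \<open>How the effect of \<open>v\<close> changes when the points \<open>w'\<close>
    between \<open>A\<close> and \<open>B\<close> are present. Both are inside \<open>B\<close>, so
    this is bounded conditionally.\<close>
  define \<psi>1 where "\<psi>1 = (\<lambda>(v, w') m. (D x (m + w' + v) - D x (m + w')) - (D x (m + v) - D x m))"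
  obtain \<phi>1 where \<phi>1: "\<phi>1 \<in> borel_measurable N"
    "AE \<omega> in N. \<phi>1 \<omega> \<le> R_cond a u k G t B N \<Psi> \<omega> * ennreal (real (size (?V \<omega>)) * real (size (?W \<omega>)))"
    "ennreal \<bar>\<integral>\<omega>. \<psi>1 (?V \<omega>, ?W \<omega>) (?P \<omega>) \<partial>N\<bar> \<le> (\<integral>\<^sup>+\<omega>. \<phi>1 \<omega> \<partial>N)"
    "integrable N (\<lambda>\<omega>. \<psi>1 (?V \<omega>, ?W \<omega>) (?P \<omega>))"
  proof (rule conditional_bound[OF N \<Psi> B _ Win, of "over \<times> over",
        where \<psi>="\<psi>1" and c="\<lambda>_. 4" and n="\<lambda>(v, w'). real (size v) * real (size w')"])
    show "countable (over \<times> over)" using countable_over by (intro countable_SIGMA) auto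
    show "(?V \<omega>, ?W \<omega>) \<in> over \<times> over" for \<omega> using tally_over(1) by simp
    show "\<bar>\<psi>1 w m\<bar> \<le> 4" for w m
    proof -
      obtain v w' where w: "w = (v, w')" by (cases w)
      show ?thesis unfolding w \<psi>1_def
        using D_abs_le_1[of x "m + w' + v"] D_abs_le_1[of x "m + w'"] D_abs_le_1[of x "m + v"] D_abs_le_1[of x m]
        by simp
    qed
    show "\<bar>\<integral>m. \<psi>1 w m \<partial>law Q\<bar> \<le> rQ Q * (case w of (v, w') \<Rightarrow> real (size v) * real (size w'))"
      if "prob_space Q" "sets Q = sets config_algebra" "w \<in> over \<times> over" for Q w
    proof -
      obtain v w' where w: "w = (v, w')" by (cases w)
      show ?thesis unfolding w \<psi>1_def
        using mixed_shift_bound[OF that(1,2), of v w' x] that(3) w by (simp add: mult_ac)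
    qed
  qed auto
  \<comment> \<open>With \<open>B - A\<close> removed, only points in \<open>A\<close> and outside
    \<open>B\<close> remain, and these are independent.\<close>
  define \<psi>2 where "\<psi>2 = (\<lambda>v m. (D x (m + v) - D x m) - real (size v) * cN)"
  have cN2: "\<bar>cN\<bar> \<le> 2"
  proof -
    have "\<bar>cN\<bar> \<le> (\<integral>\<omega>. \<bar>V s0 s0 (?P \<omega>)\<bar> \<partial>N)" by (rule integral_abs_bound)
    also have "\<dots> \<le> (\<integral>\<omega>. 2 \<partial>N)"
      by (intro integral_mono integrable_abs integrable_bounded_tally[OF V_abs_le_2 sb(1)]) (auto intro: V_abs_le_2)
    finally show ?thesis by (simp add: N.prob_space)
  qed
  let ?L = "distr N config_algebra (outer \<Psi> B)"
  have pL: "prob_space ?L" "sets ?L = sets config_algebra"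
    by (simp_all add: N.prob_space_distr[OF measurable_outer[OF N \<Psi> B]])
  obtain \<phi>2 where \<phi>2: "\<phi>2 \<in> borel_measurable N"
    "AE \<omega> in N. \<phi>2 \<omega> \<le> R_bar a u k G t B N \<Psi> * ennreal (1 / 2 * (real (size (?V \<omega>)) + 1) * real (size (?V \<omega>)))"
    "ennreal \<bar>\<integral>\<omega>. \<psi>2 (?V \<omega>) (?P \<omega>) \<partial>N\<bar> \<le> (\<integral>\<^sup>+\<omega>. \<phi>2 \<omega> \<partial>N)"
    "integrable N (\<lambda>\<omega>. \<psi>2 (?V \<omega>) (?P \<omega>))"
  proof (rule independent_bound[OF N \<Psi> B A(1) ind,
        where \<psi>="\<psi>2" and c="\<lambda>v. 2 + real (size v) * 2" and n="\<lambda>v. 1 / 2 * (real (size v) + 1) * real (size v)"])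
    show "\<bar>\<psi>2 w m\<bar> \<le> 2 + real (size w) * 2" for w m
    proof -
      have "\<bar>real (size w) * cN\<bar> \<le> real (size w) * 2" using cN2 by (simp add: abs_mult mult_left_mono)
      then show ?thesis unfolding \<psi>2_def using D_abs_le_1[of x "m + w"] D_abs_le_1[of x m] by linarith
    qed
    show "integrable N (\<lambda>\<omega>. 2 + real (size (?V \<omega>)) * 2)" using fin by simp
    show "\<bar>\<integral>m. \<psi>2 w m \<partial>law ?L\<bar> \<le> rQ ?L * (1 / 2 * (real (size w) + 1) * real (size w))"
      if "w \<in> over" for w
    proof -
      have pl: "prob_space (law ?L)"
        unfolding law_def by (rule prob_space.prob_space_distr[OF pL(1) tally_measurable_Q[OF pL]])
      have "(\<integral>m. \<psi>2 w m \<partial>law ?L) = (\<integral>m. D x (m + w) - D x m \<partial>law ?L) - real (size w) * cN"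
        unfolding \<psi>2_def
        by (subst Bochner_Integration.integral_diff)
           (auto simp: prob_space.prob_space[OF pl] intro!: avg_integrable[OF pL] finite_measure.integrable_const prob_space.finite_measure[OF pl])
      then show ?thesis
        using increment_bound[OF pL, of w x s0] that x by (simp add: cN_law mult_ac)
    qed
  qed
  define F where "F = (\<integral>\<omega>. real (size (?V \<omega>)) \<partial>N)"
  have iD: "integrable N (\<lambda>\<omega>. D x (tally \<tau> (\<Psi> \<omega>)))" "integrable N (\<lambda>\<omega>. D x (tally \<tau> (restr (- A) (\<Psi> \<omega>))))"
    by (rule integrable_bounded_tally0[OF D_abs_le_1]) (rule integrable_bounded_tally[OF D_abs_le_1 sb(3)])
  have "(\<integral>\<omega>. \<psi>1 (?V \<omega>, ?W \<omega>) (?P \<omega>) \<partial>N) + (\<integral>\<omega>. \<psi>2 (?V \<omega>) (?P \<omega>) \<partial>N)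
     = (\<integral>\<omega>. \<psi>1 (?V \<omega>, ?W \<omega>) (?P \<omega>) + \<psi>2 (?V \<omega>) (?P \<omega>) \<partial>N)"
    using \<phi>1(4) \<phi>2(4) by simp
  also have "\<dots> = (\<integral>\<omega>. D x (tally \<tau> (\<Psi> \<omega>)) - D x (tally \<tau> (restr (- A) (\<Psi> \<omega>))) - real (size (?V \<omega>)) * cN \<partial>N)"
    by (intro Bochner_Integration.integral_cong refl) (simp add: dec1 dec2 \<psi>1_def \<psi>2_def)
  also have "\<dots> = (\<integral>\<omega>. D x (tally \<tau> (\<Psi> \<omega>)) \<partial>N) - (\<integral>\<omega>. D x (tally \<tau> (restr (- A) (\<Psi> \<omega>))) \<partial>N) - F * cN"
    using iD fin by (simp add: F_def)
  finally have eq: "(\<integral>\<omega>. D x (tally \<tau> (\<Psi> \<omega>)) \<partial>N) - (\<integral>\<omega>. D x (tally \<tau> (restr (- A) (\<Psi> \<omega>))) \<partial>N) - c0 * F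
     = (\<integral>\<omega>. \<psi>1 (?V \<omega>, ?W \<omega>) (?P \<omega>) \<partial>N) + (\<integral>\<omega>. \<psi>2 (?V \<omega>) (?P \<omega>) \<partial>N) + (cN - c0) * F"
    by (simp add: algebra_simps)
  have F0: "F \<ge> 0" by (simp add: F_def)
  have "\<bar>(\<integral>\<omega>. D x (tally \<tau> (\<Psi> \<omega>)) \<partial>N) - (\<integral>\<omega>. D x (tally \<tau> (restr (- A) (\<Psi> \<omega>))) \<partial>N) - c0 * F\<bar>
     \<le> \<bar>\<integral>\<omega>. \<psi>1 (?V \<omega>, ?W \<omega>) (?P \<omega>) \<partial>N\<bar> + \<bar>\<integral>\<omega>. \<psi>2 (?V \<omega>) (?P \<omega>) \<partial>N\<bar> + \<bar>cN - c0\<bar> * F"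
    unfolding eq using F0 abs_mult[of "cN - c0" F] by linarith
  then have "ennreal \<bar>(\<integral>\<omega>. D x (tally \<tau> (\<Psi> \<omega>)) \<partial>N) - (\<integral>\<omega>. D x (tally \<tau> (restr (- A) (\<Psi> \<omega>))) \<partial>N) - c0 * F\<bar>
     \<le> ennreal (\<bar>\<integral>\<omega>. \<psi>1 (?V \<omega>, ?W \<omega>) (?P \<omega>) \<partial>N\<bar> + \<bar>\<integral>\<omega>. \<psi>2 (?V \<omega>) (?P \<omega>) \<partial>N\<bar> + \<bar>cN - c0\<bar> * F)"
    by (rule ennreal_leI)
  also have "\<dots> = ennreal \<bar>\<integral>\<omega>. \<psi>1 (?V \<omega>, ?W \<omega>) (?P \<omega>) \<partial>N\<bar> + ennreal \<bar>\<integral>\<omega>. \<psi>2 (?V \<omega>) (?P \<omega>) \<partial>N\<bar> + ennreal \<bar>cN - c0\<bar> * ennreal F"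
    using F0 by (simp add: ennreal_plus ennreal_mult)
  also have "\<dots> \<le> (\<integral>\<^sup>+\<omega>. \<phi>1 \<omega> \<partial>N) + (\<integral>\<^sup>+\<omega>. \<phi>2 \<omega> \<partial>N) + removal_cost M \<Xi> B * (\<integral>\<^sup>+\<omega>. ennreal (real (size (?V \<omega>))) \<partial>N)"
  proof (intro add_mono \<phi>1(3) \<phi>2(3) mult_mono cN_bound)
    show "ennreal F \<le> (\<integral>\<^sup>+\<omega>. ennreal (real (size (?V \<omega>))) \<partial>N)"
      unfolding F_def using fin by (subst nn_integral_eq_integral) auto
  qed auto
  \<comment> \<open>The three bounds are added here, where everything is measurable; the error term
    enters afterwards by monotonicity alone.\<close>
  also have "\<dots> = (\<integral>\<^sup>+\<omega>. \<phi>1 \<omega> + \<phi>2 \<omega> + removal_cost M \<Xi> B * ennreal (real (size (?V \<omega>))) \<partial>N)"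
  proof -
    have m: "(\<lambda>\<omega>. ennreal (real (size (?V \<omega>)))) \<in> borel_measurable N"
      by (rule measurable_compose[OF measurable_tally_restr[OF N \<Psi> B A(1)]]) simp
    show ?thesis using \<phi>1(1) \<phi>2(1) m by (simp add: nn_integral_add nn_integral_cmult)
  qed
  also have "\<dots> \<le> (\<integral>\<^sup>+\<omega>. eps1 a u k G t M \<Xi> A B N \<Psi> \<omega> \<partial>N)"
  proof (rule nn_integral_mono_AE)
    show "AE \<omega> in N. \<phi>1 \<omega> + \<phi>2 \<omega> + removal_cost M \<Xi> B * ennreal (real (size (?V \<omega>))) \<le> eps1 a u k G t M \<Xi> A B N \<Psi> \<omega>"
      using \<phi>1(2) \<phi>2(2) AE_space
    proof eventually_elim
      case (elim \<omega>)
      have eA: "emeasure (\<Psi> \<omega>) A = ennreal (real (size (?V \<omega>)))" "emeasure (\<Psi> \<omega>) (B - A) = ennreal (real (size (?W \<omega>)))"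
        using emeasure_eq_size[OF conf[OF elim(3)]] A(1) sb(2) by (simp_all add: ennreal_of_nat_eq_real_of_nat)
      have h: "ennreal (1 / 2 * (n + 1) * n) = 1 / 2 * (ennreal n + 1) * ennreal n" if "0 \<le> n" for n
      proof -
        have "ennreal (1 / 2 * (n + 1) * n) = ennreal (1 / 2) * ennreal (n + 1) * ennreal n"
          using ennreal_mult[of "1 / 2 * (n + 1)" n] ennreal_mult[of "1 / 2" "n + 1"] that by simp
        also have "ennreal (n + 1) = ennreal n + 1" using that by (simp add: ennreal_plus)
        also have "ennreal (1 / 2) = 1 / 2" using divide_ennreal[of 1 2] by simp
        finally show ?thesis .
      qed
      have "\<phi>1 \<omega> \<le> R_cond a u k G t B N \<Psi> \<omega> * emeasure (\<Psi> \<omega>) A * emeasure (\<Psi> \<omega>) (B - A)"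
        using elim(1) unfolding eA by (simp add: ennreal_mult mult.assoc)
      moreover have "\<phi>2 \<omega> \<le> 1 / 2 * R_bar a u k G t B N \<Psi> * (emeasure (\<Psi> \<omega>) A + 1) * emeasure (\<Psi> \<omega>) A"
        using elim(2) unfolding eA h[OF of_nat_0_le_iff] by (simp add: mult_ac)
      ultimately show ?case
        unfolding eps1_def removal_cost_def[symmetric] eA(1)[symmetric]
        by (intro add_mono) (simp_all add: mult.commute)
    qed
  qed
  finally show ?thesis unfolding F_def .
qed

text \<open>Three steps from the second difference at \<open>x\<close>, \<open>y\<close> to the
  reference constant: remove \<open>B\<close> (conditional R), change the location under the law
  outside \<open>B\<close> (unconditional R), and restore \<open>B\<close> for \<open>\<Xi>\<close>
  (removal cost).\<close>

theorem eps2_bound: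
  assumes x: "x \<in> centers" and y: "y \<in> centers"
  shows "ennreal \<bar>(\<integral>\<omega>. V x y (tally \<tau> (\<Psi> \<omega>)) \<partial>N) - c0\<bar> \<le> (\<integral>\<^sup>+\<omega>. eps2 a u k G t M \<Xi> B N \<Psi> \<omega> \<partial>N)"
proof -
  let ?W = "\<lambda>\<omega>. tally \<tau> (restr B (\<Psi> \<omega>))" and ?P = "\<lambda>\<omega>. tally \<tau> (restr (- B) (\<Psi> \<omega>))"
  let ?L = "distr N config_algebra (outer \<Psi> B)"
  have pL: "prob_space ?L" "sets ?L = sets config_algebra"
    by (simp_all add: N.prob_space_distr[OF measurable_outer[OF N \<Psi> B]])
  have Bc: "- B \<in> sets borel" using B by auto
  note conf = \<Psi>_config[OF N \<Psi> B]
  obtain \<phi> where \<phi>: "\<phi> \<in> borel_measurable N"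
    "AE \<omega> in N. \<phi> \<omega> \<le> R_cond a u k G t B N \<Psi> \<omega> * ennreal (real (size (?W \<omega>)))"
    "ennreal \<bar>\<integral>\<omega>. V x y (?P \<omega> + ?W \<omega> + {#}) - V x y (?P \<omega> + {#}) \<partial>N\<bar> \<le> (\<integral>\<^sup>+\<omega>. \<phi> \<omega> \<partial>N)"
  proof (rule conditional_bound[OF N \<Psi> B countable_over inner_tally[OF N \<Psi> B B order_refl] tally_over(1),
        where \<psi>="\<lambda>w m. V x y (m + w + {#}) - V x y (m + {#})" and c="\<lambda>_. 4" and n="\<lambda>w. real (size w)"])
    show "\<bar>V x y (m + w + {#}) - V x y (m + {#})\<bar> \<le> 4" for w m
      using V_abs_le_2[of x y "m + w + {#}"] V_abs_le_2[of x y "m + {#}"] by linarith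
    show "\<bar>\<integral>m. V x y (m + w + {#}) - V x y (m + {#}) \<partial>law Q\<bar> \<le> rQ Q * real (size w)"
      if "prob_space Q" "sets Q = sets config_algebra" "w \<in> over" for Q w
      using V_shift_bound[OF that(1,2), of w x y "{#}"] that(3) by (simp add: mult.commute)
  qed auto
  have dec: "tally \<tau> (\<Psi> \<omega>) = ?P \<omega> + ?W \<omega>" if "\<omega> \<in> space N" for \<omega>
    using tally_restr_add[OF conf[OF that], of "- B" B] B restr_UNIV[OF conf[OF that]]
    by (simp add: Compl_partition2)
  have iV: "integrable N (\<lambda>\<omega>. V x y (?P \<omega>))" "integrable N (\<lambda>\<omega>. V s0 s0 (?P \<omega>))"
    by (rule integrable_bounded_tally[OF V_abs_le_2 Bc])+
  have iV0: "integrable N (\<lambda>\<omega>. V x y (tally \<tau> (\<Psi> \<omega>)))" by (rule integrable_bounded_tally0[OF V_abs_le_2])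
  have J1: "(\<integral>\<omega>. V x y (tally \<tau> (\<Psi> \<omega>)) \<partial>N) - (\<integral>\<omega>. V x y (?P \<omega>) \<partial>N)
      = (\<integral>\<omega>. V x y (?P \<omega> + ?W \<omega> + {#}) - V x y (?P \<omega> + {#}) \<partial>N)"
  proof -
    have "(\<integral>\<omega>. V x y (tally \<tau> (\<Psi> \<omega>)) \<partial>N) - (\<integral>\<omega>. V x y (?P \<omega>) \<partial>N) = (\<integral>\<omega>. V x y (tally \<tau> (\<Psi> \<omega>)) - V x y (?P \<omega>) \<partial>N)"
      using iV0 iV by simp
    also have "\<dots> = (\<integral>\<omega>. V x y (?P \<omega> + ?W \<omega> + {#}) - V x y (?P \<omega> + {#}) \<partial>N)"
      by (intro Bochner_Integration.integral_cong refl) (simp add: dec)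
    finally show ?thesis .
  qed
  have J2: "\<bar>(\<integral>\<omega>. V x y (?P \<omega>) \<partial>N) - cN\<bar> \<le> rQ ?L"
  proof -
    have m: "(\<lambda>\<eta>. V x y (tally \<rho> \<eta>) - V s0 s0 (tally \<rho> \<eta>)) \<in> borel_measurable config_algebra"
      by (intro borel_measurable_diff measurable_compose[OF measurable_tally(2)]) simp_all
    have "(\<integral>m. V x y m - V s0 s0 m \<partial>law ?L) = (\<integral>\<omega>. V x y (tally \<rho> (outer \<Psi> B \<omega>)) - V s0 s0 (tally \<rho> (outer \<Psi> B \<omega>)) \<partial>N)"
      unfolding law_integral[OF pL] by (rule integral_distr[OF measurable_outer[OF N \<Psi> B] m])
    also have "\<dots> = (\<integral>\<omega>. V x y (?P \<omega>) - V s0 s0 (?P \<omega>) \<partial>N)"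
      by (intro Bochner_Integration.integral_cong refl) (simp add: tally_outer[OF N \<Psi> B])
    also have "\<dots> = (\<integral>\<omega>. V x y (?P \<omega>) \<partial>N) - cN" using iV by simp
    finally show ?thesis using location_move[OF pL x y s0_center s0_center] by simp
  qed
  have "ennreal \<bar>(\<integral>\<omega>. V x y (tally \<tau> (\<Psi> \<omega>)) \<partial>N) - c0\<bar>
    \<le> ennreal (\<bar>(\<integral>\<omega>. V x y (tally \<tau> (\<Psi> \<omega>)) \<partial>N) - (\<integral>\<omega>. V x y (?P \<omega>) \<partial>N)\<bar> + rQ ?L + \<bar>cN - c0\<bar>)"
    using J2 by (intro ennreal_leI) linarith
  also have "\<dots> = ennreal \<bar>(\<integral>\<omega>. V x y (tally \<tau> (\<Psi> \<omega>)) \<partial>N) - (\<integral>\<omega>. V x y (?P \<omega>) \<partial>N)\<bar> + Rf ?L + ennreal \<bar>cN - c0\<bar>"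
    unfolding Rf_eq[OF pL] using rQ_nonneg[OF pL] by (simp add: ennreal_plus)
  also have "\<dots> \<le> (\<integral>\<^sup>+\<omega>. \<phi> \<omega> \<partial>N) + R_bar a u k G t B N \<Psi> + removal_cost M \<Xi> B"
    unfolding R_bar_eq[OF N \<Psi> B] J1 by (intro add_mono \<phi>(3) cN_bound order_refl)
  also have "\<dots> = (\<integral>\<^sup>+\<omega>. \<phi> \<omega> + R_bar a u k G t B N \<Psi> + removal_cost M \<Xi> B \<partial>N)"
    using \<phi>(1) by (simp add: nn_integral_add N.emeasure_space_1)
  also have "\<dots> \<le> (\<integral>\<^sup>+\<omega>. eps2 a u k G t M \<Xi> B N \<Psi> \<omega> \<partial>N)"
  proof (rule nn_integral_mono_AE)
    show "AE \<omega> in N. \<phi> \<omega> + R_bar a u k G t B N \<Psi> + removal_cost M \<Xi> B \<le> eps2 a u k G t M \<Xi> B N \<Psi> \<omega>"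
      using \<phi>(2) AE_space
    proof eventually_elim
      case (elim \<omega>)
      have "emeasure (\<Psi> \<omega>) B = ennreal (real (size (?W \<omega>)))"
        using emeasure_eq_size[OF conf[OF elim(2)] B] by (simp add: ennreal_of_nat_eq_real_of_nat)
      then show ?case
        unfolding eps2_def removal_cost_def[symmetric] using elim(1) by (intro add_mono) simp_all
    qed
  qed
  finally show ?thesis .
qed

end

end

section \<open>Polynomial birth-death point processes\<close>

context birth_death_stein
begin

definition add_random :: "('a multiset \<Rightarrow> real) \<Rightarrow> 'a multiset \<Rightarrow> real" where
  "add_random \<phi> m = Nu (\<lambda>s. \<phi> (add_mset s m))"

text \<open>The expectation of \<open>\<phi>\<close> over a configuration of \<open>n\<close> independent points with distribution \<open>w\<close>.\<close>

definition eta :: "nat \<Rightarrow> ('a multiset \<Rightarrow> real) \<Rightarrow> real" where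
  "eta n \<phi> = (add_random ^^ n) \<phi> {#}"

lemma Nu_add: "Nu (\<lambda>s. \<phi> s + \<psi> s) = Nu \<phi> + Nu \<psi>"
  unfolding Nu_def by (simp add: algebra_simps sum.distrib)

lemma Nu_cmult: "Nu (\<lambda>s. c * \<phi> s) = c * Nu \<phi>"
  unfolding Nu_def by (simp add: sum_distrib_left mult_ac)

lemma add_random_add: "add_random (\<lambda>m. \<phi> m + \<psi> m) = (\<lambda>m. add_random \<phi> m + add_random \<psi> m)"
  by (rule ext) (simp add: add_random_def Nu_add)

lemma add_random_diff: "add_random (\<lambda>m. \<phi> m - \<psi> m) = (\<lambda>m. add_random \<phi> m - add_random \<psi> m)"
  by (rule ext) (simp add: add_random_def Nu_diff)

lemma funpow_add_random_add:
  "(add_random ^^ n) (\<lambda>m. \<phi> m + \<psi> m) = (\<lambda>m. (add_random ^^ n) \<phi> m + (add_random ^^ n) \<psi> m)"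
  by (induction n) (simp_all add: add_random_add)

lemma funpow_add_random_diff:
  "(add_random ^^ n) (\<lambda>m. \<phi> m - \<psi> m) = (\<lambda>m. (add_random ^^ n) \<phi> m - (add_random ^^ n) \<psi> m)"
  by (induction n) (simp_all add: add_random_diff)

lemma funpow_add_random_size:
  "(add_random ^^ n) (\<lambda>m. c (size m) * \<phi> m) = (\<lambda>m. c (size m + n) * (add_random ^^ n) \<phi> m)"
proof (induction n arbitrary: \<phi> c)
  case (Suc n)
  show ?case
  proof
    fix m
    have "(add_random ^^ Suc n) (\<lambda>m. c (size m) * \<phi> m) m = add_random (\<lambda>m. c (size m + n) * (add_random ^^ n) \<phi> m) m"
      by (simp add: Suc)
    also have "\<dots> = c (size m + Suc n) * add_random ((add_random ^^ n) \<phi>) m"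
      unfolding add_random_def[where m=m] by (simp add: Nu_cmult)
    finally show "(add_random ^^ Suc n) (\<lambda>m. c (size m) * \<phi> m) m = c (size m + Suc n) * (add_random ^^ Suc n) \<phi> m"
      by simp
  qed
qed simp

definition remove_sum :: "('a multiset \<Rightarrow> real) \<Rightarrow> 'a multiset \<Rightarrow> real" where
  "remove_sum \<phi> m = (\<Sum>s\<in>#m. \<phi> (m - {#s#}))"

text \<open>A commutation relation: after a random point has been added, the removed point is either
  the new one, which restores \<open>m\<close>, or an old one, and then addition and removal may be
  exchanged.\<close>

lemma add_random_remove_sum: "add_random (remove_sum \<phi>) = (\<lambda>m. \<phi> m + remove_sum (add_random \<phi>) m)"
proof
  fix m
  have sumNu: "(\<Sum>r\<in>#m'. Nu (\<lambda>s. \<psi> s r)) = Nu (\<lambda>s. \<Sum>r\<in>#m'. \<psi> s r)" for \<psi> :: "'a \<Rightarrow> 'a \<Rightarrow> real" and m'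
    by (induction m') (simp_all add: Nu_add)
  have "add_random (remove_sum \<phi>) m = Nu (\<lambda>s. \<phi> m + (\<Sum>r\<in>#m. \<phi> (add_mset s (m - {#r#}))))"
    unfolding add_random_def remove_sum_def by (simp only: sum_mset_remove1_add)
  also have "\<dots> = \<phi> m + Nu (\<lambda>s. \<Sum>r\<in>#m. \<phi> (add_mset s (m - {#r#})))" by (simp add: Nu_add)
  also have "\<dots> = \<phi> m + remove_sum (add_random \<phi>) m"
    unfolding remove_sum_def add_random_def sumNu ..
  finally show "add_random (remove_sum \<phi>) m = \<phi> m + remove_sum (add_random \<phi>) m" .
qed

lemma funpow_add_random_remove_sum:
  "(add_random ^^ n) (remove_sum \<phi>)
    = (\<lambda>m. real n * (add_random ^^ (n - 1)) \<phi> m + remove_sum ((add_random ^^ n) \<phi>) m)"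
proof (induction n)
  case (Suc n)
  have "(add_random ^^ Suc n) (remove_sum \<phi>)
     = add_random (\<lambda>m. real n * (add_random ^^ (n - 1)) \<phi> m + remove_sum ((add_random ^^ n) \<phi>) m)"
    by (simp add: Suc)
  also have "\<dots> = (\<lambda>m. real n * add_random ((add_random ^^ (n - 1)) \<phi>) m
      + ((add_random ^^ n) \<phi> m + remove_sum (add_random ((add_random ^^ n) \<phi>)) m))"
    unfolding add_random_add add_random_remove_sum by (simp add: add_random_def Nu_cmult)
  finally have "(add_random ^^ Suc n) (remove_sum \<phi>) = (\<lambda>m. real n * add_random ((add_random ^^ (n - 1)) \<phi>) m
      + ((add_random ^^ n) \<phi> m + remove_sum (add_random ((add_random ^^ n) \<phi>)) m))" .
  moreover have "real n * add_random ((add_random ^^ (n - 1)) \<phi>) m = real n * (add_random ^^ n) \<phi> m" for m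
    by (cases n) simp_all
  ultimately have eq: "(add_random ^^ Suc n) (remove_sum \<phi>) = (\<lambda>m. real n * (add_random ^^ n) \<phi> m
      + ((add_random ^^ n) \<phi> m + remove_sum (add_random ((add_random ^^ n) \<phi>)) m))"
    by (simp only:)
  show ?case
  proof
    fix m
    show "(add_random ^^ Suc n) (remove_sum \<phi>) m
        = real (Suc n) * (add_random ^^ (Suc n - 1)) \<phi> m + remove_sum ((add_random ^^ Suc n) \<phi>) m"
      unfolding fun_cong[OF eq, of m] by (simp add: algebra_simps)
  qed
qed simp

text \<open>Averaged over n independent points, the generator on configurations becomes the
  birth-death generator in n: immigration adds one more independent point, and a death leaves n-1
  independent points, as \<open>funpow_add_random_remove_sum\<close> shows at the empty
  configuration.\<close>

lemma eta_generator:
  "eta n (\<lambda>m. \<epsilon> * sol m - f m) = a * (eta (Suc n) sol - eta n sol) + real n * dr n * (eta (n - 1) sol - eta n sol)"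
proof -
  have "(\<lambda>m. \<epsilon> * sol m - f m)
     = (\<lambda>m. (a * (add_random sol m - sol m)) + dr (size m) * (remove_sum sol m - real (size m) * sol m))"
  proof
    fix m
    show "\<epsilon> * sol m - f m = a * (add_random sol m - sol m) + dr (size m) * (remove_sum sol m - real (size m) * sol m)"
      using sol_eq[of m] by (simp add: add_random_def remove_sum_def Nu_diff sum_mset_diff_const)
  qed
  also have "\<dots> = (\<lambda>m. (a * add_random sol m - a * sol m) + (dr (size m) * remove_sum sol m - (real (size m) * dr (size m)) * sol m))"
    by (simp add: algebra_simps)
  finally have eq: "(\<lambda>m. \<epsilon> * sol m - f m) = \<dots>" .
  have c: "(add_random ^^ n) (\<lambda>m. a * \<phi> m) = (\<lambda>m. a * (add_random ^^ n) \<phi> m)" for \<phi>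
    using funpow_add_random_size[where c="\<lambda>_. a"] by simp
  have swap: "(add_random ^^ n) (add_random sol) = (add_random ^^ Suc n) sol" by (simp add: funpow_swap1)
  show ?thesis
    unfolding eta_def eq funpow_add_random_add funpow_add_random_diff c swap
      funpow_add_random_size[where c=dr] funpow_add_random_size[where c="\<lambda>n. real n * dr n"] funpow_add_random_remove_sum
    by (simp add: remove_sum_def algebra_simps)
qed

lemma eta_bounds:
  assumes "\<And>m. l (size m) \<le> \<phi> m \<and> \<phi> m \<le> h (size m)"
  shows "l n \<le> eta n \<phi> \<and> eta n \<phi> \<le> (h n :: real)"
proof -
  have "l (size m + n) \<le> (add_random ^^ n) \<phi> m \<and> (add_random ^^ n) \<phi> m \<le> h (size m + n)" for m
  proof (induction n arbitrary: m)
    case (Suc n)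
    have "l (size m + Suc n) \<le> Nu (\<lambda>s. (add_random ^^ n) \<phi> (add_mset s m))"
      by (rule Nu_ge) (use Suc[of "add_mset _ m"] in simp)
    moreover have "Nu (\<lambda>s. (add_random ^^ n) \<phi> (add_mset s m)) \<le> h (size m + Suc n)"
      by (rule Nu_le) (use Suc[of "add_mset _ m"] in simp)
    ultimately show ?case by (simp add: add_random_def[where m=m])
  qed (use assms in simp)
  from this[of "{#}"] show ?thesis by (simp add: eta_def)
qed

lemma eta_abs_le: "(\<And>m. \<bar>\<phi> m\<bar> \<le> c) \<Longrightarrow> \<bar>eta n \<phi>\<bar> \<le> c"
  using eta_bounds[of "\<lambda>_. - c" \<phi> "\<lambda>_. c"] by (simp add: abs_le_iff) (metis minus_le_iff)

text \<open>Detailed balance turns each weighted term into a difference of consecutive probability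
  flows, so the series telescopes. The flow at infinity vanishes because the masses tend to 0 and
  \<open>sol\<close> is bounded for fixed \<open>\<epsilon>\<close>.\<close>

lemma stationary:
  assumes balance: "\<And>n. pmf p n * a = pmf p (Suc n) * (real (Suc n) * dr (Suc n))"
  shows "(\<integral>n. eta n (\<lambda>m. \<epsilon> * sol m - f m) \<partial>measure_pmf p) = 0"
proof -
  define B where "B = (\<lambda>n. pmf p n * a * (eta (Suc n) sol - eta n sol))"
  have step: "pmf p n * eta n (\<lambda>m. \<epsilon> * sol m - f m) = B n - (case n of 0 \<Rightarrow> 0 | Suc k \<Rightarrow> B k)" for n
  proof (cases n)
    case 0
    then show ?thesis by (simp add: eta_generator B_def)
  next
    case (Suc k)
    have "pmf p n * eta n (\<lambda>m. \<epsilon> * sol m - f m) = B n - (pmf p (Suc k) * (real (Suc k) * dr (Suc k))) * (eta (Suc k) sol - eta k sol)"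
      unfolding eta_generator B_def Suc by (simp add: algebra_simps)
    also have "\<dots> = B n - B k" unfolding balance[symmetric] B_def by simp
    finally show ?thesis using Suc by simp
  qed
  have bnd: "\<bar>eta n (\<lambda>m. \<epsilon> * sol m - f m)\<bar> \<le> 1" for n by (rule eta_abs_le) (rule residual_abs_le)
  have "(\<lambda>n. pmf p n * eta n (\<lambda>m. \<epsilon> * sol m - f m)) sums (\<integral>n. eta n (\<lambda>m. \<epsilon> * sol m - f m) \<partial>measure_pmf p)"
    unfolding integral_pmf_count_space(2)[OF bnd]
    by (rule sums_integral_count_space_nat) (rule integral_pmf_count_space(1)[OF bnd])
  moreover have "(\<Sum>n<N. pmf p n * eta n (\<lambda>m. \<epsilon> * sol m - f m)) = (case N of 0 \<Rightarrow> 0 | Suc k \<Rightarrow> B k)" for N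
    by (induction N) (simp_all add: step split: nat.splits)
  ultimately have lim: "(\<lambda>N. case N of 0 \<Rightarrow> 0 | Suc k \<Rightarrow> B k) \<longlonglongrightarrow> (\<integral>n. eta n (\<lambda>m. \<epsilon> * sol m - f m) \<partial>measure_pmf p)"
    by (simp add: sums_def)
  have p0: "(\<lambda>n. pmf p n) \<longlonglongrightarrow> 0"
    using sums_integral_count_space_nat[OF integrable_pmf[of UNIV p]] by (intro summable_LIMSEQ_zero sums_summable)
  have "B \<longlonglongrightarrow> 0"
  proof (rule Lim_null_comparison)
    show "\<forall>\<^sub>F n in sequentially. norm (B n) \<le> pmf p n * (a * (2 / \<epsilon>))"
    proof (intro always_eventually allI)
      fix n
      have "\<bar>eta (Suc n) sol - eta n sol\<bar> \<le> 2 / \<epsilon>"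
        using eta_abs_le[of sol "1 / \<epsilon>" "Suc n"] eta_abs_le[of sol "1 / \<epsilon>" n] sol_abs_le by simp
      then have "pmf p n * (a * \<bar>eta (Suc n) sol - eta n sol\<bar>) \<le> pmf p n * (a * (2 / \<epsilon>))"
        using a_pos by (intro mult_left_mono) auto
      moreover have "norm (B n) = pmf p n * (a * \<bar>eta (Suc n) sol - eta n sol\<bar>)"
        unfolding B_def using a_pos by (simp add: abs_mult)
      ultimately show "norm (B n) \<le> pmf p n * (a * (2 / \<epsilon>))" by simp
    qed
    show "(\<lambda>n. pmf p n * (a * (2 / \<epsilon>))) \<longlonglongrightarrow> 0" using tendsto_mult_right[OF p0, of "a * (2 / \<epsilon>)"] by simp
  qed
  then have "(\<lambda>N. case N of 0 \<Rightarrow> 0 | Suc k \<Rightarrow> B k) \<longlonglongrightarrow> 0"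
    by (subst filterlim_sequentially_Suc[symmetric]) simp
  with lim show ?thesis by (rule LIMSEQ_unique)
qed

end

section \<open>The invariant distribution of the number of points\<close>

context
  fixes a \<beta> :: real
  assumes a: "a > 0" and \<beta>: "\<beta> \<ge> 0"
begin

definition death :: "nat \<Rightarrow> real" where
  "death n = real n + \<beta> * real n * (real n - 1)"

lemma death_Suc_ge: "death (Suc n) \<ge> real (Suc n)"
  using \<beta> by (simp add: death_def)

lemma death_Suc_pos: "death (Suc n) > 0"
  using death_Suc_ge[of n] by linarith

definition balanced :: "nat pmf \<Rightarrow> bool" where
  "balanced p \<longleftrightarrow> (\<forall>n. pmf p n * a = pmf p (Suc n) * death (Suc n))"

text \<open>Column j of the invariance equation is the difference of the net flows across the edges
  next to j. There is no edge below 0, so by induction every net flow is zero.\<close>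

lemma bd_invariant_iff_balanced: "bd_invariant (\<lambda>k. a + 0 * real k) (\<lambda>k. real k + \<beta> * real k * (real k - 1)) p \<longleftrightarrow> balanced p"
proof -
  let ?g = "bd_generator (\<lambda>k. a + 0 * real k) (\<lambda>k. real k + \<beta> * real k * (real k - 1))"
  have col: "(\<lambda>i. pmf p i * ?g i j) sums
      ((case j of 0 \<Rightarrow> 0 | Suc k \<Rightarrow> pmf p k * a - pmf p j * death j) + pmf p (Suc j) * death (Suc j) - pmf p j * a)" for j
  proof -
    have "(\<lambda>i. pmf p i * ?g i j) sums (\<Sum>i\<in>{j - 1..Suc j}. pmf p i * ?g i j)"
      by (rule sums_finite) (auto simp: bd_generator_def)
    also have "(\<Sum>i\<in>{j - 1..Suc j}. pmf p i * ?g i j)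
       = (case j of 0 \<Rightarrow> 0 | Suc k \<Rightarrow> pmf p k * a - pmf p j * death j) + pmf p (Suc j) * death (Suc j) - pmf p j * a"
    proof (cases j)
      case 0
      have "{0..Suc 0} = {0, Suc 0}" by auto
      then show ?thesis using 0 by (simp add: bd_generator_def death_def)
    next
      case (Suc k)
      have "{j - 1..Suc j} = {k, Suc k, Suc (Suc k)}" using Suc by auto
      then show ?thesis using Suc by (simp add: bd_generator_def death_def algebra_simps)
    qed
    finally show ?thesis .
  qed
  show ?thesis
  proof
    assume inv: "bd_invariant (\<lambda>k. a + 0 * real k) (\<lambda>k. real k + \<beta> * real k * (real k - 1)) p"
    then have eq: "(case j of 0 \<Rightarrow> 0 | Suc k \<Rightarrow> pmf p k * a - pmf p j * death j) + pmf p (Suc j) * death (Suc j) - pmf p j * a = 0" for j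
      using sums_unique2[OF col[of j]] unfolding bd_invariant_def by blast
    have "pmf p n * a = pmf p (Suc n) * death (Suc n)" for n
    proof (induction n)
      case 0
      show ?case using eq[of 0] by simp
    next
      case (Suc n)
      then show ?case using eq[of "Suc n"] by simp
    qed
    then show "balanced p" by (simp add: balanced_def)
  next
    assume "balanced p"
    then have "(case j of 0 \<Rightarrow> 0 | Suc k \<Rightarrow> pmf p k * a - pmf p j * death j) + pmf p (Suc j) * death (Suc j) - pmf p j * a = 0" for j
      unfolding balanced_def by (cases j) simp_all
    then show "bd_invariant (\<lambda>k. a + 0 * real k) (\<lambda>k. real k + \<beta> * real k * (real k - 1)) p"
      unfolding bd_invariant_def using col by metis
  qed
qed

text \<open>Balance fixes all ratios to the mass at 0, and total mass 1 fixes that mass.\<close>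

lemma balanced_unique:
  assumes "balanced p" "balanced q"
  shows "p = q"
proof -
  have ratio: "pmf p n * pmf q 0 = pmf q n * pmf p 0" for n
  proof (induction n)
    case (Suc n)
    have "pmf r (Suc n) = pmf r n * a / death (Suc n)" if "balanced r" for r
      using that death_Suc_pos[of n] unfolding balanced_def by (simp add: field_simps)
    then show ?case using Suc assms by simp
  qed simp
  have one: "(\<integral>n. pmf r n \<partial>count_space UNIV) = 1" for r :: "nat pmf" by (simp add: integral_pmf)
  have "(\<integral>n. pmf p n * pmf q 0 \<partial>count_space UNIV) = (\<integral>n. pmf q n * pmf p 0 \<partial>count_space UNIV)"
    unfolding ratio ..
  then have eq: "pmf q 0 = pmf p 0" by (simp add: one)
  have "pmf p 0 \<noteq> 0"
  proof
    assume 0: "pmf p 0 = 0"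
    have "pmf p n = 0" for n
    proof (induction n)
      case (Suc n)
      then show ?case using assms(1) death_Suc_pos[of n] unfolding balanced_def by (metis mult_eq_0_iff less_irrefl mult_zero_left)
    qed (rule 0)
    then show False using one[of p] by simp
  qed
  then show ?thesis using ratio eq by (intro pmf_eqI) simp
qed

text \<open>The product solution is summable since \<open>death n\<close> is at least n for positive
  n, which puts its terms below those of the exponential series at \<open>a\<close>.\<close>

lemma balanced_ex: "\<exists>p. balanced p"
proof -
  define c where "c = (\<lambda>n. \<Prod>j<n. a / death (Suc j))"
  have cpos: "c n > 0" for n unfolding c_def using a death_Suc_pos by (intro prod_pos) auto
  have cSuc: "c (Suc n) = c n * (a / death (Suc n))" for n by (simp add: c_def)
  have cle: "c n \<le> a ^ n /\<^sub>R fact n" for n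
  proof (induction n)
    case (Suc n)
    have "a / death (Suc n) \<le> a / real (Suc n)"
      using a death_Suc_ge[of n] by (intro divide_left_mono) (auto simp: death_Suc_pos)
    then have "c (Suc n) \<le> (a ^ n /\<^sub>R fact n) * (a / real (Suc n))"
      unfolding cSuc using Suc cpos[of n] a death_Suc_pos[of n] by (intro mult_mono) (auto simp: less_imp_le)
    also have "\<dots> = a ^ Suc n /\<^sub>R fact (Suc n)" by (simp add: field_simps)
    finally show ?case .
  qed (simp add: c_def)
  have sc: "summable c"
    by (rule summable_comparison_test'[OF summable_exp_generic[of a], of 0]) (use cle cpos in \<open>auto simp: less_imp_le\<close>)
  define S where "S = (\<Sum>n. c n)"
  have S: "S > 0" unfolding S_def using sc cpos by (intro suminf_pos) auto
  have nn: "0 \<le> c n / S" for n using cpos[of n] S by simp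
  have "(\<integral>\<^sup>+n. ennreal (c n / S) \<partial>count_space UNIV) = 1"
  proof -
    have "(\<lambda>n. c n / S) sums 1" using sums_divide[OF summable_sums[OF sc], of S] S by (simp add: S_def)
    then have "(\<Sum>n. ennreal (c n / S)) = ennreal 1"
      by (intro suminf_ennreal_eq nn)
    then show ?thesis by (simp add: nn_integral_count_space_nat)
  qed
  then have pe: "pmf (embed_pmf (\<lambda>n. c n / S)) n = c n / S" for n
    by (intro pmf_embed_pmf nn)
  have "c (Suc n) * death (Suc n) = c n * a" for n
    using death_Suc_pos[of n] by (simp add: cSuc)
  then have "balanced (embed_pmf (\<lambda>n. c n / S))"
    unfolding balanced_def pe by simp
  then show ?thesis ..
qed

lemma balanced_pbd_count: "balanced (pbd_count a 0 \<beta>)"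
proof -
  have "\<exists>!p. balanced p" using balanced_ex balanced_unique by blast
  then have "balanced (THE p. balanced p)" by (rule theI')
  then show ?thesis unfolding pbd_count_def bd_invariant_iff_balanced .
qed

text \<open>By balance the (n+1)-st term of the mean is at most a times the mass at n, so the mean
  is at most a.\<close>

lemma integrable_pbd_count: "integrable (measure_pmf (pbd_count a 0 \<beta>)) real"
proof -
  let ?p = "pbd_count a 0 \<beta>"
  have "integrable (count_space UNIV) (\<lambda>n. pmf ?p n *\<^sub>R real n)"
  proof -
    have bal: "pmf ?p n * a = pmf ?p (Suc n) * death (Suc n)" for n
      using balanced_pbd_count by (simp add: balanced_def)
    have le: "pmf ?p (Suc n) * real (Suc n) \<le> pmf ?p n * a" for n
      unfolding bal using death_Suc_ge[of n] by (intro mult_left_mono) auto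
    have sg: "summable (\<lambda>n. pmf ?p n * a)"
      using sums_integral_count_space_nat[OF integrable_pmf[of UNIV ?p]] by (intro summable_mult2 sums_summable)
    have "summable (\<lambda>n. pmf ?p (Suc n) * real (Suc n))"
    proof (rule summable_comparison_test'[OF sg, of 0])
      show "norm (pmf ?p (Suc n) * real (Suc n)) \<le> pmf ?p n * a" for n
        using le[of n] by (simp add: abs_of_nonneg del: of_nat_Suc)
    qed
    then have "summable (\<lambda>n. pmf ?p n * real n)" by (subst (asm) summable_Suc_iff)
    then show ?thesis unfolding integrable_count_space_nat_iff by simp
  qed
  then show ?thesis unfolding measure_pmf_eq_density by (subst integrable_density) auto
qed

end

context discretization
begin

lemma measurable_emb_mset_set:
  assumes J: "finite (J :: 'i set)" "J \<subseteq> I"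
  shows "(\<lambda>U. emb (image_mset U (mset_set J))) \<in> measurable (Pi\<^sub>M I (\<lambda>_. borel :: 'a measure)) config_algebra"
proof (rule measurable_config_algebraI)
  fix C :: "'a set" assume C: "C \<in> sets borel"
  have "emeasure (emb (image_mset U (mset_set J))) C = (\<Sum>j\<in>J. indicator C (U j))" for U :: "'i \<Rightarrow> 'a"
  proof -
    have "emeasure (emb (image_mset U (mset_set J))) C = (\<Sum>y\<in>#image_mset U (mset_set J). of_bool (y \<in> C))"
      by (simp add: emeasure_emb[OF C] size_filter_mset_eq)
    also have "\<dots> = (\<Sum>j\<in>J. indicator C (U j))"
      by (simp add: sum_unfold_sum_mset image_mset.compositionality comp_def indicator_def of_bool_def)
    finally show ?thesis .
  qed
  moreover have "(\<lambda>U. \<Sum>j\<in>J. indicator C (U j) :: ennreal) \<in> borel_measurable (Pi\<^sub>M I (\<lambda>_. borel :: 'a measure))"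
  proof (rule borel_measurable_sum)
    fix j assume "j \<in> J"
    then have "(\<lambda>U. U j) \<in> measurable (Pi\<^sub>M I (\<lambda>_. borel :: 'a measure)) borel"
      using J(2) by (intro measurable_component_singleton) auto
    then show "(\<lambda>U. indicator C (U j) :: ennreal) \<in> borel_measurable (Pi\<^sub>M I (\<lambda>_. borel :: 'a measure))"
      by (rule measurable_compose) (use C in simp)
  qed
  ultimately show "(\<lambda>U. emeasure (emb (image_mset U (mset_set J))) C) \<in> borel_measurable (Pi\<^sub>M I (\<lambda>_. borel :: 'a measure))"
    by simp
qed simp

end

section \<open>Independent points as iterated averages\<close>

context stein_discretization
begin

context
  fixes \<nu> :: "'a measure"
  assumes \<nu>: "prob_space \<nu>" "sets \<nu> = sets borel"
    and T_centers: "T = centers" and w_eq: "\<And>s. s \<in> centers \<Longrightarrow> w s = measure \<nu> (\<tau> -` {s})"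
begin

interpretation \<nu>: prob_space \<nu> by (rule \<nu>)
interpretation P: product_prob_space "\<lambda>_ :: nat. \<nu>" UNIV
  by unfold_locales

lemma sets_PiM_\<nu>: "sets (Pi\<^sub>M I (\<lambda>_. \<nu>)) = sets (Pi\<^sub>M I (\<lambda>_. borel))"
  by (intro sets_PiM_cong refl) (simp add: \<nu>(2))

lemma integral_\<nu>: "(\<integral>x. \<phi> (\<tau> x) \<partial>\<nu>) = Nu \<phi>"
proof -
  have \<tau>m: "\<tau> -` {s} \<in> sets \<nu>" for s using \<tau>_borel by (simp add: \<nu>(2))
  have "(\<integral>x. \<phi> (\<tau> x) \<partial>\<nu>) = (\<integral>x. (\<Sum>s\<in>centers. \<phi> s * indicator (\<tau> -` {s}) x) \<partial>\<nu>)"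
  proof (intro Bochner_Integration.integral_cong refl)
    fix x
    have "(\<Sum>s\<in>centers. \<phi> s * indicator (\<tau> -` {s}) x) = (\<Sum>s\<in>centers. if s = \<tau> x then \<phi> s else 0)"
      by (intro sum.cong) (auto simp: indicator_def)
    then show "\<phi> (\<tau> x) = (\<Sum>s\<in>centers. \<phi> s * indicator (\<tau> -` {s}) x)" by (simp add: sum.delta)
  qed
  also have "\<dots> = (\<Sum>s\<in>centers. \<phi> s * measure \<nu> (\<tau> -` {s}))"
    using \<tau>m by (subst Bochner_Integration.integral_sum)
      (auto intro!: integrable_mult_right integrable_real_indicator simp: \<nu>.emeasure_eq_measure)
  also have "\<dots> = Nu \<phi>" unfolding Nu_def unfolding T_centers by (intro sum.cong) (auto simp: w_eq)
  finally show ?thesis .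
qed

lemma measurable_image_mset:
  assumes J: "finite J" "J \<subseteq> (I :: nat set)"
  shows "(\<lambda>U. image_mset (\<lambda>j. \<tau> (U j)) (mset_set J)) \<in> measurable (Pi\<^sub>M I (\<lambda>_. \<nu>)) (count_space UNIV)"
proof -
  have "(\<lambda>U. tally \<tau> (emb (image_mset U (mset_set J)))) \<in> measurable (Pi\<^sub>M I (\<lambda>_. borel)) (count_space UNIV)"
    by (rule measurable_compose[OF measurable_emb_mset_set[OF J] measurable_tally(1)])
  then show ?thesis unfolding measurable_cong_sets[OF sets_PiM_\<nu> refl]
    by (simp add: image_mset.compositionality comp_def)
qed

text \<open>Integrating out one coordinate turns \<open>\<phi>\<close> into its average over one
  added center. The induction therefore lets \<open>\<phi>\<close> vary, and \<open>m\<close>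
  collects the other points.\<close>

lemma integral_iid:
  fixes \<phi> :: "'a multiset \<Rightarrow> real"
  assumes bd: "\<And>m. \<bar>\<phi> m\<bar> \<le> c" and J: "finite (J :: nat set)"
  shows "(\<integral>U. \<phi> (m + image_mset (\<lambda>j. \<tau> (U j)) (mset_set J)) \<partial>Pi\<^sub>M J (\<lambda>_. \<nu>)) = (add_random ^^ card J) \<phi> m"
  using J bd
proof (induction J arbitrary: m \<phi>)
  case empty
  interpret E: prob_space "Pi\<^sub>M {} (\<lambda>_ :: nat. \<nu>)" by (intro prob_space_PiM \<nu>)
  show ?case by (simp add: E.prob_space)
next
  case (insert i J)
  interpret I: prob_space "Pi\<^sub>M (insert i J) (\<lambda>_ :: nat. \<nu>)" by (intro prob_space_PiM \<nu>)
  have int: "integrable (Pi\<^sub>M (insert i J) (\<lambda>_. \<nu>)) (\<lambda>U. \<phi> (m + image_mset (\<lambda>j. \<tau> (U j)) (mset_set (insert i J))))"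
    using insert.prems insert.hyps measurable_compose[OF measurable_image_mset[of "insert i J" "insert i J"], of "\<lambda>n. \<phi> (m + n)" borel]
    by (intro I.integrable_const_bound[where B=c]) auto
  have "(\<integral>U. \<phi> (m + image_mset (\<lambda>j. \<tau> (U j)) (mset_set (insert i J))) \<partial>Pi\<^sub>M (insert i J) (\<lambda>_. \<nu>))
     = (\<integral>U. (\<integral>y. \<phi> (m + image_mset (\<lambda>j. \<tau> ((U(i := y)) j)) (mset_set (insert i J))) \<partial>\<nu>) \<partial>Pi\<^sub>M J (\<lambda>_. \<nu>))"
    by (rule P.product_integral_insert[OF insert.hyps int])
  also have "\<dots> = (\<integral>U. add_random \<phi> (m + image_mset (\<lambda>j. \<tau> (U j)) (mset_set J)) \<partial>Pi\<^sub>M J (\<lambda>_. \<nu>))"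
  proof (intro Bochner_Integration.integral_cong refl)
    fix U :: "nat \<Rightarrow> 'a"
    have "image_mset (\<lambda>j. \<tau> ((U(i := y)) j)) (mset_set J) = image_mset (\<lambda>j. \<tau> (U j)) (mset_set J)" for y
      using insert.hyps by (intro image_mset_cong) auto
    then have "\<phi> (m + image_mset (\<lambda>j. \<tau> ((U(i := y)) j)) (mset_set (insert i J)))
        = \<phi> (add_mset (\<tau> y) (m + image_mset (\<lambda>j. \<tau> (U j)) (mset_set J)))" for y
      using insert.hyps by simp
    then show "(\<integral>y. \<phi> (m + image_mset (\<lambda>j. \<tau> ((U(i := y)) j)) (mset_set (insert i J))) \<partial>\<nu>)
       = add_random \<phi> (m + image_mset (\<lambda>j. \<tau> (U j)) (mset_set J))"
      unfolding add_random_def[where m="m + _"] integral_\<nu>[symmetric] by simp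
  qed
  also have "\<dots> = (add_random ^^ card J) (add_random \<phi>) m"
  proof -
    have "\<bar>add_random \<phi> m\<bar> \<le> c" for m unfolding add_random_def[where m=m] by (rule Nu_abs_le) (rule insert.prems)
    then show ?thesis by (rule insert.IH)
  qed
  finally show ?case using insert.hyps by (simp add: funpow_swap1)
qed

end

end

section \<open>Palm identities for discretized configurations\<close>

text \<open>A finite total makes the inner extended integral finite almost everywhere, so an
  identity between nonnegative integrals becomes one between real integrals.\<close>

lemma enn2real_disintegration:
  assumes J: "J \<in> borel_measurable L" and S: "integrable M S" "\<And>\<omega>. S \<omega> \<ge> (0::real)"
    and eq: "(\<integral>\<^sup>+x. J x \<partial>L) = (\<integral>\<^sup>+\<omega>. ennreal (S \<omega>) \<partial>M)"
  shows "AE x in L. J x < \<infinity>" "integrable L (\<lambda>x. enn2real (J x))"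
    "(\<integral>x. enn2real (J x) \<partial>L) = (\<integral>\<omega>. S \<omega> \<partial>M)"
proof -
  have fin: "(\<integral>\<^sup>+x. J x \<partial>L) = ennreal (\<integral>\<omega>. S \<omega> \<partial>M)"
    unfolding eq using S by (intro nn_integral_eq_integral) auto
  show ae: "AE x in L. J x < \<infinity>"
    using nn_integral_PInf_AE[OF J] fin by (auto simp: less_top[symmetric] elim: eventually_mono)
  have e: "(\<integral>\<^sup>+x. ennreal (enn2real (J x)) \<partial>L) = (\<integral>\<^sup>+x. J x \<partial>L)"
    using ae by (intro nn_integral_cong_AE) (auto elim!: eventually_mono simp: less_top)
  show "integrable L (\<lambda>x. enn2real (J x))"
    using J e fin by (intro integrableI_nonneg) auto
  have "(\<integral>x. enn2real (J x) \<partial>L) = enn2real (\<integral>\<^sup>+x. ennreal (enn2real (J x)) \<partial>L)"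
    using J by (intro integral_eq_nn_integral) auto
  also have "\<dots> = (\<integral>\<omega>. S \<omega> \<partial>M)" unfolding e fin using S by (simp add: integral_nonneg_AE)
  finally show "(\<integral>x. enn2real (J x) \<partial>L) = (\<integral>\<omega>. S \<omega> \<partial>M)" .
qed

lemma sum_mset_nonneg_real:
  fixes \<phi> :: "'a \<Rightarrow> real"
  shows "(\<And>s. s \<in># m \<Longrightarrow> 0 \<le> \<phi> s) \<Longrightarrow> 0 \<le> (\<Sum>s\<in>#m. \<phi> s)"
  by (induction m) auto

lemma ennreal_sum_mset: "(\<And>s. s \<in># m \<Longrightarrow> 0 \<le> \<phi> s) \<Longrightarrow> (\<Sum>s\<in>#m. ennreal (\<phi> s)) = ennreal (\<Sum>s\<in>#m. \<phi> s)"
proof (induction m)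
  case (add x m)
  have "0 \<le> (\<Sum>s\<in>#m. \<phi> s)" by (rule sum_mset_nonneg_real) (use add in auto)
  then show ?case using add by (simp add: ennreal_plus)
qed simp

context discretization
begin

lemma measurable_discrete_pair:
  assumes C: "finite C" and g: "g \<in> measurable K (count_space UNIV)" "\<And>x. g x \<in> C"
  shows "(\<lambda>(x, \<eta>). (g x, tally \<tau> \<eta>)) \<in> measurable (K \<Otimes>\<^sub>M config_algebra) (count_space UNIV)"
proof (rule discrete_measurableI[of "C \<times> over"])
  show "countable (C \<times> over)" using countable_over C by (intro countable_SIGMA) (auto intro: countable_finite)
  show "(case p of (x, \<eta>) \<Rightarrow> (g x, tally \<tau> \<eta>)) \<in> C \<times> over" for p
    using g(2) tally_over(1) by (auto split: prod.split)
  fix c :: "'b \<times> 'a multiset"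
  have 1: "(\<lambda>p. g (fst p)) \<in> measurable (K \<Otimes>\<^sub>M config_algebra) (count_space UNIV)"
    by (rule measurable_compose[OF measurable_fst g(1)])
  have 2: "(\<lambda>p. tally \<tau> (snd p)) \<in> measurable (K \<Otimes>\<^sub>M config_algebra) (count_space UNIV)"
    by (rule measurable_compose[OF measurable_snd measurable_tally(1)])
  have "{p \<in> space (K \<Otimes>\<^sub>M config_algebra). (case p of (x, \<eta>) \<Rightarrow> (g x, tally \<tau> \<eta>)) = c}
    = ((\<lambda>p. g (fst p)) -` {fst c} \<inter> space (K \<Otimes>\<^sub>M config_algebra)) \<inter> ((\<lambda>p. tally \<tau> (snd p)) -` {snd c} \<inter> space (K \<Otimes>\<^sub>M config_algebra))"
    by (auto simp: case_prod_unfold)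
  also have "\<dots> \<in> sets (K \<Otimes>\<^sub>M config_algebra)"
    by (intro sets.Int measurable_sets[OF 1] measurable_sets[OF 2]) auto
  finally show "{p \<in> space (K \<Otimes>\<^sub>M config_algebra). (case p of (x, \<eta>) \<Rightarrow> (g x, tally \<tau> \<eta>)) = c} \<in> sets (K \<Otimes>\<^sub>M config_algebra)" .
qed

lemma measurable_\<tau>: "\<tau> \<in> measurable borel (count_space UNIV)"
  by (rule measurableI) (use \<tau>_borel in auto)

lemma measurable_\<tau>_pair: "(\<lambda>(x, y). (\<tau> x, \<tau> y)) \<in> measurable (borel \<Otimes>\<^sub>M borel) (count_space UNIV)"
proof (rule discrete_measurableI[of "centers \<times> centers"])
  show "countable (centers \<times> centers)" by (intro countable_finite) simp
  fix c :: "'a \<times> 'a"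
  have "{p \<in> space (borel \<Otimes>\<^sub>M borel). (case p of (x, y) \<Rightarrow> (\<tau> x, \<tau> y)) = c} = (\<tau> -` {fst c}) \<times> (\<tau> -` {snd c})"
    by (auto simp: space_pair_measure)
  also have "\<dots> \<in> sets (borel \<Otimes>\<^sub>M borel)" using \<tau>_borel by (intro pair_measureI)
  finally show "{p \<in> space (borel \<Otimes>\<^sub>M borel). (case p of (x, y) \<Rightarrow> (\<tau> x, \<tau> y)) = c} \<in> sets (borel \<Otimes>\<^sub>M borel)" .
qed auto

lemma measurable_pair_tally:
  "(\<lambda>(x, \<eta>). \<phi> (\<tau> x) (tally \<tau> \<eta>)) \<in> borel_measurable (borel \<Otimes>\<^sub>M config_algebra)"
  using measurable_compose[OF measurable_discrete_pair[OF finite_centers measurable_\<tau> \<tau>_center], of "\<lambda>(s, m). \<phi> s m" borel]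
  by (simp add: case_prod_unfold)

lemma measurable_pair_tally2:
  "(\<lambda>((x, y), \<eta>). \<phi> (\<tau> x) (\<tau> y) (tally \<tau> \<eta>)) \<in> borel_measurable ((borel \<Otimes>\<^sub>M borel) \<Otimes>\<^sub>M config_algebra)"
proof -
  have c: "finite (centers \<times> centers)" by simp
  have "(case p of (x, y) \<Rightarrow> (\<tau> x, \<tau> y)) \<in> centers \<times> centers" for p by (cases p) simp
  from measurable_compose[OF measurable_discrete_pair[OF c measurable_\<tau>_pair this], of "\<lambda>((s, r), m). \<phi> s r m" borel]
  show ?thesis by (simp add: case_prod_unfold)
qed

context
  fixes M :: "'m measure" and \<Xi> :: "'m \<Rightarrow> 'a measure"
    and M1 :: "'a \<Rightarrow> 'v measure" and \<Xi>1 :: "'a \<Rightarrow> 'v \<Rightarrow> 'a measure"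
    and M2 :: "'a \<Rightarrow> 'a \<Rightarrow> 'z measure" and \<Xi>2 :: "'a \<Rightarrow> 'a \<Rightarrow> 'z \<Rightarrow> 'a measure"
  assumes process: "point_process M \<Xi>" and palm1: "palm_process M \<Xi> M1 \<Xi>1" and palm2: "palm_process2 M \<Xi> M2 \<Xi>2"
begin

abbreviation "\<Lambda> \<equiv> mean_measure M \<Xi>"
abbreviation "\<Lambda>2 \<equiv> factorial_moment2 M \<Xi>"
abbreviation "Y \<omega> \<equiv> tally \<tau> (\<Xi> \<omega>)"

lemma process_props: "prob_space M" "\<Xi> \<in> measurable M config_algebra"
  using process by (auto simp: point_process_def)

lemma palm1_props: "prob_space (M1 x)" "\<Xi>1 x \<in> measurable (M1 x) config_algebra"
  using palm1 by (auto simp: palm_process_def point_process_def)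

lemma palm2_props: "prob_space (M2 x y)" "\<Xi>2 x y \<in> measurable (M2 x y) config_algebra"
  using palm2 by (auto simp: palm_process2_def point_process_def)

interpretation M: prob_space M by (rule process_props)

lemma sets_\<Lambda>: "sets \<Lambda> = sets borel" "space \<Lambda> = UNIV"
proof -
  show "sets \<Lambda> = sets borel" by (simp add: mean_measure_def)
  from sets_eq_imp_space_eq[OF this] show "space \<Lambda> = UNIV" by simp
qed

lemma sets_\<Lambda>2: "sets \<Lambda>2 = sets (borel \<Otimes>\<^sub>M borel)" "space \<Lambda>2 = UNIV"
proof -
  have sp: "UNIV = space (borel \<Otimes>\<^sub>M (borel :: 'a measure))" by (simp add: space_pair_measure)
  show "sets \<Lambda>2 = sets (borel \<Otimes>\<^sub>M borel)"
    unfolding factorial_moment2_def by (subst sp) (rule sets.sets_measure_of_eq)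
  from sets_eq_imp_space_eq[OF this] show "space \<Lambda>2 = UNIV" by (simp add: space_pair_measure)
qed

lemma \<Xi>_config: "\<omega> \<in> space M \<Longrightarrow> \<Xi> \<omega> \<in> configs"
  using measurable_space[OF process_props(2)] by (simp add: space_config)

lemma total_mass_size: "\<omega> \<in> space M \<Longrightarrow> total_mass (\<Xi> \<omega>) = real (size (Y \<omega>))"
  using emb_pts[OF \<Xi>_config] total_mass_emb[of "pts (\<Xi> \<omega>)"] by (simp add: tally_def)

lemma measurable_Y: "Y \<in> measurable M (count_space UNIV)"
  by (rule measurable_compose[OF process_props(2) measurable_tally(1)])

lemma remove_tally:
  assumes "x \<in># m" shows "tally \<tau> (remove_point (emb m) x) = image_mset \<tau> m - {#\<tau> x#}"
  using assms by (simp add: remove_point_emb image_mset_Diff)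

text \<open>The Palm identity for functions of the discretized pair. \<open>\<phi>\<close> is
  arbitrary because the pair takes countably many values; the integral over a configuration becomes
  a sum over its tally.\<close>

lemma palm1_tally:
  "(\<integral>\<^sup>+\<omega>. (\<Sum>s\<in>#Y \<omega>. \<phi> s (Y \<omega> - {#s#})) \<partial>M)
    = (\<integral>\<^sup>+x. (\<integral>\<^sup>+\<omega>. \<phi> (\<tau> x) (tally \<tau> (\<Xi>1 x \<omega>)) \<partial>M1 x) \<partial>\<Lambda>)"
proof -
  let ?f = "\<lambda>(x, \<eta>). \<phi> (\<tau> x) (tally \<tau> \<eta>)"
  have "(\<integral>\<^sup>+\<omega>. (\<integral>\<^sup>+x. ?f (x, remove_point (\<Xi> \<omega>) x) \<partial>\<Xi> \<omega>) \<partial>M) = (\<integral>\<^sup>+x. (\<integral>\<^sup>+\<omega>. ?f (x, \<Xi>1 x \<omega>) \<partial>M1 x) \<partial>\<Lambda>)"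
    using palm1 measurable_pair_tally unfolding palm_process_def by blast
  moreover have "(\<integral>\<^sup>+x. ?f (x, remove_point (\<Xi> \<omega>) x) \<partial>\<Xi> \<omega>) = (\<Sum>s\<in>#Y \<omega>. \<phi> s (Y \<omega> - {#s#}))"
    if \<omega>: "\<omega> \<in> space M" for \<omega>
  proof -
    obtain m where m: "\<Xi> \<omega> = emb m" using emb_pts[OF \<Xi>_config[OF \<omega>], symmetric] by blast
    have "image_mset (\<lambda>x. ?f (x, remove_point (emb m) x)) m = image_mset (\<lambda>x. \<phi> (\<tau> x) (image_mset \<tau> m - {#\<tau> x#})) m"
      by (intro image_mset_cong) (simp add: remove_tally)
    then show ?thesis unfolding m nn_integral_emb tally_emb by (simp add: image_mset.compositionality comp_def)
  qed
  ultimately show ?thesis by (simp cong: nn_integral_cong)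
qed

lemma palm2_tally:
  "(\<integral>\<^sup>+\<omega>. (\<Sum>s\<in>#Y \<omega>. \<Sum>r\<in>#Y \<omega> - {#s#}. \<phi> s r (Y \<omega> - {#s#} - {#r#})) \<partial>M)
    = (\<integral>\<^sup>+(x, y). (\<integral>\<^sup>+\<omega>. \<phi> (\<tau> x) (\<tau> y) (tally \<tau> (\<Xi>2 x y \<omega>)) \<partial>M2 x y) \<partial>\<Lambda>2)"
proof -
  let ?f = "\<lambda>((x, y), \<eta>). \<phi> (\<tau> x) (\<tau> y) (tally \<tau> \<eta>)"
  have "(\<integral>\<^sup>+\<omega>. (\<integral>\<^sup>+x. (\<integral>\<^sup>+y. ?f ((x, y), remove_point (remove_point (\<Xi> \<omega>) x) y) \<partial>remove_point (\<Xi> \<omega>) x) \<partial>\<Xi> \<omega>) \<partial>M)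
      = (\<integral>\<^sup>+(x, y). (\<integral>\<^sup>+\<omega>. ?f ((x, y), \<Xi>2 x y \<omega>) \<partial>M2 x y) \<partial>\<Lambda>2)"
    using palm2 measurable_pair_tally2 unfolding palm_process2_def by blast
  moreover have "(\<integral>\<^sup>+x. (\<integral>\<^sup>+y. ?f ((x, y), remove_point (remove_point (\<Xi> \<omega>) x) y) \<partial>remove_point (\<Xi> \<omega>) x) \<partial>\<Xi> \<omega>)
      = (\<Sum>s\<in>#Y \<omega>. \<Sum>r\<in>#Y \<omega> - {#s#}. \<phi> s r (Y \<omega> - {#s#} - {#r#}))" if \<omega>: "\<omega> \<in> space M" for \<omega>
  proof -
    obtain m where m: "\<Xi> \<omega> = emb m" using emb_pts[OF \<Xi>_config[OF \<omega>], symmetric] by blast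
    have inner: "(\<integral>\<^sup>+y. ?f ((x, y), remove_point (remove_point (emb m) x) y) \<partial>remove_point (emb m) x)
       = (\<Sum>r\<in>#image_mset \<tau> m - {#\<tau> x#}. \<phi> (\<tau> x) r (image_mset \<tau> m - {#\<tau> x#} - {#r#}))" if x: "x \<in># m" for x
    proof -
      have im: "image_mset \<tau> (m - {#x#}) = image_mset \<tau> m - {#\<tau> x#}" using x by (simp add: image_mset_Diff)
      have "image_mset (\<lambda>y. ?f ((x, y), remove_point (emb (m - {#x#})) y)) (m - {#x#})
        = image_mset (\<lambda>y. \<phi> (\<tau> x) (\<tau> y) (image_mset \<tau> (m - {#x#}) - {#\<tau> y#})) (m - {#x#})"
        by (intro image_mset_cong) (simp add: remove_tally)
      then show ?thesis
        unfolding remove_point_emb[OF x] nn_integral_emb im[symmetric] by (simp add: image_mset.compositionality comp_def)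
    qed
    have "image_mset (\<lambda>x. \<integral>\<^sup>+y. ?f ((x, y), remove_point (remove_point (emb m) x) y) \<partial>remove_point (emb m) x) m
      = image_mset (\<lambda>x. \<Sum>r\<in>#image_mset \<tau> m - {#\<tau> x#}. \<phi> (\<tau> x) r (image_mset \<tau> m - {#\<tau> x#} - {#r#})) m"
      by (intro image_mset_cong inner)
    then show ?thesis unfolding m nn_integral_emb tally_emb by (simp add: image_mset.compositionality comp_def)
  qed
  ultimately show ?thesis by (simp cong: nn_integral_cong)
qed

abbreviation "J1 \<phi> x \<equiv> (\<integral>\<^sup>+\<omega>. ennreal (\<phi> (\<tau> x) (tally \<tau> (\<Xi>1 x \<omega>))) \<partial>M1 x)"
abbreviation "I1 \<phi> x \<equiv> (\<integral>\<omega>. \<phi> (\<tau> x) (tally \<tau> (\<Xi>1 x \<omega>)) \<partial>M1 x)"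
abbreviation "J2 \<phi> p \<equiv> (\<integral>\<^sup>+\<omega>. ennreal (\<phi> (\<tau> (fst p)) (\<tau> (snd p)) (tally \<tau> (\<Xi>2 (fst p) (snd p) \<omega>))) \<partial>M2 (fst p) (snd p))"
abbreviation "I2 \<phi> p \<equiv> (\<integral>\<omega>. \<phi> (\<tau> (fst p)) (\<tau> (snd p)) (tally \<tau> (\<Xi>2 (fst p) (snd p) \<omega>)) \<partial>M2 (fst p) (snd p))"

lemma measurable_tally1: "(\<lambda>\<omega>. \<phi> (tally \<tau> (\<Xi>1 x \<omega>)) :: 'b :: topological_space) \<in> borel_measurable (M1 x)"
  using measurable_compose[OF measurable_compose[OF palm1_props(2) measurable_tally(1)], of \<phi> borel] by simp

lemma measurable_tally2: "(\<lambda>\<omega>. \<phi> (tally \<tau> (\<Xi>2 x y \<omega>)) :: 'b :: topological_space) \<in> borel_measurable (M2 x y)"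
  using measurable_compose[OF measurable_compose[OF palm2_props(2) measurable_tally(1)], of \<phi> borel] by simp

lemma J1_measurable: "J1 \<phi> \<in> borel_measurable \<Lambda>"
proof -
  have L: "(\<lambda>x. distr (M1 x) config_algebra (\<Xi>1 x)) \<in> measurable borel (subprob_algebra config_algebra)"
    using palm1 unfolding palm_process_def by (intro measurable_prob_algebraD) blast
  have "(\<lambda>x. \<integral>\<^sup>+\<eta>. ennreal (\<phi> (\<tau> x) (tally \<tau> \<eta>)) \<partial>distr (M1 x) config_algebra (\<Xi>1 x)) \<in> borel_measurable borel"
    by (rule nn_integral_measurable_subprob_algebra2[OF measurable_pair_tally[of "\<lambda>s m. ennreal (\<phi> s m)"] L])
  moreover have "(\<integral>\<^sup>+\<eta>. ennreal (\<phi> (\<tau> x) (tally \<tau> \<eta>)) \<partial>distr (M1 x) config_algebra (\<Xi>1 x)) = J1 \<phi> x" for x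
    using measurable_compose[OF measurable_tally(1), of "\<lambda>m. ennreal (\<phi> (\<tau> x) m)" borel]
    by (subst nn_integral_distr[OF palm1_props(2)]) simp_all
  ultimately show ?thesis by (subst measurable_cong_sets[OF sets_\<Lambda>(1) refl]) simp
qed

lemma J2_measurable: "J2 \<phi> \<in> borel_measurable \<Lambda>2"
proof -
  have L: "(\<lambda>p. distr (M2 (fst p) (snd p)) config_algebra (\<Xi>2 (fst p) (snd p)))
      \<in> measurable (borel \<Otimes>\<^sub>M borel) (subprob_algebra config_algebra)"
    using palm2 unfolding palm_process2_def case_prod_unfold by (intro measurable_prob_algebraD) blast
  have "(\<lambda>(p, \<eta>). ennreal (\<phi> (\<tau> (fst p)) (\<tau> (snd p)) (tally \<tau> \<eta>))) \<in> borel_measurable ((borel \<Otimes>\<^sub>M borel) \<Otimes>\<^sub>M config_algebra)"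
    using measurable_pair_tally2[of "\<lambda>s r m. ennreal (\<phi> s r m)"] by (simp add: case_prod_unfold)
  from nn_integral_measurable_subprob_algebra2[OF this L]
  have "(\<lambda>p. \<integral>\<^sup>+\<eta>. ennreal (\<phi> (\<tau> (fst p)) (\<tau> (snd p)) (tally \<tau> \<eta>)) \<partial>distr (M2 (fst p) (snd p)) config_algebra (\<Xi>2 (fst p) (snd p)))
     \<in> borel_measurable (borel \<Otimes>\<^sub>M borel)" .
  moreover have "(\<integral>\<^sup>+\<eta>. ennreal (\<phi> (\<tau> (fst p)) (\<tau> (snd p)) (tally \<tau> \<eta>)) \<partial>distr (M2 (fst p) (snd p)) config_algebra (\<Xi>2 (fst p) (snd p))) = J2 \<phi> p" for p
    using measurable_compose[OF measurable_tally(1), of "\<lambda>m. ennreal (\<phi> (\<tau> (fst p)) (\<tau> (snd p)) m)" borel]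
    by (subst nn_integral_distr[OF palm2_props(2)]) simp_all
  ultimately show ?thesis by (subst measurable_cong_sets[OF sets_\<Lambda>2(1) refl]) simp
qed

text \<open>Integrability of the sum under \<open>M\<close> gives integrability under almost every
  Palm law. This is needed for the sizes, which are unbounded.\<close>

lemma palm1_real:
  fixes \<phi> :: "'a \<Rightarrow> 'a multiset \<Rightarrow> real"
  assumes nn: "\<And>s m. 0 \<le> \<phi> s m" and S: "integrable M (\<lambda>\<omega>. \<Sum>s\<in>#Y \<omega>. \<phi> s (Y \<omega> - {#s#}))"
  shows "AE x in \<Lambda>. integrable (M1 x) (\<lambda>\<omega>. \<phi> (\<tau> x) (tally \<tau> (\<Xi>1 x \<omega>)))"
    "integrable \<Lambda> (I1 \<phi>)" "(\<integral>x. I1 \<phi> x \<partial>\<Lambda>) = (\<integral>\<omega>. (\<Sum>s\<in>#Y \<omega>. \<phi> s (Y \<omega> - {#s#})) \<partial>M)"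
proof -
  have Snn: "0 \<le> (\<Sum>s\<in>#Y \<omega>. \<phi> s (Y \<omega> - {#s#}))" for \<omega> by (rule sum_mset_nonneg_real) (rule nn)
  have eq: "(\<integral>\<^sup>+x. J1 \<phi> x \<partial>\<Lambda>) = (\<integral>\<^sup>+\<omega>. ennreal (\<Sum>s\<in>#Y \<omega>. \<phi> s (Y \<omega> - {#s#})) \<partial>M)"
  proof -
    have "(\<integral>\<^sup>+x. J1 \<phi> x \<partial>\<Lambda>) = (\<integral>\<^sup>+\<omega>. (\<Sum>s\<in>#Y \<omega>. ennreal (\<phi> s (Y \<omega> - {#s#}))) \<partial>M)"
      by (rule palm1_tally[of "\<lambda>s m. ennreal (\<phi> s m)", symmetric])
    also have "\<dots> = (\<integral>\<^sup>+\<omega>. ennreal (\<Sum>s\<in>#Y \<omega>. \<phi> s (Y \<omega> - {#s#})) \<partial>M)"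
      by (intro nn_integral_cong ennreal_sum_mset nn)
    finally show ?thesis .
  qed
  have I1: "I1 \<phi> = (\<lambda>x. enn2real (J1 \<phi> x))"
    by (intro ext integral_eq_nn_integral measurable_tally1) (simp add: nn)
  note d = enn2real_disintegration[OF J1_measurable S Snn eq]
  show "AE x in \<Lambda>. integrable (M1 x) (\<lambda>\<omega>. \<phi> (\<tau> x) (tally \<tau> (\<Xi>1 x \<omega>)))"
    using d(1)
  proof eventually_elim
    case (elim x)
    then show ?case by (intro integrableI_nonneg measurable_tally1) (auto simp: nn)
  qed
  show "integrable \<Lambda> (I1 \<phi>)" "(\<integral>x. I1 \<phi> x \<partial>\<Lambda>) = (\<integral>\<omega>. (\<Sum>s\<in>#Y \<omega>. \<phi> s (Y \<omega> - {#s#})) \<partial>M)"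
    unfolding I1 by (rule d(2), rule d(3))
qed

lemma palm2_real:
  fixes \<phi> :: "'a \<Rightarrow> 'a \<Rightarrow> 'a multiset \<Rightarrow> real"
  assumes nn: "\<And>s r m. 0 \<le> \<phi> s r m"
    and S: "integrable M (\<lambda>\<omega>. \<Sum>s\<in>#Y \<omega>. \<Sum>r\<in>#Y \<omega> - {#s#}. \<phi> s r (Y \<omega> - {#s#} - {#r#}))"
  shows "AE p in \<Lambda>2. integrable (M2 (fst p) (snd p)) (\<lambda>\<omega>. \<phi> (\<tau> (fst p)) (\<tau> (snd p)) (tally \<tau> (\<Xi>2 (fst p) (snd p) \<omega>)))"
    "integrable \<Lambda>2 (I2 \<phi>)"
    "(\<integral>p. I2 \<phi> p \<partial>\<Lambda>2) = (\<integral>\<omega>. (\<Sum>s\<in>#Y \<omega>. \<Sum>r\<in>#Y \<omega> - {#s#}. \<phi> s r (Y \<omega> - {#s#} - {#r#})) \<partial>M)"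
proof -
  have in0: "0 \<le> (\<Sum>r\<in>#Y \<omega> - {#s#}. \<phi> s r (Y \<omega> - {#s#} - {#r#}))" for \<omega> s by (rule sum_mset_nonneg_real) (rule nn)
  have Snn: "0 \<le> (\<Sum>s\<in>#Y \<omega>. \<Sum>r\<in>#Y \<omega> - {#s#}. \<phi> s r (Y \<omega> - {#s#} - {#r#}))" for \<omega>
    by (rule sum_mset_nonneg_real) (rule in0)
  have eq: "(\<integral>\<^sup>+p. J2 \<phi> p \<partial>\<Lambda>2) = (\<integral>\<^sup>+\<omega>. ennreal (\<Sum>s\<in>#Y \<omega>. \<Sum>r\<in>#Y \<omega> - {#s#}. \<phi> s r (Y \<omega> - {#s#} - {#r#})) \<partial>M)"
  proof -
    have "(\<integral>\<^sup>+p. J2 \<phi> p \<partial>\<Lambda>2) = (\<integral>\<^sup>+(x, y). (\<integral>\<^sup>+\<omega>. ennreal (\<phi> (\<tau> x) (\<tau> y) (tally \<tau> (\<Xi>2 x y \<omega>))) \<partial>M2 x y) \<partial>\<Lambda>2)"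
      by (simp add: case_prod_unfold)
    also have "\<dots> = (\<integral>\<^sup>+\<omega>. (\<Sum>s\<in>#Y \<omega>. \<Sum>r\<in>#Y \<omega> - {#s#}. ennreal (\<phi> s r (Y \<omega> - {#s#} - {#r#}))) \<partial>M)"
      by (rule palm2_tally[of "\<lambda>s r m. ennreal (\<phi> s r m)", symmetric])
    also have "\<dots> = (\<integral>\<^sup>+\<omega>. ennreal (\<Sum>s\<in>#Y \<omega>. \<Sum>r\<in>#Y \<omega> - {#s#}. \<phi> s r (Y \<omega> - {#s#} - {#r#})) \<partial>M)"
      by (intro nn_integral_cong) (simp only: ennreal_sum_mset nn in0)
    finally show ?thesis .
  qed
  have I2: "I2 \<phi> = (\<lambda>p. enn2real (J2 \<phi> p))"
    by (intro ext integral_eq_nn_integral measurable_tally2) (simp add: nn)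
  note d = enn2real_disintegration[OF J2_measurable S Snn eq]
  show "AE p in \<Lambda>2. integrable (M2 (fst p) (snd p)) (\<lambda>\<omega>. \<phi> (\<tau> (fst p)) (\<tau> (snd p)) (tally \<tau> (\<Xi>2 (fst p) (snd p) \<omega>)))"
    using d(1)
  proof eventually_elim
    case (elim p)
    then show ?case by (intro integrableI_nonneg measurable_tally2) (auto simp: nn)
  qed
  show "integrable \<Lambda>2 (I2 \<phi>)"
    "(\<integral>p. I2 \<phi> p \<partial>\<Lambda>2) = (\<integral>\<omega>. (\<Sum>s\<in>#Y \<omega>. \<Sum>r\<in>#Y \<omega> - {#s#}. \<phi> s r (Y \<omega> - {#s#} - {#r#})) \<partial>M)"
    unfolding I2 by (rule d(2), rule d(3))
qed

section \<open>Moments of the number of points and bounded test functions\<close>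

context
  assumes third: "integrable M (\<lambda>\<omega>. total_mass (\<Xi> \<omega>) ^ 3)"
begin

abbreviation "sz \<omega> \<equiv> real (size (Y \<omega>))"

lemma measurable_Y_fun: "(\<lambda>\<omega>. \<phi> (Y \<omega>) :: real) \<in> borel_measurable M"
  by (rule measurable_compose[OF measurable_Y]) simp

lemma integrable_size3: "integrable M (\<lambda>\<omega>. sz \<omega> ^ 3)"
proof -
  have "integrable M (\<lambda>\<omega>. sz \<omega> ^ 3) = integrable M (\<lambda>\<omega>. total_mass (\<Xi> \<omega>) ^ 3)"
    by (intro Bochner_Integration.integrable_cong refl) (simp add: total_mass_size)
  then show ?thesis using third by simp
qed

text \<open>The third moment dominates every sum that occurs: single sums over points, double sums
  over pairs and the size itself.\<close>

lemma integrable_poly: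
  assumes "\<And>m. \<bar>\<phi> m\<bar> \<le> c * (1 + real (size m) ^ 3)"
  shows "integrable M (\<lambda>\<omega>. \<phi> (Y \<omega>))"
proof (rule Bochner_Integration.integrable_bound)
  show "integrable M (\<lambda>\<omega>. c * (1 + sz \<omega> ^ 3))" using integrable_size3 by auto
  show "AE \<omega> in M. norm (\<phi> (Y \<omega>)) \<le> norm (c * (1 + sz \<omega> ^ 3))"
    using assms by (intro AE_I2) (auto intro: order.trans[OF _ abs_ge_self])
qed (rule measurable_Y_fun)

lemma power_le_cubic: "(x::real) \<ge> 0 \<Longrightarrow> x \<le> 1 + x ^ 3" "(x::real) \<ge> 0 \<Longrightarrow> x ^ 2 \<le> 1 + x ^ 3"
proof -
  assume x: "x \<ge> 0"
  have "x \<le> 1 + x ^ 3 \<and> x ^ 2 \<le> 1 + x ^ 3"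
  proof (cases "x \<le> 1")
    case True
    then have "x ^ 2 \<le> 1" "x ^ 3 \<ge> 0" using x by (auto simp: power_le_one)
    then show ?thesis using True by linarith
  next
    case False
    then have "x ^ 1 \<le> x ^ 3" "x ^ 2 \<le> x ^ 3" by (intro power_increasing; simp)+
    then show ?thesis by simp
  qed
  then show "x \<le> 1 + x ^ 3" "x ^ 2 \<le> 1 + x ^ 3" by auto
qed

lemma integrable_size: "integrable M sz" "integrable M (\<lambda>\<omega>. sz \<omega> ^ 2)"
  using integrable_poly[of "\<lambda>m. real (size m)" 1] integrable_poly[of "\<lambda>m. real (size m) ^ 2" 1] power_le_cubic by auto

lemma double_sum_le:
  fixes \<phi> :: "'a \<Rightarrow> 'a \<Rightarrow> 'a multiset \<Rightarrow> real"
  assumes "\<And>s r m. \<bar>\<phi> s r m\<bar> \<le> c"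
  shows "\<bar>\<Sum>s\<in>#m. \<Sum>r\<in>#m - {#s#}. \<phi> s r (m - {#s#} - {#r#})\<bar> \<le> c * (1 + real (size m) ^ 3)"
proof -
  have c: "c \<ge> 0" using assms[of undefined undefined undefined] by linarith
  have "\<bar>\<Sum>s\<in>#m. \<Sum>r\<in>#m - {#s#}. \<phi> s r (m - {#s#} - {#r#})\<bar> \<le> real (size m) * (real (size m) * c)"
  proof (rule sum_mset_abs_le)
    fix s
    have "\<bar>\<Sum>r\<in>#m - {#s#}. \<phi> s r (m - {#s#} - {#r#})\<bar> \<le> real (size (m - {#s#})) * c"
      by (rule sum_mset_abs_le) (rule assms)
    also have "\<dots> \<le> real (size m) * c" using c by (intro mult_right_mono) (auto intro!: size_mset_mono)
    finally show "\<bar>\<Sum>r\<in>#m - {#s#}. \<phi> s r (m - {#s#} - {#r#})\<bar> \<le> real (size m) * c" .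
  qed
  also have "\<dots> = c * real (size m) ^ 2" by (simp add: power2_eq_square)
  also have "\<dots> \<le> c * (1 + real (size m) ^ 3)" using c power_le_cubic(2)[of "real (size m)"] by (intro mult_left_mono) auto
  finally show ?thesis .
qed

lemma single_sum_le:
  fixes \<phi> :: "'a \<Rightarrow> 'a multiset \<Rightarrow> real"
  assumes "\<And>s m. \<bar>\<phi> s m\<bar> \<le> c"
  shows "\<bar>\<Sum>s\<in>#m. \<phi> s (m - {#s#})\<bar> \<le> c * (1 + real (size m) ^ 3)"
proof -
  have c: "c \<ge> 0" using assms[of undefined undefined] by linarith
  have "\<bar>\<Sum>s\<in>#m. \<phi> s (m - {#s#})\<bar> \<le> real (size m) * c" by (rule sum_mset_abs_le) (rule assms)
  also have "\<dots> = c * real (size m)" by simp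
  also have "\<dots> \<le> c * (1 + real (size m) ^ 3)" using c power_le_cubic(1)[of "real (size m)"] by (intro mult_left_mono) auto
  finally show ?thesis .
qed

text \<open>Ordered selections without replacement produce factorial powers of the size, whose means
  are the moments in the definition of \<beta>.\<close>

lemma size_sums:
  "(\<Sum>s\<in>#m. real (size (m - {#s#}))) = real (size m) * (real (size m) - 1)"
  "(\<Sum>s\<in>#m. \<Sum>r\<in>#m - {#s#}. c) = real (size m) * (real (size m) - 1) * (c :: real)"
  "(\<Sum>s\<in>#m. \<Sum>r\<in>#m - {#s#}. real (size (m - {#s#} - {#r#}))) = real (size m) * (real (size m) - 1) * (real (size m) - 2)"
proof -
  have 1: "(\<Sum>s\<in>#m. real (size (m - {#s#})) * d) = real (size m) * (real (size m) - 1) * d" for m :: "'b multiset" and d :: real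
  proof -
    have "image_mset (\<lambda>s. real (size (m - {#s#})) * d) m = image_mset (\<lambda>s. (real (size m) - 1) * d) m"
      by (intro image_mset_cong) (simp add: size_remove1)
    then show ?thesis by simp
  qed
  show "(\<Sum>s\<in>#m. real (size (m - {#s#}))) = real (size m) * (real (size m) - 1)" using 1[of m 1] by simp
  show "(\<Sum>s\<in>#m. \<Sum>r\<in>#m - {#s#}. c) = real (size m) * (real (size m) - 1) * c" using 1[of m c] by simp
  have "image_mset (\<lambda>s. \<Sum>r\<in>#m - {#s#}. real (size (m - {#s#} - {#r#}))) m
     = image_mset (\<lambda>s. (real (size m) - 1) * (real (size m) - 2)) m"
  proof (intro image_mset_cong)
    fix s assume "s \<in># m"
    then show "(\<Sum>r\<in>#m - {#s#}. real (size (m - {#s#} - {#r#}))) = (real (size m) - 1) * (real (size m) - 2)"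
      using 1[of "m - {#s#}" 1] size_remove1[of s m] by simp
  qed
  then show "(\<Sum>s\<in>#m. \<Sum>r\<in>#m - {#s#}. real (size (m - {#s#} - {#r#}))) = real (size m) * (real (size m) - 1) * (real (size m) - 2)"
    by simp
qed

text \<open>The Palm identity for the constant 1, so the total mass of the intensity comes without
  evaluating its set function.\<close>

lemma mean_measure_mass: "emeasure \<Lambda> UNIV = ennreal (\<integral>\<omega>. sz \<omega> \<partial>M)"
proof -
  have "emeasure \<Lambda> UNIV = (\<integral>\<^sup>+x. (\<integral>\<^sup>+\<omega>. 1 \<partial>M1 x) \<partial>\<Lambda>)"
    using sets_\<Lambda> by (simp add: prob_space.emeasure_space_1[OF palm1_props(1)])
  also have "\<dots> = (\<integral>\<^sup>+\<omega>. (\<Sum>s\<in>#Y \<omega>. 1) \<partial>M)" by (rule palm1_tally[of "\<lambda>_ _. 1", symmetric])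
  also have "\<dots> = (\<integral>\<^sup>+\<omega>. ennreal (sz \<omega>) \<partial>M)" by (simp add: ennreal_of_nat_eq_real_of_nat)
  also have "\<dots> = ennreal (\<integral>\<omega>. sz \<omega> \<partial>M)" using integrable_size by (intro nn_integral_eq_integral) auto
  finally show ?thesis .
qed

lemma moment2_mass: "emeasure \<Lambda>2 UNIV = ennreal ((\<integral>\<omega>. sz \<omega> ^ 2 \<partial>M) - (\<integral>\<omega>. sz \<omega> \<partial>M))"
proof -
  have nn: "0 \<le> sz \<omega> * (sz \<omega> - 1)" for \<omega> by (cases "size (Y \<omega>)") auto
  have "emeasure \<Lambda>2 UNIV = (\<integral>\<^sup>+(x, y). (\<integral>\<^sup>+\<omega>. ennreal 1 \<partial>M2 x y) \<partial>\<Lambda>2)"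
    using sets_\<Lambda>2 by (simp add: prob_space.emeasure_space_1[OF palm2_props(1)] case_prod_unfold)
  also have "\<dots> = (\<integral>\<^sup>+\<omega>. (\<Sum>s\<in>#Y \<omega>. \<Sum>r\<in>#Y \<omega> - {#s#}. ennreal 1) \<partial>M)" by (rule palm2_tally[of "\<lambda>_ _ _. ennreal 1", symmetric])
  also have "\<dots> = (\<integral>\<^sup>+\<omega>. ennreal (sz \<omega> * (sz \<omega> - 1)) \<partial>M)"
  proof (rule nn_integral_cong)
    fix \<omega>
    have "(\<Sum>s\<in>#Y \<omega>. \<Sum>r\<in>#Y \<omega> - {#s#}. ennreal 1) = (\<Sum>s\<in>#Y \<omega>. ennreal (\<Sum>r\<in>#Y \<omega> - {#s#}. 1))"
      by (subst ennreal_sum_mset) auto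
    also have "\<dots> = ennreal (\<Sum>s\<in>#Y \<omega>. \<Sum>r\<in>#Y \<omega> - {#s#}. 1)"
      by (rule ennreal_sum_mset) (simp add: sum_mset_nonneg_real)
    finally show "(\<Sum>s\<in>#Y \<omega>. \<Sum>r\<in>#Y \<omega> - {#s#}. ennreal 1) = ennreal (sz \<omega> * (sz \<omega> - 1))" using size_sums(2)[where c=1 and m="Y \<omega>"] by simp
  qed
  also have "\<dots> = ennreal (\<integral>\<omega>. sz \<omega> * (sz \<omega> - 1) \<partial>M)"
    using integrable_size nn by (intro nn_integral_eq_integral) (auto simp: right_diff_distrib power2_eq_square)
  also have "(\<integral>\<omega>. sz \<omega> * (sz \<omega> - 1) \<partial>M) = (\<integral>\<omega>. sz \<omega> ^ 2 \<partial>M) - (\<integral>\<omega>. sz \<omega> \<partial>M)"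
    using integrable_size by (simp add: right_diff_distrib power2_eq_square)
  finally show ?thesis .
qed

lemma finite_\<Lambda>: "finite_measure \<Lambda>" and finite_\<Lambda>2: "finite_measure \<Lambda>2"
  by (intro finite_measureI; simp add: sets_\<Lambda> sets_\<Lambda>2 mean_measure_mass moment2_mass)+

text \<open>Signed functions are reduced to nonnegative ones by adding their bound; the added
  constant contributes \<open>c * e1\<close> on both sides, where \<open>e1\<close> is the mean
  number of points.\<close>

lemma palm1_bounded:
  fixes \<phi> :: "'a \<Rightarrow> 'a multiset \<Rightarrow> real"
  assumes bd: "\<And>s m. \<bar>\<phi> s m\<bar> \<le> c"
  shows "integrable \<Lambda> (I1 \<phi>)" "(\<integral>x. I1 \<phi> x \<partial>\<Lambda>) = (\<integral>\<omega>. (\<Sum>s\<in>#Y \<omega>. \<phi> s (Y \<omega> - {#s#})) \<partial>M)"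
proof -
  interpret L: finite_measure \<Lambda> by (rule finite_\<Lambda>)
  let ?\<psi> = "\<lambda>s m. \<phi> s m + c"
  have b2: "\<bar>?\<psi> s m\<bar> \<le> 2 * c" "0 \<le> ?\<psi> s m" for s m using bd[of s m] by auto
  have S: "integrable M (\<lambda>\<omega>. \<Sum>s\<in>#Y \<omega>. ?\<psi> s (Y \<omega> - {#s#}))" by (rule integrable_poly) (rule single_sum_le[OF b2(1)])
  have S0: "integrable M (\<lambda>\<omega>. \<Sum>s\<in>#Y \<omega>. \<phi> s (Y \<omega> - {#s#}))" by (rule integrable_poly) (rule single_sum_le[OF bd])
  note P = palm1_real[of ?\<psi>, OF b2(2) S]
  have I: "I1 ?\<psi> x = I1 \<phi> x + c" for x
  proof -
    interpret N: prob_space "M1 x" by (rule palm1_props)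
    have "integrable (M1 x) (\<lambda>\<omega>. \<phi> (\<tau> x) (tally \<tau> (\<Xi>1 x \<omega>)))"
      using bd by (intro N.integrable_const_bound[where B=c] measurable_tally1) auto
    then show ?thesis by (simp add: N.prob_space)
  qed
  have iL: "integrable \<Lambda> (\<lambda>x. (I1 \<phi> x + c) - c)" using P(2) unfolding I by (intro Bochner_Integration.integrable_diff) auto
  then show i: "integrable \<Lambda> (I1 \<phi>)" by simp
  have "(\<integral>x. I1 \<phi> x \<partial>\<Lambda>) + c * (\<integral>\<omega>. sz \<omega> \<partial>M) = (\<integral>x. I1 ?\<psi> x \<partial>\<Lambda>)"
    unfolding I using i sets_\<Lambda> mean_measure_mass by (simp add: measure_def integral_nonneg_AE mult.commute)
  also have "\<dots> = (\<integral>\<omega>. (\<Sum>s\<in>#Y \<omega>. \<phi> s (Y \<omega> - {#s#})) + c * sz \<omega> \<partial>M)"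
    unfolding P(3) by (simp add: sum_mset.distrib mult.commute)
  also have "\<dots> = (\<integral>\<omega>. (\<Sum>s\<in>#Y \<omega>. \<phi> s (Y \<omega> - {#s#})) \<partial>M) + c * (\<integral>\<omega>. sz \<omega> \<partial>M)"
    using S0 integrable_size by simp
  finally show "(\<integral>x. I1 \<phi> x \<partial>\<Lambda>) = (\<integral>\<omega>. (\<Sum>s\<in>#Y \<omega>. \<phi> s (Y \<omega> - {#s#})) \<partial>M)" by simp
qed

lemma palm2_bounded:
  fixes \<phi> :: "'a \<Rightarrow> 'a \<Rightarrow> 'a multiset \<Rightarrow> real"
  assumes bd: "\<And>s r m. \<bar>\<phi> s r m\<bar> \<le> c"
  shows "integrable \<Lambda>2 (I2 \<phi>)"
    "(\<integral>p. I2 \<phi> p \<partial>\<Lambda>2) = (\<integral>\<omega>. (\<Sum>s\<in>#Y \<omega>. \<Sum>r\<in>#Y \<omega> - {#s#}. \<phi> s r (Y \<omega> - {#s#} - {#r#})) \<partial>M)"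
proof -
  interpret L: finite_measure \<Lambda>2 by (rule finite_\<Lambda>2)
  let ?\<psi> = "\<lambda>s r m. \<phi> s r m + c"
  have b2: "\<bar>?\<psi> s r m\<bar> \<le> 2 * c" "0 \<le> ?\<psi> s r m" for s r m using bd[of s r m] by auto
  have S: "integrable M (\<lambda>\<omega>. \<Sum>s\<in>#Y \<omega>. \<Sum>r\<in>#Y \<omega> - {#s#}. ?\<psi> s r (Y \<omega> - {#s#} - {#r#}))"
    by (rule integrable_poly) (rule double_sum_le[of ?\<psi>, OF b2(1)])
  have S0: "integrable M (\<lambda>\<omega>. \<Sum>s\<in>#Y \<omega>. \<Sum>r\<in>#Y \<omega> - {#s#}. \<phi> s r (Y \<omega> - {#s#} - {#r#}))"
    by (rule integrable_poly) (rule double_sum_le[OF bd])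
  note P = palm2_real[of ?\<psi>, OF b2(2) S]
  have I: "I2 ?\<psi> p = I2 \<phi> p + c" for p
  proof -
    interpret N: prob_space "M2 (fst p) (snd p)" by (rule palm2_props)
    have "integrable (M2 (fst p) (snd p)) (\<lambda>\<omega>. \<phi> (\<tau> (fst p)) (\<tau> (snd p)) (tally \<tau> (\<Xi>2 (fst p) (snd p) \<omega>)))"
      using bd by (intro N.integrable_const_bound[where B=c] measurable_tally2) auto
    then show ?thesis by (simp add: N.prob_space)
  qed
  have iL: "integrable \<Lambda>2 (\<lambda>x. (I2 \<phi> x + c) - c)" using P(2) unfolding I by (intro Bochner_Integration.integrable_diff) auto
  then show i: "integrable \<Lambda>2 (I2 \<phi>)" by simp
  let ?q = "\<lambda>\<omega>. sz \<omega> * (sz \<omega> - 1)"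
  have iq: "integrable M ?q" using integrable_size by (simp add: right_diff_distrib power2_eq_square)
  have qnn: "0 \<le> ?q \<omega>" for \<omega> by (cases "size (Y \<omega>)") auto
  have mass: "measure \<Lambda>2 UNIV = (\<integral>\<omega>. ?q \<omega> \<partial>M)"
  proof -
    have "(\<integral>\<omega>. ?q \<omega> \<partial>M) = (\<integral>\<omega>. sz \<omega> ^ 2 \<partial>M) - (\<integral>\<omega>. sz \<omega> \<partial>M)"
      using integrable_size by (simp add: right_diff_distrib power2_eq_square)
    moreover have "0 \<le> (\<integral>\<omega>. ?q \<omega> \<partial>M)" using qnn by (intro integral_nonneg_AE) auto
    ultimately show ?thesis unfolding measure_def moment2_mass by simp
  qed
  have "(\<integral>x. I2 \<phi> x \<partial>\<Lambda>2) + c * (\<integral>\<omega>. ?q \<omega> \<partial>M) = (\<integral>x. I2 ?\<psi> x \<partial>\<Lambda>2)"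
    unfolding I using i sets_\<Lambda>2 mass by (simp add: mult.commute)
  also have "\<dots> = (\<integral>\<omega>. (\<Sum>s\<in>#Y \<omega>. \<Sum>r\<in>#Y \<omega> - {#s#}. \<phi> s r (Y \<omega> - {#s#} - {#r#})) + c * ?q \<omega> \<partial>M)"
    unfolding P(3)
  proof (intro Bochner_Integration.integral_cong refl)
    fix \<omega>
    show "(\<Sum>s\<in>#Y \<omega>. \<Sum>r\<in>#Y \<omega> - {#s#}. ?\<psi> s r (Y \<omega> - {#s#} - {#r#}))
       = (\<Sum>s\<in>#Y \<omega>. \<Sum>r\<in>#Y \<omega> - {#s#}. \<phi> s r (Y \<omega> - {#s#} - {#r#})) + c * ?q \<omega>"
      using size_sums(2)[where m="Y \<omega>" and c=c] by (simp only: sum_mset.distrib mult.commute)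
  qed
  also have "\<dots> = (\<integral>\<omega>. (\<Sum>s\<in>#Y \<omega>. \<Sum>r\<in>#Y \<omega> - {#s#}. \<phi> s r (Y \<omega> - {#s#} - {#r#})) \<partial>M) + c * (\<integral>\<omega>. ?q \<omega> \<partial>M)"
    using S0 iq by simp
  finally show "(\<integral>p. I2 \<phi> p \<partial>\<Lambda>2) = (\<integral>\<omega>. (\<Sum>s\<in>#Y \<omega>. \<Sum>r\<in>#Y \<omega> - {#s#}. \<phi> s r (Y \<omega> - {#s#} - {#r#})) \<partial>M)" by simp
qed

end

end

end

section \<open>The generator applied to a locally dependent process\<close>

lemma integral_finite_range:
  fixes h :: "'b \<Rightarrow> real"
  assumes L: "finite_measure L" and C: "finite C" and g: "\<And>x. g x \<in> C" "\<And>s. g -` {s} \<in> sets L"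
  shows "integrable L (\<lambda>x. h (g x))" "(\<integral>x. h (g x) \<partial>L) = (\<Sum>s\<in>C. h s * measure L (g -` {s}))"
proof -
  interpret L: finite_measure L by (rule L)
  have eq: "h (g x) = (\<Sum>s\<in>C. h s * indicator (g -` {s}) x)" for x
  proof -
    have "(\<Sum>s\<in>C. h s * indicator (g -` {s}) x) = (\<Sum>s\<in>C. if s = g x then h s else 0)"
      by (intro sum.cong) (auto simp: indicator_def)
    then show ?thesis using C g(1) by (simp add: sum.delta)
  qed
  have i: "integrable L (\<lambda>x. h s * indicator (g -` {s}) x)" for s
    using g(2) by (intro integrable_mult_right integrable_real_indicator) (auto simp: L.emeasure_eq_measure)
  show "integrable L (\<lambda>x. h (g x))" unfolding eq using i by (intro Bochner_Integration.integrable_sum)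
  show "(\<integral>x. h (g x) \<partial>L) = (\<Sum>s\<in>C. h s * measure L (g -` {s}))"
    unfolding eq using i g(2) by (subst Bochner_Integration.integral_sum) auto
qed

text \<open>The algebra of the cancellation, isolated: subtracting \<open>c\<close> times size
  differences from the local terms changes the total by \<open>c\<close> times one combination of
  moments.\<close>

lemma linear_balance:
  fixes g :: real
  assumes "g = h1 + b * h2 - (k1 + b * k2)" "q = h1 - k1 - c * \<alpha>" "r = h2 - k2 - c * \<gamma>"
  shows "g - (q + b * r) = c * (\<alpha> + b * \<gamma>)"
  unfolding assms by (simp add: algebra_simps)

context discretization
begin

text \<open>The configuration outside the larger set is a function of the one outside the smaller
  set, so equality of laws is inherited.\<close>

lemma distr_restr_mono:
  fixes \<Psi> :: "'n \<Rightarrow> 'a measure" and \<Xi> :: "'m \<Rightarrow> 'a measure"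
  assumes N: "prob_space N" "\<Psi> \<in> measurable N config_algebra" and M: "prob_space M" "\<Xi> \<in> measurable M config_algebra"
    and AB: "A \<in> sets borel" "B \<in> sets borel" "A \<subseteq> B"
    and eq: "distr N config_algebra (\<lambda>\<omega>. restr (- A) (\<Psi> \<omega>)) = distr M config_algebra (\<lambda>\<omega>. restr (- A) (\<Xi> \<omega>))"
  shows "distr N config_algebra (\<lambda>\<omega>. restr (- B) (\<Psi> \<omega>)) = distr M config_algebra (\<lambda>\<omega>. restr (- B) (\<Xi> \<omega>))"
proof -
  have s: "- A \<in> sets borel" "- B \<in> sets borel" using AB by auto
  have *: "distr K config_algebra (\<lambda>\<omega>. restr (- B) (Z \<omega>))
      = distr (distr K config_algebra (\<lambda>\<omega>. restr (- A) (Z \<omega>))) config_algebra (restr (- B))"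
    if K: "prob_space K" "Z \<in> measurable K config_algebra" for K :: "'k measure" and Z :: "'k \<Rightarrow> 'a measure"
  proof -
    have "distr (distr K config_algebra (\<lambda>\<omega>. restr (- A) (Z \<omega>))) config_algebra (restr (- B))
       = distr K config_algebra (restr (- B) \<circ> (\<lambda>\<omega>. restr (- A) (Z \<omega>)))"
      by (rule distr_distr[OF measurable_restr[OF s(2)] measurable_restr_process[OF K AB(1) s(1)]])
    also have "\<dots> = distr K config_algebra (\<lambda>\<omega>. restr (- B) (Z \<omega>))"
    proof (intro distr_cong refl)
      fix \<omega> assume "\<omega> \<in> space K"
      moreover have "- B \<inter> - A = - B" using AB(3) by blast
      ultimately show "(restr (- B) \<circ> (\<lambda>\<omega>. restr (- A) (Z \<omega>))) \<omega> = restr (- B) (Z \<omega>)"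
        using restr_restr[OF \<Psi>_config[OF K AB(1)] s(2,1)] by simp
    qed
    finally show ?thesis ..
  qed
  show ?thesis unfolding *[OF N] *[OF M] eq ..
qed

end

context stein_discretization
begin

abbreviation "mean_c0 M \<Xi> \<equiv> (\<integral>\<omega>. V s0 s0 (tally \<tau> (\<Xi> \<omega>)) \<partial>M)"

text \<open>Both processes are compared with their restrictions outside \<open>A\<close>. These have
  the same law, so their contributions to the increment and to the mean size cancel, and
  \<open>eps1_bound\<close> is applied once to each process.\<close>

lemma local_pair_bound:
  fixes \<Psi> :: "'n \<Rightarrow> 'a measure" and \<Xi> :: "'m \<Rightarrow> 'a measure"
  assumes M: "prob_space M" "\<Xi> \<in> measurable M config_algebra" and N: "prob_space N" "\<Psi> \<in> measurable N config_algebra"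
    and AB: "A \<in> sets borel" "B \<in> sets borel" "A \<subseteq> B"
    and eq: "distr N config_algebra (\<lambda>\<omega>. restr (- A) (\<Psi> \<omega>)) = distr M config_algebra (\<lambda>\<omega>. restr (- A) (\<Xi> \<omega>))"
    and ind: "indep_restr M \<Xi> (- B) A" "indep_restr N \<Psi> (- B) A"
    and fin: "integrable M (\<lambda>\<omega>. real (size (tally \<tau> (\<Xi> \<omega>))))" "integrable N (\<lambda>\<omega>. real (size (tally \<tau> (\<Psi> \<omega>))))"
    and x: "x \<in> centers"
  shows "ennreal \<bar>(\<integral>\<omega>. D x (tally \<tau> (\<Xi> \<omega>)) \<partial>M) - (\<integral>\<omega>. D x (tally \<tau> (\<Psi> \<omega>)) \<partial>N)
      - mean_c0 M \<Xi> * ((\<integral>\<omega>. real (size (tally \<tau> (\<Xi> \<omega>))) \<partial>M) - (\<integral>\<omega>. real (size (tally \<tau> (\<Psi> \<omega>))) \<partial>N))\<bar>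
    \<le> (\<integral>\<^sup>+\<omega>. eps1 a u k G t M \<Xi> A B N \<Psi> \<omega> \<partial>N) + (\<integral>\<^sup>+\<omega>. eps1 a u k G t M \<Xi> A B M \<Xi> \<omega> \<partial>M)"
proof -
  have Ac: "- A \<in> sets borel" using AB by auto
  have split: "integrable K (\<lambda>\<omega>. real (size (tally \<tau> (restr A (Z \<omega>)))))"
      "(\<integral>\<omega>. real (size (tally \<tau> (Z \<omega>))) \<partial>K)
        = (\<integral>\<omega>. real (size (tally \<tau> (restr A (Z \<omega>)))) \<partial>K) + (\<integral>\<omega>. real (size (tally \<tau> (restr (- A) (Z \<omega>)))) \<partial>K)"
    if K: "prob_space K" "Z \<in> measurable K config_algebra" and f: "integrable K (\<lambda>\<omega>. real (size (tally \<tau> (Z \<omega>))))"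
    for K :: "'k measure" and Z :: "'k \<Rightarrow> 'a measure"
  proof -
    have dec: "tally \<tau> (Z \<omega>) = tally \<tau> (restr A (Z \<omega>)) + tally \<tau> (restr (- A) (Z \<omega>))" if "\<omega> \<in> space K" for \<omega>
      using tally_restr_add[OF \<Psi>_config[OF K AB(1) that] AB(1) Ac] restr_UNIV[OF \<Psi>_config[OF K AB(1) that]]
      by (simp add: Compl_partition)
    have m: "(\<lambda>\<omega>. real (size (tally \<tau> (restr C (Z \<omega>))))) \<in> borel_measurable K" if "C \<in> sets borel" for C
      by (rule measurable_compose[OF measurable_tally_restr[OF K AB(1) that]]) simp
    have i: "integrable K (\<lambda>\<omega>. real (size (tally \<tau> (restr A (Z \<omega>)))))" "integrable K (\<lambda>\<omega>. real (size (tally \<tau> (restr (- A) (Z \<omega>)))))"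
      by (rule Bochner_Integration.integrable_bound[OF f m[OF AB(1)]], rule AE_I2, simp add: dec)
         (rule Bochner_Integration.integrable_bound[OF f m[OF Ac]], rule AE_I2, simp add: dec)
    show "integrable K (\<lambda>\<omega>. real (size (tally \<tau> (restr A (Z \<omega>)))))" by (rule i)
    have "(\<integral>\<omega>. real (size (tally \<tau> (Z \<omega>))) \<partial>K)
       = (\<integral>\<omega>. real (size (tally \<tau> (restr A (Z \<omega>)))) + real (size (tally \<tau> (restr (- A) (Z \<omega>)))) \<partial>K)"
      by (intro Bochner_Integration.integral_cong refl) (simp add: dec)
    then show "(\<integral>\<omega>. real (size (tally \<tau> (Z \<omega>))) \<partial>K)
        = (\<integral>\<omega>. real (size (tally \<tau> (restr A (Z \<omega>)))) \<partial>K) + (\<integral>\<omega>. real (size (tally \<tau> (restr (- A) (Z \<omega>)))) \<partial>K)"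
      using i by simp
  qed
  have same: "(\<integral>\<omega>. \<phi> (tally \<tau> (restr (- A) (\<Psi> \<omega>))) \<partial>N) = (\<integral>\<omega>. \<phi> (tally \<tau> (restr (- A) (\<Xi> \<omega>))) \<partial>M)"
    for \<phi> :: "'a multiset \<Rightarrow> real"
  proof -
    have m: "(\<lambda>\<xi>. \<phi> (tally \<tau> \<xi>)) \<in> borel_measurable config_algebra"
      by (rule measurable_compose[OF measurable_tally(1)]) simp
    have "(\<integral>\<omega>. \<phi> (tally \<tau> (restr (- A) (\<Psi> \<omega>))) \<partial>N)
        = (\<integral>\<xi>. \<phi> (tally \<tau> \<xi>) \<partial>distr N config_algebra (\<lambda>\<omega>. restr (- A) (\<Psi> \<omega>)))"
      by (rule integral_distr[OF measurable_restr_process[OF N AB(1) Ac] m, symmetric])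
    also have "\<dots> = (\<integral>\<omega>. \<phi> (tally \<tau> (restr (- A) (\<Xi> \<omega>))) \<partial>M)"
      unfolding eq by (rule integral_distr[OF measurable_restr_process[OF M AB(1) Ac] m])
    finally show ?thesis .
  qed
  note sM = split[OF M fin(1)] and sN = split[OF N fin(2)]
  note bN = eps1_bound[OF M N AB(2) distr_restr_mono[OF N M AB eq] AB(1,3) ind(2) sN(1) x]
  note bM = eps1_bound[OF M M AB(2) refl AB(1,3) ind(1) sM(1) x]
  let ?c = "mean_c0 M \<Xi>"
  define p where "p = (\<integral>\<omega>. D x (tally \<tau> (\<Xi> \<omega>)) \<partial>M) - (\<integral>\<omega>. D x (tally \<tau> (restr (- A) (\<Xi> \<omega>))) \<partial>M)
      - ?c * (\<integral>\<omega>. real (size (tally \<tau> (restr A (\<Xi> \<omega>)))) \<partial>M)"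
  define q where "q = (\<integral>\<omega>. D x (tally \<tau> (\<Psi> \<omega>)) \<partial>N) - (\<integral>\<omega>. D x (tally \<tau> (restr (- A) (\<Psi> \<omega>))) \<partial>N)
      - ?c * (\<integral>\<omega>. real (size (tally \<tau> (restr A (\<Psi> \<omega>)))) \<partial>N)"
  have e: "(\<integral>\<omega>. D x (tally \<tau> (\<Xi> \<omega>)) \<partial>M) - (\<integral>\<omega>. D x (tally \<tau> (\<Psi> \<omega>)) \<partial>N)
      - ?c * ((\<integral>\<omega>. real (size (tally \<tau> (\<Xi> \<omega>))) \<partial>M) - (\<integral>\<omega>. real (size (tally \<tau> (\<Psi> \<omega>))) \<partial>N)) = p - q"
    unfolding p_def q_def sM(2) sN(2) same[of "D x"] same[of "\<lambda>m. real (size m)"] by (simp add: algebra_simps)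
  have "ennreal \<bar>p - q\<bar> \<le> ennreal (\<bar>q\<bar> + \<bar>p\<bar>)" by (intro ennreal_leI) linarith
  also have "\<dots> = ennreal \<bar>q\<bar> + ennreal \<bar>p\<bar>" by (simp add: ennreal_plus)
  also have "\<dots> \<le> (\<integral>\<^sup>+\<omega>. eps1 a u k G t M \<Xi> A B N \<Psi> \<omega> \<partial>N) + (\<integral>\<^sup>+\<omega>. eps1 a u k G t M \<Xi> A B M \<Xi> \<omega> \<partial>M)"
    unfolding p_def q_def by (intro add_mono bN bM)
  finally show ?thesis unfolding e .
qed

text \<open>A point dies at rate 1 on its own plus rate b for every other point present. Written
  this way the deaths are a sum over points and a sum over ordered pairs, exactly what first and
  second order Palm processes describe.\<close>

lemma generator_pointwise:
  "\<epsilon> * sol m - f m = a * Nu (\<lambda>s. D s m)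
    - ((\<Sum>s\<in>#m. D s (m - {#s#})) + b * (\<Sum>s\<in>#m. \<Sum>r\<in>#m - {#s#}. D s (add_mset r (m - {#s#} - {#r#}))))"
proof -
  have 1: "(\<Sum>s\<in>#m. sol (m - {#s#}) - sol m) = - (\<Sum>s\<in>#m. D s (m - {#s#}))"
  proof -
    have "image_mset (\<lambda>s. sol (m - {#s#}) - sol m) m = image_mset (\<lambda>s. 0 - D s (m - {#s#})) m"
      by (intro image_mset_cong) (simp add: D_def)
    then have "(\<Sum>s\<in>#m. sol (m - {#s#}) - sol m) = (\<Sum>s\<in>#m. 0 - D s (m - {#s#}))" by (rule arg_cong)
    also have "\<dots> = (\<Sum>s\<in>#m. 0) - (\<Sum>s\<in>#m. D s (m - {#s#}))" by (rule sum_mset_diff)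
    finally show ?thesis by simp
  qed
  have 2: "(\<Sum>s\<in>#m. \<Sum>r\<in>#m - {#s#}. D s (add_mset r (m - {#s#} - {#r#}))) = (real (size m) - 1) * (\<Sum>s\<in>#m. D s (m - {#s#}))"
  proof -
    have "image_mset (\<lambda>s. \<Sum>r\<in>#m - {#s#}. D s (add_mset r (m - {#s#} - {#r#}))) m
        = image_mset (\<lambda>s. (real (size m) - 1) * D s (m - {#s#})) m"
    proof (intro image_mset_cong)
      fix s assume s: "s \<in># m"
      have "image_mset (\<lambda>r. D s (add_mset r (m - {#s#} - {#r#}))) (m - {#s#}) = image_mset (\<lambda>r. D s (m - {#s#})) (m - {#s#})"
        by (intro image_mset_cong) (simp only: insert_DiffM)
      then show "(\<Sum>r\<in>#m - {#s#}. D s (add_mset r (m - {#s#} - {#r#}))) = (real (size m) - 1) * D s (m - {#s#})"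
        using size_remove1[OF s] by simp
    qed
    then have "(\<Sum>s\<in>#m. \<Sum>r\<in>#m - {#s#}. D s (add_mset r (m - {#s#} - {#r#}))) = (\<Sum>s\<in>#m. (real (size m) - 1) * D s (m - {#s#}))"
      by (rule arg_cong)
    also have "\<dots> = (real (size m) - 1) * (\<Sum>s\<in>#m. D s (m - {#s#}))" by (rule sum_mset_distrib_left[symmetric])
    finally show ?thesis .
  qed
  show ?thesis
    using sol_eq[of m] unfolding 1 2 by (simp add: D_def dr_def algebra_simps)
qed

context
  fixes M :: "'m measure" and \<Xi> :: "'m \<Rightarrow> 'a measure"
    and M1 :: "'a \<Rightarrow> 'v measure" and \<Xi>1 :: "'a \<Rightarrow> 'v \<Rightarrow> 'a measure"
    and M2 :: "'a \<Rightarrow> 'a \<Rightarrow> 'z measure" and \<Xi>2 :: "'a \<Rightarrow> 'a \<Rightarrow> 'z \<Rightarrow> 'a measure"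
    and A B :: "'a \<Rightarrow> 'a set" and A2 B2 :: "'a \<Rightarrow> 'a \<Rightarrow> 'a set"
  assumes process: "point_process M \<Xi>" and palm1: "palm_process M \<Xi> M1 \<Xi>1" and palm2: "palm_process2 M \<Xi> M2 \<Xi>2"
    and third: "integrable M (\<lambda>\<omega>. total_mass (\<Xi> \<omega>) ^ 3)"
    and local1: "local_dependence1 M \<Xi> M1 \<Xi>1 A B"
    and local2: "local_dependence2 M \<Xi> M2 \<Xi>2 A2 B2"
    and T_centers: "T = centers"
    and w_intensity: "\<And>s. s \<in> centers \<Longrightarrow>
      a * w s = measure (mean_measure M \<Xi>) (\<tau> -` {s}) + b * measure (factorial_moment2 M \<Xi>) ((\<tau> -` {s}) \<times> UNIV)"
begin

interpretation M: prob_space M by (rule process_props(1)[OF process palm1 palm2])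
interpretation L: finite_measure "mean_measure M \<Xi>" by (rule finite_\<Lambda>[OF process palm1 palm2 third])
interpretation L2: finite_measure "factorial_moment2 M \<Xi>" by (rule finite_\<Lambda>2[OF process palm1 palm2 third])

abbreviation "n\<Xi> \<omega> \<equiv> real (size (tally \<tau> (\<Xi> \<omega>)))"
abbreviation "e1 \<equiv> (\<integral>\<omega>. n\<Xi> \<omega> \<partial>M)"
abbreviation "e2 \<equiv> (\<integral>\<omega>. n\<Xi> \<omega> ^ 2 \<partial>M)"
abbreviation "e3 \<equiv> (\<integral>\<omega>. n\<Xi> \<omega> ^ 3 \<partial>M)"

lemmas props = process_props[OF process palm1 palm2] palm1_props[OF process palm1 palm2] palm2_props[OF process palm1 palm2]
  and int_sz = integrable_size[OF process palm1 palm2 third] integrable_size3[OF process palm1 palm2 third]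
  and L_sets = sets_\<Lambda>[OF process palm1 palm2] sets_\<Lambda>2[OF process palm1 palm2]

abbreviation "error_sum \<equiv>
  (\<integral>\<^sup>+x. (\<integral>\<^sup>+\<omega>. eps1 a u k G t M \<Xi> (A x) (B x) (M1 x) (\<Xi>1 x) \<omega> \<partial>M1 x)
            + (\<integral>\<^sup>+\<omega>. eps1 a u k G t M \<Xi> (A x) (B x) M \<Xi> \<omega> \<partial>M) \<partial>mean_measure M \<Xi>)
      + ennreal b *
        (\<integral>\<^sup>+(x, y). (\<integral>\<^sup>+\<omega>. eps1 a u k G t M \<Xi> (A2 x y) (B2 x y) (M2 x y) (\<Xi>2 x y) \<omega> \<partial>M2 x y)
            + (\<integral>\<^sup>+\<omega>. eps1 a u k G t M \<Xi> (A2 x y) (B2 x y) M \<Xi> \<omega> \<partial>M)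
            + (\<integral>\<^sup>+\<omega>. eps2 a u k G t M \<Xi> (B2 x y) (M2 x y) (\<Xi>2 x y) \<omega> \<partial>M2 x y) \<partial>factorial_moment2 M \<Xi>)"

text \<open>\<open>coef\<close> states that the mean size differences between \<open>\<Xi>\<close>
  and its Palm processes, weighted by the intensity and by b times the second factorial moment
  measure, sum to zero. So their multiples of the reference constant can be subtracted from the
  local terms at no cost.\<close>

theorem generator_bound:
  assumes coef: "e1 * e1 - (e2 - e1) + b * ((e2 - e1) * e1 - (e3 - 3 * e2 + 2 * e1) - (e2 - e1)) = 0"
  shows "ennreal \<bar>\<integral>\<omega>. \<epsilon> * sol (tally \<tau> (\<Xi> \<omega>)) - f (tally \<tau> (\<Xi> \<omega>)) \<partial>M\<bar> \<le> error_sum"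
proof -
  let ?Y = "\<lambda>\<omega>. tally \<tau> (\<Xi> \<omega>)"
  let ?L = "mean_measure M \<Xi>" and ?L2 = "factorial_moment2 M \<Xi>"
  let ?c = "mean_c0 M \<Xi>"
  have bI: "integrable M (\<lambda>\<omega>. \<phi> (?Y \<omega>))" if "\<And>m. \<bar>\<phi> m\<bar> \<le> c" for \<phi> :: "'a multiset \<Rightarrow> real" and c
    using that measurable_Y_fun[OF process palm1 palm2 third] by (intro M.integrable_const_bound[where B=c]) auto
  define h where "h = (\<lambda>s. \<integral>\<omega>. D s (?Y \<omega>) \<partial>M)"
  define k1 where "k1 = (\<lambda>x. \<integral>\<omega>. D (\<tau> x) (tally \<tau> (\<Xi>1 x \<omega>)) \<partial>M1 x)"
  define k2 where "k2 = (\<lambda>p. \<integral>\<omega>. D (\<tau> (fst p)) (add_mset (\<tau> (snd p)) (tally \<tau> (\<Xi>2 (fst p) (snd p) \<omega>))) \<partial>M2 (fst p) (snd p))"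
  define n1 where "n1 = (\<lambda>x. \<integral>\<omega>. real (size (tally \<tau> (\<Xi>1 x \<omega>))) \<partial>M1 x)"
  define n2 where "n2 = (\<lambda>p. \<integral>\<omega>. real (size (tally \<tau> (\<Xi>2 (fst p) (snd p) \<omega>))) \<partial>M2 (fst p) (snd p))"
  have D1: "\<bar>D s m\<bar> \<le> 1" and D2: "\<bar>D s (add_mset r m)\<bar> \<le> 1" for s r m by (rule D_abs_le_1)+
  have k1: "integrable ?L k1" "(\<integral>x. k1 x \<partial>?L) = (\<integral>\<omega>. (\<Sum>s\<in>#?Y \<omega>. D s (?Y \<omega> - {#s#})) \<partial>M)"
    unfolding k1_def by (rule palm1_bounded[OF process palm1 palm2 third, of "\<lambda>s m. D s m", OF D1])+
  have k2: "integrable ?L2 k2"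
    "(\<integral>p. k2 p \<partial>?L2) = (\<integral>\<omega>. (\<Sum>s\<in>#?Y \<omega>. \<Sum>r\<in>#?Y \<omega> - {#s#}. D s (add_mset r (?Y \<omega> - {#s#} - {#r#}))) \<partial>M)"
    unfolding k2_def by (rule palm2_bounded[OF process palm1 palm2 third, of "\<lambda>s r m. D s (add_mset r m)", OF D2])+
  have q2: "integrable M (\<lambda>\<omega>. n\<Xi> \<omega> * (n\<Xi> \<omega> - 1))" using int_sz by (simp add: right_diff_distrib power2_eq_square)
  have q3: "integrable M (\<lambda>\<omega>. n\<Xi> \<omega> * (n\<Xi> \<omega> - 1) * (n\<Xi> \<omega> - 2))"
  proof -
    have "n\<Xi> \<omega> * (n\<Xi> \<omega> - 1) * (n\<Xi> \<omega> - 2) = n\<Xi> \<omega> ^ 3 - 3 * n\<Xi> \<omega> ^ 2 + 2 * n\<Xi> \<omega>" for \<omega>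
      by (simp add: algebra_simps power2_eq_square power3_eq_cube)
    then show ?thesis using int_sz by simp
  qed
  have E2: "(\<integral>\<omega>. n\<Xi> \<omega> * (n\<Xi> \<omega> - 1) \<partial>M) = e2 - e1"
    using int_sz by (simp add: right_diff_distrib power2_eq_square)
  have E3: "(\<integral>\<omega>. n\<Xi> \<omega> * (n\<Xi> \<omega> - 1) * (n\<Xi> \<omega> - 2) \<partial>M) = e3 - 3 * e2 + 2 * e1"
  proof -
    have "n\<Xi> \<omega> * (n\<Xi> \<omega> - 1) * (n\<Xi> \<omega> - 2) = n\<Xi> \<omega> ^ 3 - 3 * n\<Xi> \<omega> ^ 2 + 2 * n\<Xi> \<omega>" for \<omega>
      by (simp add: algebra_simps power2_eq_square power3_eq_cube)
    then show ?thesis using int_sz by simp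
  qed
  have n1: "AE x in ?L. integrable (M1 x) (\<lambda>\<omega>. real (size (tally \<tau> (\<Xi>1 x \<omega>))))" "integrable ?L n1" "(\<integral>x. n1 x \<partial>?L) = e2 - e1"
  proof -
    have S: "integrable M (\<lambda>\<omega>. \<Sum>s\<in>#?Y \<omega>. real (size (?Y \<omega> - {#s#})))"
      using q2 by (simp add: size_sums(1)[OF process palm1 palm2 third])
    note P = palm1_real[OF process palm1 palm2, of "\<lambda>s m. real (size m)", OF of_nat_0_le_iff S]
    show "AE x in ?L. integrable (M1 x) (\<lambda>\<omega>. real (size (tally \<tau> (\<Xi>1 x \<omega>))))" by (rule P(1))
    show "integrable ?L n1" unfolding n1_def by (rule P(2))
    show "(\<integral>x. n1 x \<partial>?L) = e2 - e1" unfolding n1_def P(3) size_sums(1)[OF process palm1 palm2 third] by (rule E2)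
  qed
  have n2: "AE p in ?L2. integrable (M2 (fst p) (snd p)) (\<lambda>\<omega>. real (size (tally \<tau> (\<Xi>2 (fst p) (snd p) \<omega>))))"
    "integrable ?L2 n2" "(\<integral>p. n2 p \<partial>?L2) = e3 - 3 * e2 + 2 * e1"
  proof -
    have S: "integrable M (\<lambda>\<omega>. \<Sum>s\<in>#?Y \<omega>. \<Sum>r\<in>#?Y \<omega> - {#s#}. real (size (?Y \<omega> - {#s#} - {#r#})))"
      using q3 unfolding size_sums(3)[OF process palm1 palm2 third] .
    note P = palm2_real[OF process palm1 palm2, of "\<lambda>s r m. real (size m)", OF of_nat_0_le_iff S]
    show "AE p in ?L2. integrable (M2 (fst p) (snd p)) (\<lambda>\<omega>. real (size (tally \<tau> (\<Xi>2 (fst p) (snd p) \<omega>))))" by (rule P(1))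
    show "integrable ?L2 n2" unfolding n2_def by (rule P(2))
    show "(\<integral>p. n2 p \<partial>?L2) = e3 - 3 * e2 + 2 * e1" unfolding n2_def P(3) size_sums(3)[OF process palm1 palm2 third] by (rule E3)
  qed
  have mL: "measure ?L UNIV = e1"
    using mean_measure_mass[OF process palm1 palm2 third] by (simp add: measure_def integral_nonneg_AE)
  have nn2: "0 \<le> e2 - e1"
  proof -
    have "0 \<le> n\<Xi> \<omega> * (n\<Xi> \<omega> - 1)" for \<omega> by (cases "size (?Y \<omega>)") auto
    then have "0 \<le> (\<integral>\<omega>. n\<Xi> \<omega> * (n\<Xi> \<omega> - 1) \<partial>M)" by (intro integral_nonneg_AE) auto
    then show ?thesis unfolding E2 .
  qed
  have mL2: "measure ?L2 UNIV = e2 - e1"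
    using moment2_mass[OF process palm1 palm2 third] nn2 by (simp add: measure_def)
  have hL: "integrable ?L (\<lambda>x. h (\<tau> x))" "(\<integral>x. h (\<tau> x) \<partial>?L) = (\<Sum>s\<in>centers. h s * measure ?L (\<tau> -` {s}))"
    by (rule integral_finite_range[OF L.finite_measure_axioms finite_centers \<tau>_center]; simp add: L_sets \<tau>_borel)+
  have fstv: "(\<lambda>p. \<tau> (fst p)) -` {s} = (\<tau> -` {s}) \<times> (UNIV :: 'a set)" for s by auto
  have hL2: "integrable ?L2 (\<lambda>p. h (\<tau> (fst p)))"
    "(\<integral>p. h (\<tau> (fst p)) \<partial>?L2) = (\<Sum>s\<in>centers. h s * measure ?L2 ((\<tau> -` {s}) \<times> UNIV))"
  proof -
    have s: "(\<lambda>p. \<tau> (fst p)) -` {s} \<in> sets ?L2" for s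
      unfolding fstv L_sets using \<tau>_borel by (intro pair_measureI) auto
    show "integrable ?L2 (\<lambda>p. h (\<tau> (fst p)))"
      "(\<integral>p. h (\<tau> (fst p)) \<partial>?L2) = (\<Sum>s\<in>centers. h s * measure ?L2 ((\<tau> -` {s}) \<times> UNIV))"
      using integral_finite_range[OF L2.finite_measure_axioms finite_centers _ s, of h] unfolding fstv by simp_all
  qed
  \<comment> \<open>The immigration rate at a center is the mass of its cell under the intensity
    plus b times the first marginal of the pair measure. This splits the immigration term to match
    the two death terms.\<close>
  have aNu: "a * Nu h = (\<integral>x. h (\<tau> x) \<partial>?L) + b * (\<integral>p. h (\<tau> (fst p)) \<partial>?L2)"
  proof -
    have "a * Nu h = (\<Sum>s\<in>centers. h s * (a * w s))" unfolding Nu_def unfolding T_centers by (simp add: sum_distrib_left mult_ac)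
    also have "\<dots> = (\<Sum>s\<in>centers. h s * measure ?L (\<tau> -` {s}) + b * (h s * measure ?L2 ((\<tau> -` {s}) \<times> UNIV)))"
      by (intro sum.cong refl) (simp add: w_intensity algebra_simps)
    finally show ?thesis unfolding hL(2) hL2(2) by (simp add: sum.distrib sum_distrib_left)
  qed
  define q1 where "q1 = (\<lambda>x. h (\<tau> x) - k1 x - ?c * (e1 - n1 x))"
  \<comment> \<open>The extra -1 counts the second point of the pair: its death term is evaluated at
    the reduced configuration with \<open>\<tau> (snd p)\<close> put back.\<close>
  define r2 where "r2 = (\<lambda>p. h (\<tau> (fst p)) - k2 p - ?c * (e1 - n2 p - 1))"
  have iq1: "integrable ?L q1" unfolding q1_def using hL(1) k1(1) n1(2) by auto
  have ir2: "integrable ?L2 r2" unfolding r2_def using hL2(1) k2(1) n2(2) by auto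
  have gen: "(\<integral>\<omega>. \<epsilon> * sol (?Y \<omega>) - f (?Y \<omega>) \<partial>M) = (\<integral>x. q1 x \<partial>?L) + b * (\<integral>p. r2 p \<partial>?L2)"
  proof -
    have iN: "integrable M (\<lambda>\<omega>. Nu (\<lambda>s. D s (?Y \<omega>)))" by (rule bI[of "\<lambda>m. Nu (\<lambda>s. D s m)" 1]) (rule Nu_abs_le, rule D_abs_le_1)
    have iS: "integrable M (\<lambda>\<omega>. \<Sum>s\<in>#?Y \<omega>. D s (?Y \<omega> - {#s#}))"
      by (rule integrable_poly[OF process palm1 palm2 third]) (rule single_sum_le[OF process palm1 palm2 third D1])
    have iS2: "integrable M (\<lambda>\<omega>. \<Sum>s\<in>#?Y \<omega>. \<Sum>r\<in>#?Y \<omega> - {#s#}. D s (add_mset r (?Y \<omega> - {#s#} - {#r#})))"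
      by (rule integrable_poly[OF process palm1 palm2 third])
         (rule double_sum_le[OF process palm1 palm2 third, of "\<lambda>s r m. D s (add_mset r m)", OF D2])
    have Nuh: "(\<integral>\<omega>. Nu (\<lambda>s. D s (?Y \<omega>)) \<partial>M) = Nu h"
      unfolding Nu_def h_def by (subst Bochner_Integration.integral_sum) (auto intro!: integrable_mult_right bI D_abs_le_1)
    have "(\<integral>\<omega>. \<epsilon> * sol (?Y \<omega>) - f (?Y \<omega>) \<partial>M) = a * Nu h - ((\<integral>x. k1 x \<partial>?L) + b * (\<integral>p. k2 p \<partial>?L2))"
      unfolding generator_pointwise k1(2) k2(2) Nuh[symmetric] using iN iS iS2 by simp
    moreover have "(\<integral>x. q1 x \<partial>?L) = (\<integral>x. h (\<tau> x) \<partial>?L) - (\<integral>x. k1 x \<partial>?L) - ?c * (e1 * e1 - (e2 - e1))"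
    proof -
      have "(\<integral>x. e1 - n1 x \<partial>?L) = e1 * e1 - (e2 - e1)" using n1(2,3) mL L_sets by simp
      moreover have "integrable ?L (\<lambda>x. e1 - n1 x)" using n1(2) by simp
      ultimately show ?thesis unfolding q1_def using hL(1) k1(1) by simp
    qed
    moreover have "(\<integral>p. r2 p \<partial>?L2) = (\<integral>p. h (\<tau> (fst p)) \<partial>?L2) - (\<integral>p. k2 p \<partial>?L2)
        - ?c * ((e2 - e1) * e1 - (e3 - 3 * e2 + 2 * e1) - (e2 - e1))"
    proof -
      have "(\<integral>p. e1 - n2 p - 1 \<partial>?L2) = (e2 - e1) * e1 - (e3 - 3 * e2 + 2 * e1) - (e2 - e1)"
        using n2(2,3) mL2 L_sets by simp
      moreover have "integrable ?L2 (\<lambda>p. e1 - n2 p - 1)" using n2(2) by simp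
      ultimately show ?thesis unfolding r2_def using hL2(1) k2(1) by simp
    qed
    ultimately have "(\<integral>\<omega>. \<epsilon> * sol (?Y \<omega>) - f (?Y \<omega>) \<partial>M) - ((\<integral>x. q1 x \<partial>?L) + b * (\<integral>p. r2 p \<partial>?L2))
       = ?c * (e1 * e1 - (e2 - e1) + b * ((e2 - e1) * e1 - (e3 - 3 * e2 + 2 * e1) - (e2 - e1)))"
      unfolding aNu by (rule linear_balance)
    then show ?thesis unfolding coef by simp
  qed
  have absL: "ennreal \<bar>\<integral>x. g x \<partial>K\<bar> \<le> (\<integral>\<^sup>+x. ennreal \<bar>g x\<bar> \<partial>K)" if "integrable K g" for K :: "'k measure" and g :: "'k \<Rightarrow> real"
  proof -
    have "ennreal \<bar>\<integral>x. g x \<partial>K\<bar> \<le> ennreal (\<integral>x. \<bar>g x\<bar> \<partial>K)" by (intro ennreal_leI integral_abs_bound)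
    also have "\<dots> = (\<integral>\<^sup>+x. ennreal \<bar>g x\<bar> \<partial>K)" using that by (intro nn_integral_eq_integral[symmetric]) auto
    finally show ?thesis .
  qed
  have nb: "A x \<in> sets borel" "B x \<in> sets borel" "A x \<subseteq> B x" for x
    using local1 unfolding local_dependence1_def neighbourhood1_def by blast+
  have nb2: "A2 x y \<in> sets borel" "B2 x y \<in> sets borel" "A2 x y \<subseteq> B2 x y" for x y
    using local2 unfolding local_dependence2_def neighbourhood2_def by blast+
  have b1: "AE x in ?L. ennreal \<bar>q1 x\<bar> \<le> (\<integral>\<^sup>+\<omega>. eps1 a u k G t M \<Xi> (A x) (B x) (M1 x) (\<Xi>1 x) \<omega> \<partial>M1 x)
            + (\<integral>\<^sup>+\<omega>. eps1 a u k G t M \<Xi> (A x) (B x) M \<Xi> \<omega> \<partial>M)"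
    using n1(1)
  proof eventually_elim
    case (elim x)
    have "distr (M1 x) config_algebra (\<lambda>\<omega>. restr (- A x) (\<Xi>1 x \<omega>)) = distr M config_algebra (\<lambda>\<omega>. restr (- A x) (\<Xi> \<omega>))"
      "indep_restr M \<Xi> (- B x) (A x)" "indep_restr (M1 x) (\<Xi>1 x) (- B x) (A x)"
      using local1 unfolding local_dependence1_def by blast+
    from local_pair_bound[OF props(1,2,3,4) nb this int_sz(1) elim \<tau>_center[of x]]
    show ?case unfolding q1_def h_def k1_def n1_def .
  qed
  have b2: "AE p in ?L2. ennreal \<bar>r2 p\<bar> \<le>
     (\<lambda>(x, y). (\<integral>\<^sup>+\<omega>. eps1 a u k G t M \<Xi> (A2 x y) (B2 x y) (M2 x y) (\<Xi>2 x y) \<omega> \<partial>M2 x y)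
            + (\<integral>\<^sup>+\<omega>. eps1 a u k G t M \<Xi> (A2 x y) (B2 x y) M \<Xi> \<omega> \<partial>M)
            + (\<integral>\<^sup>+\<omega>. eps2 a u k G t M \<Xi> (B2 x y) (M2 x y) (\<Xi>2 x y) \<omega> \<partial>M2 x y)) p"
    using n2(1)
  proof eventually_elim
    case (elim p)
    obtain x y where p: "p = (x, y)" by (cases p)
    have loc: "distr (M2 x y) config_algebra (\<lambda>\<omega>. restr (- A2 x y) (\<Xi>2 x y \<omega>)) = distr M config_algebra (\<lambda>\<omega>. restr (- A2 x y) (\<Xi> \<omega>))"
      "indep_restr M \<Xi> (- B2 x y) (A2 x y)" "indep_restr (M2 x y) (\<Xi>2 x y) (- B2 x y) (A2 x y)"
      using local2 unfolding local_dependence2_def by blast+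
    have fin: "integrable (M2 x y) (\<lambda>\<omega>. real (size (tally \<tau> (\<Xi>2 x y \<omega>))))" using elim p by simp
    note 1 = local_pair_bound[OF props(1,2,5,6) nb2 loc int_sz(1) fin \<tau>_center[of x]]
    note 2 = eps2_bound[OF props(1,2,5,6) nb2(2) distr_restr_mono[OF props(5,6,1,2) nb2 loc(1)] \<tau>_center[of x] \<tau>_center[of y]]
    interpret N: prob_space "M2 x y" by (rule props)
    have iD: "integrable (M2 x y) (\<lambda>\<omega>. \<phi> (tally \<tau> (\<Xi>2 x y \<omega>)))" if "\<And>m. \<bar>\<phi> m\<bar> \<le> c" for \<phi> :: "'a multiset \<Rightarrow> real" and c
      using that measurable_tally2[OF process palm1 palm2] by (intro N.integrable_const_bound[where B=c]) auto
    \<comment> \<open>Separating the point put back leaves an increment of the reduced Palm process,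
      bounded by \<open>eps1\<close> terms, and a second difference close to the reference constant,
      bounded by \<open>eps2\<close>; the latter absorbs the -1.\<close>
    have "(\<integral>\<omega>. D (\<tau> x) (add_mset (\<tau> y) (tally \<tau> (\<Xi>2 x y \<omega>))) \<partial>M2 x y)
        = (\<integral>\<omega>. D (\<tau> x) (tally \<tau> (\<Xi>2 x y \<omega>)) + V (\<tau> x) (\<tau> y) (tally \<tau> (\<Xi>2 x y \<omega>)) \<partial>M2 x y)"
      by (intro Bochner_Integration.integral_cong refl) (simp add: V_def)
    also have "\<dots> = (\<integral>\<omega>. D (\<tau> x) (tally \<tau> (\<Xi>2 x y \<omega>)) \<partial>M2 x y) + (\<integral>\<omega>. V (\<tau> x) (\<tau> y) (tally \<tau> (\<Xi>2 x y \<omega>)) \<partial>M2 x y)"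
      by (intro Bochner_Integration.integral_add iD[OF D_abs_le_1] iD[OF V_abs_le_2])
    finally have k2p: "k2 p = \<dots>" unfolding k2_def p by simp
    define X where "X = h (\<tau> x) - (\<integral>\<omega>. D (\<tau> x) (tally \<tau> (\<Xi>2 x y \<omega>)) \<partial>M2 x y) - ?c * (e1 - n2 p)"
    define Z where "Z = (\<integral>\<omega>. V (\<tau> x) (\<tau> y) (tally \<tau> (\<Xi>2 x y \<omega>)) \<partial>M2 x y) - ?c"
    have "r2 p = X - Z" unfolding r2_def k2p X_def Z_def by (simp add: p algebra_simps)
    then have "ennreal \<bar>r2 p\<bar> \<le> ennreal (\<bar>X\<bar> + \<bar>Z\<bar>)" by (intro ennreal_leI) linarith
    also have "\<dots> = ennreal \<bar>X\<bar> + ennreal \<bar>Z\<bar>" by (simp add: ennreal_plus)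
    also have "\<dots> \<le> ((\<integral>\<^sup>+\<omega>. eps1 a u k G t M \<Xi> (A2 x y) (B2 x y) (M2 x y) (\<Xi>2 x y) \<omega> \<partial>M2 x y)
            + (\<integral>\<^sup>+\<omega>. eps1 a u k G t M \<Xi> (A2 x y) (B2 x y) M \<Xi> \<omega> \<partial>M))
            + (\<integral>\<^sup>+\<omega>. eps2 a u k G t M \<Xi> (B2 x y) (M2 x y) (\<Xi>2 x y) \<omega> \<partial>M2 x y)"
      using 1 2 unfolding X_def Z_def h_def n2_def p fst_conv snd_conv by (rule add_mono)
    finally show ?case unfolding p by simp
  qed
  have "ennreal \<bar>\<integral>\<omega>. \<epsilon> * sol (?Y \<omega>) - f (?Y \<omega>) \<partial>M\<bar> \<le> ennreal (\<bar>\<integral>x. q1 x \<partial>?L\<bar> + b * \<bar>\<integral>p. r2 p \<partial>?L2\<bar>)"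
    unfolding gen using b_nonneg by (intro ennreal_leI) (simp add: abs_mult order.trans[OF abs_triangle_ineq])
  also have "\<dots> = ennreal \<bar>\<integral>x. q1 x \<partial>?L\<bar> + ennreal b * ennreal \<bar>\<integral>p. r2 p \<partial>?L2\<bar>"
    using b_nonneg by (simp add: ennreal_plus ennreal_mult)
  also have "\<dots> \<le> (\<integral>\<^sup>+x. ennreal \<bar>q1 x\<bar> \<partial>?L) + ennreal b * (\<integral>\<^sup>+p. ennreal \<bar>r2 p\<bar> \<partial>?L2)"
    by (intro add_mono mult_left_mono absL iq1 ir2) auto
  also have "\<dots> \<le> error_sum"
    by (intro add_mono mult_left_mono nn_integral_mono_AE b1 b2) auto
  finally show ?thesis .
qed

end

section \<open>Comparison with the birth-death point process\<close>

context
  fixes \<nu> :: "'a measure"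
  assumes \<nu>: "prob_space \<nu>" "sets \<nu> = sets borel"
    and T_centers: "T = centers" and w_eq: "\<And>s. s \<in> centers \<Longrightarrow> w s = measure \<nu> (\<tau> -` {s})"
begin

interpretation \<nu>: prob_space \<nu> by (rule \<nu>)
interpretation P: product_prob_space "\<lambda>_ :: nat. \<nu>" UNIV by unfold_locales

abbreviation "pbd \<equiv> pbd_process a 0 b \<nu>"
abbreviation "pcount \<equiv> pbd_count a 0 b"

lemma measurable_points:
  "(\<lambda>(n, U). points n U) \<in> measurable (measure_pmf pcount \<Otimes>\<^sub>M Pi\<^sub>M (UNIV :: nat set) (\<lambda>_. \<nu>)) config_algebra"
proof -
  have "(\<lambda>(n, U). points n U) \<in> measurable (count_space (UNIV :: nat set) \<Otimes>\<^sub>M Pi\<^sub>M (UNIV :: nat set) (\<lambda>_. \<nu>)) config_algebra"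
  proof (rule measurable_pair_measure_countable1)
    fix n :: nat
    have "(\<lambda>U. points n U) \<in> measurable (Pi\<^sub>M (UNIV :: nat set) (\<lambda>_. borel :: 'a measure)) config_algebra"
      unfolding points_eq_emb by (rule measurable_emb_mset_set) auto
    then show "(\<lambda>U. case (n, U) of (n, U) \<Rightarrow> points n U) \<in> measurable (Pi\<^sub>M (UNIV :: nat set) (\<lambda>_. \<nu>)) config_algebra"
      by (subst measurable_cong_sets[OF sets_PiM_\<nu>[OF \<nu> T_centers w_eq] refl]) simp_all
  qed simp
  moreover have "sets (measure_pmf pcount \<Otimes>\<^sub>M Pi\<^sub>M (UNIV :: nat set) (\<lambda>_. \<nu>)) = sets (count_space (UNIV :: nat set) \<Otimes>\<^sub>M Pi\<^sub>M (UNIV :: nat set) (\<lambda>_. \<nu>))"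
    by (intro sets_pair_measure_cong) simp_all
  ultimately show ?thesis by (simp cong: measurable_cong_sets)
qed

lemma prob_space_pbd: "prob_space pbd" and sets_pbd: "sets pbd = sets config_algebra"
proof -
  interpret PP: pair_prob_space "measure_pmf pcount" "Pi\<^sub>M (UNIV :: nat set) (\<lambda>_. \<nu>)" by unfold_locales
  show "prob_space pbd" unfolding pbd_process_def by (rule PP.prob_space_distr[OF measurable_points])
  show "sets pbd = sets config_algebra" by (simp add: pbd_process_def)
qed

lemma integral_pbd_tally:
  fixes \<phi> :: "'a multiset \<Rightarrow> real"
  assumes bd: "\<And>m. \<bar>\<phi> m\<bar> \<le> c"
  shows "(\<integral>\<xi>. \<phi> (tally \<tau> \<xi>) \<partial>pbd) = (\<integral>n. eta n \<phi> \<partial>measure_pmf pcount)"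
proof -
  let ?P = "Pi\<^sub>M (UNIV :: nat set) (\<lambda>_. \<nu>)"
  interpret PP: pair_prob_space "measure_pmf pcount" ?P by unfold_locales
  have m: "(\<lambda>\<xi>. \<phi> (tally \<tau> \<xi>)) \<in> borel_measurable config_algebra"
    by (rule measurable_compose[OF measurable_tally(1)]) simp
  have "(\<integral>\<xi>. \<phi> (tally \<tau> \<xi>) \<partial>pbd) = (\<integral>p. \<phi> (tally \<tau> ((\<lambda>(n, U). points n U) p)) \<partial>(measure_pmf pcount \<Otimes>\<^sub>M ?P))"
    unfolding pbd_process_def by (rule integral_distr[OF measurable_points m])
  also have "\<dots> = (\<integral>n. (\<integral>U. \<phi> (tally \<tau> (points n U)) \<partial>?P) \<partial>measure_pmf pcount)"
  proof -
    have "integrable (measure_pmf pcount \<Otimes>\<^sub>M ?P) (\<lambda>p. \<phi> (tally \<tau> ((\<lambda>(n, U). points n U) p)))"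
      using bd measurable_compose[OF measurable_points m] by (intro PP.P.integrable_const_bound[where B=c]) auto
    from PP.integral_fst'[OF this] show ?thesis by simp
  qed
  also have "\<dots> = (\<integral>n. eta n \<phi> \<partial>measure_pmf pcount)"
  proof (intro Bochner_Integration.integral_cong refl)
    fix n :: nat
    let ?J = "{1..n} :: nat set"
    let ?g = "\<lambda>U. \<phi> ({#} + image_mset (\<lambda>j. \<tau> (U j)) (mset_set ?J))"
    have gm: "?g \<in> borel_measurable (Pi\<^sub>M ?J (\<lambda>_. \<nu>))"
      using measurable_compose[OF measurable_image_mset[OF \<nu> T_centers w_eq, of ?J ?J], of \<phi> borel] by simp
    \<comment> \<open>Only the first n coordinates are read, so the infinite product is replaced by
      its finite marginal, on which \<open>integral_iid\<close> applies.\<close>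
    have "(\<integral>U. \<phi> (tally \<tau> (points n U)) \<partial>?P) = (\<integral>U. ?g (restrict U ?J) \<partial>?P)"
    proof (intro Bochner_Integration.integral_cong refl)
      fix U :: "nat \<Rightarrow> 'a"
      have "image_mset (\<lambda>j. \<tau> (restrict U ?J j)) (mset_set ?J) = image_mset (\<lambda>j. \<tau> (U j)) (mset_set ?J)"
        by (intro image_mset_cong) auto
      then show "\<phi> (tally \<tau> (points n U)) = ?g (restrict U ?J)"
        by (simp add: points_eq_emb image_mset.compositionality comp_def)
    qed
    also have "\<dots> = (\<integral>U. ?g U \<partial>distr ?P (Pi\<^sub>M ?J (\<lambda>_. \<nu>)) (\<lambda>U. restrict U ?J))"
      by (rule integral_distr[symmetric, OF measurable_restrict_subset gm]) simp
    also have "\<dots> = (\<integral>U. ?g U \<partial>Pi\<^sub>M ?J (\<lambda>_. \<nu>))"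
      by (subst P.distr_PiM_restrict_finite) simp_all
    also have "\<dots> = (add_random ^^ card ?J) \<phi> {#}"
      using integral_iid[OF \<nu> T_centers w_eq bd finite_atLeastAtMost[of 1 n], where m="{#}"] by simp
    finally show "(\<integral>U. \<phi> (tally \<tau> (points n U)) \<partial>?P) = eta n \<phi>" by (simp add: eta_def)
  qed
  finally show ?thesis .
qed

lemma pbd_stationary: "(\<integral>\<xi>. \<epsilon> * sol (tally \<tau> \<xi>) - f (tally \<tau> \<xi>) \<partial>pbd) = 0"
proof -
  have "pmf pcount n * a = pmf pcount (Suc n) * (real (Suc n) * dr (Suc n))" for n
  proof -
    have "death b (Suc n) = real (Suc n) * dr (Suc n)"
      by (simp add: death_def[OF a_pos b_nonneg] dr_def algebra_simps)
    then show ?thesis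
      using balanced_pbd_count[OF a_pos b_nonneg] unfolding balanced_def[OF a_pos b_nonneg] by metis
  qed
  from stationary[OF this] show ?thesis
    using integral_pbd_tally[of "\<lambda>m. \<epsilon> * sol m - f m" 1] residual_abs_le by simp
qed

lemma pbd_sol_growth: "\<bar>(\<integral>\<xi>. sol (tally \<tau> \<xi>) \<partial>pbd) - sol {#}\<bar> \<le> (\<integral>n. real n \<partial>measure_pmf pcount)"
proof -
  have b: "\<bar>eta n sol - sol {#}\<bar> \<le> real n" for n
  proof -
    have "sol {#} - real n \<le> eta n sol \<and> eta n sol \<le> sol {#} + real n"
    proof (rule eta_bounds[where l="\<lambda>n. sol {#} - real n" and h="\<lambda>n. sol {#} + real n"])
      show "sol {#} - real (size m) \<le> sol m \<and> sol m \<le> sol {#} + real (size m)" for m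
        using sol_growth[of m] by (auto simp: abs_le_iff)
    qed
    then show ?thesis by linarith
  qed
  have i: "integrable (measure_pmf pcount) (\<lambda>n. eta n sol)"
    using eta_abs_le[of sol "1 / \<epsilon>"] sol_abs_le by (intro measure_pmf.integrable_const_bound[where B="1 / \<epsilon>"]) auto
  have "\<bar>(\<integral>\<xi>. sol (tally \<tau> \<xi>) \<partial>pbd) - sol {#}\<bar> = \<bar>\<integral>n. eta n sol - sol {#} \<partial>measure_pmf pcount\<bar>"
    unfolding integral_pbd_tally[of sol "1 / \<epsilon>", OF sol_abs_le] using i by simp
  also have "\<dots> \<le> (\<integral>n. \<bar>eta n sol - sol {#}\<bar> \<partial>measure_pmf pcount)" by (rule integral_abs_bound)
  also have "\<dots> \<le> (\<integral>n. real n \<partial>measure_pmf pcount)"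
    using i b integrable_pbd_count[OF a_pos b_nonneg] by (intro integral_mono) auto
  finally show ?thesis .
qed

text \<open>Under the target law the resolvent equation has mean zero, so the mean of
  \<open>f\<close> is \<open>\<epsilon>\<close> times the mean of \<open>sol\<close>; under
  \<open>\<Xi>\<close> this holds up to \<open>s\<close>. The two means of \<open>sol\<close> are
  compared through \<open>sol {#}\<close>, each at a distance of at most a mean number of
  points.\<close>

lemma stein_comparison:
  fixes M :: "'m measure" and \<Xi> :: "'m \<Rightarrow> 'a measure"
  assumes M: "prob_space M" "\<Xi> \<in> measurable M config_algebra"
    and n: "integrable M (\<lambda>\<omega>. real (size (tally \<tau> (\<Xi> \<omega>))))"
    and bound: "\<bar>\<integral>\<omega>. \<epsilon> * sol (tally \<tau> (\<Xi> \<omega>)) - f (tally \<tau> (\<Xi> \<omega>)) \<partial>M\<bar> \<le> s"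
  shows "\<bar>(\<integral>\<omega>. f (tally \<tau> (\<Xi> \<omega>)) \<partial>M) - (\<integral>\<xi>. f (tally \<tau> \<xi>) \<partial>pbd)\<bar>
    \<le> s + \<epsilon> * ((\<integral>\<omega>. real (size (tally \<tau> (\<Xi> \<omega>))) \<partial>M) + (\<integral>n. real n \<partial>measure_pmf pcount))"
proof -
  interpret M: prob_space M by (rule M)
  interpret Q: prob_space pbd by (rule prob_space_pbd)
  have f1: "\<bar>f m\<bar> \<le> 1" for m using f_range[of m] by auto
  have iM: "integrable M (\<lambda>\<omega>. \<phi> (tally \<tau> (\<Xi> \<omega>)))" if "\<And>m. \<bar>\<phi> m\<bar> \<le> c" for \<phi> :: "'a multiset \<Rightarrow> real" and c
    using that measurable_compose[OF measurable_compose[OF M(2) measurable_tally(1)], of \<phi> borel]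
    by (intro M.integrable_const_bound[where B=c]) auto
  have iQ: "integrable pbd (\<lambda>\<xi>. \<phi> (tally \<tau> \<xi>))" if "\<And>m. \<bar>\<phi> m\<bar> \<le> c" for \<phi> :: "'a multiset \<Rightarrow> real" and c
  proof (rule Q.integrable_const_bound[where B=c])
    show "(\<lambda>\<xi>. \<phi> (tally \<tau> \<xi>)) \<in> borel_measurable pbd"
      unfolding measurable_cong_sets[OF sets_pbd refl] by (rule measurable_compose[OF measurable_tally(1)]) simp
  qed (use that in auto)
  have i: "integrable M (\<lambda>\<omega>. sol (tally \<tau> (\<Xi> \<omega>)))" "integrable M (\<lambda>\<omega>. f (tally \<tau> (\<Xi> \<omega>)))"
    by (rule iM, rule sol_abs_le) (rule iM, rule f1)
  have j: "integrable pbd (\<lambda>\<xi>. sol (tally \<tau> \<xi>))" "integrable pbd (\<lambda>\<xi>. f (tally \<tau> \<xi>))"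
    by (rule iQ, rule sol_abs_le) (rule iQ, rule f1)
  define p where "p = (\<integral>\<omega>. sol (tally \<tau> (\<Xi> \<omega>)) \<partial>M)"
  define q where "q = (\<integral>\<xi>. sol (tally \<tau> \<xi>) \<partial>pbd)"
  define F where "F = (\<integral>\<omega>. f (tally \<tau> (\<Xi> \<omega>)) \<partial>M)"
  define H where "H = (\<integral>\<xi>. f (tally \<tau> \<xi>) \<partial>pbd)"
  have "\<epsilon> * q = H"
    using pbd_stationary j by (simp add: q_def H_def)
  moreover have "\<bar>\<epsilon> * p - F\<bar> \<le> s"
    using bound i by (simp add: p_def F_def)
  ultimately have "\<bar>F - H\<bar> \<le> s + \<bar>\<epsilon> * (p - q)\<bar>" by (simp add: algebra_simps abs_if split: if_splits)
  moreover have "\<bar>p - sol {#}\<bar> \<le> (\<integral>\<omega>. real (size (tally \<tau> (\<Xi> \<omega>))) \<partial>M)"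
  proof -
    have "\<bar>p - sol {#}\<bar> = \<bar>\<integral>\<omega>. sol (tally \<tau> (\<Xi> \<omega>)) - sol {#} \<partial>M\<bar>"
      using i(1) by (simp add: p_def M.prob_space)
    also have "\<dots> \<le> (\<integral>\<omega>. \<bar>sol (tally \<tau> (\<Xi> \<omega>)) - sol {#}\<bar> \<partial>M)" by (rule integral_abs_bound)
    also have "\<dots> \<le> (\<integral>\<omega>. real (size (tally \<tau> (\<Xi> \<omega>))) \<partial>M)"
      using i(1) n sol_growth by (intro integral_mono) auto
    finally show ?thesis .
  qed
  then have "\<bar>p - q\<bar> \<le> (\<integral>\<omega>. real (size (tally \<tau> (\<Xi> \<omega>))) \<partial>M) + (\<integral>n. real n \<partial>measure_pmf pcount)"
    using pbd_sol_growth unfolding q_def by linarith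
  then have "\<bar>\<epsilon> * (p - q)\<bar> \<le> \<epsilon> * ((\<integral>\<omega>. real (size (tally \<tau> (\<Xi> \<omega>))) \<partial>M) + (\<integral>n. real n \<partial>measure_pmf pcount))"
    using eps_pos by (simp add: abs_mult)
  ultimately show ?thesis unfolding F_def H_def by linarith
qed

end

end

section \<open>Passing from test functions to the metric\<close>

text \<open>The defining set function is a combination of \<open>L\<close> and the first marginal of
  \<open>L2\<close>, which gives countable additivity and hence its values.\<close>

lemma intensity_measure:
  fixes L :: "'a::topological_space measure" and L2 :: "('a \<times> 'a) measure"
  assumes L: "sets L = sets borel" "finite_measure L" and L2: "sets L2 = sets (borel \<Otimes>\<^sub>M borel)" "finite_measure L2"
    and a: "a > 0" and b: "b \<ge> 0" and C: "C \<in> sets borel"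
  defines "\<nu> \<equiv> measure_of UNIV (sets borel) (\<lambda>C. (emeasure L C + ennreal b * emeasure L2 (C \<times> UNIV)) / ennreal a)"
  shows "emeasure \<nu> C = ennreal ((measure L C + b * measure L2 (C \<times> UNIV)) / a)"
proof -
  interpret L: finite_measure L by (rule L)
  interpret L2: finite_measure L2 by (rule L2)
  let ?f = "\<lambda>C. (emeasure L C + ennreal b * emeasure L2 (C \<times> UNIV)) / ennreal a"
  let ?N = "\<lambda>i. if i then distr L2 borel fst else L" and ?w = "\<lambda>i. if i then ennreal b * inverse (ennreal a) else inverse (ennreal a)"
  have sp: "space L2 = UNIV" using sets_eq_imp_space_eq[OF L2(1)] by (simp add: space_pair_measure)
  have fst: "fst \<in> measurable L2 borel" by (simp add: measurable_cong_sets[OF L2(1) refl])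
  have eq: "?f C = (\<Sum>i\<in>UNIV. ?w i * emeasure (?N i) C)" if "C \<in> sets borel" for C
  proof -
    have "fst -` C \<inter> space L2 = C \<times> (UNIV :: 'a set)" unfolding sp by auto
    then have "emeasure (distr L2 borel fst) C = emeasure L2 (C \<times> UNIV)" using emeasure_distr[OF fst that] by simp
    then show ?thesis
      by (simp add: UNIV_bool divide_ennreal_def distrib_left mult_ac)
  qed
  have "countably_additive (sets borel) (\<lambda>C. \<Sum>i\<in>UNIV. ?w i * emeasure (?N i) C)"
    by (rule countably_additive_sum) (auto simp: L(1))
  then have "countably_additive (sets borel) ?f"
    unfolding countably_additive_def
  proof (intro allI impI)
    fix X :: "nat \<Rightarrow> 'a set"
    assume h: "\<forall>X. range X \<subseteq> sets borel \<longrightarrow> disjoint_family X \<longrightarrow> \<Union> (range X) \<in> sets borel \<longrightarrow>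
        (\<Sum>i. \<Sum>j\<in>UNIV. ?w j * emeasure (?N j) (X i)) = (\<Sum>j\<in>UNIV. ?w j * emeasure (?N j) (\<Union> (range X)))"
      and X: "range X \<subseteq> sets borel" "disjoint_family X" "\<Union> (range X) \<in> sets borel"
    have "(\<Sum>i. ?f (X i)) = (\<Sum>i. \<Sum>j\<in>UNIV. ?w j * emeasure (?N j) (X i))"
      using X(1) by (intro suminf_cong eq) auto
    also have "\<dots> = (\<Sum>j\<in>UNIV. ?w j * emeasure (?N j) (\<Union> (range X)))" using h X by blast
    also have "\<dots> = ?f (\<Union> (range X))" by (rule eq[OF X(3), symmetric])
    finally show "(\<Sum>i. ?f (X i)) = ?f (\<Union> (range X))" .
  qed
  then have "emeasure \<nu> C = ?f C"
    unfolding \<nu>_def by (intro emeasure_measure_of_sigma C sigma_algebra_borel) (simp_all add: positive_def)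
  also have "\<dots> = ennreal ((measure L C + b * measure L2 (C \<times> UNIV)) / a)"
    using a b by (simp add: L.emeasure_eq_measure L2.emeasure_eq_measure divide_ennreal flip: ennreal_mult ennreal_plus)
  finally show ?thesis .
qed

context discretization
begin

lemma dist_\<tau>_le:
  assumes "\<forall>x y :: 'a. dist x y \<le> 1"
  shows "dist x (\<tau> x) \<le> mesh k G t"
proof -
  let ?i = "cell_index x"
  have "dist x (t ?i) \<le> (SUP s\<in>G ?i. dist s (t ?i))"
    using assms cell_index(2)[of x] by (intro cSUP_upper bdd_aboveI2[where M=1]) auto
  also have "\<dots> \<le> mesh k G t"
    unfolding mesh_def using cell_index(1)[of x] by (intro Max_ge finite_imageI imageI finite_atLeastAtMost)
  finally show ?thesis by (simp add: \<tau>_def)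
qed

lemma mesh_nonneg: "\<forall>x y :: 'a. dist x y \<le> 1 \<Longrightarrow> 0 \<le> mesh k G t"
  by (rule order.trans[OF zero_le_dist dist_\<tau>_le])

text \<open>Every point moves by at most the mesh and keeps its label, so the matching distance to
  the discretized configuration is at most the mesh. Used for both laws, it accounts for the factor
  2.\<close>

lemma lipschitz_integral_tally:
  assumes dist1: "\<forall>x y :: 'a. dist x y \<le> 1" and g: "g \<in> d1_Lipschitz" "g \<in> borel_measurable config_algebra"
    and Q: "prob_space Q" "sets Q = sets config_algebra"
  shows "\<bar>(\<integral>\<xi>. g \<xi> \<partial>Q) - (\<integral>\<xi>. g (emb (tally \<tau> \<xi>)) \<partial>Q)\<bar> \<le> mesh k G t"
proof -
  interpret Q: prob_space Q by (rule Q)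
  have sp: "space Q = configs" using sets_eq_imp_space_eq[OF Q(2)] space_config by simp
  have lip: "\<bar>g (emb m) - g (emb m')\<bar> \<le> d1 (emb m) (emb m')" for m m' using g(1) by (auto simp: d1_Lipschitz_def)
  have bd: "\<bar>g (emb m)\<bar> \<le> \<bar>g (emb {#})\<bar> + 1" for m
    using lip[of m "{#}"] d1_emb_range[OF dist1, of m "{#}"] by linarith
  have bdQ: "\<bar>g \<xi>\<bar> \<le> \<bar>g (emb {#})\<bar> + 1" if "\<xi> \<in> configs" for \<xi> :: "'a measure"
    using bd[of "pts \<xi>"] unfolding emb_pts[OF that] .
  have i1: "integrable Q g"
    using bdQ g(2) by (intro Q.integrable_const_bound[where B="\<bar>g (emb {#})\<bar> + 1"] AE_I2)
      (auto simp: sp measurable_cong_sets[OF Q(2) refl])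
  have m: "(\<lambda>\<xi>. g (emb (tally \<tau> \<xi>))) \<in> borel_measurable Q"
    unfolding measurable_cong_sets[OF Q(2) refl] by (rule measurable_compose[OF measurable_tally(1)]) simp
  have i2: "integrable Q (\<lambda>\<xi>. g (emb (tally \<tau> \<xi>)))"
    using bd m by (intro Q.integrable_const_bound[where B="\<bar>g (emb {#})\<bar> + 1"] AE_I2) auto
  have c: "\<bar>g \<xi> - g (emb (tally \<tau> \<xi>))\<bar> \<le> mesh k G t" if "\<xi> \<in> configs" for \<xi> :: "'a measure"
  proof -
    have "\<bar>g (emb m) - g (emb (image_mset \<tau> m))\<bar> \<le> mesh k G t" for m
      using lip[of m "image_mset \<tau> m"] d1_emb_image_le[of \<tau> "mesh k G t" m] dist_\<tau>_le[OF dist1] mesh_nonneg[OF dist1]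
      by (meson order.trans)
    from this[of "pts \<xi>"] show ?thesis unfolding emb_pts[OF that] by (simp add: tally_def)
  qed
  have "\<bar>(\<integral>\<xi>. g \<xi> \<partial>Q) - (\<integral>\<xi>. g (emb (tally \<tau> \<xi>)) \<partial>Q)\<bar> = \<bar>\<integral>\<xi>. g \<xi> - g (emb (tally \<tau> \<xi>)) \<partial>Q\<bar>"
    using i1 i2 by simp
  also have "\<dots> \<le> (\<integral>\<xi>. \<bar>g \<xi> - g (emb (tally \<tau> \<xi>))\<bar> \<partial>Q)" by (rule integral_abs_bound)
  also have "\<dots> \<le> (\<integral>\<xi>. mesh k G t \<partial>Q)"
    using i1 i2 c by (intro integral_mono) (auto simp: sp)
  finally show ?thesis by (simp add: Q.prob_space)
qed

end

theorem theorem3p3: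
  fixes M :: "'w measure"
    and \<Xi> :: "'w \<Rightarrow> 'a::metric_space measure"
    and M1 :: "'a \<Rightarrow> 'v measure" and \<Xi>1 :: "'a \<Rightarrow> 'v \<Rightarrow> 'a measure"
    and M2 :: "'a \<Rightarrow> 'a \<Rightarrow> 'z measure" and \<Xi>2 :: "'a \<Rightarrow> 'a \<Rightarrow> 'z \<Rightarrow> 'a measure"
    and A B :: "'a \<Rightarrow> 'a set" and A2 B2 :: "'a \<Rightarrow> 'a \<Rightarrow> 'a set"
    and k :: nat and G :: "nat \<Rightarrow> 'a set" and t :: "nat \<Rightarrow> 'a"
    and u a \<beta> m1 m2 m3 var :: real
    and \<Lambda> :: "'a measure" and \<Lambda>2 :: "('a \<times> 'a) measure" and \<nu> :: "'a measure"
  assumes compact_space: "compact (UNIV :: 'a set)"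
    and dist_le_1: "\<forall>x y :: 'a. dist x y \<le> 1"
    and process: "point_process M \<Xi>"
    and mean: "\<Lambda> = mean_measure M \<Xi>"
    and finite_mean: "emeasure \<Lambda> UNIV < \<infinity>"
    and moment2: "\<Lambda>2 = factorial_moment2 M \<Xi>"
    and third_moment: "integrable M (\<lambda>\<omega>. total_mass (\<Xi> \<omega>) ^ 3)"
    and m1: "m1 = total_mass \<Lambda>"
    and m2: "m2 = (\<integral>\<omega>. total_mass (\<Xi> \<omega>) ^ 2 \<partial>M)"
    and m3: "m3 = (\<integral>\<omega>. total_mass (\<Xi> \<omega>) ^ 3 \<partial>M)"
    and var: "var = prob_space.variance M (\<lambda>\<omega>. total_mass (\<Xi> \<omega>))"
    and underdispersed: "var < (\<integral>\<omega>. total_mass (\<Xi> \<omega>) \<partial>M)"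
    and palm1: "palm_process M \<Xi> M1 \<Xi>1"
    and palm2: "palm_process2 M \<Xi> M2 \<Xi>2"
    and local1: "local_dependence1 M \<Xi> M1 \<Xi>1 A B"
    and local2: "local_dependence2 M \<Xi> M2 \<Xi>2 A2 B2"
    and u: "u > 0"
    and partition: "borel_partition k G"
    and centers: "\<forall>i\<in>{1..k}. is_center (G i) (t i)"
    and denominator: "m1 - var + m3 - (m1 + 1) * m2 \<noteq> 0"
    and beta: "\<beta> = (m1 - var) / (m1 - var + m3 - (m1 + 1) * m2)"
    and a: "a = m1 + \<beta> * (m2 - m1)"
    and nu: "\<nu> = measure_of UNIV (sets borel)
               (\<lambda>C. (emeasure \<Lambda> C + ennreal \<beta> * emeasure \<Lambda>2 (C \<times> UNIV)) / ennreal a)"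
    and beta_nonneg: "\<beta> \<ge> 0"
  shows "ennreal (d2 (distr M config_algebra \<Xi>) (pbd_process a 0 \<beta> \<nu>))
    \<le> 2 * ennreal (mesh k G t)
      + (\<integral>\<^sup>+x. (\<integral>\<^sup>+\<omega>. eps1 a u k G t M \<Xi> (A x) (B x) (M1 x) (\<Xi>1 x) \<omega> \<partial>M1 x)
            + (\<integral>\<^sup>+\<omega>. eps1 a u k G t M \<Xi> (A x) (B x) M \<Xi> \<omega> \<partial>M) \<partial>\<Lambda>)
      + ennreal \<beta> *
        (\<integral>\<^sup>+(x, y). (\<integral>\<^sup>+\<omega>. eps1 a u k G t M \<Xi> (A2 x y) (B2 x y) (M2 x y) (\<Xi>2 x y) \<omega> \<partial>M2 x y)
            + (\<integral>\<^sup>+\<omega>. eps1 a u k G t M \<Xi> (A2 x y) (B2 x y) M \<Xi> \<omega> \<partial>M)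
            + (\<integral>\<^sup>+\<omega>. eps2 a u k G t M \<Xi> (B2 x y) (M2 x y) (\<Xi>2 x y) \<omega> \<partial>M2 x y) \<partial>\<Lambda>2)"
    (is "_ \<le> 2 * ennreal ?mesh + ?err1 + ennreal \<beta> * ?err2")
proof -
  interpret M: prob_space M using process by (simp add: point_process_def)
  have \<Xi>: "\<Xi> \<in> measurable M config_algebra" using process by (simp add: point_process_def)
  let ?n = "\<lambda>\<omega>. total_mass (\<Xi> \<omega>)"
  \<comment> \<open>The map \<open>\<tau>\<close> does not involve the last two parameters, so the moments can be computed before \<open>a > 0\<close> is known.\<close>
  interpret D0: discretization k G t 1 1 using compact_space partition by unfold_locales auto
  note ctx = process palm1 palm2 third_moment
  let ?Y = "\<lambda>\<omega>. tally D0.\<tau> (\<Xi> \<omega>)"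
  have sz: "(\<integral>\<omega>. real (size (?Y \<omega>)) ^ j \<partial>M) = (\<integral>\<omega>. ?n \<omega> ^ j \<partial>M)" for j :: nat
    by (intro Bochner_Integration.integral_cong refl) (simp add: D0.total_mass_size[OF process palm1 palm2])
  have int: "integrable M (\<lambda>\<omega>. ?n \<omega>)" "integrable M (\<lambda>\<omega>. ?n \<omega> ^ 2)"
  proof -
    have "integrable M (\<lambda>\<omega>. ?n \<omega> ^ j) = integrable M (\<lambda>\<omega>. real (size (?Y \<omega>)) ^ j)" for j
      by (intro Bochner_Integration.integrable_cong refl) (simp add: D0.total_mass_size[OF process palm1 palm2])
    from this[of 1] this[of 2] show "integrable M (\<lambda>\<omega>. ?n \<omega>)" "integrable M (\<lambda>\<omega>. ?n \<omega> ^ 2)"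
      using D0.integrable_size[OF ctx] by simp_all
  qed
  have e1: "(\<integral>\<omega>. real (size (?Y \<omega>)) \<partial>M) = m1"
    unfolding m1 mean measure_def D0.mean_measure_mass[OF ctx] by (simp add: integral_nonneg_AE)
  have n1: "(\<integral>\<omega>. ?n \<omega> \<partial>M) = m1" using sz[of 1] e1 by simp
  have e2: "(\<integral>\<omega>. real (size (?Y \<omega>)) ^ 2 \<partial>M) = m2" and e3: "(\<integral>\<omega>. real (size (?Y \<omega>)) ^ 3 \<partial>M) = m3"
    unfolding sz m2 m3 by simp_all
  have v: "var = m2 - m1 ^ 2"
    unfolding var m2 n1[symmetric] by (rule M.variance_eq[OF int])
  have vm: "var < m1" using underdispersed n1 by simp
  have "var \<ge> 0" unfolding var by (rule M.variance_positive)
  then have m1_pos: "m1 > 0" using vm by simp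
  let ?den = "m1 - var + m3 - (m1 + 1) * m2"
  \<comment> \<open>Counts satisfy n <= n^2. This gives positivity of \<open>a\<close> and ensures
    that the mass of \<open>\<Lambda>2\<close>, an \<open>ennreal\<close> of a difference, is not
    cut off at 0.\<close>
  have m21: "m1 \<le> m2"
  proof -
    have "real n \<le> real n ^ 2" for n :: nat by (cases n) (auto simp: power2_eq_square)
    then have "(\<integral>\<omega>. real (size (?Y \<omega>)) \<partial>M) \<le> (\<integral>\<omega>. real (size (?Y \<omega>)) ^ 2 \<partial>M)"
      using D0.integrable_size[OF ctx] by (intro integral_mono)
    then show ?thesis unfolding e1 e2 .
  qed
  then have a_pos: "a > 0" unfolding a using m1_pos beta_nonneg by (intro add_pos_nonneg) auto
  have \<beta>_den: "\<beta> * ?den = m1 - var" unfolding beta using denominator by simp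
  \<comment> \<open>Since the variance is m2 - m1^2, the first-order part is m1 - var, and the
    second-order bracket is minus the denominator of \<beta>. Hence the definition of \<beta> is
    exactly this equation.\<close>
  have coef: "m1 * m1 - (m2 - m1) + \<beta> * ((m2 - m1) * m1 - (m3 - 3 * m2 + 2 * m1) - (m2 - m1)) = 0"
  proof -
    have den: "(m2 - m1) * m1 - (m3 - 3 * m2 + 2 * m1) - (m2 - m1) = - ?den"
      unfolding v by (simp add: algebra_simps power2_eq_square)
    show ?thesis unfolding den mult_minus_right \<beta>_den by (simp add: v power2_eq_square)
  qed
  note \<Lambda>_sets = D0.sets_\<Lambda>[OF process palm1 palm2, folded mean]
    and \<Lambda>2_sets = D0.sets_\<Lambda>2[OF process palm1 palm2, folded moment2]
  have fin: "finite_measure \<Lambda>" "finite_measure \<Lambda>2"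
    unfolding mean moment2 by (rule D0.finite_\<Lambda>[OF ctx] D0.finite_\<Lambda>2[OF ctx])+
  note \<nu>_eq = intensity_measure[OF \<Lambda>_sets(1) fin(1) \<Lambda>2_sets(1) fin(2) a_pos beta_nonneg, folded nu]
  have \<nu>_sets: "sets \<nu> = sets borel" unfolding nu by simp
  have \<nu>_meas: "a * measure \<nu> C = measure \<Lambda> C + \<beta> * measure \<Lambda>2 (C \<times> UNIV)" if "C \<in> sets borel" for C
    unfolding measure_def[of \<nu>] \<nu>_eq[OF that] using a_pos beta_nonneg by (simp add: measure_nonneg)
  have \<nu>: "prob_space \<nu>"
  proof (rule prob_spaceI)
    have "measure \<Lambda>2 UNIV = m2 - m1"
      unfolding measure_def moment2 D0.moment2_mass[OF ctx] e1 e2 using m21 by simp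
    moreover have "measure \<Lambda> UNIV = m1" by (simp add: m1)
    ultimately have "emeasure \<nu> UNIV = ennreal ((m1 + \<beta> * (m2 - m1)) / a)" using \<nu>_eq[of UNIV] by simp
    also have "\<dots> = 1" using a_pos unfolding a[symmetric] by simp
    finally show "emeasure \<nu> (space \<nu>) = 1" using sets_eq_imp_space_eq[OF \<nu>_sets] by simp
  qed
  interpret \<nu>: prob_space \<nu> by (rule \<nu>)
  let ?P = "distr M config_algebra \<Xi>" and ?Q = "pbd_process a 0 \<beta> \<nu>"
  let ?S = "?err1 + ennreal \<beta> * ?err2"
  interpret D: discretization k G t a u using compact_space partition a_pos u by unfold_locales
  define w where "w = (\<lambda>s. measure \<nu> (D.\<tau> -` {s}))"
  have w_sum: "(\<Sum>s\<in>D.centers. w s) = 1"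
  proof -
    have "(\<Sum>s\<in>D.centers. w s) = measure \<nu> (\<Union>s\<in>D.centers. D.\<tau> -` {s})"
      unfolding w_def using D.\<tau>_borel
      by (intro \<nu>.finite_measure_finite_Union[symmetric]) (auto simp: \<nu>_sets disjoint_family_on_def)
    also have "(\<Union>s\<in>D.centers. D.\<tau> -` {s}) = space \<nu>"
      using D.\<tau>_center sets_eq_imp_space_eq[OF \<nu>_sets] by auto
    finally show ?thesis by (simp add: \<nu>.prob_space)
  qed
  have w_int: "a * w s = measure (mean_measure M \<Xi>) (D.\<tau> -` {s}) + \<beta> * measure (factorial_moment2 M \<Xi>) ((D.\<tau> -` {s}) \<times> UNIV)" for s
    unfolding w_def mean[symmetric] moment2[symmetric] by (rule \<nu>_meas) (rule D.\<tau>_borel)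
  let ?C = "m1 + (\<integral>n. real n \<partial>measure_pmf (pbd_count a 0 \<beta>))"
  \<comment> \<open>The facts about the target law are proved in the same block because they live in
    a context that needs some test function and some positive \<open>\<epsilon>\<close>.\<close>
  have stein: "\<bar>(\<integral>\<xi>. g (emb (tally D.\<tau> \<xi>)) \<partial>?P) - (\<integral>\<xi>. g (emb (tally D.\<tau> \<xi>)) \<partial>?Q)\<bar> \<le> s + \<epsilon> * ?C"
      and Q: "prob_space ?Q" "sets ?Q = sets config_algebra"
    if g: "g \<in> d1_Lipschitz" and eps: "\<epsilon> > 0" and S: "?S = ennreal s" "s \<ge> 0" for g s \<epsilon>
  proof -
    have lip: "\<bar>g (emb m) - g (emb m')\<bar> \<le> d1 (emb m) (emb m')" for m m' using g by (auto simp: d1_Lipschitz_def)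
    have lip1: "\<bar>g (emb m) - g (emb m')\<bar> \<le> 1" for m m'
      using lip[of m m'] d1_emb_range[OF dist_le_1, of m m'] by linarith
    \<comment> \<open>Subtracting the infimum over finite multisets puts the test function into
      [0,1] without affecting the difference of two means.\<close>
    define I where "I = (INF m. g (emb m))"
    define f where "f = (\<lambda>m. g (emb m) - I)"
    have bdd: "bdd_below (range (\<lambda>m. g (emb m)))"
      using lip1[of _ "{#}"] by (intro bdd_belowI2[where m="g (emb {#}) - 1"]) (smt (verit))
    have I_le: "I \<le> g (emb m)" for m unfolding I_def by (rule cINF_lower[OF bdd]) simp
    have I_ge: "g (emb m) - 1 \<le> I" for m unfolding I_def
      using lip1[of m] by (intro cINF_greatest) (auto simp: abs_le_iff algebra_simps)
    interpret SD: stein_discretization k G t a u \<beta> \<epsilon> D.centers w f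
    proof unfold_locales
      show "0 \<le> f m \<and> f m \<le> 1" for m using I_le[of m] I_ge[of m] by (auto simp: f_def)
      show "\<bar>f (add_mset x m) - f (add_mset y m)\<bar> \<le> 1 / (real (size m) + 1)" for m x y
        using lip[of "add_mset x m" "add_mset y m"] d1_emb_add_le[OF dist_le_1, of x m y] by (simp add: f_def)
    qed (use a_pos beta_nonneg eps w_sum in \<open>auto simp: w_def\<close>)
    note \<nu>ctx = \<nu> \<nu>_sets refl w_def[THEN fun_cong]
    show "prob_space ?Q" "sets ?Q = sets config_algebra"
      using SD.prob_space_pbd[OF \<nu>ctx] SD.sets_pbd[OF \<nu>ctx] by simp_all
    have "ennreal \<bar>\<integral>\<omega>. \<epsilon> * SD.sol (tally D.\<tau> (\<Xi> \<omega>)) - f (tally D.\<tau> (\<Xi> \<omega>)) \<partial>M\<bar> \<le> ?S"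
      unfolding mean moment2
      by (rule SD.generator_bound[OF ctx local1 local2 refl w_int]) (unfold e1 e2 e3, rule coef)
    then have bound: "\<bar>\<integral>\<omega>. \<epsilon> * SD.sol (tally D.\<tau> (\<Xi> \<omega>)) - f (tally D.\<tau> (\<Xi> \<omega>)) \<partial>M\<bar> \<le> s"
      unfolding S using S(2) by simp
    have in1: "integrable M (\<lambda>\<omega>. real (size (tally D.\<tau> (\<Xi> \<omega>))))" using D.integrable_size[OF ctx] by simp
    have cmp: "\<bar>(\<integral>\<omega>. f (tally D.\<tau> (\<Xi> \<omega>)) \<partial>M) - (\<integral>\<xi>. f (tally D.\<tau> \<xi>) \<partial>?Q)\<bar> \<le> s + \<epsilon> * ?C"
      using SD.stein_comparison[OF \<nu>ctx M.prob_space_axioms \<Xi> in1 bound] unfolding e1 .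
    interpret Q: prob_space ?Q by fact
    interpret P: prob_space ?P by (rule M.prob_space_distr[OF \<Xi>])
    have m: "(\<lambda>\<xi>. f (tally D.\<tau> \<xi>)) \<in> borel_measurable config_algebra"
      by (rule measurable_compose[OF D.measurable_tally(1)]) simp
    have f1: "\<bar>f m\<bar> \<le> 1" for m using SD.f_range[of m] by auto
    have "integrable ?Q (\<lambda>\<xi>. f (tally D.\<tau> \<xi>))" "integrable ?P (\<lambda>\<xi>. f (tally D.\<tau> \<xi>))"
      using m f1 \<open>sets ?Q = sets config_algebra\<close>
      by (auto intro!: Q.integrable_const_bound[where B=1] P.integrable_const_bound[where B=1] cong: measurable_cong_sets)
    moreover have g_eq: "g (emb (tally D.\<tau> \<xi>)) = f (tally D.\<tau> \<xi>) + I" for \<xi> by (simp add: f_def)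
    ultimately have "(\<integral>\<xi>. g (emb (tally D.\<tau> \<xi>)) \<partial>?P) - (\<integral>\<xi>. g (emb (tally D.\<tau> \<xi>)) \<partial>?Q)
        = (\<integral>\<xi>. f (tally D.\<tau> \<xi>) \<partial>?P) - (\<integral>\<xi>. f (tally D.\<tau> \<xi>) \<partial>?Q)"
      unfolding g_eq using P.prob_space Q.prob_space by simp
    moreover have "(\<integral>\<xi>. f (tally D.\<tau> \<xi>) \<partial>?P) = (\<integral>\<omega>. f (tally D.\<tau> (\<Xi> \<omega>)) \<partial>M)" by (rule integral_distr[OF \<Xi> m])
    ultimately show "\<bar>(\<integral>\<xi>. g (emb (tally D.\<tau> \<xi>)) \<partial>?P) - (\<integral>\<xi>. g (emb (tally D.\<tau> \<xi>)) \<partial>?Q)\<bar> \<le> s + \<epsilon> * ?C"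
      using cmp by simp
  qed
  have mesh: "0 \<le> ?mesh" by (rule D.mesh_nonneg[OF dist_le_1])
  have assoc: "2 * ennreal ?mesh + ?err1 + ennreal \<beta> * ?err2 = 2 * ennreal ?mesh + ?S" by (rule add.assoc)
  show ?thesis
  proof (cases "?S = top")
    \<comment> \<open>An infinite error bound leaves nothing to prove; otherwise it is a real
      number.\<close>
    case True
    show ?thesis unfolding assoc True by simp
  next
    case False
    define s where "s = enn2real ?S"
    have s: "?S = ennreal s" "s \<ge> 0" unfolding s_def using False by (simp_all add: ennreal_enn2real_if)
    have zero: "(\<lambda>_. 0) \<in> (d1_Lipschitz :: ('a measure \<Rightarrow> real) set)"
    proof -
      have "0 \<le> d1 \<xi> \<eta>" if "\<xi> \<in> configs" "\<eta> \<in> configs" for \<xi> \<eta> :: "'a measure"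
        using d1_emb_range[OF dist_le_1, of "pts \<xi>" "pts \<eta>"] unfolding D.emb_pts[OF that(1)] D.emb_pts[OF that(2)] by simp
      then show ?thesis by (simp add: d1_Lipschitz_def)
    qed
    \<comment> \<open>The zero function and \<open>\<epsilon>\<close> = 1 serve as the required test
      data; they also show that the supremum in \<open>d2\<close> is over a nonempty set.\<close>
    note Q = Q[OF zero zero_less_one s]
    have P: "prob_space ?P" "sets ?P = sets config_algebra" by (simp_all add: M.prob_space_distr[OF \<Xi>])
    have le: "\<bar>(\<integral>\<xi>. g \<xi> \<partial>?P) - (\<integral>\<xi>. g \<xi> \<partial>?Q)\<bar> \<le> 2 * ?mesh + s" if g: "g \<in> d1_Lipschitz" for g
    proof (cases "g \<in> borel_measurable config_algebra")
      case True
      note R = D.lipschitz_integral_tally[OF dist_le_1 g True P] D.lipschitz_integral_tally[OF dist_le_1 g True Q]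
      have C: "?C \<ge> 0" using m1_pos by (intro add_nonneg_nonneg integral_nonneg_AE) auto
      show ?thesis
      proof (rule field_le_epsilon)
        fix e :: real assume e: "e > 0"
        \<comment> \<open>The summand 1 guards the division when \<open>?C\<close> is small;
          \<open>\<epsilon> * ?C\<close> is then at most the given slack.\<close>
        define \<epsilon> where "\<epsilon> = e / (?C + 1)"
        have "\<epsilon> > 0" using e C by (simp add: \<epsilon>_def)
        moreover have "\<epsilon> * ?C \<le> e" using e C by (simp add: \<epsilon>_def field_simps)
        ultimately show "\<bar>(\<integral>\<xi>. g \<xi> \<partial>?P) - (\<integral>\<xi>. g \<xi> \<partial>?Q)\<bar> \<le> 2 * ?mesh + s + e"
          using stein[OF g _ s, of \<epsilon>] R by linarith
      qed
    next
      case False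
      \<comment> \<open>The class of test functions contains nonmeasurable ones. Their Bochner
        integral is 0 by default under both laws, so they add nothing to the supremum.\<close>
      have "(\<integral>\<xi>. g \<xi> \<partial>K) = 0" if "sets K = sets config_algebra" for K :: "'a measure measure"
        using False borel_measurable_integrable[of K g] not_integrable_integral_eq[of K g]
        unfolding measurable_cong_sets[OF that refl] by blast
      from this[OF P(2)] this[OF Q(2)] show ?thesis using mesh s(2) by simp
    qed
    have "d2 ?P ?Q \<le> 2 * ?mesh + s"
      unfolding d2_def using zero by (intro cSUP_least le) auto
    then have "ennreal (d2 ?P ?Q) \<le> ennreal (2 * ?mesh + s)" by (rule ennreal_leI)
    also have "\<dots> = 2 * ennreal ?mesh + ?S" unfolding s(1) using mesh s(2) by (simp add: ennreal_plus ennreal_mult)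
    finally show ?thesis unfolding assoc .
  qed
qed

end
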